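(* Let $A$ and $B$ be Artin algebras, let $M$ be an $A$-$B$-bimodule with $\mathrm{proj.dim}\,{}_AM<\infty$, and suppose that $\Lambda=\begin{pmatrix}A&M\\0&B\end{pmatrix}$ is an Artin algebra. (1) If $\mathrm{proj.dim}\,M_B<\infty$ and $\mathrm{D}(M_B)\in({}^{\perp}B)^{\perp}$, then $\Lambda$ is weakly Gorenstein if and only if every semi-Gorenstein-projective $\Lambda$-module is monic with respect to the bimodule $M$, and $A$ and $B$ are weakly Gorenstein. (2) If $\mathrm{proj.dim}\,M_B<\infty$ and $B$ is a Gorenstein algebra, then $\Lambda$ is weakly Gorenstein if and only if every semi-Gorenstein-projective $\Lambda$-module is monic with respect to the bimodule $M$ and $A$ is weakly Gorenstein. (3) If ${}_AM$ is torsionless and $M_B$ is projective, then $\Lambda$ is weakly Gorenstein if and only if $A$ and $B$ are weakly Gorenstein. In particular, if ${}_AM$ and $M_B$ are projective, then $\Lambda$ is weakly Gorenstein if and only if $A$ and $B$ are weakly Gorenstein.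
   Context: All modules are finitely generated, and are left modules unless otherwise stated. For an Artin algebra $R$ and a left $R$-module $N$: ${}^{\perp}N=\{X\in R\text{-mod}\mid \mathrm{Ext}_R^i(X,N)=0\ \forall i\ge1\}$. For a class $\mathscr X$ of left $R$-modules, $\mathscr X^{\perp}=\{Y\in R\text{-mod}\mid \mathrm{Ext}_R^i(X,Y)=0\ \forall i\ge 1,\ \forall X\in\mathscr X\}$. $\mathrm D$ is the standard duality of Artin algebras (so $\mathrm D(M_B)$ is a left $B$-module), and ${}^{\perp}B={}^{\perp}({}_BB)$. $N^*=\mathrm{Hom}_R(N,R)$ and $\phi_N:N\to N^{**}$, $\phi_N(n)(f)=f(n)$, is the canonical map. $N$ is torsionless if it is a submodule of a projective module (equivalently $\phi_N$ is a monomorphism), and reflexive if $\phi_N$ is an isomorphism. $N$ is semi-Gorenstein-projective if $N\in{}^{\perp}R$. $N$ is Gorenstein-projective if $N$ and the right $R$-module $N^*$ are both semi-Gorenstein-projective and $N$ is reflexive. $R$ is (left) weakly Gorenstein if every semi-Gorenstein-projective left $R$-module is Gorenstein-projective. $R$ is Gorenstein if $\mathrm{inj.dim}\,{}_RR<\infty$ and $\mathrm{inj.dim}\,R_R<\infty$. A left $\Lambda$-module is identified with a triple $\binom{X}{Y}_\varphi$, where $X$ is a left $A$-module, $Y$ is a left $B$-module and $\varphi:M\otimes_BY\to X$ is a left $A$-map; it is monic with respect to the bimodule $M$ if $\varphi$ is a monomorphism. *)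

theory Defs
  imports "HOL-Algebra.Module" "HOL-Algebra.QuotRing" "HOL-Algebra.Free_Abelian_Groups"
    "HOL-Algebra.Generated_Groups" "HOL-Library.Extended_Nat" "HOL-Library.Poly_Mapping"
begin

section \<open>Modules over noncommutative rings\<close>

text \<open>
  The library locale \<open>module\<close> requires a commutative ring. We keep its record type and drop
  commutativity. A right \<open>R\<close>-module is a left module over \<open>opposite R\<close>, so there
  \<open>smult r x\<close> stands for \<open>x r\<close>.
\<close>

definition opposite :: "'r ring \<Rightarrow> 'r ring" where
  "opposite R = R\<lparr>monoid.mult := \<lambda>x y. y \<otimes>\<^bsub>R\<^esub> x\<rparr>"

locale left_module = R?: ring R + M?: abelian_group M
  for R :: "'r ring" and M :: "('r, 'x) module" (structure) +
  assumes smult_closed [simp, intro]: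
      "\<lbrakk>a \<in> carrier R; x \<in> carrier M\<rbrakk> \<Longrightarrow> a \<odot>\<^bsub>M\<^esub> x \<in> carrier M"
    and smult_l_distr:
      "\<lbrakk>a \<in> carrier R; b \<in> carrier R; x \<in> carrier M\<rbrakk> \<Longrightarrow>
        (a \<oplus>\<^bsub>R\<^esub> b) \<odot>\<^bsub>M\<^esub> x = a \<odot>\<^bsub>M\<^esub> x \<oplus>\<^bsub>M\<^esub> b \<odot>\<^bsub>M\<^esub> x"
    and smult_r_distr:
      "\<lbrakk>a \<in> carrier R; x \<in> carrier M; y \<in> carrier M\<rbrakk> \<Longrightarrow>
        a \<odot>\<^bsub>M\<^esub> (x \<oplus>\<^bsub>M\<^esub> y) = a \<odot>\<^bsub>M\<^esub> x \<oplus>\<^bsub>M\<^esub> a \<odot>\<^bsub>M\<^esub> y"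
    and smult_assoc1:
      "\<lbrakk>a \<in> carrier R; b \<in> carrier R; x \<in> carrier M\<rbrakk> \<Longrightarrow>
        (a \<otimes>\<^bsub>R\<^esub> b) \<odot>\<^bsub>M\<^esub> x = a \<odot>\<^bsub>M\<^esub> (b \<odot>\<^bsub>M\<^esub> x)"
    and smult_one [simp]:
      "x \<in> carrier M \<Longrightarrow> \<one>\<^bsub>R\<^esub> \<odot>\<^bsub>M\<^esub> x = x"

definition fg_module :: "'r ring \<Rightarrow> ('r, 'x) module \<Rightarrow> bool" where
  "fg_module R N \<longleftrightarrow> left_module R N \<and>
     (\<exists>S. finite S \<and> S \<subseteq> carrier N \<and> (\<forall>H. submodule H R N \<and> S \<subseteq> H \<longrightarrow> H = carrier N))"

text \<open>Homomorphisms are extensional, so that equal maps are equal functions.\<close>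

definition mod_hom :: "'r ring \<Rightarrow> ('r, 'x) module \<Rightarrow> ('r, 'y) module \<Rightarrow> ('x \<Rightarrow> 'y) set" where
  "mod_hom R X Y = {f \<in> carrier X \<rightarrow>\<^sub>E carrier Y.
     (\<forall>x\<in>carrier X. \<forall>y\<in>carrier X. f (x \<oplus>\<^bsub>X\<^esub> y) = f x \<oplus>\<^bsub>Y\<^esub> f y) \<and>
     (\<forall>r\<in>carrier R. \<forall>x\<in>carrier X. f (r \<odot>\<^bsub>X\<^esub> x) = r \<odot>\<^bsub>Y\<^esub> f x)}"

definition mod_iso :: "'r ring \<Rightarrow> ('r, 'x) module \<Rightarrow> ('r, 'y) module \<Rightarrow> bool" where
  "mod_iso R X Y \<longleftrightarrow> (\<exists>f\<in>mod_hom R X Y. bij_betw f (carrier X) (carrier Y))"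

definition mod_ker :: "('r, 'x) module \<Rightarrow> ('r, 'y) module \<Rightarrow> ('x \<Rightarrow> 'y) \<Rightarrow> 'x set" where
  "mod_ker X Y f = {x \<in> carrier X. f x = \<zero>\<^bsub>Y\<^esub>}"

text \<open>
  A universe for \<open>R\<close>-mod: every finitely generated \<open>R\<close>-module is a quotient of some \<open>R\<^sup>n\<close>,
  hence isomorphic to a module whose elements are sets of functions \<open>nat \<Rightarrow> 'r\<close>
  (lemma \<open>fg_module_small\<close> below). Quantifiers over all finitely generated modules range over
  this type.
\<close>

type_synonym 'r small_module = "('r, (nat \<Rightarrow> 'r) set) module"

definition regular :: "'r ring \<Rightarrow> ('r, 'r) module" where
  "regular R = \<lparr>carrier = carrier R, monoid.mult = mult R, one = \<one>\<^bsub>R\<^esub>,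
     ring.zero = \<zero>\<^bsub>R\<^esub>, add = add R, smult = mult R\<rparr>"

definition hom_group ::
  "'r ring \<Rightarrow> ('r, 'x) module \<Rightarrow> ('r, 'y) module \<Rightarrow> ('x \<Rightarrow> 'y) monoid" where
  "hom_group R X Y = \<lparr>carrier = mod_hom R X Y,
     monoid.mult = (\<lambda>f g. \<lambda>x\<in>carrier X. f x \<oplus>\<^bsub>Y\<^esub> g x),
     one = (\<lambda>x\<in>carrier X. \<zero>\<^bsub>Y\<^esub>)\<rparr>"

text \<open>
  \<open>Hom\<^sub>R(X, Y)\<close> with a scalar multiplication \<open>s\<close>. The fields \<open>mult\<close> and \<open>one\<close> of a module
  record are never used for modules.
\<close>

definition hom_module ::
  "'r ring \<Rightarrow> ('r, 'x) module \<Rightarrow> ('r, 'y) module \<Rightarrow> ('s \<Rightarrow> ('x \<Rightarrow> 'y) \<Rightarrow> 'x \<Rightarrow> 'y)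
     \<Rightarrow> ('s, 'x \<Rightarrow> 'y) module" where
  "hom_module R X Y s = \<lparr>carrier = mod_hom R X Y, monoid.mult = undefined, one = undefined,
     ring.zero = \<one>\<^bsub>hom_group R X Y\<^esub>, add = mult (hom_group R X Y), smult = s\<rparr>"

definition quot_module :: "('r, 'x) module \<Rightarrow> 'x set \<Rightarrow> ('r, 'x set) module" where
  "quot_module N H = \<lparr>carrier = a_rcosets\<^bsub>N\<^esub> H, monoid.mult = undefined, one = undefined,
     ring.zero = H, add = set_add N, smult = (\<lambda>r S. \<Union>x\<in>S. H +>\<^bsub>N\<^esub> (r \<odot>\<^bsub>N\<^esub> x))\<rparr>"


section \<open>Homological notions\<close>

definition projective_module :: "'r ring \<Rightarrow> ('r, 'x) module \<Rightarrow> bool" where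
  "projective_module R P \<longleftrightarrow> fg_module R P \<and>
     (\<forall>(X :: 'r small_module) (Y :: 'r small_module) g f.
        fg_module R X \<and> fg_module R Y \<and> g \<in> mod_hom R X Y \<and> g ` carrier X = carrier Y \<and>
        f \<in> mod_hom R P Y \<longrightarrow>
        (\<exists>h\<in>mod_hom R P X. \<forall>p\<in>carrier P. g (h p) = f p))"

definition injective_module :: "'r ring \<Rightarrow> ('r, 'x) module \<Rightarrow> bool" where
  "injective_module R I \<longleftrightarrow> fg_module R I \<and>
     (\<forall>(X :: 'r small_module) (Y :: 'r small_module) g f.
        fg_module R X \<and> fg_module R Y \<and> g \<in> mod_hom R X Y \<and> inj_on g (carrier X) \<and>
        f \<in> mod_hom R X I \<longrightarrow>
        (\<exists>h\<in>mod_hom R Y I. \<forall>x\<in>carrier X. h (g x) = f x))"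

text \<open>\<open>\<dots> \<longrightarrow> P 2 \<longrightarrow>\<^bsub>d 1\<^esub> P 1 \<longrightarrow>\<^bsub>d 0\<^esub> P 0 \<longrightarrow>\<^bsub>e\<^esub> X \<longrightarrow> 0\<close>\<close>

definition projective_resolution ::
  "'r ring \<Rightarrow> ('r, 'x) module \<Rightarrow> (nat \<Rightarrow> 'r small_module)
     \<Rightarrow> (nat \<Rightarrow> (nat \<Rightarrow> 'r) set \<Rightarrow> (nat \<Rightarrow> 'r) set) \<Rightarrow> ((nat \<Rightarrow> 'r) set \<Rightarrow> 'x) \<Rightarrow> bool" where
  "projective_resolution R X P d e \<longleftrightarrow>
     (\<forall>i. projective_module R (P i)) \<and>
     (\<forall>i. d i \<in> mod_hom R (P (Suc i)) (P i)) \<and>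
     e \<in> mod_hom R (P 0) X \<and>
     e ` carrier (P 0) = carrier X \<and>
     mod_ker (P 0) X e = d 0 ` carrier (P 1) \<and>
     (\<forall>i. mod_ker (P (Suc i)) (P i) (d i) = d (Suc i) ` carrier (P (Suc (Suc i))))"

definition proj_dim :: "'r ring \<Rightarrow> ('r, 'x) module \<Rightarrow> enat" where
  "proj_dim R X = Inf {enat n | n. \<exists>P d e. projective_resolution R X P d e \<and>
     (\<forall>i>n. carrier (P i) = {\<zero>\<^bsub>P i\<^esub>})}"

text \<open>\<open>0 \<longrightarrow> X \<longrightarrow>\<^bsub>e\<^esub> I 0 \<longrightarrow>\<^bsub>d 0\<^esub> I 1 \<longrightarrow>\<^bsub>d 1\<^esub> I 2 \<longrightarrow> \<dots>\<close>\<close>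

definition injective_resolution ::
  "'r ring \<Rightarrow> ('r, 'x) module \<Rightarrow> (nat \<Rightarrow> 'r small_module)
     \<Rightarrow> (nat \<Rightarrow> (nat \<Rightarrow> 'r) set \<Rightarrow> (nat \<Rightarrow> 'r) set) \<Rightarrow> ('x \<Rightarrow> (nat \<Rightarrow> 'r) set) \<Rightarrow> bool" where
  "injective_resolution R X I d e \<longleftrightarrow>
     (\<forall>i. injective_module R (I i)) \<and>
     (\<forall>i. d i \<in> mod_hom R (I i) (I (Suc i))) \<and>
     e \<in> mod_hom R X (I 0) \<and>
     inj_on e (carrier X) \<and>
     mod_ker (I 0) (I 1) (d 0) = e ` carrier X \<and>
     (\<forall>i. mod_ker (I (Suc i)) (I (Suc (Suc i))) (d (Suc i)) = d i ` carrier (I i))"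

definition inj_dim :: "'r ring \<Rightarrow> ('r, 'x) module \<Rightarrow> enat" where
  "inj_dim R X = Inf {enat n | n. \<exists>I d e. injective_resolution R X I d e \<and>
     (\<forall>i>n. carrier (I i) = {\<zero>\<^bsub>I i\<^esub>})}"

text \<open>The \<open>i\<close>-th cohomology group of the complex \<open>Hom (P, N)\<close>.\<close>

definition hom_cohomology ::
  "'r ring \<Rightarrow> (nat \<Rightarrow> ('r, 'p) module) \<Rightarrow> (nat \<Rightarrow> 'p \<Rightarrow> 'p) \<Rightarrow> ('r, 'y) module \<Rightarrow> nat
     \<Rightarrow> ('p \<Rightarrow> 'y) set monoid" where
  "hom_cohomology R P d N i =
     ((hom_group R (P i) N)
        \<lparr>carrier := {f \<in> mod_hom R (P i) N. \<forall>x\<in>carrier (P (Suc i)). f (d i x) = \<zero>\<^bsub>N\<^esub>}\<rparr>)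
     Mod (case i of 0 \<Rightarrow> {\<lambda>x\<in>carrier (P 0). \<zero>\<^bsub>N\<^esub>}
          | Suc j \<Rightarrow> (\<lambda>g. \<lambda>x\<in>carrier (P i). g (d j x)) ` mod_hom R (P j) N)"

definition Ext ::
  "'r ring \<Rightarrow> nat \<Rightarrow> ('r, 'x) module \<Rightarrow> ('r, 'y) module \<Rightarrow> ((nat \<Rightarrow> 'r) set \<Rightarrow> 'y) set monoid" where
  "Ext R i X N =
     (let (P, d) = (SOME (P, d). \<exists>e. projective_resolution R X P d e)
      in hom_cohomology R P d N i)"

definition left_perp :: "'r ring \<Rightarrow> ('r, 'y) module \<Rightarrow> ('r, 'x) module set" where
  "left_perp R N = {X. fg_module R X \<and> (\<forall>i\<ge>1. trivial_group (Ext R i X N))}"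

definition right_perp :: "'r ring \<Rightarrow> ('r, 'x) module set \<Rightarrow> ('r, 'y) module set" where
  "right_perp R \<X> = {Y. fg_module R Y \<and> (\<forall>X\<in>\<X>. \<forall>i\<ge>1. trivial_group (Ext R i X Y))}"

text \<open>
  \<open>ring_dual R N = Hom\<^sub>R(N, R)\<close> with \<open>(f r)(x) = f(x) r\<close>; as a right \<open>R\<close>-module it is a left
  module over \<open>opposite R\<close>. Applying \<open>ring_dual (opposite R)\<close> to it gives the left module
  \<open>N\<^sup>*\<^sup>*\<close> over \<open>opposite (opposite R) = R\<close>.
\<close>

definition ring_dual :: "'r ring \<Rightarrow> ('r, 'x) module \<Rightarrow> ('r, 'x \<Rightarrow> 'r) module" where
  "ring_dual R N = hom_module R N (regular R) (\<lambda>r f. \<lambda>x\<in>carrier N. f x \<otimes>\<^bsub>R\<^esub> r)"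

definition eval_map :: "'r ring \<Rightarrow> ('r, 'x) module \<Rightarrow> 'x \<Rightarrow> ('x \<Rightarrow> 'r) \<Rightarrow> 'r" where
  "eval_map R N = (\<lambda>x\<in>carrier N. \<lambda>f\<in>carrier (ring_dual R N). f x)"

definition reflexive :: "'r ring \<Rightarrow> ('r, 'x) module \<Rightarrow> bool" where
  "reflexive R N \<longleftrightarrow>
     bij_betw (eval_map R N) (carrier N) (carrier (ring_dual (opposite R) (ring_dual R N)))"

definition torsionless :: "'r ring \<Rightarrow> ('r, 'x) module \<Rightarrow> bool" where
  "torsionless R N \<longleftrightarrow> (\<exists>(P :: 'r small_module) \<iota>. projective_module R P \<and>
     \<iota> \<in> mod_hom R N P \<and> inj_on \<iota> (carrier N))"

definition semi_Gorenstein_projective :: "'r ring \<Rightarrow> ('r, 'x) module \<Rightarrow> bool" where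
  "semi_Gorenstein_projective R N \<longleftrightarrow> N \<in> left_perp R (regular R)"

definition Gorenstein_projective :: "'r ring \<Rightarrow> ('r, 'x) module \<Rightarrow> bool" where
  "Gorenstein_projective R N \<longleftrightarrow> semi_Gorenstein_projective R N \<and>
     semi_Gorenstein_projective (opposite R) (ring_dual R N) \<and> reflexive R N"

definition weakly_Gorenstein :: "'r ring \<Rightarrow> bool" where
  "weakly_Gorenstein R \<longleftrightarrow> (\<forall>N :: 'r small_module.
     semi_Gorenstein_projective R N \<longrightarrow> Gorenstein_projective R N)"

definition Gorenstein :: "'r ring \<Rightarrow> bool" where
  "Gorenstein R \<longleftrightarrow> inj_dim R (regular R) < \<infinity> \<and>
     inj_dim (opposite R) (regular (opposite R)) < \<infinity>"


section \<open>Artin algebras and the standard duality\<close>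

definition artinian_cring :: "'k ring \<Rightarrow> bool" where
  "artinian_cring K \<longleftrightarrow> cring K \<and>
     (\<forall>I :: nat \<Rightarrow> 'k set. (\<forall>n. ideal (I n) K \<and> I (Suc n) \<subseteq> I n) \<longrightarrow> (\<exists>n. \<forall>m\<ge>n. I m = I n))"

definition restrict_scalars :: "('k \<Rightarrow> 'r) \<Rightarrow> ('r, 'x) module \<Rightarrow> ('k, 'x) module" where
  "restrict_scalars \<eta> N = \<lparr>carrier = carrier N, monoid.mult = mult N, one = \<one>\<^bsub>N\<^esub>,
     ring.zero = \<zero>\<^bsub>N\<^esub>, add = add N, smult = (\<lambda>k. smult N (\<eta> k))\<rparr>"

definition artin_algebra_over :: "'k ring \<Rightarrow> ('k \<Rightarrow> 'r) \<Rightarrow> 'r ring \<Rightarrow> bool" where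
  "artin_algebra_over K \<eta> R \<longleftrightarrow> artinian_cring K \<and> ring R \<and> \<eta> \<in> ring_hom K R \<and>
     (\<forall>k\<in>carrier K. \<forall>r\<in>carrier R. \<eta> k \<otimes>\<^bsub>R\<^esub> r = r \<otimes>\<^bsub>R\<^esub> \<eta> k) \<and>
     fg_module K (restrict_scalars \<eta> (regular R))"

text \<open>
  Letting the elements of the base ring come from the element type of \<open>R\<close> is no restriction,
  since the base ring may be replaced by its image in \<open>R\<close> (lemma \<open>artin_algebra_overD\<close>).
\<close>

definition artin_algebra :: "'r ring \<Rightarrow> bool" where
  "artin_algebra R \<longleftrightarrow> (\<exists>(K :: 'r ring) \<eta>. artin_algebra_over K \<eta> R)"

definition jacobson_radical :: "'k ring \<Rightarrow> 'k set" where
  "jacobson_radical K = carrier K \<inter> \<Inter>{I. maximalideal I K}"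

definition injective_envelope :: "'k ring \<Rightarrow> ('k, 'x) module \<Rightarrow> ('k, 'y) module \<Rightarrow> bool" where
  "injective_envelope K X J \<longleftrightarrow> injective_module K J \<and>
     (\<exists>\<iota>\<in>mod_hom K X J. inj_on \<iota> (carrier X) \<and>
       (\<forall>U. submodule U K J \<and> U \<inter> \<iota> ` carrier X = {\<zero>\<^bsub>J\<^esub>} \<longrightarrow> U = {\<zero>\<^bsub>J\<^esub>}))"

text \<open>
  The standard duality is \<open>D = Hom\<^sub>K(-, J)\<close> with \<open>J\<close> the injective envelope of \<open>K / rad K\<close>. It
  sends a left \<open>R\<close>-module \<open>N\<close> to a left \<open>opposite R\<close>-module via \<open>(r f)(x) = f(r x)\<close>; for
  \<open>R = opposite B\<close> the result is a left \<open>B\<close>-module.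
\<close>

definition dualizing_module :: "'k ring \<Rightarrow> ('k, 'j) module \<Rightarrow> bool" where
  "dualizing_module K J \<longleftrightarrow>
     injective_envelope K (quot_module (regular K) (jacobson_radical K)) J"

definition standard_dual ::
  "'k ring \<Rightarrow> ('k \<Rightarrow> 'r) \<Rightarrow> ('k, 'j) module \<Rightarrow> ('r, 'x) module \<Rightarrow> ('r, 'x \<Rightarrow> 'j) module" where
  "standard_dual K \<eta> J N =
     hom_module K (restrict_scalars \<eta> N) J (\<lambda>r f. \<lambda>x\<in>carrier N. f (r \<odot>\<^bsub>N\<^esub> x))"


section \<open>Bimodules and triangular matrix rings\<close>

record ('a, 'b, 'm) bimodule = "('a, 'm) module" +
  rsmult :: "'m \<Rightarrow> 'b \<Rightarrow> 'm"

definition left_part :: "('a, 'b, 'm) bimodule \<Rightarrow> ('a, 'm) module" where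
  "left_part M = module.truncate M"

definition right_part :: "('a, 'b, 'm) bimodule \<Rightarrow> ('b, 'm) module" where
  "right_part M = \<lparr>carrier = carrier M, monoid.mult = mult M, one = \<one>\<^bsub>M\<^esub>,
     ring.zero = \<zero>\<^bsub>M\<^esub>, add = add M, smult = (\<lambda>b m. rsmult M m b)\<rparr>"

definition is_bimodule :: "'a ring \<Rightarrow> 'b ring \<Rightarrow> ('a, 'b, 'm) bimodule \<Rightarrow> bool" where
  "is_bimodule A B M \<longleftrightarrow> left_module A (left_part M) \<and> left_module (opposite B) (right_part M) \<and>
     (\<forall>a\<in>carrier A. \<forall>m\<in>carrier M. \<forall>b\<in>carrier B.
        rsmult M (a \<odot>\<^bsub>M\<^esub> m) b = a \<odot>\<^bsub>M\<^esub> rsmult M m b)"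

text \<open>\<open>(a, m, b)\<close> is the matrix with rows \<open>(a, m)\<close> and \<open>(0, b)\<close>.\<close>

definition triangular_ring ::
  "'a ring \<Rightarrow> 'b ring \<Rightarrow> ('a, 'b, 'm) bimodule \<Rightarrow> ('a \<times> 'm \<times> 'b) ring" where
  "triangular_ring A B M = \<lparr>carrier = carrier A \<times> carrier M \<times> carrier B,
     monoid.mult = (\<lambda>(a, m, b) (a', m', b').
       (a \<otimes>\<^bsub>A\<^esub> a', a \<odot>\<^bsub>M\<^esub> m' \<oplus>\<^bsub>M\<^esub> rsmult M m b', b \<otimes>\<^bsub>B\<^esub> b')),
     one = (\<one>\<^bsub>A\<^esub>, \<zero>\<^bsub>M\<^esub>, \<one>\<^bsub>B\<^esub>),
     ring.zero = (\<zero>\<^bsub>A\<^esub>, \<zero>\<^bsub>M\<^esub>, \<zero>\<^bsub>B\<^esub>),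
     add = (\<lambda>(a, m, b) (a', m', b'). (a \<oplus>\<^bsub>A\<^esub> a', m \<oplus>\<^bsub>M\<^esub> m', b \<oplus>\<^bsub>B\<^esub> b'))\<rparr>"

text \<open>
  \<open>M \<otimes>\<^sub>B Y\<close>: the free abelian group on \<open>M \<times> Y\<close> modulo the subgroup generated by the bilinearity
  and balancing relations, with \<open>A\<close> acting through \<open>a (m \<otimes> y) = (a m) \<otimes> y\<close>.
\<close>

definition tensor_relators ::
  "'b ring \<Rightarrow> ('a, 'b, 'm) bimodule \<Rightarrow> ('b, 'y) module \<Rightarrow> ('m \<times> 'y \<Rightarrow>\<^sub>0 int) set" where
  "tensor_relators B M Y =
     {frag_of (m \<oplus>\<^bsub>M\<^esub> m', y) - frag_of (m, y) - frag_of (m', y) | m m' y.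
        m \<in> carrier M \<and> m' \<in> carrier M \<and> y \<in> carrier Y} \<union>
     {frag_of (m, y \<oplus>\<^bsub>Y\<^esub> y') - frag_of (m, y) - frag_of (m, y') | m y y'.
        m \<in> carrier M \<and> y \<in> carrier Y \<and> y' \<in> carrier Y} \<union>
     {frag_of (rsmult M m b, y) - frag_of (m, b \<odot>\<^bsub>Y\<^esub> y) | m b y.
        m \<in> carrier M \<and> b \<in> carrier B \<and> y \<in> carrier Y}"

definition tensor_kernel ::
  "'b ring \<Rightarrow> ('a, 'b, 'm) bimodule \<Rightarrow> ('b, 'y) module \<Rightarrow> ('m \<times> 'y \<Rightarrow>\<^sub>0 int) set" where
  "tensor_kernel B M Y =
     generate (free_Abelian_group (carrier M \<times> carrier Y)) (tensor_relators B M Y)"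

definition tensor_class ::
  "'b ring \<Rightarrow> ('a, 'b, 'm) bimodule \<Rightarrow> ('b, 'y) module \<Rightarrow> ('m \<times> 'y \<Rightarrow>\<^sub>0 int)
     \<Rightarrow> ('m \<times> 'y \<Rightarrow>\<^sub>0 int) set" where
  "tensor_class B M Y c =
     tensor_kernel B M Y #>\<^bsub>free_Abelian_group (carrier M \<times> carrier Y)\<^esub> c"

definition pure_tensor ::
  "'b ring \<Rightarrow> ('a, 'b, 'm) bimodule \<Rightarrow> ('b, 'y) module \<Rightarrow> 'm \<Rightarrow> 'y \<Rightarrow> ('m \<times> 'y \<Rightarrow>\<^sub>0 int) set" where
  "pure_tensor B M Y m y = tensor_class B M Y (frag_of (m, y))"

definition tensor ::
  "'b ring \<Rightarrow> ('a, 'b, 'm) bimodule \<Rightarrow> ('b, 'y) module \<Rightarrow> ('a, ('m \<times> 'y \<Rightarrow>\<^sub>0 int) set) module" where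
  "tensor B M Y =
     (let T = free_Abelian_group (carrier M \<times> carrier Y) Mod tensor_kernel B M Y
      in \<lparr>carrier = carrier T, monoid.mult = undefined, one = undefined,
          ring.zero = \<one>\<^bsub>T\<^esub>, add = mult T,
          smult = (\<lambda>a S. \<Union>c\<in>S. tensor_class B M Y
                     (frag_extend (\<lambda>(m, y). frag_of (a \<odot>\<^bsub>M\<^esub> m, y)) c))\<rparr>)"

definition module_triple ::
  "'a ring \<Rightarrow> 'b ring \<Rightarrow> ('a, 'b, 'm) bimodule \<Rightarrow> ('a, 'x) module \<Rightarrow> ('b, 'y) module
     \<Rightarrow> (('m \<times> 'y \<Rightarrow>\<^sub>0 int) set \<Rightarrow> 'x) \<Rightarrow> bool" where
  "module_triple A B M X Y \<phi> \<longleftrightarrow>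
     fg_module A X \<and> fg_module B Y \<and> \<phi> \<in> mod_hom A (tensor B M Y) X"

text \<open>The module of column vectors \<open>(x, y)\<close>: \<open>(a, m, b) (x, y) = (a x + \<phi>(m \<otimes> y), b y)\<close>.\<close>

definition triple_module ::
  "'b ring \<Rightarrow> ('a, 'b, 'm) bimodule \<Rightarrow> ('a, 'x) module \<Rightarrow> ('b, 'y) module
     \<Rightarrow> (('m \<times> 'y \<Rightarrow>\<^sub>0 int) set \<Rightarrow> 'x) \<Rightarrow> ('a \<times> 'm \<times> 'b, 'x \<times> 'y) module" where
  "triple_module B M X Y \<phi> = \<lparr>carrier = carrier X \<times> carrier Y,
     monoid.mult = undefined, one = undefined,
     ring.zero = (\<zero>\<^bsub>X\<^esub>, \<zero>\<^bsub>Y\<^esub>),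
     add = (\<lambda>(x, y) (x', y'). (x \<oplus>\<^bsub>X\<^esub> x', y \<oplus>\<^bsub>Y\<^esub> y')),
     smult = (\<lambda>(a, m, b) (x, y).
       (a \<odot>\<^bsub>X\<^esub> x \<oplus>\<^bsub>X\<^esub> \<phi> (pure_tensor B M Y m y), b \<odot>\<^bsub>Y\<^esub> y))\<rparr>"

text \<open>The identification of modules with triples is read as isomorphism.\<close>

definition monic_wrt ::
  "'a ring \<Rightarrow> 'b ring \<Rightarrow> ('a, 'b, 'm) bimodule \<Rightarrow> ('a \<times> 'm \<times> 'b, 'n) module \<Rightarrow> bool" where
  "monic_wrt A B M N \<longleftrightarrow>
     (\<exists>(X :: 'a small_module) (Y :: 'b small_module) \<phi>.
        module_triple A B M X Y \<phi> \<and>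
        mod_iso (triangular_ring A B M) N (triple_module B M X Y \<phi>) \<and>
        inj_on \<phi> (carrier (tensor B M Y)))"


section \<open>Adequacy of the type choices\<close>

lemma opposite_opposite: "opposite (opposite R) = R"
  by (simp add: opposite_def)

lemma ring_opposite: "ring R \<Longrightarrow> ring (opposite R)"
proof -
  assume "ring R"
  then interpret ring R .
  have 1: "abelian_group (opposite R)"
    by (rule abelian_groupI) (auto simp: opposite_def add.m_ac intro: add.l_inv_ex)
  have 2: "monoid (opposite R)"
    by (rule monoidI) (auto simp: opposite_def m_assoc)
  show ?thesis
    by (rule ringI[OF 1 2]) (auto simp: opposite_def l_distr r_distr)
qed

lemma left_module_regular: "ring R \<Longrightarrow> left_module R (regular R)"
proof -
  assume "ring R"
  then interpret ring R .
  have 1: "abelian_group (regular R)"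
    by (rule abelian_groupI) (auto simp: regular_def add.m_ac intro: add.l_inv_ex)
  show ?thesis
    by (intro left_module.intro 1 \<open>ring R\<close> left_module_axioms.intro)
       (auto simp: regular_def l_distr r_distr m_assoc)
qed

lemma submodule_generated:
  assumes "left_module R N" "finite S" "S \<subseteq> carrier N"
  shows "submodule {finsum N (\<lambda>s. c s \<odot>\<^bsub>N\<^esub> s) S | c. c \<in> S \<rightarrow> carrier R} R N"
    (is "submodule ?H R N")
proof -
  interpret left_module R N by fact
  have cl: "(\<lambda>s. c s \<odot>\<^bsub>N\<^esub> s) \<in> S \<rightarrow> carrier N" if "c \<in> S \<rightarrow> carrier R" for c
    using that assms by auto
  have sum: "finsum N (\<lambda>s. c s \<odot>\<^bsub>N\<^esub> s) S \<oplus>\<^bsub>N\<^esub> finsum N (\<lambda>s. d s \<odot>\<^bsub>N\<^esub> s) S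
      = finsum N (\<lambda>s. (c s \<oplus>\<^bsub>R\<^esub> d s) \<odot>\<^bsub>N\<^esub> s) S"
    if "c \<in> S \<rightarrow> carrier R" "d \<in> S \<rightarrow> carrier R" for c d
  proof -
    have "finsum N (\<lambda>s. (c s \<oplus>\<^bsub>R\<^esub> d s) \<odot>\<^bsub>N\<^esub> s) S
        = finsum N (\<lambda>s. c s \<odot>\<^bsub>N\<^esub> s \<oplus>\<^bsub>N\<^esub> d s \<odot>\<^bsub>N\<^esub> s) S"
      using that assms by (intro M.finsum_cong') (auto simp: smult_l_distr Pi_iff subset_iff)
    then show ?thesis using M.finsum_addf[OF cl[OF that(1)] cl[OF that(2)]] by simp
  qed
  have lnull: "\<zero>\<^bsub>R\<^esub> \<odot>\<^bsub>N\<^esub> x = \<zero>\<^bsub>N\<^esub>" if "x \<in> carrier N" for x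
    using smult_l_distr[of "\<zero>\<^bsub>R\<^esub>" "\<zero>\<^bsub>R\<^esub>" x] that
    by (metis M.add.r_cancel_one' R.l_zero R.zero_closed smult_closed)
  have rnull: "a \<odot>\<^bsub>N\<^esub> \<zero>\<^bsub>N\<^esub> = \<zero>\<^bsub>N\<^esub>" if "a \<in> carrier R" for a
    using smult_r_distr[of a "\<zero>\<^bsub>N\<^esub>" "\<zero>\<^bsub>N\<^esub>"] that
    by (metis M.add.r_cancel_one' M.l_zero M.zero_closed smult_closed)
  have zero: "finsum N (\<lambda>s. \<zero>\<^bsub>R\<^esub> \<odot>\<^bsub>N\<^esub> s) S = \<zero>\<^bsub>N\<^esub>"
    using assms by (intro M.add.finprod_one_eqI) (auto simp: lnull)
  have neg: "\<ominus>\<^bsub>N\<^esub> finsum N (\<lambda>s. c s \<odot>\<^bsub>N\<^esub> s) S = finsum N (\<lambda>s. (\<ominus>\<^bsub>R\<^esub> c s) \<odot>\<^bsub>N\<^esub> s) S"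
    if c: "c \<in> S \<rightarrow> carrier R" for c
  proof -
    have n: "(\<lambda>s. \<ominus>\<^bsub>R\<^esub> c s) \<in> S \<rightarrow> carrier R" using c by auto
    have "finsum N (\<lambda>s. c s \<odot>\<^bsub>N\<^esub> s) S \<oplus>\<^bsub>N\<^esub> finsum N (\<lambda>s. (\<ominus>\<^bsub>R\<^esub> c s) \<odot>\<^bsub>N\<^esub> s) S
      = finsum N (\<lambda>s. \<zero>\<^bsub>R\<^esub> \<odot>\<^bsub>N\<^esub> s) S"
      unfolding sum[OF c n] using c assms
      by (intro M.finsum_cong') (auto simp: R.r_neg Pi_iff subset_iff)
    then show ?thesis
      using M.finsum_closed[OF cl[OF c]] M.finsum_closed[OF cl[OF n]]
      by (metis M.minus_equality M.a_comm zero)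
  qed
  have smul: "a \<odot>\<^bsub>N\<^esub> finsum N f S = finsum N (\<lambda>s. a \<odot>\<^bsub>N\<^esub> f s) S"
    if a: "a \<in> carrier R" and f: "f \<in> S \<rightarrow> carrier N" for a f
    using assms(2) f
  proof (induction S)
    case empty
    show ?case by (simp add: rnull a)
  next
    case (insert s S)
    have "(\<lambda>s. a \<odot>\<^bsub>N\<^esub> f s) \<in> S \<rightarrow> carrier N" using insert a by auto
    then show ?case
      using insert a by (simp add: smult_r_distr Pi_iff)
  qed
  show ?thesis
  proof (intro submodule.intro submodule_axioms.intro subgroup.intro)
    show "?H \<subseteq> carrier (add_monoid N)"
      using M.finsum_closed[OF cl] by auto
  next
    fix x y assume "x \<in> ?H" "y \<in> ?H"
    then obtain c d where "c \<in> S \<rightarrow> carrier R" "d \<in> S \<rightarrow> carrier R"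
      "x = finsum N (\<lambda>s. c s \<odot>\<^bsub>N\<^esub> s) S" "y = finsum N (\<lambda>s. d s \<odot>\<^bsub>N\<^esub> s) S" by auto
    then show "x \<otimes>\<^bsub>add_monoid N\<^esub> y \<in> ?H"
      by (simp add: sum) (rule exI[of _ "\<lambda>s. c s \<oplus>\<^bsub>R\<^esub> d s"], auto)
  next
    show "\<one>\<^bsub>add_monoid N\<^esub> \<in> ?H"
      using zero by (simp, intro exI[of _ "\<lambda>s. \<zero>\<^bsub>R\<^esub>"]) auto
  next
    fix x assume "x \<in> ?H"
    then obtain c where "c \<in> S \<rightarrow> carrier R" "x = finsum N (\<lambda>s. c s \<odot>\<^bsub>N\<^esub> s) S" by auto
    then have "inv\<^bsub>add_monoid N\<^esub> x = finsum N (\<lambda>s. (\<ominus>\<^bsub>R\<^esub> c s) \<odot>\<^bsub>N\<^esub> s) S"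
      "(\<lambda>s. \<ominus>\<^bsub>R\<^esub> c s) \<in> S \<rightarrow> carrier R"
      using neg[of c] by (auto simp: a_inv_def[of N])
    then show "inv\<^bsub>add_monoid N\<^esub> x \<in> ?H"
      by (intro CollectI exI[of _ "\<lambda>s. \<ominus>\<^bsub>R\<^esub> c s"] conjI)
  next
    fix a x assume a: "a \<in> carrier R" and "x \<in> ?H"
    then obtain c where c: "c \<in> S \<rightarrow> carrier R" "x = finsum N (\<lambda>s. c s \<odot>\<^bsub>N\<^esub> s) S" by auto
    have "a \<odot>\<^bsub>N\<^esub> x = finsum N (\<lambda>s. (a \<otimes>\<^bsub>R\<^esub> c s) \<odot>\<^bsub>N\<^esub> s) S"
      using a c assms cl[OF c(1)]
      by (subst c(2), subst smul) (auto intro!: M.finsum_cong' simp: smult_assoc1 Pi_iff subset_iff)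
    then show "a \<odot>\<^bsub>N\<^esub> x \<in> ?H"
      using a c(1) by (auto intro!: exI[of _ "\<lambda>s. a \<otimes>\<^bsub>R\<^esub> c s"])
  qed
qed

lemma fg_module_spanned:
  assumes "left_module R N" "finite S" "S \<subseteq> carrier N"
    "\<And>H. submodule H R N \<Longrightarrow> S \<subseteq> H \<Longrightarrow> H = carrier N"
  shows "carrier N = {finsum N (\<lambda>s. c s \<odot>\<^bsub>N\<^esub> s) S | c. c \<in> S \<rightarrow> carrier R}"
proof (rule assms(4)[OF submodule_generated[OF assms(1-3)], symmetric])
  interpret left_module R N by fact
  have lnull: "\<zero>\<^bsub>R\<^esub> \<odot>\<^bsub>N\<^esub> x = \<zero>\<^bsub>N\<^esub>" if "x \<in> carrier N" for x
    using smult_l_distr[of "\<zero>\<^bsub>R\<^esub>" "\<zero>\<^bsub>R\<^esub>" x] that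
    by (metis M.add.r_cancel_one' R.l_zero R.zero_closed smult_closed)
  show "S \<subseteq> {finsum N (\<lambda>s. c s \<odot>\<^bsub>N\<^esub> s) S | c. c \<in> S \<rightarrow> carrier R}"
  proof
    fix t assume t: "t \<in> S"
    let ?c = "\<lambda>s. if s = t then \<one>\<^bsub>R\<^esub> else \<zero>\<^bsub>R\<^esub>"
    have "finsum N (\<lambda>s. ?c s \<odot>\<^bsub>N\<^esub> s) S = finsum N (\<lambda>s. if t = s then s else \<zero>\<^bsub>N\<^esub>) S"
      using assms(3) by (intro M.finsum_cong') (auto simp: lnull)
    also have "\<dots> = t"
      using M.finsum_singleton[OF t assms(2), of "\<lambda>s. s"] assms(3) by auto
    finally show "t \<in> {finsum N (\<lambda>s. c s \<odot>\<^bsub>N\<^esub> s) S | c. c \<in> S \<rightarrow> carrier R}"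
      by (auto intro!: exI[of _ ?c])
  qed
qed

lemma fg_module_transport:
  fixes h :: "'x \<Rightarrow> 'y"
  assumes fg: "fg_module R N" and inj: "inj_on h (carrier N)"
  shows "\<exists>N' :: ('r, 'y) module. fg_module R N' \<and> mod_iso R N N'"
proof -
  have "left_module R N" using fg by (simp add: fg_module_def)
  then interpret left_module R N .
  define g where "g = inv_into (carrier N) h"
  have gh [simp]: "g (h x) = x" if "x \<in> carrier N" for x
    using inj that by (simp add: g_def)
  define N' :: "('r, 'y) module" where
    "N' = \<lparr>carrier = h ` carrier N, monoid.mult = undefined, one = undefined,
       ring.zero = h \<zero>\<^bsub>N\<^esub>, add = (\<lambda>x y. h (g x \<oplus>\<^bsub>N\<^esub> g y)), smult = (\<lambda>r x. h (r \<odot>\<^bsub>N\<^esub> g x))\<rparr>"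
  have ag: "abelian_group N'"
  proof (rule abelian_groupI)
    fix x assume "x \<in> carrier N'"
    then obtain x0 where "x0 \<in> carrier N" "x = h x0" by (auto simp: N'_def)
    then show "\<exists>y\<in>carrier N'. y \<oplus>\<^bsub>N'\<^esub> x = \<zero>\<^bsub>N'\<^esub>"
      by (intro bexI[of _ "h (\<ominus>\<^bsub>N\<^esub> x0)"]) (auto simp: N'_def M.l_neg)
  qed (auto simp: N'_def M.add.m_ac)
  have lm: "left_module R N'"
    by (intro left_module.intro R.ring_axioms ag left_module_axioms.intro)
       (auto simp: N'_def smult_l_distr smult_r_distr smult_assoc1)
  interpret N': left_module R N' by fact
  have hom: "restrict h (carrier N) \<in> mod_hom R N N'"
    by (auto simp: mod_hom_def N'_def)
  obtain S where S: "finite S" "S \<subseteq> carrier N"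
    "\<And>H. submodule H R N \<Longrightarrow> S \<subseteq> H \<Longrightarrow> H = carrier N"
    using fg by (auto simp: fg_module_def)
  have "H = carrier N'" if H: "submodule H R N'" "h ` S \<subseteq> H" for H
  proof -
    interpret H: submodule H R N' by fact
    have Hs: "H \<subseteq> h ` carrier N" using H.subset by (auto simp: N'_def)
    let ?G = "{x \<in> carrier N. h x \<in> H}"
    have neg: "inv\<^bsub>add_monoid N'\<^esub> (h x) = h (\<ominus>\<^bsub>N\<^esub> x)" if "x \<in> carrier N" for x
      unfolding a_inv_def[symmetric]
      by (rule N'.M.minus_equality) (use that in \<open>auto simp: N'_def M.l_neg\<close>)
    have "submodule ?G R N"
    proof (intro submodule.intro submodule_axioms.intro subgroup.intro)
      fix x y assume "x \<in> ?G" "y \<in> ?G"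
      then show "x \<otimes>\<^bsub>add_monoid N\<^esub> y \<in> ?G"
        using H.m_closed[of "h x" "h y"] by (auto simp: N'_def)
    next
      show "\<one>\<^bsub>add_monoid N\<^esub> \<in> ?G" using H.one_closed by (auto simp: N'_def)
    next
      fix x assume "x \<in> ?G"
      then show "inv\<^bsub>add_monoid N\<^esub> x \<in> ?G"
        using H.m_inv_closed[of "h x"] neg[of x] by (auto simp: a_inv_def[symmetric])
    next
      fix a x assume "a \<in> carrier R" "x \<in> ?G"
      then show "a \<odot>\<^bsub>N\<^esub> x \<in> ?G"
        using H.smult_closed[of a "h x"] by (auto simp: N'_def)
    qed auto
    then have "?G = carrier N" using S(2) H(2) by (intro S(3)) auto
    then show ?thesis using Hs by (auto simp: N'_def)
  qed
  then have "fg_module R N'"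
    unfolding fg_module_def using lm S(1,2)
    by (intro conjI exI[of _ "h ` S"]) (auto simp: N'_def)
  moreover have "mod_iso R N N'"
    unfolding mod_iso_def using hom inj
    by (intro bexI[of _ "restrict h (carrier N)"]) (auto simp: bij_betw_def N'_def inj_on_def)
  ultimately show ?thesis by blast
qed

lemma fg_module_small:
  assumes "fg_module R N"
  shows "\<exists>N' :: 'r small_module. fg_module (R :: 'r ring) N' \<and> mod_iso R N N'"
proof -
  obtain S where S: "finite S" "S \<subseteq> carrier N"
    "\<And>H. submodule H R N \<Longrightarrow> S \<subseteq> H \<Longrightarrow> H = carrier N" and lm: "left_module R N"
    using assms by (auto simp: fg_module_def)
  obtain n and s :: "nat \<Rightarrow> _" where s: "inj_on s {..<n}" "s ` {..<n} = S"
    using finite_imp_nat_seg_image_inj_on[OF S(1)] by (metis lessThan_def)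
  define t where "t = inv_into {..<n} s"
  have st: "t (s i) = i" if "i < n" for i using s(1) that by (simp add: t_def)
  define h where "h x = {c :: nat \<Rightarrow> _. finsum N (\<lambda>u. c (t u) \<odot>\<^bsub>N\<^esub> u) S = x}" for x
  have ne: "h x \<noteq> {}" if "x \<in> carrier N" for x
  proof -
    interpret left_module R N by fact
    have "x \<in> {finsum N (\<lambda>u. c u \<odot>\<^bsub>N\<^esub> u) S | c. c \<in> S \<rightarrow> carrier R}"
      using that fg_module_spanned[OF lm S] by simp
    then obtain c where c: "c \<in> S \<rightarrow> carrier R" "x = finsum N (\<lambda>u. c u \<odot>\<^bsub>N\<^esub> u) S"
      by (elim CollectE exE conjE)
    have "finsum N (\<lambda>u. (c \<circ> s) (t u) \<odot>\<^bsub>N\<^esub> u) S = x"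
      unfolding c(2) using c(1) S(2) s st
      by (intro M.finsum_cong') (auto simp: Pi_iff subset_iff)
    then show ?thesis by (auto simp: h_def)
  qed
  have "inj_on h (carrier N)"
    using ne by (fastforce simp: inj_on_def h_def)
  then show ?thesis by (rule fg_module_transport[OF assms])
qed

lemma artin_algebra_overD:
  fixes K :: "'k ring" and R :: "'r ring"
  assumes "artin_algebra_over K \<eta> R"
  shows "artin_algebra R"
proof -
  have K: "cring K" and dcc: "\<And>I :: nat \<Rightarrow> 'k set. (\<forall>n. ideal (I n) K \<and> I (Suc n) \<subseteq> I n) \<Longrightarrow>
      \<exists>n. \<forall>m\<ge>n. I m = I n"
    and R: "ring R" and \<eta>: "\<eta> \<in> ring_hom K R"
    and central: "\<And>k r. k \<in> carrier K \<Longrightarrow> r \<in> carrier R \<Longrightarrow> \<eta> k \<otimes>\<^bsub>R\<^esub> r = r \<otimes>\<^bsub>R\<^esub> \<eta> k"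
    and fg: "fg_module K (restrict_scalars \<eta> (regular R))"
    using assms by (auto simp: artin_algebra_over_def artinian_cring_def)
  interpret R: ring R by fact
  interpret K: cring K by fact
  interpret h: ring_hom_ring K R \<eta>
    using K.ring_axioms R \<eta> by (auto intro: ring_hom_ringI2)
  let ?L = "R\<lparr>carrier := \<eta> ` carrier K\<rparr>"
  have "ring ?L"
    using h.img_is_ring by simp
  then interpret L: ring ?L .
  have L: "cring ?L"
  proof (intro cring.intro \<open>ring ?L\<close> comm_monoid.intro L.monoid_axioms comm_monoid_axioms.intro)
    fix x y assume "x \<in> carrier ?L" "y \<in> carrier ?L"
    then obtain k where "k \<in> carrier K" "x = \<eta> k" "y \<in> carrier R" by auto
    then show "x \<otimes>\<^bsub>?L\<^esub> y = y \<otimes>\<^bsub>?L\<^esub> x" using central[of k y] by simp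
  qed
  have homL: "\<eta> \<in> ring_hom K ?L"
    using \<eta> by (auto simp: ring_hom_def)
  interpret hL: ring_hom_ring K ?L \<eta>
    using K.ring_axioms \<open>ring ?L\<close> homL by (auto intro: ring_hom_ringI2)
  have "\<exists>n. \<forall>m\<ge>n. I m = I n"
    if I: "\<And>n. ideal (I n) ?L \<and> I (Suc n) \<subseteq> I n" for I :: "nat \<Rightarrow> 'r set"
  proof -
    let ?I = "\<lambda>n. {k \<in> carrier K. \<eta> k \<in> I n}"
    have "ideal (?I n) K" for n
      using I by (intro hL.ideal_vimage) simp
    then have "\<forall>n. ideal (?I n) K \<and> ?I (Suc n) \<subseteq> ?I n" using I by blast
    from dcc[OF this] obtain n where n: "\<And>m. m \<ge> n \<Longrightarrow> ?I m = ?I n" by blast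
    have im: "I m = \<eta> ` ?I m" for m
    proof -
      interpret Im: ideal "I m" ?L using I by blast
      show ?thesis using Im.Icarr by auto
    qed
    have "I m = I n" if "m \<ge> n" for m
      using n[OF that] im[of m] im[of n] by simp
    then show ?thesis by blast
  qed
  then have "artinian_cring ?L" using L by (auto simp: artinian_cring_def)
  moreover have "id \<in> ring_hom ?L R"
    by (auto simp: ring_hom_def)
  moreover have "fg_module ?L (restrict_scalars id (regular R))"
  proof -
    interpret rm: left_module K "restrict_scalars \<eta> (regular R)"
      using fg by (simp add: fg_module_def)
    have "abelian_group (restrict_scalars id (regular R))"
      by (rule abelian_groupI)
         (auto simp: regular_def restrict_scalars_def R.add.m_ac intro: R.add.l_inv_ex)
    then have "left_module ?L (restrict_scalars id (regular R))"
      by (intro left_module.intro \<open>ring ?L\<close> left_module_axioms.intro)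
         (auto simp: regular_def restrict_scalars_def R.l_distr R.r_distr R.m_assoc)
    moreover have "submodule H ?L (restrict_scalars id (regular R)) \<longleftrightarrow>
        submodule H K (restrict_scalars \<eta> (regular R))" for H
      by (simp add: submodule_def submodule_axioms_def restrict_scalars_def regular_def
          subgroup_def m_inv_def Ball_image_comp Ball_def[symmetric])
    ultimately show ?thesis using fg
      by (auto simp: fg_module_def restrict_scalars_def)
  qed
  ultimately show ?thesis
    unfolding artin_algebra_def artin_algebra_over_def
    using R by (intro exI[of _ ?L] exI[of _ id] conjI) (auto intro: central)
qed

end

theory Submission
  imports Defs "HOL-Algebra.Ring_Divisibility"
begin

text \<open>
  A module with a resolution by finite free modules is encoded by a sequence of matrices \<open>F i\<close> whose
  row sequence \<open>\<dots> \<longrightarrow> R\<^sup>n\<^sup>1 \<longrightarrow> R\<^sup>n\<^sup>0\<close> is exact. By comparison of resolutions, it is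
  semi-Gorenstein-projective iff the sequences of columns over \<open>R\<close> are exact as well; call such a sequence
  acyclic. Then \<open>R\<close> is weakly Gorenstein iff the cokernel of every acyclic sequence is torsionless: in that
  case an acyclic sequence extends indefinitely to the left, and the extension resolves the dual module.

  Over \<open>\<Lambda>\<close> a matrix splits into components \<open>F\<^sub>A\<close>, \<open>F\<^sub>M\<close>, \<open>F\<^sub>B\<close>. Finite projective dimension of
  \<open>\<^sub>AM\<close> makes the columns of \<open>F\<^sub>A\<close> exact over \<open>M\<close>, so that \<open>F\<^sub>B\<close> is acyclic over \<open>B\<close>. Each hypothesis on
  \<open>M\<^sub>B\<close> implies that the rows of an acyclic sequence over \<open>B\<close> stay exact over \<open>M\<^sub>B\<close>. The cokernel of
  \<open>F\<close> is monic iff \<open>x F\<^sub>A = 0\<close> implies \<open>x F\<^sub>M = m F\<^sub>B\<close> for some \<open>m\<close>. Granted this, \<open>F\<^sub>A\<close> is acyclic over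
  \<open>A\<close>, and torsionlessness over \<open>\<Lambda>\<close> is checked componentwise. In the other direction, an acyclic sequence over
  \<open>A\<close> or \<open>B\<close>, added to its own shift, is completed by a contractible sequence over the other ring to an
  acyclic sequence over \<open>\<Lambda>\<close>.
\<close>


\<comment> \<open>A column over a module \<open>W\<close> is a homomorphism from a free module to
  \<open>W\<close>, so with matrices the vanishing of Ext and Tor becomes solvability of linear
  systems, and these split along the three components of \<open>triangular_ring\<close>.
  Torsionlessness of the cokernel says that the matrix whose columns generate the solutions of
  \<open>F 0 w = 0\<close> can be put in front of the sequence without losing row exactness. The
  hypotheses on \<open>M\<^sub>B\<close> enter through Tor against cokernels of acyclic sequences.
  Against a projective module Tor vanishes. For finite projective dimension it is shifted along the
  sequence to the left until the syzygies of \<open>M\<^sub>B\<close> are zero; the room for this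
  shift exists because a Gorenstein \<open>B\<close> is weakly Gorenstein. For the dual, Ext into
  \<open>D(M\<^sub>B)\<close> is dual to Tor, and the dualizing module separates points. The
  contractible sequences have ranks of the form \<open>r i + r (Suc i)\<close>, which an arbitrary
  acyclic sequence need not have. Adding the sequence to its own shift produces such ranks, and the
  original problem is recovered from the first block.\<close>
text \<open>Permits \<open>\<zero>\<^sub>R\<close> as a shorthand for \<open>\<zero>\<^bsub>R\<^esub>\<close>.\<close>

syntax "_index_sub" :: "id => index" ("\<^sub>_")
translations "_index_sub x" \<rightharpoonup> "_index x"

section \<open>Finite sums, linear combinations and submodules\<close>

text \<open>Sums are ordered and indexed by an initial segment of \<open>nat\<close>. The recursion
  mentions only zero and addition of the record, so rings, modules, opposites and restrictions of
  scalars share the same sums by rewriting.\<close>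

primrec msum :: "('v, 'e) ring_scheme => nat => (nat => 'v) => 'v" where
 "msum V 0 f = \<zero>\<^sub>V"
| "msum V (Suc n) f = msum V n f \<oplus>\<^sub>V f n"

abbreviation dot :: "('r, 'e) ring_scheme => nat => (nat => 'r) => (nat => 'r) => 'r" where
 "dot R n u v \<equiv> msum R n (%i. u i \<otimes>\<^sub>R v i)"

definition lincomb :: "('r, 'v) module => nat => (nat => 'r) => (nat => 'v) => 'v" where
 "lincomb V n a v = msum V n (%i. a i \<odot>\<^sub>V v i)"

definition unit_vec :: "('r, 'e) ring_scheme => nat => nat => 'r" where
 "unit_vec R k = (%i. if i = k then \<one>\<^sub>R else \<zero>\<^sub>R)"

lemma msum_cong: "(\<And>i. i < n ==> f i = g i) ==> msum V n f = msum V n g"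
 by (induction n) auto

lemma lincomb_cong:
 "(\<And>i. i < n ==> a i = b i) ==> (\<And>i. i < n ==> v i = w i) ==> lincomb V n a v = lincomb V n b w"
 unfolding lincomb_def by (rule msum_cong) auto

lemma lincomb_0 [simp]: "lincomb V 0 a v = \<zero>\<^sub>V"
 by (simp add: lincomb_def)

lemma lincomb_Suc [simp]: "lincomb V (Suc n) a v = lincomb V n a v \<oplus>\<^sub>V a n \<odot>\<^sub>V v n"
 by (simp add: lincomb_def)

context abelian_group
begin

lemma a_inv_zero [simp]: "\<ominus> \<zero> = \<zero>"
 by (rule minus_equality) auto

lemma diff_zero [simp]: "x \<in> carrier G ==> x \<ominus> \<zero> = x"
 by (simp add: a_minus_def)

lemma minus_eq_zero_iff: "x \<in> carrier G ==> y \<in> carrier G ==> x \<ominus> y = \<zero> \<longleftrightarrow> x = y"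
 unfolding a_minus_def by (metis a_inv_closed minus_equality minus_minus r_neg)

lemma msum_closed [simp, intro]:
 "(\<And>i. i < n ==> f i \<in> carrier G) ==> msum G n f \<in> carrier G"
 by (induction n) auto

lemma msum_zero [simp]: "msum G n (%i. \<zero>) = \<zero>"
 by (induction n) auto

lemma msum_add:
 "(\<And>i. i < n ==> f i \<in> carrier G) ==> (\<And>i. i < n ==> g i \<in> carrier G) ==>
  msum G n (%i. f i \<oplus> g i) = msum G n f \<oplus> msum G n g"
 by (induction n) (auto simp: a_ac)

lemma msum_minus:
 "(\<And>i. i < n ==> f i \<in> carrier G) ==> msum G n (%i. \<ominus> f i) = \<ominus> msum G n f"
proof (induction n)
 case 0
 show ?case by simp
qed (simp add: minus_add)

lemma msum_swap:
 "(\<And>i j. i < n ==> j < m ==> f i j \<in> carrier G) ==>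
  msum G n (%i. msum G m (f i)) = msum G m (%j. msum G n (%i. f i j))"
proof (induction n)
 case (Suc n)
 then have "msum G m (%j. msum G n (%i. f i j) \<oplus> f n j)
   = msum G m (%j. msum G n (%i. f i j)) \<oplus> msum G m (f n)"
  by (intro msum_add) auto
 then show ?case using Suc by simp
qed auto

lemma msum_single:
 "k < n ==> x \<in> carrier G ==> msum G n (%i. if i = k then x else \<zero>) = x"
proof (induction n)
 case (Suc n)
 have "msum G n (%i. if i = k then x else \<zero>) = msum G n (%i. \<zero>)" if "k = n"
  using that by (intro msum_cong) auto
 then show ?case using Suc by (cases "k = n") auto
qed auto

lemma msum_split:
 "(\<And>i. i < n + m ==> f i \<in> carrier G) ==>
  msum G (n + m) f = msum G n f \<oplus> msum G m (%i. f (n + i))"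
proof (induction m)
 case (Suc m)
 then have "msum G n f \<in> carrier G" "msum G m (%i. f (n + i)) \<in> carrier G" "f (n + m) \<in> carrier G"
  by auto
 then show ?case using Suc by (simp add: a_assoc)
qed auto

lemma msum_subset_closed:
 assumes "\<zero> \<in> U" "\<And>x y. x \<in> U ==> y \<in> U ==> x \<oplus> y \<in> U" "\<And>i. i < n ==> f i \<in> U"
 shows "msum G n f \<in> U"
 using assms(3) by (induction n) (auto intro: assms)

end

lemma msum_hom:
 assumes "abelian_group V" "f \<zero>\<^sub>V = \<zero>\<^sub>W"
  "\<And>x y. x \<in> carrier V ==> y \<in> carrier V ==> f (x \<oplus>\<^sub>V y) = f x \<oplus>\<^sub>W f y"
  "\<And>i. i < n ==> v i \<in> carrier V"
 shows "f (msum V n v) = msum W n (%i. f (v i))"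
 using assms(4)
proof (induction n)
 case (Suc n)
 interpret abelian_group V by fact
 show ?case using Suc assms(2,3) by simp
qed (use assms in simp)

lemma regular_simps [simp]:
 "carrier (regular R) = carrier R" "\<zero>\<^bsub>regular R\<^esub> = \<zero>\<^sub>R" "add (regular R) = add R"
 "smult (regular R) = monoid.mult R"
 by (simp_all add: regular_def)

lemma opposite_simps [simp]:
 "carrier (opposite R) = carrier R" "\<zero>\<^bsub>opposite R\<^esub> = \<zero>\<^sub>R" "add (opposite R) = add R"
 "\<one>\<^bsub>opposite R\<^esub> = \<one>\<^sub>R" "x \<otimes>\<^bsub>opposite R\<^esub> y = y \<otimes>\<^sub>R x"
 by (simp_all add: opposite_def)

lemma opposite_opposite' [simp]: "opposite (opposite R) = R"
 by (rule opposite_opposite)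

lemma msum_regular [simp]: "msum (regular R) n f = msum R n f"
 by (induction n) auto

lemma msum_opposite [simp]: "msum (opposite R) n f = msum R n f"
 by (induction n) auto

lemma lincomb_regular: "lincomb (regular R) n a v = dot R n a v"
 by (simp add: lincomb_def)

lemma lincomb_regular_opposite: "lincomb (regular (opposite R)) n a v = dot R n v a"
 by (simp add: lincomb_def)

lemma ex_preimages:
 assumes "\<And>j. j < m ==> v j \<in> g ` S"
 obtains x where "\<forall>j<m. x j \<in> S" "\<forall>j<m. g (x j) = v j"
 by (rule that[of "%j. inv_into S g (v j)"]) (use assms inv_into_into[of _ g S] f_inv_into_f[of _ g S] in blast)+

lemma (in ring) msum_mult_right:
 "(\<And>i. i < n ==> f i \<in> carrier R) ==> a \<in> carrier R ==> msum R n f \<otimes> a = dot R n f (%i. a)"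
 by (induction n) (auto simp: l_distr)

lemma (in ring) msum_mult_left:
 "(\<And>i. i < n ==> f i \<in> carrier R) ==> a \<in> carrier R ==> a \<otimes> msum R n f = dot R n (%i. a) f"
 by (induction n) (auto simp: r_distr)

context left_module
begin

lemma zero_smult [simp]: "x \<in> carrier M ==> \<zero>\<^sub>R \<odot> x = \<zero>\<^sub>M"
 using smult_l_distr[of "\<zero>\<^sub>R" "\<zero>\<^sub>R" x]
 by (metis M.add.r_cancel_one' R.l_zero R.zero_closed smult_closed)

lemma smult_zero [simp]: "a \<in> carrier R ==> a \<odot> \<zero>\<^sub>M = \<zero>\<^sub>M"
 using smult_r_distr[of a "\<zero>\<^sub>M" "\<zero>\<^sub>M"]
 by (metis M.add.r_cancel_one' M.l_zero M.zero_closed smult_closed)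

lemma smult_minus: "a \<in> carrier R ==> x \<in> carrier M ==> a \<odot> (\<ominus>\<^sub>M x) = \<ominus>\<^sub>M (a \<odot> x)"
 using smult_r_distr[of a x "\<ominus>\<^sub>M x"]
 by (metis M.a_inv_closed M.minus_equality M.r_neg M.a_comm smult_closed smult_zero)

lemma minus_smult: "a \<in> carrier R ==> x \<in> carrier M ==> (\<ominus>\<^sub>R a) \<odot> x = \<ominus>\<^sub>M (a \<odot> x)"
 using smult_l_distr[of a "\<ominus>\<^sub>R a" x]
 by (metis M.minus_equality M.a_comm R.a_inv_closed R.r_neg smult_closed zero_smult)

lemma smult_msum:
 "a \<in> carrier R ==> (\<And>i. i < n ==> f i \<in> carrier M) ==> a \<odot> msum M n f = msum M n (%i. a \<odot> f i)"
 by (induction n) (auto simp: smult_r_distr)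

lemma msum_smult:
 "x \<in> carrier M ==> (\<And>i. i < n ==> f i \<in> carrier R) ==> msum R n f \<odot> x = msum M n (%i. f i \<odot> x)"
 by (induction n) (auto simp: smult_l_distr)

lemma lincomb_closed [simp, intro]:
 "(\<And>i. i < n ==> a i \<in> carrier R) ==> (\<And>i. i < n ==> v i \<in> carrier M) ==> lincomb M n a v \<in> carrier M"
 unfolding lincomb_def by auto

text \<open>After the scalars are collected, only the order of two sums has to be exchanged. This is
  \<open>(a F) v = a (F v)\<close> for a matrix \<open>F\<close> and a column \<open>v\<close> over
  a module, the form in which products of matrices are used throughout.\<close>

lemma lincomb_assoc:
 assumes "\<And>j. j < m ==> a j \<in> carrier R" "\<And>i j. j < m ==> i < n ==> F j i \<in> carrier R"
  "\<And>i. i < n ==> v i \<in> carrier M"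
 shows "lincomb M m a (%j. lincomb M n (F j) v)
  = lincomb M n (%i. dot R m a (%j. F j i)) v"
proof -
 have "lincomb M m a (%j. lincomb M n (F j) v)
   = msum M m (%j. msum M n (%i. (a j \<otimes>\<^sub>R F j i) \<odot> v i))"
  unfolding lincomb_def using assms by (intro msum_cong) (auto simp: smult_msum smult_assoc1 intro!: msum_cong)
 also have "\<dots> = msum M n (%i. msum M m (%j. (a j \<otimes>\<^sub>R F j i) \<odot> v i))"
  using assms by (intro M.msum_swap) auto
 also have "\<dots> = lincomb M n (%i. dot R m a (%j. F j i)) v"
  unfolding lincomb_def using assms by (intro msum_cong) (auto simp: msum_smult)
 finally show ?thesis .
qed

lemma lincomb_assoc_zero:
 assumes "\<And>j. j < m ==> a j \<in> carrier R" "\<And>i j. j < m ==> i < n ==> F j i \<in> carrier R"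
  "\<And>i. i < n ==> v i \<in> carrier M" "\<And>i. i < n ==> dot R m a (%j. F j i) = \<zero>\<^sub>R"
 shows "lincomb M m a (%j. lincomb M n (F j) v) = \<zero>\<^sub>M"
proof -
 have "lincomb M n (%i. dot R m a (%j. F j i)) v = lincomb M n (%i. \<zero>\<^sub>R) v"
  using assms(4) by (intro lincomb_cong) simp_all
 moreover have "lincomb M n (%i. \<zero>\<^sub>R) v = \<zero>\<^sub>M" using assms(3) by (induction n) auto
 ultimately show ?thesis using lincomb_assoc[of m a n F v] assms(1-3) by simp
qed

lemma lincomb_add_left:
 "(\<And>i. i < n ==> a i \<in> carrier R) ==> (\<And>i. i < n ==> b i \<in> carrier R) ==> (\<And>i. i < n ==> v i \<in> carrier M)
  ==> lincomb M n (%i. a i \<oplus>\<^sub>R b i) v = lincomb M n a v \<oplus>\<^sub>M lincomb M n b v"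
 unfolding lincomb_def by (subst M.msum_add[symmetric]) (auto intro!: msum_cong simp: smult_l_distr)

lemma lincomb_add_right:
 "(\<And>i. i < n ==> a i \<in> carrier R) ==> (\<And>i. i < n ==> v i \<in> carrier M) ==> (\<And>i. i < n ==> w i \<in> carrier M)
  ==> lincomb M n a (%i. v i \<oplus>\<^sub>M w i) = lincomb M n a v \<oplus>\<^sub>M lincomb M n a w"
 unfolding lincomb_def by (subst M.msum_add[symmetric]) (auto intro!: msum_cong simp: smult_r_distr)

lemma lincomb_minus_left:
 "(\<And>i. i < n ==> a i \<in> carrier R) ==> (\<And>i. i < n ==> v i \<in> carrier M)
  ==> lincomb M n (%i. \<ominus>\<^sub>R a i) v = \<ominus>\<^sub>M lincomb M n a v"
 unfolding lincomb_def by (subst M.msum_minus[symmetric]) (auto intro!: msum_cong simp: minus_smult)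

lemma lincomb_minus_right:
 "(\<And>i. i < n ==> a i \<in> carrier R) ==> (\<And>i. i < n ==> v i \<in> carrier M)
  ==> lincomb M n a (%i. \<ominus>\<^sub>M v i) = \<ominus>\<^sub>M lincomb M n a v"
 unfolding lincomb_def by (subst M.msum_minus[symmetric]) (auto intro!: msum_cong simp: smult_minus)

lemma lincomb_smult_left:
 "r \<in> carrier R ==> (\<And>i. i < n ==> a i \<in> carrier R) ==> (\<And>i. i < n ==> v i \<in> carrier M)
  ==> lincomb M n (%i. r \<otimes>\<^sub>R a i) v = r \<odot> lincomb M n a v"
 unfolding lincomb_def by (subst smult_msum) (auto intro!: msum_cong simp: smult_assoc1)

lemma lincomb_zero_left [simp]:
 "(\<And>i. i < n ==> v i \<in> carrier M) ==> lincomb M n (%i. \<zero>\<^sub>R) v = \<zero>\<^sub>M"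
 by (induction n) auto

lemma lincomb_zero_right [simp]:
 "(\<And>i. i < n ==> a i \<in> carrier R) ==> lincomb M n a (%i. \<zero>\<^sub>M) = \<zero>\<^sub>M"
 by (induction n) auto

lemma unit_vec_closed [simp]: "unit_vec R k i \<in> carrier R"
 by (simp add: unit_vec_def)

lemma lincomb_unit_vec:
 assumes "k < n" "\<And>i. i < n ==> v i \<in> carrier M"
 shows "lincomb M n (unit_vec R k) v = v k"
proof -
 have "lincomb M n (unit_vec R k) v = msum M n (%i. if i = k then v k else \<zero>\<^sub>M)"
  unfolding lincomb_def unit_vec_def using assms by (intro msum_cong) auto
 then show ?thesis using assms by (simp add: M.msum_single)
qed

lemma lincomb_split:
 "(\<And>i. i < n + m ==> a i \<in> carrier R) ==> (\<And>i. i < n + m ==> v i \<in> carrier M) ==>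
 lincomb M (n + m) a v = lincomb M n a v \<oplus>\<^sub>M lincomb M m (%i. a (n + i)) (%i. v (n + i))"
 unfolding lincomb_def by (subst M.msum_split) auto

end

section \<open>Homomorphisms of modules\<close>

lemma mod_homI:
 assumes "\<And>x. x \<in> carrier X ==> f x \<in> carrier Y"
  "\<And>x y. x \<in> carrier X ==> y \<in> carrier X ==> f (x \<oplus>\<^sub>X y) = f x \<oplus>\<^sub>Y f y"
  "\<And>r x. r \<in> carrier R ==> x \<in> carrier X ==> f (r \<odot>\<^sub>X x) = r \<odot>\<^sub>Y f x"
  "\<And>x. x \<notin> carrier X ==> f x = undefined"
 shows "f \<in> mod_hom R X Y"
 using assms by (auto simp: mod_hom_def)

lemma mod_hom_restrictI:
 assumes "left_module R X" "\<And>x. x \<in> carrier X ==> f x \<in> carrier Y"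
  "\<And>x y. x \<in> carrier X ==> y \<in> carrier X ==> f (x \<oplus>\<^sub>X y) = f x \<oplus>\<^sub>Y f y"
  "\<And>r x. r \<in> carrier R ==> x \<in> carrier X ==> f (r \<odot>\<^sub>X x) = r \<odot>\<^sub>Y f x"
 shows "restrict f (carrier X) \<in> mod_hom R X Y"
proof -
 interpret X: left_module R X by fact
 show ?thesis using assms(2-4) by (intro mod_homI) auto
qed

lemma mod_homD:
 assumes "f \<in> mod_hom R X Y"
 shows "\<And>x. x \<in> carrier X ==> f x \<in> carrier Y"
  "\<And>x y. x \<in> carrier X ==> y \<in> carrier X ==> f (x \<oplus>\<^sub>X y) = f x \<oplus>\<^sub>Y f y"
  "\<And>r x. r \<in> carrier R ==> x \<in> carrier X ==> f (r \<odot>\<^sub>X x) = r \<odot>\<^sub>Y f x"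
  "\<And>x. x \<notin> carrier X ==> f x = undefined"
 using assms by (auto simp: mod_hom_def)

lemma mod_hom_eqI:
 "f \<in> mod_hom R X Y ==> g \<in> mod_hom R X Y ==> (\<And>x. x \<in> carrier X ==> f x = g x) ==> f = g"
 using mod_homD(4)[of f R X Y] mod_homD(4)[of g R X Y] by (metis ext)

lemma mod_hom_zero:
 assumes "f \<in> mod_hom R X Y" "left_module R X" "left_module R Y"
 shows "f \<zero>\<^sub>X = \<zero>\<^sub>Y"
proof -
 interpret X: left_module R X by fact
 interpret Y: left_module R Y by fact
 show ?thesis
  using mod_homD(3)[OF assms(1), of "\<zero>\<^sub>R" "\<zero>\<^sub>X"] mod_homD(1)[OF assms(1), of "\<zero>\<^sub>X"]
  by simp
qed

lemma mod_hom_lincomb: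
 assumes "f \<in> mod_hom R X Y" "left_module R X" "left_module R Y"
  "\<And>i. i < n ==> a i \<in> carrier R" "\<And>i. i < n ==> v i \<in> carrier X"
 shows "f (lincomb X n a v) = lincomb Y n a (%i. f (v i))"
proof -
 interpret X: left_module R X by fact
 have "f (lincomb X n a v) = msum Y n (%i. f (a i \<odot>\<^sub>X v i))"
  unfolding lincomb_def
  using assms mod_hom_zero[OF assms(1-3)] mod_homD[OF assms(1)] X.M.abelian_group_axioms
  by (intro msum_hom) auto
 also have "\<dots> = lincomb Y n a (%i. f (v i))"
  unfolding lincomb_def using assms mod_homD[OF assms(1)] by (intro msum_cong) auto
 finally show ?thesis .
qed

lemma mod_hom_compose:
 assumes "f \<in> mod_hom R X Y" "g \<in> mod_hom R Y Z" "left_module R X"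
 shows "(\<lambda>x\<in>carrier X. g (f x)) \<in> mod_hom R X Z"
 using mod_homD[OF assms(1)] mod_homD[OF assms(2)] assms(3) by (intro mod_hom_restrictI) auto

lemma mod_hom_add:
 assumes "f \<in> mod_hom R X Y" "g \<in> mod_hom R X Y" "left_module R X" "left_module R Y"
 shows "(\<lambda>x\<in>carrier X. f x \<oplus>\<^sub>Y g x) \<in> mod_hom R X Y"
proof -
 interpret Y: left_module R Y by fact
 show ?thesis using mod_homD[OF assms(1)] mod_homD[OF assms(2)] assms(3)
  by (intro mod_hom_restrictI) (auto simp: Y.M.a_ac Y.smult_r_distr)
qed

lemma mod_hom_diff:
 assumes "f \<in> mod_hom R X Y" "g \<in> mod_hom R X Y" "left_module R X" "left_module R Y"
 shows "(\<lambda>x\<in>carrier X. f x \<ominus>\<^sub>Y g x) \<in> mod_hom R X Y"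
proof -
 interpret Y: left_module R Y by fact
 show ?thesis using mod_homD[OF assms(1)] mod_homD[OF assms(2)] assms(3)
  by (intro mod_hom_restrictI)
   (auto simp: a_minus_def Y.M.a_ac Y.smult_r_distr Y.smult_minus Y.M.minus_add)
qed

lemma mod_hom_minus:
 assumes "f \<in> mod_hom R X Y" "left_module R X" "left_module R Y" "x \<in> carrier X"
 shows "f (\<ominus>\<^sub>X x) = \<ominus>\<^sub>Y f x"
proof -
 interpret X: left_module R X by fact
 interpret Y: left_module R Y by fact
 have "f (\<ominus>\<^sub>X x) \<oplus>\<^sub>Y f x = \<zero>\<^sub>Y"
  using mod_homD(2)[OF assms(1), of "\<ominus>\<^sub>X x" x] assms(4) mod_hom_zero[OF assms(1-3)]
  by (simp add: X.M.l_neg)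
 then show ?thesis using mod_homD(1)[OF assms(1)] assms(4)
  by (metis X.M.a_inv_closed Y.M.minus_equality)
qed

section \<open>Submodules and finite systems of generators\<close>

lemma submoduleI:
 assumes "left_module R N" "H \<subseteq> carrier N" "\<zero>\<^sub>N \<in> H" "\<And>x y. x \<in> H ==> y \<in> H ==> x \<oplus>\<^sub>N y \<in> H"
  "\<And>r x. r \<in> carrier R ==> x \<in> H ==> r \<odot>\<^sub>N x \<in> H"
 shows "submodule H R N"
proof -
 interpret N: left_module R N by fact
 \<comment> \<open>Negatives are multiples by minus one, so they come from closure under
   scalars.\<close>
 have "\<ominus>\<^sub>N x \<in> H" if "x \<in> H" for x
  using assms(5)[of "\<ominus>\<^sub>R \<one>\<^sub>R" x] that assms(2) N.minus_smult[of "\<one>\<^sub>R" x] by auto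
 then show ?thesis using assms
  by (intro submodule.intro submodule_axioms.intro subgroup.intro)
   (auto simp: a_inv_def)
qed

lemma submoduleD:
 assumes "submodule H R N"
 shows "H \<subseteq> carrier N" "\<zero>\<^sub>N \<in> H" "\<And>x y. x \<in> H ==> y \<in> H ==> x \<oplus>\<^sub>N y \<in> H"
  "\<And>r x. r \<in> carrier R ==> x \<in> H ==> r \<odot>\<^sub>N x \<in> H" "\<And>x. x \<in> H ==> \<ominus>\<^sub>N x \<in> H"
proof -
 interpret submodule H R N by fact
 show "H \<subseteq> carrier N" "\<zero>\<^sub>N \<in> H" using subset one_closed by auto
 show "\<And>x y. x \<in> H ==> y \<in> H ==> x \<oplus>\<^sub>N y \<in> H" using m_closed by simp
 show "\<And>r x. r \<in> carrier R ==> x \<in> H ==> r \<odot>\<^sub>N x \<in> H" by (rule smult_closed)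
 show "\<And>x. x \<in> H ==> \<ominus>\<^sub>N x \<in> H" using m_inv_closed by (simp add: a_inv_def)
qed

lemma submodule_lincomb:
 assumes "submodule H R N" "\<And>i. i < n ==> a i \<in> carrier R" "\<And>i. i < n ==> v i \<in> H"
 shows "lincomb N n a v \<in> H"
 using assms(2,3) by (induction n) (auto intro: submoduleD(2,3,4)[OF assms(1)])

lemma submodule_left_module:
 assumes "submodule H R N" "left_module R N"
 shows "left_module R (N\<lparr>carrier := H\<rparr>)"
proof -
 interpret N: left_module R N by fact
 note H = submoduleD[OF assms(1)]
 have "abelian_group (N\<lparr>carrier := H\<rparr>)"
 proof (rule abelian_groupI)
  fix x assume "x \<in> carrier (N\<lparr>carrier := H\<rparr>)"
  then show "\<exists>y\<in>carrier (N\<lparr>carrier := H\<rparr>). y \<oplus>\<^bsub>N\<lparr>carrier := H\<rparr>\<^esub> x = \<zero>\<^bsub>N\<lparr>carrier := H\<rparr>\<^esub>"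
   using H by (intro bexI[of _ "\<ominus>\<^sub>N x"]) (auto simp: N.M.l_neg)
 qed (use H in \<open>auto simp: N.M.a_ac subset_iff\<close>)
 then show ?thesis using H
  by (intro left_module.intro N.R.ring_axioms left_module_axioms.intro)
   (auto simp: N.smult_l_distr N.smult_r_distr N.smult_assoc1 subset_iff)
qed

text \<open>Generators form a finite sequence instead of a set, so that coefficients are vectors.
  The spanned set \<open>U\<close> is kept apart from the carrier because modules of relations are
  spanned inside a free module.\<close>

definition spans :: "'r ring => ('r, 'x) module => 'x set => nat => (nat => 'x) => bool" where
 "spans R N U m g \<longleftrightarrow> (\<forall>j<m. g j \<in> U) \<and>
  (\<forall>x\<in>U. \<exists>c. (\<forall>j<m. c j \<in> carrier R) \<and> x = lincomb N m c g)"

lemma spansD: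
 assumes "spans R N U m g"
 shows "\<And>j. j < m ==> g j \<in> U"
  "\<And>x. x \<in> U ==> \<exists>c. (\<forall>j<m. c j \<in> carrier R) \<and> x = lincomb N m c g"
 using assms by (simp_all add: spans_def)

lemma spansE:
 assumes "spans R N U m g" "x \<in> U"
 obtains c where "\<forall>j<m. c j \<in> carrier R" "x = lincomb N m c g"
 using spansD(2)[OF assms] by metis

lemma spans_fg_module:
 assumes "left_module R N" "spans R N (carrier N) m g"
 shows "fg_module R N"
 unfolding fg_module_def
proof (intro conjI exI[of _ "g ` {..<m}"] allI impI)
 show "g ` {..<m} \<subseteq> carrier N" using spansD(1)[OF assms(2)] by auto
next
 fix H assume H: "submodule H R N \<and> g ` {..<m} \<subseteq> H"
 show "H = carrier N"
 proof
  show "carrier N \<subseteq> H"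
  proof
   fix x assume "x \<in> carrier N"
   then obtain c where "\<forall>j<m. c j \<in> carrier R" "x = lincomb N m c g"
    by (rule spansE[OF assms(2)])
   then show "x \<in> H" using H submodule_lincomb[of H R N m c g] by auto
  qed
  show "H \<subseteq> carrier N" using H by (elim conjE submoduleD(1))
 qed
qed (use assms(1) in auto)

text \<open>\<open>fg_module_spanned\<close> speaks of unordered sums over a set. An injective
  enumeration of that set turns them into ordered ones without merging generators.\<close>

lemma finsum_lincomb:
 assumes "left_module R N" "inj_on g {..<m}" "\<And>i. i < m ==> g i \<in> carrier N"
  "\<And>i. i < m ==> c (g i) \<in> carrier R"
 shows "finsum N (%s. c s \<odot>\<^sub>N s) (g ` {..<m}) = lincomb N m (%i. c (g i)) g"
 using assms(2-4)
proof (induction m)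
 case 0
 interpret N: left_module R N by fact
 show ?case by simp
next
 case (Suc m)
 interpret N: left_module R N by fact
 have "g m \<notin> g ` {..<m}" using inj_onD[OF Suc.prems(1), of m] by fastforce
 then have "finsum N (%s. c s \<odot>\<^sub>N s) (insert (g m) (g ` {..<m}))
   = c (g m) \<odot>\<^sub>N g m \<oplus>\<^sub>N finsum N (%s. c s \<odot>\<^sub>N s) (g ` {..<m})"
  using Suc.prems by (intro N.M.finsum_insert) auto
 moreover have "insert (g m) (g ` {..<m}) = g ` {..<Suc m}" by (auto simp: less_Suc_eq)
 ultimately show ?case using Suc
  by (simp add: inj_on_def) (rule N.M.a_comm; auto)
qed

lemma fg_module_spans:
 assumes "fg_module R N"
 obtains m g where "spans R N (carrier N) m g"
proof -
 obtain S where S: "finite S" "S \<subseteq> carrier N"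
  "\<And>H. submodule H R N ==> S \<subseteq> H ==> H = carrier N" and lm: "left_module R N"
  using assms by (auto simp: fg_module_def)
 obtain m and g :: "nat => _" where g: "inj_on g {..<m}" "g ` {..<m} = S"
  using finite_imp_nat_seg_image_inj_on[OF S(1)] by (metis lessThan_def)
 have "spans R N (carrier N) m g"
  unfolding spans_def
 proof (intro conjI ballI)
  show "\<forall>j<m. g j \<in> carrier N" using g S by auto
  fix x assume "x \<in> carrier N"
  then have "x \<in> {finsum N (%s. c s \<odot>\<^sub>N s) S | c. c \<in> S \<rightarrow> carrier R}"
   using fg_module_spanned[OF lm S] by simp
  then obtain c where c: "c \<in> S \<rightarrow> carrier R" "x = finsum N (%s. c s \<odot>\<^sub>N s) S"
   by (elim CollectE exE conjE)
  then show "\<exists>c. (\<forall>j<m. c j \<in> carrier R) \<and> x = lincomb N m c g"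
   using finsum_lincomb[OF lm g(1), of c] g(2) S(2)
   by (intro exI[of _ "%i. c (g i)"]) (auto simp: Pi_iff)
 qed
 then show ?thesis by (rule that)
qed

lemma left_module_if_fg: "fg_module R N ==> left_module R N"
 by (simp add: fg_module_def)

lemma spans_image:
 assumes "f \<in> mod_hom R X Y" "left_module R X" "left_module R Y" "spans R X (carrier X) m g"
 shows "spans R Y (f ` carrier X) m (%i. f (g i))"
 unfolding spans_def
proof (intro conjI ballI)
 fix y assume "y \<in> f ` carrier X"
 then obtain x where x: "x \<in> carrier X" "y = f x" by (rule imageE)
 obtain c where c: "\<forall>j<m. c j \<in> carrier R" "x = lincomb X m c g"
  by (rule spansE[OF assms(4) x(1)])
 show "\<exists>c. (\<forall>j<m. c j \<in> carrier R) \<and> y = lincomb Y m c (%i. f (g i))"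
  using mod_hom_lincomb[OF assms(1-3), of m c g] spansD(1)[OF assms(4)] c x(2) by auto
next
 show "\<forall>j<m. f (g j) \<in> f ` carrier X" using spansD(1)[OF assms(4)] by simp
qed

lemma vimage_submodule:
 assumes "f \<in> mod_hom R X Y" "left_module R X" "left_module R Y" "submodule U R Y"
 shows "submodule {x \<in> carrier X. f x \<in> U} R X"
proof -
 interpret X: left_module R X by fact
 show ?thesis
  by (rule submoduleI[OF assms(2)])
   (use submoduleD[OF assms(4)] in \<open>simp_all add: mod_hom_zero[OF assms(1-3)] mod_homD[OF assms(1)]\<close>)
qed

lemma image_submodule:
 assumes "f \<in> mod_hom R X Y" "left_module R X" "left_module R Y"
 shows "submodule (f ` carrier X) R Y"
proof -
 interpret X: left_module R X by fact
 show ?thesis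
 proof (rule submoduleI[OF assms(3)])
  show "f ` carrier X \<subseteq> carrier Y" using mod_homD(1)[OF assms(1)] by auto
  show "\<zero>\<^sub>Y \<in> f ` carrier X" using mod_hom_zero[OF assms] by (metis X.M.zero_closed image_eqI)
  show "x \<oplus>\<^sub>Y y \<in> f ` carrier X" if "x \<in> f ` carrier X" "y \<in> f ` carrier X" for x y
   using that by (elim imageE) (simp add: mod_homD(2)[OF assms(1), symmetric])
  show "r \<odot>\<^sub>Y y \<in> f ` carrier X" if "r \<in> carrier R" "y \<in> f ` carrier X" for r y
   using that by (elim imageE) (simp add: mod_homD(3)[OF assms(1), symmetric])
 qed
qed

lemma lincomb_carrier_update [simp]: "lincomb (N\<lparr>carrier := H\<rparr>) n a v = lincomb N n a v"
 by (induction n) auto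

lemma image_fg_module:
 assumes "f \<in> mod_hom R X Y" "fg_module R X" "left_module R Y"
 shows "fg_module R (Y\<lparr>carrier := f ` carrier X\<rparr>)"
proof -
 have X: "left_module R X" using assms(2) by (rule left_module_if_fg)
 obtain m g where g: "spans R X (carrier X) m g" using assms(2) by (rule fg_module_spans)
 have "spans R (Y\<lparr>carrier := f ` carrier X\<rparr>) (f ` carrier X) m (%i. f (g i))"
  using spans_image[OF assms(1) X assms(3) g] by (simp add: spans_def)
 then show ?thesis
  using spans_fg_module[OF submodule_left_module[OF image_submodule[OF assms(1) X assms(3)] assms(3)]]
  by simp
qed

section \<open>Lifting, quotient and free modules\<close>

text \<open>Cutting the target down to the image of \<open>\<phi>\<close> leaves well-definedness as
  the only issue. Maps out of quotients, out of presented modules and out of cyclic submodules are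
  all obtained in this way.\<close>

lemma mod_hom_factor:
 assumes "left_module R X" "left_module R Y" "left_module R W" "\<phi> \<in> mod_hom R X Y" "h \<in> mod_hom R X W"
  "\<And>x. x \<in> carrier X ==> \<phi> x = \<zero>\<^sub>Y ==> h x = \<zero>\<^sub>W"
 obtains f where "f \<in> mod_hom R (Y\<lparr>carrier := \<phi> ` carrier X\<rparr>) W" "\<forall>x\<in>carrier X. f (\<phi> x) = h x"
proof -
 interpret X: left_module R X by fact
 interpret Y: left_module R Y by fact
 interpret W: left_module R W by fact
 let ?Y = "Y\<lparr>carrier := \<phi> ` carrier X\<rparr>"
 have sub: "submodule (\<phi> ` carrier X) R Y" by (rule image_submodule[OF assms(4,1,2)])
 have lm: "left_module R ?Y" by (rule submodule_left_module[OF sub assms(2)])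
 \<comment> \<open>The difference of two preimages of one element lies in the kernel of
   \<open>\<phi>\<close>, hence in that of \<open>h\<close>.\<close>
 have wd: "h x = h y" if xy: "x \<in> carrier X" "y \<in> carrier X" "\<phi> x = \<phi> y" for x y
 proof -
  let ?d = "x \<oplus>\<^sub>X \<ominus>\<^sub>X y"
  have "\<phi> ?d = \<zero>\<^sub>Y"
   using mod_homD(1,2)[OF assms(4)] mod_hom_minus[OF assms(4,1,2)] xy by (simp add: Y.M.r_neg)
  then have "h ?d = \<zero>\<^sub>W" using xy by (intro assms(6)) simp_all
  then have "h x \<ominus>\<^sub>W h y = \<zero>\<^sub>W"
   using mod_homD(2)[OF assms(5)] mod_hom_minus[OF assms(5,1,3)] xy by (simp add: a_minus_def)
  then show ?thesis using mod_homD(1)[OF assms(5)] xy by (simp add: W.M.minus_eq_zero_iff)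
 qed
 define f where "f y = h (SOME x. x \<in> carrier X \<and> \<phi> x = y)" for y
 have f: "f (\<phi> x) = h x" if x: "x \<in> carrier X" for x
 proof -
  have "(SOME z. z \<in> carrier X \<and> \<phi> z = \<phi> x) \<in> carrier X \<and> \<phi> (SOME z. z \<in> carrier X \<and> \<phi> z = \<phi> x) = \<phi> x"
   by (rule someI[of _ x]) (use x in simp)
  then show ?thesis unfolding f_def by (intro wd x) simp_all
 qed
 show ?thesis
 proof (rule that)
  show "restrict f (carrier ?Y) \<in> mod_hom R ?Y W"
  proof (rule mod_hom_restrictI[OF lm])
   fix y assume "y \<in> carrier ?Y"
   then obtain x where x: "x \<in> carrier X" "y = \<phi> x" by auto
   show "f y \<in> carrier W" using f x mod_homD(1)[OF assms(5)] by simp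
   fix y' assume "y' \<in> carrier ?Y"
   then obtain x' where x': "x' \<in> carrier X" "y' = \<phi> x'" by auto
   show "f (y \<oplus>\<^bsub>?Y\<^esub> y') = f y \<oplus>\<^sub>W f y'"
    using f[of "x \<oplus>\<^sub>X x'"] f[OF x(1)] f[OF x'(1)] x x'
    by (simp add: mod_homD(2)[OF assms(4)] mod_homD(2)[OF assms(5)])
  next
   fix r y assume r: "r \<in> carrier R" and "y \<in> carrier ?Y"
   then obtain x where x: "x \<in> carrier X" "y = \<phi> x" by auto
   show "f (r \<odot>\<^bsub>?Y\<^esub> y) = r \<odot>\<^sub>W f y"
    using f[of "r \<odot>\<^sub>X x"] f[OF x(1)] x r
    by (simp add: mod_homD(3)[OF assms(4)] mod_homD(3)[OF assms(5)])
  qed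
  show "\<forall>x\<in>carrier X. restrict f (carrier ?Y) (\<phi> x) = h x" using f by simp
 qed
qed

lemma mod_hom_inverse:
 assumes "f \<in> mod_hom R X Y" "bij_betw f (carrier X) (carrier Y)" "left_module R X" "left_module R Y"
 obtains g where "g \<in> mod_hom R Y X" "\<forall>x\<in>carrier X. g (f x) = x"
  "\<forall>y\<in>carrier Y. f (g y) = y"
proof -
 interpret X: left_module R X by fact
 define h where "h = inv_into (carrier X) f"
 have inj: "inj_on f (carrier X)" and im: "f ` carrier X = carrier Y"
  using assms(2) by (auto simp: bij_betw_def)
 have hf: "h (f x) = x" if "x \<in> carrier X" for x
  unfolding h_def using that inj by (rule inv_into_f_f[rotated])
 have fh: "f (h y) = y" "h y \<in> carrier X" if "y \<in> carrier Y" for y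
  unfolding h_def using that im by (auto intro: f_inv_into_f inv_into_into)
 have "restrict h (carrier Y) \<in> mod_hom R Y X"
 proof (rule mod_hom_restrictI[OF assms(4)])
  fix x y assume xy: "x \<in> carrier Y" "y \<in> carrier Y"
  show "h (x \<oplus>\<^sub>Y y) = h x \<oplus>\<^sub>X h y"
   using hf[of "h x \<oplus>\<^sub>X h y"] fh[OF xy(1)] fh[OF xy(2)] mod_homD(2)[OF assms(1)] by simp
 next
  fix r x assume rx: "r \<in> carrier R" "x \<in> carrier Y"
  show "h (r \<odot>\<^sub>Y x) = r \<odot>\<^sub>X h x"
   using hf[of "r \<odot>\<^sub>X h x"] fh[OF rx(2)] rx(1) mod_homD(3)[OF assms(1)] by simp
 qed (rule fh)
 then show ?thesis
  using fh hf mod_homD(1)[OF assms(1)] by (intro that[of "restrict h (carrier Y)"]) auto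
qed

text \<open>\<open>projective_module\<close> tests surjections between small modules. The image of
  \<open>g\<close> is finitely generated and so has a small copy; the lifting problem is transported
  there, where \<open>g\<close> has become surjective.\<close>

lemma projective_lift:
 fixes X :: "'r small_module"
 assumes "projective_module R P" "fg_module R X" "left_module R Y" "g \<in> mod_hom R X Y"
  "f \<in> mod_hom R P Y" "f ` carrier P \<subseteq> g ` carrier X"
 obtains h where "h \<in> mod_hom R P X" "\<forall>p\<in>carrier P. g (h p) = f p"
proof -
 let ?Y = "Y\<lparr>carrier := g ` carrier X\<rparr>"
 have X: "left_module R X" using assms(2) by (rule left_module_if_fg)
 have P: "left_module R P" using assms(1) by (simp add: projective_module_def fg_module_def)
 interpret Y: left_module R Y by fact
 have fgY: "fg_module R ?Y" using assms(4,2,3) by (rule image_fg_module)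
 then obtain Y' :: "'r small_module" and t where Y': "fg_module R Y'"
  and t: "t \<in> mod_hom R ?Y Y'" "bij_betw t (carrier ?Y) (carrier Y')"
  using fg_module_small unfolding mod_iso_def by metis
 have g: "g \<in> mod_hom R X ?Y" using mod_homD[OF assms(4)] by (intro mod_homI) auto
 have f: "f \<in> mod_hom R P ?Y" using mod_homD[OF assms(5)] assms(6) by (intro mod_homI) auto
 let ?g = "\<lambda>x\<in>carrier X. t (g x)" and ?f = "\<lambda>x\<in>carrier P. t (f x)"
 have "?g \<in> mod_hom R X Y'" "?f \<in> mod_hom R P Y'"
  using mod_hom_compose[OF g t(1) X] mod_hom_compose[OF f t(1) P] by auto
 moreover have "?g ` carrier X = carrier Y'"
  using t(2) by (auto simp: bij_betw_def)
 ultimately obtain h where h: "h \<in> mod_hom R P X" "\<forall>p\<in>carrier P. ?g (h p) = ?f p"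
  using assms(1) assms(2) Y' unfolding projective_module_def by blast
 show ?thesis
 proof (rule that[OF h(1)], intro ballI)
  fix p assume p: "p \<in> carrier P"
  then have "t (g (h p)) = t (f p)" using h mod_homD(1)[OF h(1) p] by auto
  then show "g (h p) = f p"
   using t(2) mod_homD(1)[OF h(1) p] assms(6) p unfolding bij_betw_def
   by (elim conjE inj_onD) auto
 qed
qed

text \<open>\<open>injective_module\<close> tests embeddings of small modules. Both \<open>X\<close>
  and \<open>Y\<close> are replaced by small copies, and the extension is carried back along the
  isomorphism of \<open>Y\<close>.\<close>

lemma injective_extend:
 fixes R :: "'a ring"
 assumes "injective_module R I" "fg_module R X" "fg_module R Y" "g \<in> mod_hom R X Y"
  "inj_on g (carrier X)" "f \<in> mod_hom R X I"
 obtains h where "h \<in> mod_hom R Y I" "\<forall>x\<in>carrier X. h (g x) = f x"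
proof -
 have lm: "left_module R X" "left_module R Y" using assms(2,3) left_module_if_fg by auto
 obtain X' :: "'a small_module" and s where X': "fg_module R X'"
  and s: "s \<in> mod_hom R X X'" "bij_betw s (carrier X) (carrier X')"
  using assms(2) fg_module_small unfolding mod_iso_def by metis
 obtain Y' :: "'a small_module" and t where Y': "fg_module R Y'"
  and t: "t \<in> mod_hom R Y Y'" "bij_betw t (carrier Y) (carrier Y')"
  using assms(3) fg_module_small unfolding mod_iso_def by metis
 have lm': "left_module R X'" "left_module R Y'" using X' Y' left_module_if_fg by auto
 obtain s' where s': "s' \<in> mod_hom R X' X" "\<forall>x\<in>carrier X. s' (s x) = x"
  "\<forall>y\<in>carrier X'. s (s' y) = y"
  by (rule mod_hom_inverse[OF s lm(1) lm'(1)])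
 let ?g = "\<lambda>x\<in>carrier X'. t ((\<lambda>x\<in>carrier X'. g (s' x)) x)" and ?f = "\<lambda>x\<in>carrier X'. f (s' x)"
 have "?f \<in> mod_hom R X' I" by (rule mod_hom_compose[OF s'(1) assms(6) lm'(1)])
 moreover have "?g \<in> mod_hom R X' Y'"
  by (rule mod_hom_compose[OF mod_hom_compose[OF s'(1) assms(4) lm'(1)] t(1) lm'(1)])
 moreover have "inj_on ?g (carrier X')"
 proof (rule inj_onI)
  fix x y assume xy: "x \<in> carrier X'" "y \<in> carrier X'" "?g x = ?g y"
  then have "t (g (s' x)) = t (g (s' y))" by simp
  then have "g (s' x) = g (s' y)"
   using t(2) mod_homD(1)[OF s'(1)] mod_homD(1)[OF assms(4)] xy by (meson bij_betw_def inj_onD)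
  then have "s' x = s' y" using assms(5) mod_homD(1)[OF s'(1)] xy by (meson inj_onD)
  then show "x = y" using s'(3) xy by metis
 qed
 ultimately obtain h where h: "h \<in> mod_hom R Y' I" "\<forall>x\<in>carrier X'. h (?g x) = ?f x"
  using assms(1) X' Y' unfolding injective_module_def by blast
 show ?thesis
 proof (rule that[OF mod_hom_compose[OF t(1) h(1) lm(2)]], intro ballI)
  fix x assume x: "x \<in> carrier X"
  have "s x \<in> carrier X'" using mod_homD(1)[OF s(1) x] .
  then have "h (?g (s x)) = ?f (s x)" using h(2) by blast
  then show "(\<lambda>x\<in>carrier Y. h (t x)) (g x) = f x"
   using x s'(2) \<open>s x \<in> carrier X'\<close> mod_homD(1)[OF assms(4) x] by simp
 qed
qed

section \<open>Powers and free modules\<close>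

definition fun_module :: "('r, 'v) module => 'i set => ('r, 'i => 'v) module" where
 "fun_module V I = \<lparr>carrier = I \<rightarrow>\<^sub>E carrier V, monoid.mult = undefined, one = undefined,
  ring.zero = (\<lambda>i\<in>I. \<zero>\<^sub>V), add = (%v w. \<lambda>i\<in>I. v i \<oplus>\<^sub>V w i),
  smult = (%r v. \<lambda>i\<in>I. r \<odot>\<^sub>V v i)\<rparr>"

lemma fun_module_simps [simp]:
 "carrier (fun_module V I) = I \<rightarrow>\<^sub>E carrier V" "\<zero>\<^bsub>fun_module V I\<^esub> = (\<lambda>i\<in>I. \<zero>\<^sub>V)"
 "v \<oplus>\<^bsub>fun_module V I\<^esub> w = (\<lambda>i\<in>I. v i \<oplus>\<^sub>V w i)" "r \<odot>\<^bsub>fun_module V I\<^esub> v = (\<lambda>i\<in>I. r \<odot>\<^sub>V v i)"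
 by (simp_all add: fun_module_def)

abbreviation power_module :: "('r, 'v) module => nat => ('r, nat => 'v) module" where
 "power_module V n \<equiv> fun_module V {..<n}"

lemma left_module_fun:
 assumes "left_module R V"
 shows "left_module R (fun_module V I)"
proof -
 interpret V: left_module R V by fact
 have "abelian_group (fun_module V I)"
 proof (rule abelian_groupI)
  fix v assume "v \<in> carrier (fun_module V I)"
  then show "\<exists>w\<in>carrier (fun_module V I). w \<oplus>\<^bsub>fun_module V I\<^esub> v = \<zero>\<^bsub>fun_module V I\<^esub>"
   by (intro bexI[of _ "\<lambda>i\<in>I. \<ominus>\<^sub>V v i"]) (auto simp: PiE_iff V.M.l_neg restrict_def fun_eq_iff extensional_def)
 qed (auto simp: V.M.a_ac PiE_iff restrict_def fun_eq_iff extensional_def)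
 then show ?thesis
  by (intro left_module.intro V.R.ring_axioms left_module_axioms.intro)
   (auto simp: V.smult_l_distr V.smult_r_distr V.smult_assoc1 PiE_iff restrict_def fun_eq_iff extensional_def)
qed

lemma lincomb_power:
 "i < n ==> lincomb (power_module V n) m a v i = lincomb V m a (%j. v j i)"
 by (induction m) (simp_all add: restrict_def)

definition free_module :: "'r ring => nat => ('r, nat => 'r) module" where
 "free_module R n = power_module (regular R) n"

lemma free_module_simps [simp]:
 "carrier (free_module R n) = {..<n} \<rightarrow>\<^sub>E carrier R" "\<zero>\<^bsub>free_module R n\<^esub> = (\<lambda>i\<in>{..<n}. \<zero>\<^sub>R)"
 "v \<oplus>\<^bsub>free_module R n\<^esub> w = (\<lambda>i\<in>{..<n}. v i \<oplus>\<^sub>R w i)"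
 "r \<odot>\<^bsub>free_module R n\<^esub> v = (\<lambda>i\<in>{..<n}. r \<otimes>\<^sub>R v i)"
 by (simp_all add: free_module_def)

lemma left_module_free: "ring R ==> left_module R (free_module R n)"
 unfolding free_module_def by (intro left_module_fun left_module_regular)

lemma lincomb_free:
 "i < n ==> lincomb (free_module R n) m a v i = dot R m a (%j. v j i)"
 unfolding free_module_def by (simp add: lincomb_power lincomb_regular)

lemma lincomb_restrict [simp]: "lincomb V n (restrict v {..<n}) w = lincomb V n v w"
 by (rule lincomb_cong) auto

lemma free_hom:
 assumes "left_module R W" "\<And>i. i < n ==> w i \<in> carrier W"
 shows "(\<lambda>v\<in>carrier (free_module R n). lincomb W n v w) \<in> mod_hom R (free_module R n) W"
proof -
 interpret W: left_module R W by fact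
 show ?thesis
  by (rule mod_hom_restrictI[OF left_module_free[OF W.R.ring_axioms]])
   (use assms(2) in \<open>auto simp: PiE_iff intro!: W.lincomb_add_left W.lincomb_smult_left\<close>)
qed

lemma lincomb_free_unit_vec:
 assumes "ring R" "v \<in> {..<n} \<rightarrow>\<^sub>E carrier R"
 shows "lincomb (free_module R n) n v (%j. restrict (unit_vec R j) {..<n}) = v"
proof -
 interpret ring R by fact
 interpret F: left_module R "free_module R n" using assms(1) by (rule left_module_free)
 have u: "restrict (unit_vec R j) {..<n} \<in> carrier (free_module R n)" for j
  by (auto simp: unit_vec_def)
 show ?thesis
 proof
  fix i show "lincomb (free_module R n) n v (%j. restrict (unit_vec R j) {..<n}) i = v i"
  proof (cases "i < n")
   case True
   have "lincomb (free_module R n) n v (%j. restrict (unit_vec R j) {..<n}) i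
     = msum R n (%j. if j = i then v i else \<zero>\<^sub>R)"
    unfolding lincomb_free[OF True] using True assms(2)
    by (intro msum_cong) (auto simp: unit_vec_def PiE_iff)
   then show ?thesis using True assms(2) by (subst (asm) msum_single) (auto simp: PiE_iff)
  next
   case False
   have "lincomb (free_module R n) n v (%j. restrict (unit_vec R j) {..<n}) \<in> {..<n} \<rightarrow>\<^sub>E carrier R"
    using F.lincomb_closed[of n v "%j. restrict (unit_vec R j) {..<n}"] u assms(2)
    by (auto simp: PiE_iff)
   then show ?thesis using False assms(2) by (simp add: PiE_def extensional_def)
  qed
 qed
qed

lemma spans_free:
 assumes "ring R"
 shows "spans R (free_module R n) (carrier (free_module R n)) n (%j. restrict (unit_vec R j) {..<n})"
proof -
 interpret ring R by fact
 show ?thesis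
  unfolding spans_def
 proof (intro conjI ballI)
  fix v assume v: "v \<in> carrier (free_module R n)"
  then show "\<exists>c. (\<forall>j<n. c j \<in> carrier R) \<and>
    v = lincomb (free_module R n) n c (%j. restrict (unit_vec R j) {..<n})"
   using lincomb_free_unit_vec[OF assms, of v n] by (intro exI[of _ v]) (auto simp: PiE_iff)
 qed (auto simp: unit_vec_def)
qed

lemma fg_module_free: "ring R ==> fg_module R (free_module R n)"
 using spans_fg_module[OF left_module_free spans_free] .

lemma fg_module_regular:
 assumes "ring R"
 shows "fg_module R (regular R)"
proof -
 interpret ring R by fact
 interpret left_module R "regular R" using assms by (rule left_module_regular)
 have "spans R (regular R) (carrier (regular R)) 1 (%_. \<one>\<^sub>R)"
  unfolding spans_def lincomb_def
 proof (intro conjI ballI)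
  fix x assume "x \<in> carrier (regular R)"
  then show "\<exists>c. (\<forall>j<1. c j \<in> carrier R) \<and> x = msum (regular R) 1 (%i. c i \<odot>\<^bsub>regular R\<^esub> \<one>\<^sub>R)"
   by (intro exI[of _ "%_. x"]) simp
 qed simp
 then show ?thesis by (rule spans_fg_module[OF left_module_axioms])
qed

section \<open>Quotient modules\<close>

lemma submodule_abelian_subgroup:
 assumes "submodule H R N" "left_module R N"
 shows "abelian_subgroup H N"
proof -
 interpret N: left_module R N by fact
 interpret H: submodule H R N by fact
 show ?thesis
  by (rule abelian_subgroupI3[OF additive_subgroup.intro[OF H.subgroup_axioms] N.M.abelian_group_axioms])
qed

lemma quot_module_simps:
 "carrier (quot_module N H) = a_rcosets\<^bsub>N\<^esub> H" "\<zero>\<^bsub>quot_module N H\<^esub> = H"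
 "S \<oplus>\<^bsub>quot_module N H\<^esub> T = set_add N S T"
 "r \<odot>\<^bsub>quot_module N H\<^esub> S = (\<Union>x\<in>S. H +>\<^sub>N (r \<odot>\<^sub>N x))"
 by (simp_all add: quot_module_def)

context
 fixes R :: "'r ring" and N :: "('r, 'x) module" and H
 assumes sub: "submodule H R N" and lm: "left_module R N"
begin

interpretation N: left_module R N by (rule lm)
interpretation H: abelian_subgroup H N by (rule submodule_abelian_subgroup[OF sub lm])

lemma coset_eq_iff:
 assumes "x \<in> carrier N" "y \<in> carrier N"
 shows "H +>\<^sub>N x = H +>\<^sub>N y \<longleftrightarrow> x \<ominus>\<^sub>N y \<in> H"
proof
 assume "H +>\<^sub>N x = H +>\<^sub>N y"
 then have "x \<in> H +>\<^sub>N y" using H.a_rcos_self[OF assms(1)] by simp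
 then show "x \<ominus>\<^sub>N y \<in> H" using H.a_rcos_module_imp[OF assms(2)] assms(2)
  by (simp add: a_minus_def)
next
 assume "x \<ominus>\<^sub>N y \<in> H"
 then have "x \<in> H +>\<^sub>N y"
  using H.a_rcos_module_rev[OF assms(2,1)] by (simp add: a_minus_def)
 then show "H +>\<^sub>N x = H +>\<^sub>N y" using N.M.a_repr_independence[OF _ assms(2) H.a_subgroup] by simp
qed

lemma quot_carrier: "carrier (quot_module N H) = (%x. H +>\<^sub>N x) ` carrier N"
 by (auto simp: quot_module_simps A_RCOSETS_def')

lemma quot_add: "x \<in> carrier N ==> y \<in> carrier N ==>
  (H +>\<^sub>N x) \<oplus>\<^bsub>quot_module N H\<^esub> (H +>\<^sub>N y) = H +>\<^sub>N (x \<oplus>\<^sub>N y)"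
 by (simp add: quot_module_simps H.a_rcos_sum)

lemma quot_zero: "\<zero>\<^bsub>quot_module N H\<^esub> = H +>\<^sub>N \<zero>\<^sub>N"
 using N.M.a_coset_add_zero[OF submoduleD(1)[OF sub]] by (simp add: quot_module_simps)

text \<open>The scalar action of \<open>quot_module\<close> is a union over representatives; it
  collapses because all representatives contribute the same coset.\<close>

lemma quot_smult:
 assumes "r \<in> carrier R" "x \<in> carrier N"
 shows "r \<odot>\<^bsub>quot_module N H\<^esub> (H +>\<^sub>N x) = H +>\<^sub>N (r \<odot>\<^sub>N x)"
proof -
 have "H +>\<^sub>N (r \<odot>\<^sub>N y) = H +>\<^sub>N (r \<odot>\<^sub>N x)" if y: "y \<in> H +>\<^sub>N x" for y
 proof -
  have yc: "y \<in> carrier N" using y assms(2) H.a_rcosets_carrier by (meson H.a_elemrcos_carrier)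
  have "y \<ominus>\<^sub>N x \<in> H" using H.a_rcos_module_imp[OF assms(2) y] by (simp add: a_minus_def)
  then have "r \<odot>\<^sub>N (y \<ominus>\<^sub>N x) \<in> H" using submoduleD(4)[OF sub] assms(1) by simp
  then have "r \<odot>\<^sub>N y \<ominus>\<^sub>N r \<odot>\<^sub>N x \<in> H"
   using assms yc by (simp add: a_minus_def N.smult_r_distr N.smult_minus)
  then show ?thesis using coset_eq_iff assms yc by simp
 qed
 then have "(\<Union>y\<in>H +>\<^sub>N x. H +>\<^sub>N (r \<odot>\<^sub>N y)) = (\<Union>y\<in>H +>\<^sub>N x. H +>\<^sub>N (r \<odot>\<^sub>N x))"
  by (rule SUP_cong[OF refl])
 also have "\<dots> = H +>\<^sub>N (r \<odot>\<^sub>N x)"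
  using H.a_rcos_self[OF assms(2)] by (subst UN_constant) (metis empty_iff)
 finally show ?thesis by (simp only: quot_module_simps)
qed

lemma left_module_quot: "left_module R (quot_module N H)"
proof -
 have "abelian_group (quot_module N H)"
 proof (rule abelian_groupI)
  fix S assume "S \<in> carrier (quot_module N H)"
  then obtain x where "x \<in> carrier N" "S = H +>\<^sub>N x" by (auto simp: quot_carrier)
  then show "\<exists>T\<in>carrier (quot_module N H). T \<oplus>\<^bsub>quot_module N H\<^esub> S = \<zero>\<^bsub>quot_module N H\<^esub>"
   by (intro bexI[of _ "H +>\<^sub>N (\<ominus>\<^sub>N x)"]) (auto simp: quot_carrier quot_add quot_zero N.M.l_neg)
 qed (auto simp: quot_carrier quot_add quot_zero N.M.a_ac)
 then show ?thesis
  by (intro left_module.intro N.R.ring_axioms left_module_axioms.intro)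
   (auto simp: quot_carrier quot_add quot_smult N.smult_l_distr N.smult_r_distr N.smult_assoc1)
qed

lemma quot_proj: "(\<lambda>x\<in>carrier N. H +>\<^sub>N x) \<in> mod_hom R N (quot_module N H)"
 by (rule mod_hom_restrictI[OF lm]) (simp_all add: quot_carrier quot_add quot_smult)

lemma quot_lincomb:
 assumes "\<And>i. i < n ==> a i \<in> carrier R" "\<And>i. i < n ==> v i \<in> carrier N"
 shows "lincomb (quot_module N H) n a (%i. H +>\<^sub>N v i) = H +>\<^sub>N lincomb N n a v"
 using assms
proof (induction n)
 case 0
 show ?case by (simp add: quot_zero)
next
 case (Suc n)
 have "lincomb N n a v \<in> carrier N" using Suc.prems by (intro N.lincomb_closed) simp_all
 then show ?case using Suc by (simp add: quot_add quot_smult)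
qed

text \<open>The projection is onto, so cutting the quotient down to its image gives the same record.
  The lemmas about images thereby apply to quotients.\<close>

lemma quot_image: "(quot_module N H)\<lparr>carrier := (\<lambda>x\<in>carrier N. H +>\<^sub>N x) ` carrier N\<rparr> = quot_module N H"
 unfolding image_restrict_eq quot_carrier[symmetric] by (rule module.equality) simp_all

lemma quot_fg: "fg_module R N ==> fg_module R (quot_module N H)"
 using image_fg_module[OF quot_proj _ left_module_quot] quot_image by simp

lemma quot_hom:
 assumes "f \<in> mod_hom R N W" "left_module R W" "\<And>x. x \<in> H ==> f x = \<zero>\<^sub>W"
 obtains g where "g \<in> mod_hom R (quot_module N H) W" "\<forall>x\<in>carrier N. g (H +>\<^sub>N x) = f x"
proof -
 have ker: "f x = \<zero>\<^sub>W" if x: "x \<in> carrier N" and z: "(\<lambda>x\<in>carrier N. H +>\<^sub>N x) x = \<zero>\<^bsub>quot_module N H\<^esub>" for x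
  using z coset_eq_iff[OF x N.M.zero_closed] N.M.diff_zero[OF x] x unfolding quot_zero
  by (intro assms(3)) simp
 obtain g where g: "g \<in> mod_hom R ((quot_module N H)\<lparr>carrier := (\<lambda>x\<in>carrier N. H +>\<^sub>N x) ` carrier N\<rparr>) W"
  "\<forall>x\<in>carrier N. g ((\<lambda>x\<in>carrier N. H +>\<^sub>N x) x) = f x"
  by (rule mod_hom_factor[OF lm left_module_quot assms(2) quot_proj assms(1) ker])
 then show ?thesis unfolding quot_image by (intro that[of g]) simp_all
qed

end

section \<open>Cokernels, and free modules as small modules\<close>

definition coker :: "'r ring => nat => (nat => 'r) set => 'r small_module" where
 "coker R n H = quot_module (free_module R n) H"

text \<open>Vectors are functions on all of \<open>nat\<close> of which the first \<open>n\<close>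
  values count; the restriction makes the class independent of the rest. Classes are sets of
  functions on \<open>nat\<close>, so cokernels are small modules without transport.\<close>

definition coset :: "'r ring => nat => (nat => 'r) set => (nat => 'r) => (nat => 'r) set" where
 "coset R n H v = H +>\<^bsub>free_module R n\<^esub> restrict v {..<n}"

lemma restrict_free_closed [simp]:
 "(\<And>i. i < n ==> v i \<in> carrier R) ==> restrict v {..<n} \<in> {..<n} \<rightarrow>\<^sub>E carrier R"
 by auto

context
 fixes R :: "'r ring" and n H
 assumes R: "ring R" and sub: "submodule H R (free_module R n)"
begin

interpretation R: ring R by (rule R)

lemma coker_left_module: "left_module R (coker R n H)"
 unfolding coker_def by (rule left_module_quot[OF sub left_module_free[OF R]])

lemma coker_fg: "fg_module R (coker R n H)"
 unfolding coker_def by (rule quot_fg[OF sub left_module_free[OF R] fg_module_free[OF R]])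

lemma coset_closed: "(\<And>i. i < n ==> v i \<in> carrier R) ==> coset R n H v \<in> carrier (coker R n H)"
 using quot_carrier[OF sub left_module_free[OF R]] by (simp add: coker_def coset_def)

lemma coker_carrierE:
 assumes "x \<in> carrier (coker R n H)"
 obtains v where "\<forall>i<n. v i \<in> carrier R" "x = coset R n H v"
proof -
 obtain v where v: "v \<in> {..<n} \<rightarrow>\<^sub>E carrier R" "x = H +>\<^bsub>free_module R n\<^esub> v"
  using assms quot_carrier[OF sub left_module_free[OF R]] by (auto simp: coker_def)
 then have "restrict v {..<n} = v" by (auto simp: PiE_iff extensional_def)
 then show ?thesis using v by (intro that[of v]) (auto simp: coset_def)
qed

lemma coset_eq_zero_iff:
 assumes "\<And>i. i < n ==> v i \<in> carrier R"
 shows "coset R n H v = \<zero>\<^bsub>coker R n H\<^esub> \<longleftrightarrow> restrict v {..<n} \<in> H"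
proof -
 interpret F: left_module R "free_module R n" by (rule left_module_free[OF R])
 have v: "restrict v {..<n} \<in> carrier (free_module R n)" using assms by simp
 show ?thesis
  unfolding coset_def coker_def quot_zero[OF sub F.left_module_axioms]
  using coset_eq_iff[OF sub F.left_module_axioms v F.M.zero_closed] unfolding F.M.diff_zero[OF v] .
qed

lemma coset_lincomb:
 assumes "\<And>i. i < m ==> a i \<in> carrier R" "\<And>i j. i < m ==> j < n ==> v i j \<in> carrier R"
 shows "lincomb (coker R n H) m a (%i. coset R n H (v i)) = coset R n H (%j. dot R m a (%i. v i j))"
proof -
 interpret F: left_module R "free_module R n" by (rule left_module_free[OF R])
 have "lincomb (free_module R n) m a (%i. restrict (v i) {..<n}) \<in> carrier (free_module R n)"
  using assms by (intro F.lincomb_closed) auto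
 then have "restrict (%j. dot R m a (%i. v i j)) {..<n}
   = lincomb (free_module R n) m a (%i. restrict (v i) {..<n})"
  by (auto simp: fun_eq_iff lincomb_free PiE_iff extensional_def intro!: msum_cong)
 then show ?thesis
  unfolding coset_def coker_def
  using quot_lincomb[OF sub F.left_module_axioms, of m a "%i. restrict (v i) {..<n}"] assms
  by simp
qed

lemma coset_unit_lincomb:
 assumes "\<And>i. i < n ==> v i \<in> carrier R"
 shows "lincomb (coker R n H) n v (%i. coset R n H (unit_vec R i)) = coset R n H v"
proof -
 have u: "unit_vec R i j \<in> carrier R" for i j by (simp add: unit_vec_def)
 have "dot R n v (%i. unit_vec R i j) = v j" if "j < n" for j
 proof -
  have "dot R n v (%i. unit_vec R i j) = msum R n (%i. if i = j then v j else \<zero>\<^sub>R)"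
   using assms that by (intro msum_cong) (auto simp: unit_vec_def)
  then show ?thesis using that assms by (simp add: R.msum_single)
 qed
 then show ?thesis
  using coset_lincomb[of n v "unit_vec R"] assms u
  by (simp add: coset_def cong: restrict_cong)
qed

lemma coker_spans:
 "spans R (coker R n H) (carrier (coker R n H)) n (%i. coset R n H (unit_vec R i))"
 unfolding spans_def
proof (intro conjI ballI)
 show "\<forall>j<n. coset R n H (unit_vec R j) \<in> carrier (coker R n H)"
  by (auto simp: unit_vec_def intro: coset_closed)
 fix x assume "x \<in> carrier (coker R n H)"
 then obtain v where "\<forall>i<n. v i \<in> carrier R" "x = coset R n H v" by (rule coker_carrierE)
 then show "\<exists>c. (\<forall>j<n. c j \<in> carrier R) \<and> x = lincomb (coker R n H) n c (%i. coset R n H (unit_vec R i))"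
  using coset_unit_lincomb[of v] by auto
qed

lemma coker_hom:
 assumes "left_module R W" "\<And>i. i < n ==> w i \<in> carrier W" "\<And>v. v \<in> H ==> lincomb W n v w = \<zero>\<^sub>W"
 obtains f where "f \<in> mod_hom R (coker R n H) W"
  "\<forall>v. (\<forall>i<n. v i \<in> carrier R) \<longrightarrow> f (coset R n H v) = lincomb W n v w"
proof -
 interpret W: left_module R W by fact
 have F: "left_module R (free_module R n)" by (rule left_module_free[OF R])
 let ?f = "\<lambda>v\<in>carrier (free_module R n). lincomb W n v w"
 have "?f \<in> mod_hom R (free_module R n) W" by (rule free_hom[OF assms(1,2)])
 moreover have "\<And>v. v \<in> H ==> ?f v = \<zero>\<^sub>W"
  using assms(3) submoduleD(1)[OF sub] by auto
 ultimately obtain g where g: "g \<in> mod_hom R (quot_module (free_module R n) H) W"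
  "\<forall>x\<in>carrier (free_module R n). g (H +>\<^bsub>free_module R n\<^esub> x) = ?f x"
  by (rule quot_hom[OF sub F _ assms(1), of ?f])
 show ?thesis
 proof (rule that)
  show "g \<in> mod_hom R (coker R n H) W" using g(1) by (simp add: coker_def)
  show "\<forall>v. (\<forall>i<n. v i \<in> carrier R) \<longrightarrow> g (coset R n H v) = lincomb W n v w"
   by (simp add: coset_def g(2))
 qed
qed

end

text \<open>Dividing by zero changes \<open>free_module R n\<close> only up to isomorphism, but
  gives it the type of a small module, which \<open>projective_resolution\<close> demands of its
  terms.\<close>

definition sfree :: "'r ring => nat => 'r small_module" where
 "sfree R n = coker R n {\<zero>\<^bsub>free_module R n\<^esub>}"

definition fvec :: "'r ring => nat => (nat => 'r) => (nat => 'r) set" where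
 "fvec R n = coset R n {\<zero>\<^bsub>free_module R n\<^esub>}"

lemma zero_submodule:
 assumes "left_module R N"
 shows "submodule {\<zero>\<^sub>N} R N"
proof -
 interpret N: left_module R N by fact
 show ?thesis by (rule submoduleI[OF assms]) auto
qed

lemma sfree_submodule: "ring R ==> submodule {\<zero>\<^bsub>free_module R n\<^esub>} R (free_module R n)"
 by (intro zero_submodule left_module_free)

lemma sfree_left_module: "ring R ==> left_module R (sfree R n)"
 unfolding sfree_def fvec_def by (rule coker_left_module[OF _ sfree_submodule])

lemma sfree_fg: "ring R ==> fg_module R (sfree R n)"
 unfolding sfree_def fvec_def by (rule coker_fg[OF _ sfree_submodule])

lemma fvec_closed: "ring R ==> (\<And>i. i < n ==> v i \<in> carrier R) ==> fvec R n v \<in> carrier (sfree R n)"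
 unfolding sfree_def fvec_def by (rule coset_closed[OF _ sfree_submodule])

lemma sfreeE:
 assumes "ring R" "x \<in> carrier (sfree R n)"
 obtains v where "\<forall>i<n. v i \<in> carrier R" "x = fvec R n v"
 using assms(2) unfolding sfree_def fvec_def by (rule coker_carrierE[OF assms(1) sfree_submodule[OF assms(1)]])

lemma sfree_hom:
 assumes "ring R" "left_module R W" "\<And>i. i < n ==> w i \<in> carrier W"
 obtains f where "f \<in> mod_hom R (sfree R n) W"
  "\<forall>v. (\<forall>i<n. v i \<in> carrier R) \<longrightarrow> f (fvec R n v) = lincomb W n v w"
proof -
 interpret W: left_module R W by fact
 have "lincomb W n v w = \<zero>\<^sub>W" if "v \<in> {\<zero>\<^bsub>free_module R n\<^esub>}" for v
 proof -
  have "lincomb W n v w = lincomb W n (%i. \<zero>\<^sub>R) w" using that by (intro lincomb_cong) auto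
  then show ?thesis using assms(3) by simp
 qed
 from coker_hom[OF assms(1) sfree_submodule[OF assms(1)] assms(2,3) this]
 obtain f where "f \<in> mod_hom R (sfree R n) W"
  "\<forall>v. (\<forall>i<n. v i \<in> carrier R) \<longrightarrow> f (fvec R n v) = lincomb W n v w"
  unfolding sfree_def fvec_def by metis
 then show ?thesis by (rule that)
qed

lemma sfree_hom_eq:
 assumes "ring R" "left_module R W" "f \<in> mod_hom R (sfree R n) W" "\<And>i. i < n ==> v i \<in> carrier R"
 shows "f (fvec R n v) = lincomb W n v (%i. f (fvec R n (unit_vec R i)))"
proof -
 interpret ring R by fact
 have "fvec R n v = lincomb (sfree R n) n v (%i. fvec R n (unit_vec R i))"
  unfolding sfree_def fvec_def using coset_unit_lincomb[OF assms(1) sfree_submodule[OF assms(1)] assms(4)] by simp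
 then show ?thesis
  using mod_hom_lincomb[OF assms(3) sfree_left_module[OF assms(1)] assms(2), of n v "%i. fvec R n (unit_vec R i)"]
   assms(4) fvec_closed[OF assms(1), of n] by (simp add: unit_vec_def)
qed

lemma fvec_eq_zero_iff:
 assumes "ring R" "\<And>i. i < n ==> v i \<in> carrier R"
 shows "fvec R n v = \<zero>\<^bsub>sfree R n\<^esub> \<longleftrightarrow> (\<forall>i<n. v i = \<zero>\<^sub>R)"
proof -
 interpret ring R by fact
 have "restrict v {..<n} = \<zero>\<^bsub>free_module R n\<^esub> \<longleftrightarrow> (\<forall>i<n. v i = \<zero>\<^sub>R)"
  by (auto simp: fun_eq_iff restrict_def)
 then show ?thesis
  unfolding sfree_def fvec_def
  using coset_eq_zero_iff[OF assms(1) sfree_submodule[OF assms(1)], of n v] assms(2) by simp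
qed

lemma fvec_cong: "(\<And>i. i < n ==> v i = w i) ==> coset R n H v = coset R n H w"
 unfolding coset_def by (metis lessThan_iff restrict_ext)

lemma sfree_projective:
 assumes "ring R"
 shows "projective_module R (sfree R n)"
 unfolding projective_module_def
proof (intro conjI allI impI sfree_fg assms)
 fix X Y :: "'a small_module" and g f
 assume a: "fg_module R X \<and> fg_module R Y \<and> g \<in> mod_hom R X Y \<and> g ` carrier X = carrier Y \<and>
  f \<in> mod_hom R (sfree R n) Y"
 then have lm: "left_module R X" "left_module R Y" and g: "g \<in> mod_hom R X Y" "g ` carrier X = carrier Y"
  and f: "f \<in> mod_hom R (sfree R n) Y" by (simp_all add: fg_module_def)
 interpret ring R by fact
 have u: "fvec R n (unit_vec R i) \<in> carrier (sfree R n)" for i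
  using fvec_closed[OF assms, of n "unit_vec R i"] by (simp add: unit_vec_def)
 have "f (fvec R n (unit_vec R i)) \<in> g ` carrier X" for i
  unfolding g(2) by (rule mod_homD(1)[OF f u])
 then have "\<exists>x. x \<in> carrier X \<and> g x = f (fvec R n (unit_vec R i))" for i
  unfolding image_iff Bex_def by (simp add: eq_commute)
 then have "\<exists>x. \<forall>i. x i \<in> carrier X \<and> g (x i) = f (fvec R n (unit_vec R i))" by (intro choice allI)
 then obtain x where x: "\<And>i. x i \<in> carrier X" "\<And>i. g (x i) = f (fvec R n (unit_vec R i))" by blast
 obtain h where h: "h \<in> mod_hom R (sfree R n) X"
  "\<forall>v. (\<forall>i<n. v i \<in> carrier R) \<longrightarrow> h (fvec R n v) = lincomb X n v x"
  by (rule sfree_hom[OF assms lm(1) x(1)])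
 have "g (h p) = f p" if p: "p \<in> carrier (sfree R n)" for p
 proof -
  obtain v where v: "\<forall>i<n. v i \<in> carrier R" "p = fvec R n v" using sfreeE[OF assms p] .
  have "g (h p) = lincomb Y n v (%i. g (x i))"
   using mod_hom_lincomb[OF g(1) lm, of n v x] v x(1) h(2) by simp
  also have "\<dots> = f p"
   using sfree_hom_eq[OF assms lm(2) f, of v] v x(2) by simp
  finally show ?thesis .
 qed
 then show "\<exists>h\<in>mod_hom R (sfree R n) X. \<forall>p\<in>carrier (sfree R n). g (h p) = f p"
  using h(1) by blast
qed

section \<open>Ext and projective resolutions\<close>

lemma projective_resolutionD:
 assumes "projective_resolution R X P d e"
 shows "projective_module R (P i)" "fg_module R (P i)" "left_module R (P i)"
  "d i \<in> mod_hom R (P (Suc i)) (P i)" "e \<in> mod_hom R (P 0) X" "e ` carrier (P 0) = carrier X"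
  "\<And>x. x \<in> carrier (P 0) ==> e x = \<zero>\<^sub>X \<longleftrightarrow> x \<in> d 0 ` carrier (P (Suc 0))"
  "\<And>x. x \<in> carrier (P (Suc i)) ==> d i x = \<zero>\<^bsub>P i\<^esub> \<longleftrightarrow> x \<in> d (Suc i) ` carrier (P (Suc (Suc i)))"
proof -
 show P: "projective_module R (P i)" using assms by (simp add: projective_resolution_def)
 then show "fg_module R (P i)" "left_module R (P i)"
  by (simp_all add: projective_module_def fg_module_def)
 show "d i \<in> mod_hom R (P (Suc i)) (P i)" "e \<in> mod_hom R (P 0) X" "e ` carrier (P 0) = carrier X"
  using assms by (simp_all add: projective_resolution_def)
 have 0: "d 0 ` carrier (P (Suc 0)) = mod_ker (P 0) X e"
  and S: "d (Suc i) ` carrier (P (Suc (Suc i))) = mod_ker (P (Suc i)) (P i) (d i)"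
  using assms by (simp_all add: projective_resolution_def)
 show "e x = \<zero>\<^sub>X \<longleftrightarrow> x \<in> d 0 ` carrier (P (Suc 0))" if "x \<in> carrier (P 0)" for x
  unfolding 0 using that by (simp add: mod_ker_def)
 show "d i x = \<zero>\<^bsub>P i\<^esub> \<longleftrightarrow> x \<in> d (Suc i) ` carrier (P (Suc (Suc i)))" if "x \<in> carrier (P (Suc i))" for x
  unfolding S using that by (simp add: mod_ker_def)
qed

text \<open>The comparison theorem. The predicate \<open>Q\<close> carried through the dependent
  choice records that \<open>\<alpha> n\<close> maps boundaries to boundaries, which is the
  condition for lifting one degree further.\<close>

lemma resolution_chain_map:
 assumes "projective_resolution R X P d e" "projective_resolution R X P' d' e'" "left_module R X"
 obtains \<alpha> where "\<And>i. \<alpha> i \<in> mod_hom R (P i) (P' i)" "\<And>x. x \<in> carrier (P 0) ==> e' (\<alpha> 0 x) = e x"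
  "\<And>i x. x \<in> carrier (P (Suc i)) ==> d' i (\<alpha> (Suc i) x) = \<alpha> i (d i x)"
proof -
 note P = projective_resolutionD[OF assms(1)] and P' = projective_resolutionD[OF assms(2)]
 define Q where "Q n \<alpha> \<longleftrightarrow> \<alpha> \<in> mod_hom R (P n) (P' n) \<and>
  (\<forall>x\<in>carrier (P (Suc n)). \<alpha> (d n x) \<in> d' n ` carrier (P' (Suc n))) \<and>
  (n = 0 \<longrightarrow> (\<forall>x\<in>carrier (P 0). e' (\<alpha> x) = e x))" for n \<alpha>
 have "\<exists>\<alpha>. \<forall>n. Q n (\<alpha> n) \<and> (\<forall>x\<in>carrier (P (Suc n)). d' n (\<alpha> (Suc n) x) = \<alpha> n (d n x))"
 proof (rule dependent_nat_choice[where P = Q and Q = "%n a b. \<forall>x\<in>carrier (P (Suc n)). d' n (b x) = a (d n x)"])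
  obtain \<alpha> where \<alpha>: "\<alpha> \<in> mod_hom R (P 0) (P' 0)" "\<forall>p\<in>carrier (P 0). e' (\<alpha> p) = e p"
   by (rule projective_lift[OF P(1)[of 0] P'(2)[of 0] assms(3) P'(5) P(5)]) (simp_all add: P(6) P'(6))
  have "\<alpha> (d 0 x) \<in> d' 0 ` carrier (P' (Suc 0))" if x: "x \<in> carrier (P (Suc 0))" for x
  proof -
   have dx: "d 0 x \<in> carrier (P 0)" by (rule mod_homD(1)[OF P(4) x])
   then have "e (d 0 x) = \<zero>\<^sub>X" using P(7)[OF dx] x by auto
   then show ?thesis using P'(7)[OF mod_homD(1)[OF \<alpha>(1) dx]] \<alpha>(2) dx by simp
  qed
  then show "\<exists>\<alpha>. Q 0 \<alpha>" using \<alpha> by (auto simp: Q_def)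
 next
  fix n \<alpha> assume Q: "Q n \<alpha>"
  then have \<alpha>: "\<alpha> \<in> mod_hom R (P n) (P' n)" by (simp add: Q_def)
  let ?f = "\<lambda>x\<in>carrier (P (Suc n)). \<alpha> (d n x)"
  have f: "?f \<in> mod_hom R (P (Suc n)) (P' n)" by (rule mod_hom_compose[OF P(4) \<alpha> P(3)])
  have "?f ` carrier (P (Suc n)) \<subseteq> d' n ` carrier (P' (Suc n))" using Q by (auto simp: Q_def)
  then obtain \<beta> where \<beta>: "\<beta> \<in> mod_hom R (P (Suc n)) (P' (Suc n))"
   "\<forall>x\<in>carrier (P (Suc n)). d' n (\<beta> x) = ?f x"
   by (rule projective_lift[OF P(1) P'(2) P'(3) P'(4) f])
  have "\<beta> (d (Suc n) x) \<in> d' (Suc n) ` carrier (P' (Suc (Suc n)))" if x: "x \<in> carrier (P (Suc (Suc n)))" for x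
  proof -
   have dx: "d (Suc n) x \<in> carrier (P (Suc n))" by (rule mod_homD(1)[OF P(4) x])
   then have "d n (d (Suc n) x) = \<zero>\<^bsub>P n\<^esub>" using P(8)[OF dx] x by auto
   then have "d' n (\<beta> (d (Suc n) x)) = \<zero>\<^bsub>P' n\<^esub>" using \<beta>(2) dx mod_hom_zero[OF \<alpha> P(3) P'(3)] by simp
   then show ?thesis using P'(8)[OF mod_homD(1)[OF \<beta>(1) dx]] by simp
  qed
  then show "\<exists>\<beta>. Q (Suc n) \<beta> \<and> (\<forall>x\<in>carrier (P (Suc n)). d' n (\<beta> x) = \<alpha> (d n x))"
   using \<beta> by (intro exI[of _ \<beta>]) (auto simp: Q_def)
 qed
 then obtain \<alpha> where \<alpha>: "\<And>n. Q n (\<alpha> n)" "\<And>n x. x \<in> carrier (P (Suc n)) ==> d' n (\<alpha> (Suc n) x) = \<alpha> n (d n x)"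
  by metis
 show ?thesis
 proof (rule that[of \<alpha>])
  show "\<alpha> i \<in> mod_hom R (P i) (P' i)" for i using \<alpha>(1)[of i] by (simp add: Q_def)
  show "e' (\<alpha> 0 x) = e x" if "x \<in> carrier (P 0)" for x using \<alpha>(1)[of 0] that by (simp add: Q_def)
 qed (rule \<alpha>(2))
qed

text \<open>The invariant \<open>d n (h (d n x)) = \<psi> n (d n x)\<close> makes
  \<open>\<psi> (Suc n)\<close> minus \<open>h n\<close> after \<open>d n\<close> land in the kernel
  of \<open>d n\<close>, so that this difference lifts along \<open>d (Suc n)\<close>.\<close>

lemma resolution_homotopy:
 assumes "projective_resolution R X P d e" "left_module R X"
  and \<psi>: "\<And>i. \<psi> i \<in> mod_hom R (P i) (P i)" "\<And>x. x \<in> carrier (P 0) ==> e (\<psi> 0 x) = \<zero>\<^sub>X"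
  "\<And>i x. x \<in> carrier (P (Suc i)) ==> d i (\<psi> (Suc i) x) = \<psi> i (d i x)"
 obtains h where "\<And>i. h i \<in> mod_hom R (P i) (P (Suc i))"
  "\<And>i x. x \<in> carrier (P (Suc i)) ==> d (Suc i) (h (Suc i) x) = \<psi> (Suc i) x \<ominus>\<^bsub>P (Suc i)\<^esub> h i (d i x)"
proof -
 note P = projective_resolutionD[OF assms(1)]
 define Q where "Q n h \<longleftrightarrow> h \<in> mod_hom R (P n) (P (Suc n)) \<and>
  (\<forall>x\<in>carrier (P (Suc n)). d n (h (d n x)) = \<psi> n (d n x))" for n h
 have "\<exists>h. \<forall>n. Q n (h n) \<and>
  (\<forall>x\<in>carrier (P (Suc n)). d (Suc n) (h (Suc n) x) = \<psi> (Suc n) x \<ominus>\<^bsub>P (Suc n)\<^esub> h n (d n x))"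
 proof (rule dependent_nat_choice[where P = Q and Q = "%n a b. \<forall>x\<in>carrier (P (Suc n)).
   d (Suc n) (b x) = \<psi> (Suc n) x \<ominus>\<^bsub>P (Suc n)\<^esub> a (d n x)"])
  have "\<psi> 0 ` carrier (P 0) \<subseteq> d 0 ` carrier (P (Suc 0))"
   using \<psi>(2) P(7)[OF mod_homD(1)[OF \<psi>(1)[of 0]]] by (intro image_subsetI) simp
  then obtain h where h: "h \<in> mod_hom R (P 0) (P (Suc 0))" "\<forall>x\<in>carrier (P 0). d 0 (h x) = \<psi> 0 x"
   by (rule projective_lift[OF P(1) P(2) P(3) P(4) \<psi>(1)])
  then have "Q 0 h" using mod_homD(1)[OF P(4)[of 0]] by (simp add: Q_def)
  then show "\<exists>h. Q 0 h" by (rule exI[of _ h])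
 next
  fix n h assume Q: "Q n h"
  then have h: "h \<in> mod_hom R (P n) (P (Suc n))" by (simp add: Q_def)
  interpret P0: left_module R "P n" by (rule P(3))
  interpret P1: left_module R "P (Suc n)" by (rule P(3))
  let ?f = "\<lambda>x\<in>carrier (P (Suc n)). \<psi> (Suc n) x \<ominus>\<^bsub>P (Suc n)\<^esub> (\<lambda>x\<in>carrier (P (Suc n)). h (d n x)) x"
  have f: "?f \<in> mod_hom R (P (Suc n)) (P (Suc n))"
   by (rule mod_hom_diff[OF \<psi>(1) mod_hom_compose[OF P(4) h P(3)] P(3) P(3)])
  have "?f ` carrier (P (Suc n)) \<subseteq> d (Suc n) ` carrier (P (Suc (Suc n)))"
  proof (rule image_subsetI)
   fix x assume x: "x \<in> carrier (P (Suc n))"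
   show "?f x \<in> d (Suc n) ` carrier (P (Suc (Suc n)))"
  proof -
   have c: "\<psi> (Suc n) x \<in> carrier (P (Suc n))" "h (d n x) \<in> carrier (P (Suc n))"
    using mod_homD(1)[OF \<psi>(1) x] mod_homD(1)[OF h mod_homD(1)[OF P(4) x]] by auto
   have "d n (?f x) = d n (\<psi> (Suc n) x) \<ominus>\<^bsub>P n\<^esub> d n (h (d n x))"
    using x c mod_homD(2)[OF P(4), of "\<psi> (Suc n) x" n "\<ominus>\<^bsub>P (Suc n)\<^esub> h (d n x)"]
     mod_hom_minus[OF P(4) P(3) P(3) c(2)] by (simp add: a_minus_def)
   also have "\<dots> = \<zero>\<^bsub>P n\<^esub>"
    using Q x \<psi>(3)[OF x] mod_homD(1)[OF \<psi>(1) mod_homD(1)[OF P(4) x]]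
    by (simp add: Q_def P0.M.minus_eq_zero_iff)
   finally show ?thesis using P(8)[OF mod_homD(1)[OF f x]] by simp
   qed
  qed
  then obtain k where k: "k \<in> mod_hom R (P (Suc n)) (P (Suc (Suc n)))"
   "\<forall>x\<in>carrier (P (Suc n)). d (Suc n) (k x) = ?f x"
   by (rule projective_lift[OF P(1) P(2) P(3) P(4) f])
  have "d (Suc n) (k (d (Suc n) x)) = \<psi> (Suc n) (d (Suc n) x)" if x: "x \<in> carrier (P (Suc (Suc n)))" for x
  proof -
   have dx: "d (Suc n) x \<in> carrier (P (Suc n))" by (rule mod_homD(1)[OF P(4) x])
   then have "d n (d (Suc n) x) = \<zero>\<^bsub>P n\<^esub>" using P(8)[OF dx] x by auto
   then show ?thesis using k(2) dx mod_hom_zero[OF h P(3) P(3)] mod_homD(1)[OF \<psi>(1) dx] by simp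
  qed
  then show "\<exists>k. Q (Suc n) k \<and> (\<forall>x\<in>carrier (P (Suc n)). d (Suc n) (k x) = \<psi> (Suc n) x \<ominus>\<^bsub>P (Suc n)\<^esub> h (d n x))"
   using k by (intro exI[of _ k]) (auto simp: Q_def)
 qed
 then obtain h where h: "\<And>n. Q n (h n)" "\<And>n x. x \<in> carrier (P (Suc n)) ==>
   d (Suc n) (h (Suc n) x) = \<psi> (Suc n) x \<ominus>\<^bsub>P (Suc n)\<^esub> h n (d n x)"
  by metis
 show ?thesis
 proof (rule that[of h])
  show "h i \<in> mod_hom R (P i) (P (Suc i))" for i using h(1)[of i] by (simp add: Q_def)
 qed (rule h(2))
qed

text \<open>Exactness of the complex of homomorphisms into \<open>W\<close> in degree
  \<open>Suc i\<close>. The shift starts the count at degree one, as in the perpendicular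
  classes.\<close>

definition hom_exact ::
 "'r ring => (nat => ('r, 'p) module) => (nat => 'p => 'p) => ('r, 'y) module => nat => bool" where
 "hom_exact R P d W i \<longleftrightarrow> (\<forall>f\<in>mod_hom R (P (Suc i)) W.
  (\<forall>x\<in>carrier (P (Suc (Suc i))). f (d (Suc i) x) = \<zero>\<^sub>W) \<longrightarrow>
  (\<exists>g\<in>mod_hom R (P i) W. \<forall>x\<in>carrier (P (Suc i)). f x = g (d i x)))"

text \<open>Comparison maps in both directions compose to the identity up to homotopy. A cocycle on
  the second resolution becomes a coboundary after pullback to the first, and the homotopy accounts
  for the difference.\<close>

lemma hom_exact_transfer:
 assumes "projective_resolution R X P d e" "projective_resolution R X P' d' e'" "left_module R X"
  "left_module R W" "hom_exact R P d W i"
 shows "hom_exact R P' d' W i"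
 unfolding hom_exact_def
proof (intro ballI impI)
 fix f assume f: "f \<in> mod_hom R (P' (Suc i)) W"
  and cocycle: "\<forall>x\<in>carrier (P' (Suc (Suc i))). f (d' (Suc i) x) = \<zero>\<^sub>W"
 interpret W: left_module R W by fact
 note P = projective_resolutionD[OF assms(1)] and P' = projective_resolutionD[OF assms(2)]
 obtain \<alpha> where \<alpha>: "\<And>i. \<alpha> i \<in> mod_hom R (P' i) (P i)" "\<And>x. x \<in> carrier (P' 0) ==> e (\<alpha> 0 x) = e' x"
  "\<And>i x. x \<in> carrier (P' (Suc i)) ==> d i (\<alpha> (Suc i) x) = \<alpha> i (d' i x)"
  using resolution_chain_map[OF assms(2,1,3)] by metis
 obtain \<beta> where \<beta>: "\<And>i. \<beta> i \<in> mod_hom R (P i) (P' i)" "\<And>x. x \<in> carrier (P 0) ==> e' (\<beta> 0 x) = e x"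
  "\<And>i x. x \<in> carrier (P (Suc i)) ==> d' i (\<beta> (Suc i) x) = \<beta> i (d i x)"
  using resolution_chain_map[OF assms(1,2,3)] by metis
 \<comment> \<open>The identity minus the composite of the two comparison maps; it lies over zero on
   \<open>X\<close>, which is what \<open>resolution_homotopy\<close> asks for.\<close>
 define \<psi> where "\<psi> j = (\<lambda>x\<in>carrier (P' j). (\<lambda>x\<in>carrier (P' j). x) x \<ominus>\<^bsub>P' j\<^esub> (\<lambda>x\<in>carrier (P' j). \<beta> j (\<alpha> j x)) x)" for j
 have idh: "(\<lambda>x\<in>carrier (P' j). x) \<in> mod_hom R (P' j) (P' j)" for j
  by (rule mod_hom_restrictI[OF P'(3)]) auto
 have \<psi>h: "\<psi> j \<in> mod_hom R (P' j) (P' j)" for j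
  unfolding \<psi>_def by (rule mod_hom_diff[OF idh mod_hom_compose[OF \<alpha>(1) \<beta>(1) P'(3)] P'(3) P'(3)])
 have \<psi>: "\<psi> j x = x \<ominus>\<^bsub>P' j\<^esub> \<beta> j (\<alpha> j x)" if "x \<in> carrier (P' j)" for j x
  using that by (simp add: \<psi>_def)
 have \<beta>\<alpha>: "\<beta> j (\<alpha> j x) \<in> carrier (P' j)" if "x \<in> carrier (P' j)" for j x
  by (rule mod_homD(1)[OF \<beta>(1) mod_homD(1)[OF \<alpha>(1) that]])
 have diff: "g (x \<ominus>\<^sub>U y) = g x \<ominus>\<^sub>V g y"
  if g: "g \<in> mod_hom R U V" "left_module R U" "left_module R V" "x \<in> carrier U" "y \<in> carrier U"
  for g x y and U :: "('a, 'v) module" and V :: "('a, 'w) module"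
 proof -
  interpret U: left_module R U by fact
  show ?thesis using mod_homD(2)[OF g(1), of x "\<ominus>\<^sub>U y"] mod_hom_minus[OF g(1-3,5)] g(4,5)
   by (simp add: a_minus_def)
 qed
 have \<psi>0: "e' (\<psi> 0 x) = \<zero>\<^sub>X" if x: "x \<in> carrier (P' 0)" for x
 proof -
  interpret X: left_module R X by fact
  show ?thesis
   using diff[OF P'(5) P'(3) assms(3) x \<beta>\<alpha>[OF x]] \<alpha>(2)[OF x] \<beta>(2)[OF mod_homD(1)[OF \<alpha>(1) x]]
    mod_homD(1)[OF P'(5) x] by (simp add: \<psi>[OF x] X.M.minus_eq_zero_iff)
 qed
 have \<psi>S: "d' j (\<psi> (Suc j) x) = \<psi> j (d' j x)" if x: "x \<in> carrier (P' (Suc j))" for j x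
  using diff[OF P'(4) P'(3) P'(3) x \<beta>\<alpha>[OF x]] \<beta>(3)[OF mod_homD(1)[OF \<alpha>(1) x]] \<alpha>(3)[OF x]
   mod_homD(1)[OF P'(4) x] by (simp add: \<psi> x)
 obtain h where h: "\<And>i. h i \<in> mod_hom R (P' i) (P' (Suc i))"
  "\<And>i x. x \<in> carrier (P' (Suc i)) ==> d' (Suc i) (h (Suc i) x) = \<psi> (Suc i) x \<ominus>\<^bsub>P' (Suc i)\<^esub> h i (d' i x)"
  using resolution_homotopy[OF assms(2,3) \<psi>h \<psi>0 \<psi>S] by metis
 have "(\<lambda>x\<in>carrier (P (Suc i)). f (\<beta> (Suc i) x)) \<in> mod_hom R (P (Suc i)) W"
  by (rule mod_hom_compose[OF \<beta>(1) f P(3)])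
 moreover have "f (\<beta> (Suc i) (d (Suc i) x)) = \<zero>\<^sub>W" if x: "x \<in> carrier (P (Suc (Suc i)))" for x
  using \<beta>(3)[OF x, symmetric] cocycle mod_homD(1)[OF \<beta>(1) x] by simp
 ultimately obtain g where g: "g \<in> mod_hom R (P i) W"
  "\<And>x. x \<in> carrier (P (Suc i)) ==> f (\<beta> (Suc i) x) = g (d i x)"
  using assms(5) mod_homD(1)[OF P(4)] unfolding hom_exact_def by fastforce
 \<comment> \<open>In \<open>f x = f (\<beta> (\<alpha> x)) + f (\<psi> x)\<close> the first summand
   is \<open>g (\<alpha> (d' x))\<close>; the second is \<open>f (h (d' x))\<close>, because
   \<open>f\<close> kills the image of \<open>d' (Suc i)\<close>.\<close>
 let ?g = "\<lambda>x\<in>carrier (P' i). (\<lambda>x\<in>carrier (P' i). g (\<alpha> i x)) x \<oplus>\<^sub>W (\<lambda>x\<in>carrier (P' i). f (h i x)) x"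
 have "?g \<in> mod_hom R (P' i) W"
  by (rule mod_hom_add[OF mod_hom_compose[OF \<alpha>(1) g(1) P'(3)] mod_hom_compose[OF h(1) f P'(3)] P'(3) assms(4)])
 moreover have "f x = ?g (d' i x)" if x: "x \<in> carrier (P' (Suc i))" for x
 proof -
  have dx: "d' i x \<in> carrier (P' i)" by (rule mod_homD(1)[OF P'(4) x])
  have hx: "h i (d' i x) \<in> carrier (P' (Suc i))" by (rule mod_homD(1)[OF h(1) dx])
  have 1: "f (\<psi> (Suc i) x) = f x \<ominus>\<^sub>W g (\<alpha> i (d' i x))"
   using diff[OF f P'(3) assms(4) x \<beta>\<alpha>[OF x]] g(2)[OF mod_homD(1)[OF \<alpha>(1) x]] \<alpha>(3)[OF x] by (simp add: \<psi>[OF x])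
  have "\<zero>\<^sub>W = f (d' (Suc i) (h (Suc i) x))"
   using cocycle mod_homD(1)[OF h(1) x] by simp
  also have "\<dots> = f (\<psi> (Suc i) x) \<ominus>\<^sub>W f (h i (d' i x))"
   using diff[OF f P'(3) assms(4) mod_homD(1)[OF \<psi>h x] hx] h(2)[OF x] by simp
  finally have "f (\<psi> (Suc i) x) = f (h i (d' i x))"
   by (rule W.M.minus_eq_zero_iff[THEN iffD1, rotated 2, OF sym])
    (intro mod_homD(1)[OF f] hx mod_homD(1)[OF \<psi>h x])+
  then have "f (h i (d' i x)) = f x \<ominus>\<^sub>W g (\<alpha> i (d' i x))" using 1 by simp
  moreover have "g (\<alpha> i (d' i x)) \<in> carrier W" by (rule mod_homD(1)[OF g(1) mod_homD(1)[OF \<alpha>(1) dx]])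
  moreover have "f x \<in> carrier W" by (rule mod_homD(1)[OF f x])
  ultimately show ?thesis using dx
   by (simp add: a_minus_def W.M.a_lcomm W.M.r_neg)
 qed
 ultimately show "\<exists>g\<in>mod_hom R (P' i) W. \<forall>x\<in>carrier (P' (Suc i)). f x = g (d' i x)" by blast
qed

section \<open>Ext as cohomology\<close>

lemma (in normal) trivial_group_Mod_iff: "trivial_group (G Mod H) \<longleftrightarrow> carrier G = H"
proof
 assume "trivial_group (G Mod H)"
 then have *: "carrier (G Mod H) = {H}" by (simp add: trivial_group_def FactGroup_def)
 have "x \<in> H" if "x \<in> carrier G" for x
 proof -
  have "H #> x \<in> carrier (G Mod H)" using that by (auto simp: FactGroup_def RCOSETS_def)
  then have "H #> x = H" using * by simp
  then show ?thesis using rcos_self[OF that subgroup_axioms] by simp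
 qed
 then show "carrier G = H" using subset by blast
next
 assume eq: "carrier G = H"
 have "H #> x = H" if "x \<in> carrier G" for x
  using coset_join2[OF that subgroup_axioms] that by (simp only: eq)
 then have "(\<Union>x\<in>carrier G. {H #> x}) = (\<Union>x\<in>carrier G. {H})"
  by (intro SUP_cong) simp_all
 also have "\<dots> = {H}" using one_closed by (subst UN_constant) (metis empty_iff)
 finally have "carrier (G Mod H) = {H}"
  unfolding FactGroup_def RCOSETS_def partial_object.simps .
 then show "trivial_group (G Mod H)"
  using factorgroup_is_group by (simp add: trivial_group_def FactGroup_def)
qed

text \<open>\<open>hom_group\<close> is a bare record. Once the cocycles are known to form a
  commutative group and the coboundaries a subgroup, a trivial factor group means that the two
  coincide.\<close>

lemma trivial_hom_cohomology_iff:
 assumes P: "\<And>i. left_module R (P i)" and W: "left_module R W"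
  and d: "\<And>i. d i \<in> mod_hom R (P (Suc i)) (P i)"
  and dd: "\<And>x. x \<in> carrier (P (Suc (Suc i))) ==> d i (d (Suc i) x) = \<zero>\<^bsub>P i\<^esub>"
 shows "trivial_group (hom_cohomology R P d W (Suc i)) \<longleftrightarrow> hom_exact R P d W i"
proof -
 interpret W: left_module R W by fact
 interpret P1: left_module R "P (Suc i)" by (rule P)
 let ?Z = "{f \<in> mod_hom R (P (Suc i)) W. \<forall>x\<in>carrier (P (Suc (Suc i))). f (d (Suc i) x) = \<zero>\<^sub>W}"
 let ?B = "(%g. \<lambda>x\<in>carrier (P (Suc i)). g (d i x)) ` mod_hom R (P i) W"
 let ?G = "(hom_group R (P (Suc i)) W)\<lparr>carrier := ?Z\<rparr>"
 have dc: "d (Suc i) x \<in> carrier (P (Suc i))" if "x \<in> carrier (P (Suc (Suc i)))" for x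
  by (rule mod_homD(1)[OF d that])
 have zero: "(\<lambda>x\<in>carrier X. \<zero>\<^sub>W) \<in> mod_hom R X W" if "left_module R X" for X :: "('a, 'p) module"
  by (rule mod_hom_restrictI[OF that]) auto
 have neg: "(\<lambda>x\<in>carrier X. \<ominus>\<^sub>W f x) \<in> mod_hom R X W" if "left_module R X" "f \<in> mod_hom R X W"
  for f and X :: "('a, 'p) module"
  using mod_homD[OF that(2)]
  by (intro mod_hom_restrictI[OF that(1)]) (auto simp: W.M.minus_add W.M.a_ac W.smult_minus)
 have G: "comm_group ?G"
 proof (rule comm_groupI)
  fix f g assume "f \<in> carrier ?G" "g \<in> carrier ?G"
  then show "f \<otimes>\<^bsub>?G\<^esub> g \<in> carrier ?G"
   using mod_hom_add[OF _ _ P W, of f "Suc i" g] dc by (auto simp: hom_group_def)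
 next
  show "\<one>\<^bsub>?G\<^esub> \<in> carrier ?G" using zero[OF P] dc by (auto simp: hom_group_def)
 next
  fix f assume "f \<in> carrier ?G"
  then show "\<exists>g\<in>carrier ?G. g \<otimes>\<^bsub>?G\<^esub> f = \<one>\<^bsub>?G\<^esub>"
   using neg[OF P, of f "Suc i"] dc mod_homD(1)[of f R "P (Suc i)" W]
   by (intro bexI[of _ "\<lambda>x\<in>carrier (P (Suc i)). \<ominus>\<^sub>W f x"])
    (auto simp: hom_group_def W.M.l_neg fun_eq_iff restrict_def)
 qed (auto simp: hom_group_def fun_eq_iff restrict_def W.M.a_ac mod_hom_def PiE_iff extensional_def)
 then interpret G: comm_group ?G .
 have B: "?B \<subseteq> carrier ?G"
 proof (intro image_subsetI)
  fix g assume g: "g \<in> mod_hom R (P i) W"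
  show "(\<lambda>x\<in>carrier (P (Suc i)). g (d i x)) \<in> carrier ?G"
   using mod_hom_compose[OF d g P] dc dd mod_hom_zero[OF g P W] by simp
 qed
 have "subgroup ?B ?G"
 proof (rule G.subgroupI[OF B])
  show "?B \<noteq> {}" using zero[OF P] by blast
 next
  fix a assume "a \<in> ?B"
  then obtain g where g: "g \<in> mod_hom R (P i) W" "a = (\<lambda>x\<in>carrier (P (Suc i)). g (d i x))" by blast
  let ?b = "\<lambda>x\<in>carrier (P (Suc i)). (\<lambda>x\<in>carrier (P i). \<ominus>\<^sub>W g x) (d i x)"
  have b: "?b \<in> ?B" using neg[OF P g(1)] by blast
  have "?b \<otimes>\<^bsub>?G\<^esub> a = \<one>\<^bsub>?G\<^esub>"
   using g(2) mod_homD(1)[OF d, of _ i] mod_homD(1)[OF g(1)]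
   by (auto simp: hom_group_def W.M.l_neg fun_eq_iff restrict_def)
  then have "inv\<^bsub>?G\<^esub> a = ?b" using G.inv_equality \<open>a \<in> ?B\<close> b B by blast
  then show "inv\<^bsub>?G\<^esub> a \<in> ?B" using b by simp
 next
  fix a b assume "a \<in> ?B" "b \<in> ?B"
  then obtain g h where g: "g \<in> mod_hom R (P i) W" "a = (\<lambda>x\<in>carrier (P (Suc i)). g (d i x))"
   and h: "h \<in> mod_hom R (P i) W" "b = (\<lambda>x\<in>carrier (P (Suc i)). h (d i x))" by blast
  have "a \<otimes>\<^bsub>?G\<^esub> b = (\<lambda>x\<in>carrier (P (Suc i)). (\<lambda>x\<in>carrier (P i). g x \<oplus>\<^sub>W h x) (d i x))"
   using g(2) h(2) mod_homD(1)[OF d, of _ i] by (auto simp: hom_group_def fun_eq_iff restrict_def)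
  then show "a \<otimes>\<^bsub>?G\<^esub> b \<in> ?B" using mod_hom_add[OF g(1) h(1) P W] by blast
 qed
 then interpret normal ?B ?G by (rule G.subgroup_imp_normal)
 have "trivial_group (hom_cohomology R P d W (Suc i)) \<longleftrightarrow> ?Z = ?B"
  using trivial_group_Mod_iff by (simp add: hom_cohomology_def)
 also have "\<dots> \<longleftrightarrow> ?Z \<subseteq> ?B" using B by auto
 also have "\<dots> \<longleftrightarrow> hom_exact R P d W i"
 proof
  assume "?Z \<subseteq> ?B"
  then show "hom_exact R P d W i" unfolding hom_exact_def by (fastforce simp: subset_iff)
 next
  assume ex: "hom_exact R P d W i"
  show "?Z \<subseteq> ?B"
  proof
   fix f assume f: "f \<in> ?Z"
   then obtain g where g: "g \<in> mod_hom R (P i) W" "\<forall>x\<in>carrier (P (Suc i)). f x = g (d i x)"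
    using ex unfolding hom_exact_def by blast
   have "f = (\<lambda>x\<in>carrier (P (Suc i)). g (d i x))"
    using f g mod_hom_compose[OF d g(1) P] by (intro mod_hom_eqI[of f R "P (Suc i)" W]) auto
   then show "f \<in> ?B" using g(1) by blast
  qed
 qed
 finally show ?thesis .
qed

text \<open>\<open>Ext\<close> picks an unspecified resolution by choice;
  \<open>hom_exact_transfer\<close>, applied in both directions, exchanges it for the given
  one.\<close>

lemma trivial_Ext_iff:
 assumes "projective_resolution R X P d e" "left_module R X" "left_module R W"
 shows "trivial_group (Ext R (Suc i) X W) \<longleftrightarrow> hom_exact R P d W i"
proof -
 obtain P' d' where P'd': "(SOME (P, d). \<exists>e. projective_resolution R X P d e) = (P', d')" by fastforce
 have "case (SOME (P, d). \<exists>e. projective_resolution R X P d e) of (P, d) => \<exists>e. projective_resolution R X P d e"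
  by (rule someI[of _ "(P, d)"]) (use assms(1) in auto)
 then obtain e' where res: "projective_resolution R X P' d' e'" using P'd' by auto
 note P' = projective_resolutionD[OF res]
 have "trivial_group (Ext R (Suc i) X W) \<longleftrightarrow> hom_exact R P' d' W i"
  unfolding Ext_def P'd' Let_def prod.case
 proof (rule trivial_hom_cohomology_iff)
  fix x assume "x \<in> carrier (P' (Suc (Suc i)))"
  then show "d' i (d' (Suc i) x) = \<zero>\<^bsub>P' i\<^esub>"
   using P'(8)[OF mod_homD(1)[OF P'(4)]] by blast
 qed (rule P'(3) assms(3) P'(4))+
 also have "\<dots> \<longleftrightarrow> hom_exact R P d W i"
  using hom_exact_transfer[OF res assms(1-3)] hom_exact_transfer[OF assms(1) res assms(2,3)] by blast
 finally show ?thesis .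
qed

section \<open>Resolutions by matrices\<close>

abbreviation vec :: "('v, 'e) ring_scheme => nat => (nat => 'v) => bool" where
 "vec V n v \<equiv> \<forall>i<n. v i \<in> carrier V"

abbreviation mat :: "('r, 'e) ring_scheme => nat => nat => (nat => nat => 'r) => bool" where
 "mat R m n F \<equiv> \<forall>i<m. \<forall>j<n. F i j \<in> carrier R"

definition tr :: "(nat => nat => 'r) => nat => nat => 'r" where
 "tr F = (%i j. F j i)"

lemma tr_apply [simp]: "tr F i j = F j i"
 by (simp add: tr_def)

text \<open>Exactness at the middle of V^l -> V^m -> V^n, where columns are multiplied by
  \<open>F\<close> and then by \<open>G\<close>. Only the inclusion of the kernel in the image is
  recorded here; that the composite vanishes is part of \<open>mat_seq\<close>.\<close>

definition exact_col ::
 "('r, 'v) module => nat => nat => nat => (nat => nat => 'r) => (nat => nat => 'r) => bool" where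
 "exact_col V l m n F G \<longleftrightarrow> (\<forall>v. vec V m v \<and> (\<forall>k<n. lincomb V m (G k) v = \<zero>\<^sub>V) \<longrightarrow>
  (\<exists>u. vec V l u \<and> (\<forall>j<m. v j = lincomb V l (F j) u)))"

lemma exact_colD:
 assumes "exact_col V l m n F G" "vec V m v" "\<forall>k<n. lincomb V m (G k) v = \<zero>\<^sub>V"
 obtains u where "vec V l u" "\<forall>j<m. v j = lincomb V l (F j) u"
 using assms unfolding exact_col_def by metis

text \<open>Homomorphisms of left modules multiply row vectors from the right. Hence
  \<open>F i\<close> has \<open>n (Suc i)\<close> rows, and the vanishing composite is the product
  of \<open>F (Suc i)\<close> with \<open>F i\<close>, in this order.\<close>

definition mat_seq :: "'r ring => (nat => nat) => (nat => nat => nat => 'r) => bool" where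
 "mat_seq R n F \<longleftrightarrow> (\<forall>i. mat R (n (Suc i)) (n i) (F i)) \<and>
  (\<forall>i. \<forall>k<n (Suc (Suc i)). \<forall>j<n i. dot R (n (Suc i)) (F (Suc i) k) (%l. F i l j) = \<zero>\<^sub>R)"

text \<open>Columns of length \<open>n i\<close> are the homomorphisms from the \<open>i\<close>-th
  free term to \<open>V\<close>, so this is the vanishing of Ext in all positive degrees; place 0
  belongs to Hom.\<close>

definition cols_exact :: "('r, 'v) module => (nat => nat) => (nat => nat => nat => 'r) => bool" where
 "cols_exact V n F \<longleftrightarrow> (\<forall>i. exact_col V (n i) (n (Suc i)) (n (Suc (Suc i))) (F i) (F (Suc i)))"

text \<open>The entries of the matrices act on \<open>V\<close> from the right, so \<open>V\<close> is a module over the opposite ring.\<close>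

definition rows_exact :: "('r, 'v) module => (nat => nat) => (nat => nat => nat => 'r) => bool" where
 "rows_exact V n F \<longleftrightarrow>
  (\<forall>i. exact_col V (n (Suc (Suc i))) (n (Suc i)) (n i) (tr (F (Suc i))) (tr (F i)))"

definition mat_resolution ::
 "'r ring => ('r, 'x) module => (nat => nat) => (nat => 'x) => (nat => nat => nat => 'r) => bool" where
 "mat_resolution R N n g F \<longleftrightarrow> mat_seq R n F \<and> rows_exact (regular (opposite R)) n F \<and>
  spans R N (carrier N) (n 0) g \<and>
  (\<forall>v. vec R (n 0) v \<longrightarrow> (lincomb N (n 0) v g = \<zero>\<^sub>N \<longleftrightarrow>
    (\<exists>u. vec R (n (Suc 0)) u \<and> (\<forall>j<n 0. v j = dot R (n (Suc 0)) u (%i. F 0 i j)))))"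

lemma mat_seqD:
 assumes "mat_seq R n F"
 shows "\<And>i j k. j < n (Suc i) ==> k < n i ==> F i j k \<in> carrier R"
  "\<And>i k j. k < n (Suc (Suc i)) ==> j < n i ==> dot R (n (Suc i)) (F (Suc i) k) (%l. F i l j) = \<zero>\<^sub>R"
 using assms by (auto simp: mat_seq_def)

lemma rows_exact_regularD:
 assumes "rows_exact (regular (opposite R)) n F" "vec R (n (Suc i)) v"
  "\<forall>k<n i. dot R (n (Suc i)) v (%j. F i j k) = \<zero>\<^sub>R"
 obtains u where "vec R (n (Suc (Suc i))) u"
  "\<forall>j<n (Suc i). v j = msum R (n (Suc (Suc i))) (%l. u l \<otimes>\<^sub>R F (Suc i) l j)"
proof -
 have "exact_col (regular (opposite R)) (n (Suc (Suc i))) (n (Suc i)) (n i) (tr (F (Suc i))) (tr (F i))"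
  using assms(1) by (simp add: rows_exact_def)
 then obtain u where "vec (regular (opposite R)) (n (Suc (Suc i))) u"
  "\<forall>j<n (Suc i). v j = lincomb (regular (opposite R)) (n (Suc (Suc i))) (tr (F (Suc i)) j) u"
  by (rule exact_colD) (use assms(2,3) in \<open>simp_all add: lincomb_regular_opposite\<close>)
 then show ?thesis by (intro that[of u]) (simp_all add: lincomb_regular_opposite)
qed

section \<open>The free resolution given by a matrix sequence\<close>

locale matrix_resolution = left_module R N for R :: "'r ring" and N :: "('r, 'x) module" (structure) +
 fixes n g F
 assumes res: "mat_resolution R N n g F"
begin

lemma seq: "mat_seq R n F" and rows: "rows_exact (regular (opposite R)) n F"
 and gens: "spans R N (carrier N) (n 0) g"
 using res by (auto simp: mat_resolution_def)

lemma relation_iff: "vec R (n 0) v ==> lincomb N (n 0) v g = \<zero> \<longleftrightarrow>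
  (\<exists>u. vec R (n (Suc 0)) u \<and> (\<forall>j<n 0. v j = dot R (n (Suc 0)) u (%i. F 0 i j)))"
 using res by (simp add: mat_resolution_def)

lemma F_closed [simp]: "j < n (Suc i) ==> k < n i ==> F i j k \<in> carrier R"
 by (rule mat_seqD(1)[OF seq])

lemma g_closed [simp]: "i < n 0 ==> g i \<in> carrier N"
 by (rule spansD(1)[OF gens])

definition "free_term i = sfree R (n i)"

lemma free_term_left_module: "left_module R (free_term i)"
 unfolding free_term_def by (rule sfree_left_module[OF R.ring_axioms])

lemma ex_diff: "\<exists>f. f \<in> mod_hom R (free_term (Suc i)) (free_term i) \<and> (\<forall>v. vec R (n (Suc i)) v \<longrightarrow>
  f (fvec R (n (Suc i)) v) = fvec R (n i) (%k. dot R (n (Suc i)) v (%j. F i j k)))"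
proof -
 have w: "\<And>j. j < n (Suc i) ==> fvec R (n i) (F i j) \<in> carrier (sfree R (n i))"
  by (rule fvec_closed[OF R.ring_axioms]) simp
 obtain f where f: "f \<in> mod_hom R (sfree R (n (Suc i))) (sfree R (n i))"
  "\<forall>v. vec R (n (Suc i)) v \<longrightarrow> f (fvec R (n (Suc i)) v) =
   lincomb (sfree R (n i)) (n (Suc i)) v (%j. fvec R (n i) (F i j))"
  by (rule sfree_hom[OF R.ring_axioms sfree_left_module[OF R.ring_axioms] w])
 have "lincomb (sfree R (n i)) (n (Suc i)) v (%j. fvec R (n i) (F i j))
   = fvec R (n i) (%k. dot R (n (Suc i)) v (%j. F i j k))" if "vec R (n (Suc i)) v" for v
  unfolding sfree_def fvec_def
  by (rule coset_lincomb[OF R.ring_axioms sfree_submodule[OF R.ring_axioms]]) (use that in auto)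
 then show ?thesis unfolding free_term_def using f by (intro exI[of _ f]) simp
qed

text \<open>Elements of \<open>free_term\<close> are classes, so the map given by the matrix
  \<open>F i\<close> is picked by its effect on \<open>fvec\<close> rather than by a
  formula.\<close>

definition "diff i = (SOME f. f \<in> mod_hom R (free_term (Suc i)) (free_term i) \<and> (\<forall>v. vec R (n (Suc i)) v \<longrightarrow>
  f (fvec R (n (Suc i)) v) = fvec R (n i) (%k. dot R (n (Suc i)) v (%j. F i j k))))"

lemma diff_hom: "diff i \<in> mod_hom R (free_term (Suc i)) (free_term i)"
 and diff_fvec: "vec R (n (Suc i)) v ==>
  diff i (fvec R (n (Suc i)) v) = fvec R (n i) (%k. dot R (n (Suc i)) v (%j. F i j k))"
proof -
 have "diff i \<in> mod_hom R (free_term (Suc i)) (free_term i) \<and> (\<forall>v. vec R (n (Suc i)) v \<longrightarrow>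
  diff i (fvec R (n (Suc i)) v) = fvec R (n i) (%k. dot R (n (Suc i)) v (%j. F i j k)))"
  unfolding diff_def by (rule someI_ex[OF ex_diff])
 then show "diff i \<in> mod_hom R (free_term (Suc i)) (free_term i)"
  "vec R (n (Suc i)) v ==>
   diff i (fvec R (n (Suc i)) v) = fvec R (n i) (%k. dot R (n (Suc i)) v (%j. F i j k))"
  by auto
qed

lemma ex_aug: "\<exists>e. e \<in> mod_hom R (free_term 0) N \<and>
  (\<forall>v. vec R (n 0) v \<longrightarrow> e (fvec R (n 0) v) = lincomb N (n 0) v g)"
proof -
 obtain e where "e \<in> mod_hom R (sfree R (n 0)) N"
  "\<forall>v. vec R (n 0) v \<longrightarrow> e (fvec R (n 0) v) = lincomb N (n 0) v g"
  by (rule sfree_hom[OF R.ring_axioms left_module_axioms g_closed])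
 then show ?thesis unfolding free_term_def by blast
qed

lemma fvec_closed': "vec R (n i) v ==> fvec R (n i) v \<in> carrier (free_term i)"
 unfolding free_term_def by (rule fvec_closed[OF R.ring_axioms]) simp

lemma free_termE:
 assumes "x \<in> carrier (free_term i)"
 obtains v where "vec R (n i) v" "x = fvec R (n i) v"
 using assms unfolding free_term_def by (rule sfreeE[OF R.ring_axioms])

lemma fvec_zero_iff: "vec R (n i) v ==> fvec R (n i) v = \<zero>\<^bsub>free_term i\<^esub> \<longleftrightarrow> (\<forall>j<n i. v j = \<zero>\<^sub>R)"
 unfolding free_term_def by (rule fvec_eq_zero_iff[OF R.ring_axioms]) simp

lemma fvec_cong: "(\<And>j. j < n i ==> v j = w j) ==> fvec R (n i) v = fvec R (n i) w"
 unfolding fvec_def by (rule Submission.fvec_cong)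

lemma row_closed: "vec R (n (Suc i)) v ==> vec R (n i) (%k. dot R (n (Suc i)) v (%j. F i j k))"
 by (auto intro!: R.msum_closed)

lemma diff_diff:
 assumes "x \<in> carrier (free_term (Suc (Suc i)))"
 shows "diff i (diff (Suc i) x) = \<zero>\<^bsub>free_term i\<^esub>"
proof -
 obtain v where v: "vec R (n (Suc (Suc i))) v" "x = fvec R (n (Suc (Suc i))) v" by (rule free_termE[OF assms])
 interpret S: left_module "opposite R" "regular (opposite R)"
  by (intro left_module_regular ring_opposite R.ring_axioms)
 have "dot R (n (Suc i)) (%j. msum R (n (Suc (Suc i))) (%l. v l \<otimes>\<^sub>R F (Suc i) l j)) (%j. F i j k) = \<zero>\<^sub>R"
  if k: "k < n i" for k
 proof -
  have "dot R (n (Suc i)) (%j. msum R (n (Suc (Suc i))) (%l. v l \<otimes>\<^sub>R F (Suc i) l j)) (%j. F i j k)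
   = msum R (n (Suc i)) (%j. msum R (n (Suc (Suc i))) (%l. v l \<otimes>\<^sub>R (F (Suc i) l j \<otimes>\<^sub>R F i j k)))"
   using v k by (intro msum_cong) (subst R.msum_mult_right, auto intro!: msum_cong simp: R.m_assoc)
  also have "\<dots> = msum R (n (Suc (Suc i))) (%l. dot R (n (Suc i)) (%j. v l) (%j. (F (Suc i) l j \<otimes>\<^sub>R F i j k)))"
   using v k by (intro R.msum_swap) auto
  also have "\<dots> = msum R (n (Suc (Suc i))) (%l. v l \<otimes>\<^sub>R dot R (n (Suc i)) (F (Suc i) l) (%j. F i j k))"
   using v k by (intro msum_cong) (subst R.msum_mult_left, auto)
  also have "\<dots> = msum R (n (Suc (Suc i))) (%l. \<zero>\<^sub>R)"
   using v k mat_seqD(2)[OF seq] by (intro msum_cong) auto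
  finally show ?thesis by simp
 qed
 then show ?thesis
  using v row_closed[OF v(1)] row_closed[OF row_closed[OF v(1)]]
  by (simp add: diff_fvec fvec_zero_iff)
qed

lemma projective_resolution:
 obtains e where "projective_resolution R N free_term diff e"
proof -
 obtain e where e: "e \<in> mod_hom R (free_term 0) N"
  "\<forall>v. vec R (n 0) v \<longrightarrow> e (fvec R (n 0) v) = lincomb N (n 0) v g"
  using ex_aug by (elim exE conjE)
 have "projective_resolution R N free_term diff e"
  unfolding projective_resolution_def
 proof (intro conjI allI)
  show "projective_module R (free_term i)" for i
   unfolding free_term_def by (rule sfree_projective[OF R.ring_axioms])
  show "diff i \<in> mod_hom R (free_term (Suc i)) (free_term i)" for i by (rule diff_hom)
  show "e \<in> mod_hom R (free_term 0) N" by (rule e(1))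
  show "e ` carrier (free_term 0) = carrier N"
  proof
   show "carrier N \<subseteq> e ` carrier (free_term 0)"
   proof
    fix x assume "x \<in> carrier N"
    then obtain c where c: "\<forall>j<n 0. c j \<in> carrier R" "x = lincomb N (n 0) c g"
     by (rule spansE[OF gens])
    then show "x \<in> e ` carrier (free_term 0)"
     using e(2) fvec_closed'[OF c(1)] by (intro image_eqI[of _ _ "fvec R (n 0) c"]) auto
   qed
  qed (use mod_homD(1)[OF e(1)] in auto)
  show "mod_ker (free_term 0) N e = diff 0 ` carrier (free_term 1)"
  proof
   show "mod_ker (free_term 0) N e \<subseteq> diff 0 ` carrier (free_term 1)"
   proof
    fix x assume "x \<in> mod_ker (free_term 0) N e"
    then have x: "x \<in> carrier (free_term 0)" "e x = \<zero>" by (auto simp: mod_ker_def)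
    obtain v where v: "vec R (n 0) v" "x = fvec R (n 0) v" by (rule free_termE[OF x(1)])
    then have "lincomb N (n 0) v g = \<zero>" using e(2) x(2) by simp
    then obtain u where u: "vec R (n (Suc 0)) u" "\<forall>j<n 0. v j = dot R (n (Suc 0)) u (%i. F 0 i j)"
     unfolding relation_iff[OF v(1)] by (elim exE conjE)
    have "x = diff 0 (fvec R (n (Suc 0)) u)"
     unfolding v(2) diff_fvec[OF u(1)] by (rule fvec_cong) (use u(2) in simp)
    then show "x \<in> diff 0 ` carrier (free_term 1)" using fvec_closed'[OF u(1)] by auto
   qed
   show "diff 0 ` carrier (free_term 1) \<subseteq> mod_ker (free_term 0) N e"
   proof (rule image_subsetI)
    fix x assume "x \<in> carrier (free_term 1)"
    then obtain u where u: "vec R (n (Suc 0)) u" "x = fvec R (n (Suc 0)) u"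
     using free_termE[of x "Suc 0"] by auto
    have "lincomb N (n 0) (%k. dot R (n (Suc 0)) u (%j. F 0 j k)) g = \<zero>"
     unfolding relation_iff[OF row_closed[OF u(1)]] using u(1) by (intro exI[of _ u]) simp
    then show "diff 0 x \<in> mod_ker (free_term 0) N e"
     unfolding mod_ker_def u(2) diff_fvec[OF u(1)]
     using e(2) row_closed[OF u(1)] fvec_closed'[OF row_closed[OF u(1)]] by simp
   qed
  qed
  show "mod_ker (free_term (Suc i)) (free_term i) (diff i) = diff (Suc i) ` carrier (free_term (Suc (Suc i)))" for i
  proof
   show "diff (Suc i) ` carrier (free_term (Suc (Suc i))) \<subseteq> mod_ker (free_term (Suc i)) (free_term i) (diff i)"
    using diff_diff mod_homD(1)[OF diff_hom] by (intro image_subsetI) (simp add: mod_ker_def)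
   show "mod_ker (free_term (Suc i)) (free_term i) (diff i) \<subseteq> diff (Suc i) ` carrier (free_term (Suc (Suc i)))"
   proof
    fix x assume "x \<in> mod_ker (free_term (Suc i)) (free_term i) (diff i)"
    then have x: "x \<in> carrier (free_term (Suc i))" "diff i x = \<zero>\<^bsub>free_term i\<^esub>" by (auto simp: mod_ker_def)
    obtain v where v: "vec R (n (Suc i)) v" "x = fvec R (n (Suc i)) v" by (rule free_termE[OF x(1)])
    have "\<forall>k<n i. dot R (n (Suc i)) v (%j. F i j k) = \<zero>\<^sub>R"
     using x(2) fvec_zero_iff[OF row_closed[OF v(1)]] unfolding v(2) diff_fvec[OF v(1)] by simp
    then obtain u where u: "vec R (n (Suc (Suc i))) u"
     "\<forall>j<n (Suc i). v j = msum R (n (Suc (Suc i))) (%l. u l \<otimes>\<^sub>R F (Suc i) l j)"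
     by (rule rows_exact_regularD[OF rows v(1)])
    have "x = diff (Suc i) (fvec R (n (Suc (Suc i))) u)"
     unfolding v(2) diff_fvec[OF u(1)] by (rule fvec_cong) (use u(2) in simp)
    then show "x \<in> diff (Suc i) ` carrier (free_term (Suc (Suc i)))" using fvec_closed'[OF u(1)] by auto
   qed
  qed
 qed
 then show ?thesis by (rule that)
qed

text \<open>A homomorphism on a free term is determined by its values on unit vectors, and these can
  be prescribed. Evaluation there turns cocycles into columns killed by \<open>F (Suc i)\<close> and
  coboundaries into columns \<open>F i u\<close>.\<close>

lemma hom_exact_iff:
 assumes W: "left_module R W"
 shows "hom_exact R free_term diff W i \<longleftrightarrow> exact_col W (n i) (n (Suc i)) (n (Suc (Suc i))) (F i) (F (Suc i))"
proof -
 interpret W: left_module R W by fact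
 have unit: "vec R m (unit_vec R k)" for m k by simp
 have unit_row: "dot R (n (Suc j)) (unit_vec R k) (%l. F j l m) = F j k m" if "k < n (Suc j)" "m < n j" for j k m
 proof -
  have "dot R (n (Suc j)) (unit_vec R k) (%l. F j l m) = msum R (n (Suc j)) (%l. if l = k then F j k m else \<zero>\<^sub>R)"
   using that by (intro msum_cong) (auto simp: unit_vec_def)
  then show ?thesis using that by (simp add: R.msum_single)
 qed
 have diff_unit: "diff j (fvec R (n (Suc j)) (unit_vec R k)) = fvec R (n j) (F j k)" if "k < n (Suc j)" for j k
  unfolding diff_fvec[OF unit] by (rule fvec_cong) (simp add: unit_row that)
 have hom_eq: "f (fvec R (n j) v) = lincomb W (n j) v (%i. f (fvec R (n j) (unit_vec R i)))"
  if "f \<in> mod_hom R (free_term j) W" "vec R (n j) v" for f j v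
  using sfree_hom_eq[OF R.ring_axioms W, of f "n j" v] that unfolding free_term_def by simp
 have hom_val: "f (fvec R (n j) (unit_vec R k)) \<in> carrier W" if "f \<in> mod_hom R (free_term j) W" for f j k
  by (rule mod_homD(1)[OF that fvec_closed'[OF unit]])
 have hom_ex: "\<exists>f\<in>mod_hom R (free_term j) W. \<forall>v. vec R (n j) v \<longrightarrow> f (fvec R (n j) v) = lincomb W (n j) v w"
  if w: "vec W (n j) w" for j w
 proof -
  obtain f where "f \<in> mod_hom R (sfree R (n j)) W"
   "\<forall>v. vec R (n j) v \<longrightarrow> f (fvec R (n j) v) = lincomb W (n j) v w"
   by (rule sfree_hom[OF R.ring_axioms W, of "n j" w]) (use w in auto)
  then show ?thesis unfolding free_term_def by blast
 qed
 have hom_eqI: "f x = f' x"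
  if f: "f \<in> mod_hom R (free_term j) W" "f' \<in> mod_hom R (free_term j) W"
   and eq: "\<And>k. k < n j ==> f (fvec R (n j) (unit_vec R k)) = f' (fvec R (n j) (unit_vec R k))"
   and x: "x \<in> carrier (free_term j)" for f f' j x
 proof -
  obtain v where v: "vec R (n j) v" "x = fvec R (n j) v" by (rule free_termE[OF x])
  show ?thesis unfolding v(2) hom_eq[OF f(1) v(1)] hom_eq[OF f(2) v(1)]
   by (rule lincomb_cong) (simp_all add: eq)
 qed
 show ?thesis
 proof
  assume ex: "hom_exact R free_term diff W i"
  show "exact_col W (n i) (n (Suc i)) (n (Suc (Suc i))) (F i) (F (Suc i))"
   unfolding exact_col_def
  proof (intro allI impI, elim conjE)
   fix w assume w: "vec W (n (Suc i)) w" and z: "\<forall>k<n (Suc (Suc i)). lincomb W (n (Suc i)) (F (Suc i) k) w = \<zero>\<^sub>W"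
   obtain f where f: "f \<in> mod_hom R (free_term (Suc i)) W"
    "\<forall>v. vec R (n (Suc i)) v \<longrightarrow> f (fvec R (n (Suc i)) v) = lincomb W (n (Suc i)) v w"
    using hom_ex[OF w] by blast
   let ?fd = "\<lambda>x\<in>carrier (free_term (Suc (Suc i))). f (diff (Suc i) x)"
   let ?z = "\<lambda>x\<in>carrier (free_term (Suc (Suc i))). \<zero>\<^sub>W"
   have fd: "?fd \<in> mod_hom R (free_term (Suc (Suc i))) W"
    by (rule mod_hom_compose[OF diff_hom f(1) free_term_left_module])
   have zh: "?z \<in> mod_hom R (free_term (Suc (Suc i))) W"
    by (rule mod_hom_restrictI[OF free_term_left_module]) auto
   have "?fd x = ?z x" if x: "x \<in> carrier (free_term (Suc (Suc i)))" for x
    using f(2) z by (intro hom_eqI[OF fd zh _ x]) (simp add: fvec_closed'[OF unit] diff_unit)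
   then have "\<forall>x\<in>carrier (free_term (Suc (Suc i))). f (diff (Suc i) x) = \<zero>\<^sub>W" by simp
   then obtain h where h: "h \<in> mod_hom R (free_term i) W" "\<forall>x\<in>carrier (free_term (Suc i)). f x = h (diff i x)"
    using ex f(1) unfolding hom_exact_def by blast
   have "w j = lincomb W (n i) (F i j) (%k. h (fvec R (n i) (unit_vec R k)))" if j: "j < n (Suc i)" for j
   proof -
    have "w j = f (fvec R (n (Suc i)) (unit_vec R j))"
     using f(2) j w by (simp add: W.lincomb_unit_vec)
    also have "\<dots> = h (fvec R (n i) (F i j))"
     using h(2) fvec_closed'[OF unit] by (simp add: diff_unit j)
    finally show ?thesis using hom_eq[OF h(1), of "F i j"] j by simp
   qed
   then show "\<exists>u. vec W (n i) u \<and> (\<forall>j<n (Suc i). w j = lincomb W (n i) (F i j) u)"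
    using hom_val[OF h(1)] by (intro exI[of _ "%k. h (fvec R (n i) (unit_vec R k))"]) simp
  qed
 next
  assume ex: "exact_col W (n i) (n (Suc i)) (n (Suc (Suc i))) (F i) (F (Suc i))"
  show "hom_exact R free_term diff W i"
   unfolding hom_exact_def
  proof (intro ballI impI)
   fix f assume f: "f \<in> mod_hom R (free_term (Suc i)) W"
    and z: "\<forall>x\<in>carrier (free_term (Suc (Suc i))). f (diff (Suc i) x) = \<zero>\<^sub>W"
   let ?w = "%j. f (fvec R (n (Suc i)) (unit_vec R j))"
   have "vec W (n (Suc i)) ?w" using hom_val[OF f] by simp
   moreover have "\<forall>k<n (Suc (Suc i)). lincomb W (n (Suc i)) (F (Suc i) k) ?w = \<zero>\<^sub>W"
   proof (intro allI impI)
    fix k assume k: "k < n (Suc (Suc i))"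
    show "lincomb W (n (Suc i)) (F (Suc i) k) ?w = \<zero>\<^sub>W"
     using z[rule_format, OF fvec_closed'[OF unit, of _ k]] hom_eq[OF f, of "F (Suc i) k"] k
     by (simp add: diff_unit)
   qed
   ultimately obtain u where u: "vec W (n i) u" "\<forall>j<n (Suc i). ?w j = lincomb W (n i) (F i j) u"
    by (rule exact_colD[OF ex])
   obtain h where h: "h \<in> mod_hom R (free_term i) W"
    "\<forall>v. vec R (n i) v \<longrightarrow> h (fvec R (n i) v) = lincomb W (n i) v u"
    using hom_ex[OF u(1)] by blast
   have hd: "(\<lambda>x\<in>carrier (free_term (Suc i)). h (diff i x)) \<in> mod_hom R (free_term (Suc i)) W"
    by (rule mod_hom_compose[OF diff_hom h(1) free_term_left_module])
   have "f x = (\<lambda>x\<in>carrier (free_term (Suc i)). h (diff i x)) x" if x: "x \<in> carrier (free_term (Suc i))" for x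
    by (rule hom_eqI[OF f hd _ x]) (simp add: fvec_closed'[OF unit] diff_unit h(2) u(2))
   then show "\<exists>h\<in>mod_hom R (free_term i) W. \<forall>x\<in>carrier (free_term (Suc i)). f x = h (diff i x)"
    using h(1) by (intro bexI[of _ h]) auto
  qed
 qed
qed

theorem trivial_Ext_iff_exact_col:
 assumes "left_module R W"
 shows "trivial_group (Ext R (Suc i) N W) \<longleftrightarrow> exact_col W (n i) (n (Suc i)) (n (Suc (Suc i))) (F i) (F (Suc i))"
proof -
 obtain e where "projective_resolution R N free_term diff e" by (rule projective_resolution)
 from trivial_Ext_iff[OF this left_module_axioms assms] show ?thesis using hom_exact_iff[OF assms] by simp
qed

lemma Ext_vanish_iff_cols_exact:
 assumes "left_module R W"
 shows "(\<forall>i\<ge>1. trivial_group (Ext R i N W)) \<longleftrightarrow> cols_exact W n F"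
 unfolding cols_exact_def trivial_Ext_iff_exact_col[OF assms, symmetric]
 by (metis One_nat_def Suc_le_D Suc_le_mono le0)

lemma semi_Gorenstein_projective_iff: "semi_Gorenstein_projective R N \<longleftrightarrow> cols_exact (regular R) n F"
proof -
 have "fg_module R N" by (rule spans_fg_module[OF left_module_axioms gens])
 then show ?thesis
  unfolding semi_Gorenstein_projective_def left_perp_def
  using Ext_vanish_iff_cols_exact[OF left_module_regular[OF R.ring_axioms]] by simp
qed

end

section \<open>Semi-Gorenstein-projective modules as acyclic sequences of matrices\<close>

text \<open>Stated for submodules of finite free modules, where modules of relations live.\<close>

definition left_noetherian :: "'r ring => bool" where
 "left_noetherian R \<longleftrightarrow> ring R \<and>
  (\<forall>n U. submodule U R (free_module R n) \<longrightarrow> (\<exists>m g. spans R (free_module R n) U m g))"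

lemma left_noetherian_ring: "left_noetherian R ==> ring R"
 by (simp add: left_noetherian_def)

lemma left_noetherian_spans:
 assumes "left_noetherian R" "submodule U R (free_module R n)"
 obtains m g where "spans R (free_module R n) U m g"
proof -
 have "\<exists>m g. spans R (free_module R n) U m g" using assms by (simp add: left_noetherian_def)
 then show ?thesis by (elim exE) (rule that)
qed

definition row_span :: "('r, 'e) ring_scheme => nat => nat => (nat => nat => 'r) => (nat => 'r) => bool" where
 "row_span R m n G v \<longleftrightarrow> (\<exists>u. vec R m u \<and> (\<forall>j<n. v j = dot R m u (%i. G i j)))"

lemma row_spanI: "vec R m u ==> (\<And>j. j < n ==> v j = dot R m u (%i. G i j)) ==> row_span R m n G v"
 unfolding row_span_def by (intro exI[of _ u]) simp

lemma row_spanE: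
 assumes "row_span R m n G v"
 obtains u where "vec R m u" "\<forall>j<n. v j = dot R m u (%i. G i j)"
 using assms unfolding row_span_def by (elim exE conjE)

lemma annihilator_submodule:
 assumes "left_module R W" "vec W n w"
 shows "submodule {v \<in> carrier (free_module R n). lincomb W n v w = \<zero>\<^sub>W} R (free_module R n)"
proof -
 interpret W: left_module R W by fact
 let ?F = "free_module R n" and ?f = "\<lambda>v\<in>carrier (free_module R n). lincomb W n v w"
 have "submodule {v \<in> carrier ?F. ?f v \<in> {\<zero>\<^sub>W}} R ?F"
  by (rule vimage_submodule[OF free_hom[OF assms(1)] left_module_free[OF W.R.ring_axioms] assms(1) zero_submodule[OF assms(1)]])
   (use assms(2) in simp)
 moreover have "{v \<in> carrier ?F. ?f v \<in> {\<zero>\<^sub>W}} = {v \<in> carrier ?F. lincomb W n v w = \<zero>\<^sub>W}" by auto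
 ultimately show ?thesis by (simp only:)
qed

lemma syzygies:
 assumes "left_noetherian R" "left_module R W" "vec W n w"
 obtains m G where "mat R m n G"
  "\<forall>v. vec R n v \<longrightarrow> (lincomb W n v w = \<zero>\<^sub>W \<longleftrightarrow> row_span R m n G v)"
proof -
 interpret W: left_module R W by fact
 let ?U = "{v \<in> carrier (free_module R n). lincomb W n v w = \<zero>\<^sub>W}"
 have sub: "submodule ?U R (free_module R n)" by (rule annihilator_submodule[OF assms(2,3)])
 obtain m G where G: "spans R (free_module R n) ?U m G"
  by (rule left_noetherian_spans[OF assms(1) sub])
 have GU: "G i \<in> ?U" if "i < m" for i by (rule spansD(1)[OF G that])
 have Gc: "G i j \<in> carrier R" if "i < m" "j < n" for i j
  using GU[OF that(1)] that(2) by (auto simp: PiE_iff)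
 show ?thesis
 proof (rule that[of m G], intro allI impI, rule Gc, assumption, assumption, intro allI impI iffI)
  fix v assume v: "vec R n v" "lincomb W n v w = \<zero>\<^sub>W"
  then have "restrict v {..<n} \<in> ?U" by simp
  then obtain c where c: "\<forall>i<m. c i \<in> carrier R" "restrict v {..<n} = lincomb (free_module R n) m c G"
   by (rule spansE[OF G])
  have "v j = dot R m c (%i. G i j)" if "j < n" for j
   using fun_cong[OF c(2), of j] that by (simp add: lincomb_free)
  then show "row_span R m n G v" by (rule row_spanI[OF c(1)])
 next
  fix v assume v: "vec R n v" "row_span R m n G v"
  obtain c where c: "vec R m c" "\<forall>j<n. v j = dot R m c (%i. G i j)" by (rule row_spanE[OF v(2)])
  have "lincomb W n v w = lincomb W n (%j. dot R m c (%i. G i j)) w"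
   using c(2) by (intro lincomb_cong) auto
  also have "\<dots> = lincomb W m c (%i. lincomb W n (G i) w)"
   using c(1) Gc assms(3) by (intro W.lincomb_assoc[symmetric]) auto
  also have "\<dots> = lincomb W m c (%i. \<zero>\<^sub>W)"
   using GU by (intro lincomb_cong) auto
  finally show "lincomb W n v w = \<zero>\<^sub>W" using c(1) by simp
 qed
qed

text \<open>The rows of \<open>F\<close> are elements of a free module, so the left kernel of a
  matrix is the module of relations among them.\<close>

lemma row_syzygies:
 assumes "left_noetherian R" "mat R n k F"
 obtains m G where "mat R m n G"
  "\<forall>v. vec R n v \<longrightarrow> ((\<forall>l<k. dot R n v (%j. F j l) = \<zero>\<^sub>R) \<longleftrightarrow> row_span R m n G v)"
proof -
 have R: "ring R" using assms(1) by (simp add: left_noetherian_def)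
 then interpret R: ring R .
 interpret F: left_module R "free_module R k" by (rule left_module_free[OF R])
 let ?w = "%j. restrict (F j) {..<k}"
 have w: "vec (free_module R k) n ?w" using assms(2) by auto
 have eq: "lincomb (free_module R k) n v ?w = \<zero>\<^bsub>free_module R k\<^esub> \<longleftrightarrow>
   (\<forall>l<k. dot R n v (%j. F j l) = \<zero>\<^sub>R)" if v: "vec R n v" for v
 proof -
  have c: "lincomb (free_module R k) n v ?w \<in> {..<k} \<rightarrow>\<^sub>E carrier R"
   using F.lincomb_closed[of n v ?w] v w by simp
  have l: "lincomb (free_module R k) n v ?w l = dot R n v (%j. F j l)" if "l < k" for l
   using that by (simp add: lincomb_free)
  show ?thesis
  proof
   assume "lincomb (free_module R k) n v ?w = \<zero>\<^bsub>free_module R k\<^esub>"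
   then have "lincomb (free_module R k) n v ?w l = (\<lambda>i\<in>{..<k}. \<zero>\<^sub>R) l" for l by simp
   then show "\<forall>l<k. dot R n v (%j. F j l) = \<zero>\<^sub>R"
    by (simp add: l[symmetric])
  next
   assume "\<forall>l<k. dot R n v (%j. F j l) = \<zero>\<^sub>R"
   then have "lincomb (free_module R k) n v ?w l = (\<lambda>i\<in>{..<k}. \<zero>\<^sub>R) l" if "l \<in> {..<k}" for l
    using that l by simp
   moreover have "lincomb (free_module R k) n v ?w \<in> extensional {..<k}"
    using c by (simp add: PiE_def)
   ultimately show "lincomb (free_module R k) n v ?w = \<zero>\<^bsub>free_module R k\<^esub>"
    unfolding free_module_simps by (intro extensionalityI[where A = "{..<k}"]) simp_all
  qed
 qed
 obtain m G where G: "mat R m n G" "\<forall>v. vec R n v \<longrightarrow>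
   (lincomb (free_module R k) n v ?w = \<zero>\<^bsub>free_module R k\<^esub> \<longleftrightarrow> row_span R m n G v)"
  by (rule syzygies[OF assms(1) F.left_module_axioms w])
 show ?thesis
 proof (rule that[OF G(1)], intro allI impI)
  fix v assume v: "vec R n v"
  show "(\<forall>l<k. dot R n v (%j. F j l) = \<zero>\<^sub>R) \<longleftrightarrow> row_span R m n G v"
   unfolding eq[OF v, symmetric] using G(2)[rule_format, OF v[rule_format]] .
 qed
qed

lemma (in ring) row_span_unit:
 assumes "mat R m n G" "i < m"
 shows "row_span R m n G (G i)"
proof (rule row_spanI[where u = "unit_vec R i"])
 fix j assume "j < n"
 have "dot R m (unit_vec R i) (%l. G l j) = msum R m (%l. if l = i then G i j else \<zero>)"
  using assms \<open>j < n\<close> by (intro msum_cong) (auto simp: unit_vec_def)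
 then show "G i j = dot R m (unit_vec R i) (%l. G l j)"
  using assms \<open>j < n\<close> by (simp add: msum_single)
qed (simp add: unit_vec_def)

lemma ex_mat_resolution:
 fixes R :: "'a ring"
 assumes "left_noetherian R" "fg_module R N"
 obtains n g F where "mat_resolution R N n g F"
proof -
 have R: "ring R" using assms(1) by (simp add: left_noetherian_def)
 then interpret R: ring R .
 have N: "left_module R N" by (rule left_module_if_fg[OF assms(2)])
 obtain n0 g where g: "spans R N (carrier N) n0 g" by (rule fg_module_spans[OF assms(2)])
 have gc: "vec N n0 g" using spansD(1)[OF g] by simp
 obtain n1 G0 where G0: "mat R n1 n0 G0"
  "\<forall>v. vec R n0 v \<longrightarrow> (lincomb N n0 v g = \<zero>\<^sub>N \<longleftrightarrow> row_span R n1 n0 G0 v)"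
  by (rule syzygies[OF assms(1) N gc])
 \<comment> \<open>A state is a triple consisting of \<open>n i\<close>, \<open>n (Suc i)\<close>
   and \<open>F i\<close>. Consecutive states share a rank, and \<open>Q\<close> says that the rows
   of the next matrix generate the kernel of the present one.\<close>
 define P where "P i s \<longleftrightarrow> mat R (fst (snd s)) (fst s) (snd (snd s)) \<and> (i = 0 \<longrightarrow> s = (n0, n1, G0))"
  for i :: nat and s
 define Q where "Q i s t \<longleftrightarrow> fst t = fst (snd s) \<and> (\<forall>v. vec R (fst (snd s)) v \<longrightarrow>
   ((\<forall>l<fst s. dot R (fst (snd s)) v (%j. snd (snd s) j l) = \<zero>\<^sub>R) \<longleftrightarrow>
   row_span R (fst (snd t)) (fst (snd s)) (snd (snd t)) v))" for i :: nat and s t :: "nat \<times> nat \<times> (nat => nat => 'a)"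
 have "\<exists>s. \<forall>i. P i (s i) \<and> Q i (s i) (s (Suc i))"
 proof (rule dependent_nat_choice)
  show "\<exists>s. P 0 s" using G0(1) by (intro exI[of _ "(n0, n1, G0)"]) (simp add: P_def)
 next
  fix s i assume "P i s"
  then have "mat R (fst (snd s)) (fst s) (snd (snd s))" by (simp add: P_def)
  then obtain m G where G: "mat R m (fst (snd s)) G" "\<forall>v. vec R (fst (snd s)) v \<longrightarrow>
   ((\<forall>l<fst s. dot R (fst (snd s)) v (%j. snd (snd s) j l) = \<zero>\<^sub>R) \<longleftrightarrow>
   row_span R m (fst (snd s)) G v)" by (rule row_syzygies[OF assms(1)])
  then show "\<exists>t. P (Suc i) t \<and> Q i s t"
   by (intro exI[of _ "(fst (snd s), m, G)"]) (simp add: P_def Q_def)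
 qed
 then obtain s where s: "\<And>i. P i (s i)" "\<And>i. Q i (s i) (s (Suc i))" by metis
 define n where "n i = fst (s i)" for i
 define F where "F i = snd (snd (s i))" for i
 have nS: "fst (snd (s i)) = n (Suc i)" for i using s(2)[of i] by (simp add: Q_def n_def)
 have F: "mat R (n (Suc i)) (n i) (F i)" for i
  using s(1)[of i] by (simp add: P_def nS F_def n_def)
 have ker: "(\<forall>l<n i. dot R (n (Suc i)) v (%j. F i j l) = \<zero>\<^sub>R) \<longleftrightarrow>
   row_span R (n (Suc (Suc i))) (n (Suc i)) (F (Suc i)) v" if "vec R (n (Suc i)) v" for i v
  using s(2)[of i] that by (simp add: Q_def nS F_def n_def)
 have s0: "n 0 = n0" "n (Suc 0) = n1" "F 0 = G0"
  using s(1)[of 0] nS[of 0] by (simp_all add: P_def n_def F_def)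
 have seq: "mat_seq R n F"
  unfolding mat_seq_def
 proof (intro conjI allI impI F[rule_format])
  fix i k j assume kj: "k < n (Suc (Suc i))" "j < n i"
  have "row_span R (n (Suc (Suc i))) (n (Suc i)) (F (Suc i)) (F (Suc i) k)"
   by (rule R.row_span_unit[OF F kj(1)])
  then show "dot R (n (Suc i)) (F (Suc i) k) (%l. F i l j) = \<zero>\<^sub>R"
   using ker[of i "F (Suc i) k"] F[of "Suc i"] kj by simp
 qed
 have "rows_exact (regular (opposite R)) n F"
  unfolding rows_exact_def exact_col_def
 proof (intro allI impI, elim conjE)
  fix i v assume v: "vec (regular (opposite R)) (n (Suc i)) v"
   "\<forall>k<n i. lincomb (regular (opposite R)) (n (Suc i)) (tr (F i) k) v = \<zero>\<^bsub>regular (opposite R)\<^esub>"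
  then have "row_span R (n (Suc (Suc i))) (n (Suc i)) (F (Suc i)) v"
   using ker[of i v] by (simp add: lincomb_regular_opposite)
  then obtain u where "vec R (n (Suc (Suc i))) u"
   "\<forall>j<n (Suc i). v j = msum R (n (Suc (Suc i))) (%l. u l \<otimes>\<^sub>R F (Suc i) l j)" by (rule row_spanE)
  then show "\<exists>u. vec (regular (opposite R)) (n (Suc (Suc i))) u \<and>
    (\<forall>j<n (Suc i). v j = lincomb (regular (opposite R)) (n (Suc (Suc i))) (tr (F (Suc i)) j) u)"
   by (intro exI[of _ u]) (simp add: lincomb_regular_opposite)
 qed
 then have "mat_resolution R N n g F"
  unfolding mat_resolution_def using seq g G0(2) by (simp add: s0 row_span_def)
 then show ?thesis by (rule that)
qed

section \<open>Acyclic sequences and torsionless cokernels\<close>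

definition acyclic_seq :: "'r ring => (nat => nat) => (nat => nat => nat => 'r) => bool" where
 "acyclic_seq R n F \<longleftrightarrow> mat_seq R n F \<and> cols_exact (regular R) n F \<and> rows_exact (regular (opposite R)) n F"

text \<open>The cokernel of the row map \<open>R\<^sup>b \<longrightarrow> R\<^sup>a\<close> given by \<open>G\<close> is torsionless.\<close>

definition torsionless_mat :: "'r ring => nat => nat => (nat => nat => 'r) => bool" where
 "torsionless_mat R a b G \<longleftrightarrow> (\<forall>v. vec R a v \<and>
  (\<forall>w. vec R a w \<and> (\<forall>j<b. dot R a (G j) w = \<zero>\<^sub>R) \<longrightarrow> dot R a v w = \<zero>\<^sub>R)
  \<longrightarrow> row_span R b a G v)"

definition weakly_Gorenstein_mat :: "'r ring => bool" where
 "weakly_Gorenstein_mat R \<longleftrightarrow> (\<forall>n F. acyclic_seq R n F \<longrightarrow> torsionless_mat R (n 0) (n (Suc 0)) (F 0))"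

lemma torsionless_matD:
 assumes "torsionless_mat R a b G" "vec R a v"
  "\<forall>w. vec R a w \<and> (\<forall>j<b. dot R a (G j) w = \<zero>\<^sub>R) \<longrightarrow> dot R a v w = \<zero>\<^sub>R"
 obtains u where "vec R b u" "\<forall>j<a. v j = dot R b u (%i. G i j)"
proof -
 have "row_span R b a G v" using assms unfolding torsionless_mat_def by simp
 then show ?thesis by (rule row_spanE) (rule that)
qed

lemma cols_exact_regularD:
 assumes "cols_exact (regular R) n F" "vec R (n (Suc i)) v"
  "\<forall>k<n (Suc (Suc i)). dot R (n (Suc i)) (F (Suc i) k) v = \<zero>\<^sub>R"
 obtains u where "vec R (n i) u" "\<forall>j<n (Suc i). v j = dot R (n i) (F i j) u"
proof -
 have "exact_col (regular R) (n i) (n (Suc i)) (n (Suc (Suc i))) (F i) (F (Suc i))"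
  using assms(1) by (simp add: cols_exact_def)
 then obtain u where "vec (regular R) (n i) u"
  "\<forall>j<n (Suc i). v j = lincomb (regular R) (n i) (F i j) u"
  by (rule exact_colD) (use assms(2,3) in \<open>simp_all add: lincomb_regular\<close>)
 then show ?thesis by (intro that[of u]) (simp_all add: lincomb_regular)
qed

lemma (in ring) msum_row_col:
 assumes "vec R m v" "mat R m n G" "vec R n u"
 shows "dot R m v (%i. dot R n (G i) u) = dot R n (%j. dot R m v (%i. G i j)) u"
proof -
 have "dot R m v (%i. dot R n (G i) u) = msum R m (%i. msum R n (%j. v i \<otimes> G i j \<otimes> u j))"
  using assms by (intro msum_cong) (subst msum_mult_left, auto intro!: msum_cong simp: m_assoc)
 also have "\<dots> = msum R n (%j. msum R m (%i. v i \<otimes> G i j \<otimes> u j))"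
  using assms by (intro msum_swap) auto
 also have "\<dots> = dot R n (%j. dot R m v (%i. G i j)) u"
  using assms by (intro msum_cong) (subst msum_mult_right, auto)
 finally show ?thesis .
qed

lemma all_nat_iff: "(\<forall>i::nat. P i) \<longleftrightarrow> P 0 \<and> (\<forall>i. P (Suc i))"
 by (metis not0_implies_Suc)

text \<open>The columns killed by \<open>F 0\<close> form a right module, namely the row kernel of
  the transposed matrix over the opposite ring. A finite generating system of it, transposed back,
  is the matrix \<open>G\<close>.\<close>

lemma cols_exact_prepend:
 assumes "left_noetherian (opposite R)" "mat_seq R n F" "cols_exact (regular R) n F"
 obtains m G where "mat_seq R (case_nat m n) (case_nat G F)" "cols_exact (regular R) (case_nat m n) (case_nat G F)"
proof -
 have "ring (opposite R)" by (rule left_noetherian_ring[OF assms(1)])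
 then have R: "ring R" using ring_opposite by fastforce
 then interpret R: ring R .
 have F0: "mat R (n (Suc 0)) (n 0) (F 0)" using mat_seqD(1)[OF assms(2)] by simp
 have "mat (opposite R) (n 0) (n (Suc 0)) (tr (F 0))" using F0 by simp
 then obtain m H where H: "mat (opposite R) m (n 0) H" "\<forall>v. vec (opposite R) (n 0) v \<longrightarrow>
  ((\<forall>l<n (Suc 0). dot (opposite R) (n 0) v (%j. tr (F 0) j l) = \<zero>\<^bsub>opposite R\<^esub>)
   \<longleftrightarrow> row_span (opposite R) m (n 0) H v)"
  by (rule row_syzygies[OF assms(1)])
 define G where "G = tr H"
 have Gc: "mat R (n 0) m G" using H(1) by (simp add: G_def)
 have Gker: "(\<forall>l<n (Suc 0). dot R (n 0) (F 0 l) v = \<zero>\<^sub>R)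
   \<longleftrightarrow> (\<exists>u. vec R m u \<and> (\<forall>j<n 0. v j = dot R m (G j) u))" if "vec R (n 0) v" for v
  using H(2) that by (simp add: row_span_def G_def)
 have F0G: "dot R (n 0) (F 0 k) (%l. G l j) = \<zero>\<^sub>R" if "k < n (Suc 0)" "j < m" for k j
 proof -
  have "\<exists>u. vec R m u \<and> (\<forall>l<n 0. G l j = dot R m (G l) u)"
  proof (intro exI[of _ "unit_vec R j"] conjI allI impI)
   fix l assume l: "l < n 0"
   have "dot R m (G l) (unit_vec R j) = msum R m (%i. if i = j then G l j else \<zero>\<^sub>R)"
    using Gc l by (intro msum_cong) (auto simp: unit_vec_def)
   then show "G l j = dot R m (G l) (unit_vec R j)"
    using that l Gc by (simp add: R.msum_single)
  qed (simp add: unit_vec_def)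
  then show ?thesis using Gker[of "%l. G l j"] Gc that by simp
 qed
 have "mat_seq R (case_nat m n) (case_nat G F)"
  unfolding mat_seq_def using Gc F0G mat_seqD[OF assms(2)]
  by (subst (1 2) all_nat_iff) simp
 moreover have "cols_exact (regular R) (case_nat m n) (case_nat G F)"
 proof -
  have "exact_col (regular R) m (n 0) (n (Suc 0)) G (F 0)"
   unfolding exact_col_def
  proof (intro allI impI, elim conjE)
   fix v assume "vec (regular R) (n 0) v" "\<forall>k<n (Suc 0). lincomb (regular R) (n 0) (F 0 k) v = \<zero>\<^bsub>regular R\<^esub>"
   then show "\<exists>u. vec (regular R) m u \<and> (\<forall>j<n 0. v j = lincomb (regular R) m (G j) u)"
    using Gker[of v] by (simp add: lincomb_regular)
  qed
  then show ?thesis using assms(3)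
   unfolding cols_exact_def by (subst all_nat_iff) simp
 qed
 ultimately show ?thesis by (rule that)
qed

text \<open>A row killed by \<open>G\<close> pairs to zero with every column killed by
  \<open>F 0\<close>, since such a column is a combination of columns of \<open>G\<close>. Row
  exactness at the former start is then exactly what torsionlessness provides.\<close>

lemma acyclic_seq_prepend:
 assumes "left_noetherian (opposite R)" "acyclic_seq R n F" "torsionless_mat R (n 0) (n (Suc 0)) (F 0)"
 obtains m G where "acyclic_seq R (case_nat m n) (case_nat G F)"
proof -
 have "ring (opposite R)" by (rule left_noetherian_ring[OF assms(1)])
 then have R: "ring R" using ring_opposite by fastforce
 then interpret R: ring R .
 have "mat_seq R n F" "cols_exact (regular R) n F" using assms(2) by (simp_all add: acyclic_seq_def)
 then obtain m G where seqG: "mat_seq R (case_nat m n) (case_nat G F)"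
  and cols: "cols_exact (regular R) (case_nat m n) (case_nat G F)"
  by (rule cols_exact_prepend[OF assms(1)])
 have Gc: "mat R (n 0) m G" using mat_seqD(1)[OF seqG, of _ 0] by simp
 have "rows_exact (regular (opposite R)) (case_nat m n) (case_nat G F)"
 proof -
  have "exact_col (regular (opposite R)) (n (Suc 0)) (n 0) m (tr (F 0)) (tr G)"
   unfolding exact_col_def
  proof (intro allI impI, elim conjE)
   fix v assume "vec (regular (opposite R)) (n 0) v"
    "\<forall>k<m. lincomb (regular (opposite R)) (n 0) (tr G k) v = \<zero>\<^bsub>regular (opposite R)\<^esub>"
   then have v: "vec R (n 0) v" "\<forall>k<m. dot R (n 0) v (%j. G j k) = \<zero>\<^sub>R"
    by (simp_all add: lincomb_regular_opposite)
   have "\<forall>w. vec R (n 0) w \<and> (\<forall>j<n (Suc 0). dot R (n 0) (F 0 j) w = \<zero>\<^sub>R)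
    \<longrightarrow> dot R (n 0) v w = \<zero>\<^sub>R"
   proof (intro allI impI, elim conjE)
    fix w assume w: "vec R (n 0) w" "\<forall>j<n (Suc 0). dot R (n 0) (F 0 j) w = \<zero>\<^sub>R"
    obtain u where u: "vec R m u" "\<forall>j<n 0. w j = dot R m (G j) u"
     by (rule cols_exact_regularD[OF cols, of 0 w]) (use w in simp_all)
    have "dot R (n 0) v w = dot R (n 0) v (%k. dot R m (G k) u)"
     using u(2) by (intro msum_cong) auto
    also have "\<dots> = dot R m (%i. dot R (n 0) v (%k. G k i)) u"
     by (rule R.msum_row_col[OF v(1) Gc u(1)])
    also have "\<dots> = msum R m (%i. \<zero>\<^sub>R)" using v(2) u(1) by (intro msum_cong) auto
    finally show "dot R (n 0) v w = \<zero>\<^sub>R" by simp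
   qed
   then obtain u where "vec R (n (Suc 0)) u" "\<forall>j<n 0. v j = dot R (n (Suc 0)) u (%i. F 0 i j)"
    by (rule torsionless_matD[OF assms(3) v(1)])
   then show "\<exists>u. vec (regular (opposite R)) (n (Suc 0)) u \<and>
     (\<forall>j<n 0. v j = lincomb (regular (opposite R)) (n (Suc 0)) (tr (F 0) j) u)"
    by (intro exI[of _ u]) (simp add: lincomb_regular_opposite)
  qed
  then show ?thesis using assms(2)
   unfolding rows_exact_def acyclic_seq_def by (subst all_nat_iff) simp
 qed
 then show ?thesis using seqG cols by (intro that[of m G]) (simp add: acyclic_seq_def)
qed

section \<open>Dual modules and modules presented by matrices\<close>

lemma ring_dual_simps [simp]:
 "carrier (ring_dual R N) = mod_hom R N (regular R)"
 "\<zero>\<^bsub>ring_dual R N\<^esub> = (\<lambda>x\<in>carrier N. \<zero>\<^sub>R)"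
 "f \<oplus>\<^bsub>ring_dual R N\<^esub> g = (\<lambda>x\<in>carrier N. f x \<oplus>\<^sub>R g x)"
 "r \<odot>\<^bsub>ring_dual R N\<^esub> f = (\<lambda>x\<in>carrier N. f x \<otimes>\<^sub>R r)"
 by (simp_all add: ring_dual_def hom_module_def hom_group_def)

text \<open>The dual is a submodule of the module of all functions on the carrier of
  \<open>N\<close>, from which it inherits the module axioms.\<close>

lemma left_module_dual:
 assumes "left_module R N"
 shows "left_module (opposite R) (ring_dual R N)"
proof -
 interpret N: left_module R N by fact
 interpret S: left_module R "regular R" by (rule left_module_regular[OF N.R.ring_axioms])
 let ?F = "fun_module (regular (opposite R)) (carrier N)" and ?H = "mod_hom R N (regular R)"
 have F: "left_module (opposite R) ?F"
  by (intro left_module_fun left_module_regular ring_opposite N.R.ring_axioms)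
 note hom = mod_homD[of _ R N "regular R", simplified]
 have "submodule ?H (opposite R) ?F"
 proof (rule submoduleI[OF F])
  show "?H \<subseteq> carrier ?F" by (auto simp: mod_hom_def)
  show "\<zero>\<^bsub>?F\<^esub> \<in> ?H" using mod_hom_restrictI[OF assms, of "%_. \<zero>\<^sub>R" "regular R"] by simp
  show "f \<oplus>\<^bsub>?F\<^esub> g \<in> ?H" if "f \<in> ?H" "g \<in> ?H" for f g
   using mod_hom_add[OF that assms S.left_module_axioms] by simp
  fix r f assume r: "r \<in> carrier (opposite R)" and f: "f \<in> ?H"
  have "(\<lambda>x\<in>carrier N. f x \<otimes>\<^sub>R r) \<in> ?H"
   by (rule mod_hom_restrictI[OF assms]) (use hom[OF f] r in \<open>simp_all add: N.R.l_distr N.R.m_assoc\<close>)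
  then show "r \<odot>\<^bsub>?F\<^esub> f \<in> ?H" by simp
 qed
 moreover have "ring_dual R N = ?F\<lparr>carrier := ?H\<rparr>"
  by (rule module.equality) (simp_all add: ring_dual_def hom_module_def hom_group_def fun_module_def fun_eq_iff)
 ultimately show ?thesis using submodule_left_module[OF _ F] by simp
qed

lemma lincomb_dual:
 "x \<in> carrier N ==> lincomb (ring_dual R N) m u f x = dot R m (%j. f j x) u"
 by (induction m) simp_all

lemma row_span_submodule:
 assumes "ring R" "mat R m n G"
 shows "submodule {v \<in> carrier (free_module R n). row_span R m n G v} R (free_module R n)"
proof -
 let ?F = "free_module R n" and ?w = "%i. restrict (G i) {..<n}"
 let ?f = "\<lambda>u\<in>carrier (free_module R m). lincomb ?F m u ?w"
 have lm: "left_module R ?F" "left_module R (free_module R m)" by (rule left_module_free[OF assms(1)])+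
 interpret F: left_module R ?F by (rule lm(1))
 have w: "?w i \<in> carrier ?F" if "i < m" for i using assms(2) that by simp
 have "?f ` carrier (free_module R m) = {v \<in> carrier ?F. row_span R m n G v}"
 proof (intro equalityI subsetI)
  fix v assume "v \<in> ?f ` carrier (free_module R m)"
  then obtain u where u: "vec R m u" "v = lincomb ?F m u ?w" by auto
  have "row_span R m n G v" by (rule row_spanI[OF u(1)]) (simp add: u(2) lincomb_free cong: msum_cong)
  moreover have "v \<in> carrier ?F" unfolding u(2) by (rule F.lincomb_closed) (use u w in simp_all)
  ultimately show "v \<in> {v \<in> carrier ?F. row_span R m n G v}" by simp
 next
  fix v assume "v \<in> {v \<in> carrier ?F. row_span R m n G v}"
  then have v: "v \<in> carrier ?F" "row_span R m n G v" by simp_all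
  obtain u where u: "vec R m u" "\<forall>j<n. v j = dot R m u (%i. G i j)" by (rule row_spanE[OF v(2)])
  have c: "lincomb ?F m u ?w \<in> carrier ?F" by (rule F.lincomb_closed) (use u w in simp_all)
  have "v = lincomb ?F m u ?w"
   by (rule PiE_ext[of _ "{..<n}" "%_. carrier R"]) (use v c u in \<open>simp_all add: lincomb_free\<close>)
  then have "v = ?f (restrict u {..<m})" using u(1) by simp
  then show "v \<in> ?f ` carrier (free_module R m)" by (rule image_eqI[of _ ?f]) (use u in simp)
 qed
 moreover have "submodule (?f ` carrier (free_module R m)) R ?F"
  by (rule image_submodule[OF free_hom[OF lm(1)] lm(2,1)]) (rule w)
 ultimately show ?thesis by (simp only:)
qed

definition coker_rows :: "'r ring => nat => nat => (nat => nat => 'r) => 'r small_module" where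
 "coker_rows R m n G = coker R n {v \<in> carrier (free_module R n). row_span R m n G v}"

lemma row_span_restrict [simp]: "row_span R m n G (restrict v {..<n}) \<longleftrightarrow> row_span R m n G v"
 by (simp add: row_span_def)

text \<open>The converse of \<open>ex_mat_resolution\<close>: between them, statements about
  finitely generated modules and statements about sequences with exact rows can be
  exchanged.\<close>

lemma mat_resolution_coker:
 assumes "ring R" "mat_seq R n F" "rows_exact (regular (opposite R)) n F"
 shows "mat_resolution R (coker_rows R (n (Suc 0)) (n 0) (F 0)) n
  (%i. coset R (n 0) {v \<in> carrier (free_module R (n 0)). row_span R (n (Suc 0)) (n 0) (F 0) v} (unit_vec R i)) F"
proof -
 have F0: "mat R (n (Suc 0)) (n 0) (F 0)" using mat_seqD(1)[OF assms(2)] by simp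
 note sub = row_span_submodule[OF assms(1) F0]
 show ?thesis
  unfolding mat_resolution_def coker_rows_def
 proof (intro conjI assms(2,3) coker_spans[OF assms(1) sub] allI impI)
  fix v assume v: "vec R (n 0) v"
  let ?H = "{v \<in> carrier (free_module R (n 0)). row_span R (n (Suc 0)) (n 0) (F 0) v}"
  have "lincomb (coker R (n 0) ?H) (n 0) v (%i. coset R (n 0) ?H (unit_vec R i)) = coset R (n 0) ?H v"
   by (rule coset_unit_lincomb[OF assms(1) sub]) (use v in simp)
  moreover have "coset R (n 0) ?H v = \<zero>\<^bsub>coker R (n 0) ?H\<^esub> \<longleftrightarrow> restrict v {..<n 0} \<in> ?H"
   by (rule coset_eq_zero_iff[OF assms(1) sub]) (use v in simp)
  moreover have "restrict v {..<n 0} \<in> ?H \<longleftrightarrow> row_span R (n (Suc 0)) (n 0) (F 0) v"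
   using v by simp
  ultimately show "lincomb (coker R (n 0) ?H) (n 0) v (%i. coset R (n 0) ?H (unit_vec R i)) = \<zero>\<^bsub>coker R (n 0) ?H\<^esub> \<longleftrightarrow>
   (\<exists>u. vec R (n (Suc 0)) u \<and> (\<forall>j<n 0. v j = dot R (n (Suc 0)) u (%i. F 0 i j)))"
   by (simp only: row_span_def)
 qed
qed

lemma coker_rows_left_module:
 "ring R ==> mat R m n G ==> left_module R (coker_rows R m n G)"
 unfolding coker_rows_def by (rule coker_left_module[OF _ row_span_submodule])

lemma eval_map_apply: "x \<in> carrier N ==> f \<in> mod_hom R N (regular R) ==> eval_map R N x f = f x"
 by (simp add: eval_map_def)

context matrix_resolution
begin

lemma hom_relation:
 assumes "f \<in> mod_hom R N (regular R)" "j < n (Suc 0)"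
 shows "dot R (n 0) (F 0 j) (%k. f (g k)) = \<zero>\<^sub>R"
proof -
 interpret S: left_module R "regular R" by (rule left_module_regular[OF R.ring_axioms])
 have "lincomb N (n 0) (F 0 j) g = \<zero>"
  using R.row_span_unit[of "n (Suc 0)" "n 0" "F 0" j] assms(2) relation_iff[of "F 0 j"]
  by (simp add: row_span_def)
 then have "f (lincomb N (n 0) (F 0 j) g) = \<zero>\<^sub>R"
  using mod_hom_zero[OF assms(1) left_module_axioms S.left_module_axioms] by simp
 then show ?thesis
  using mod_hom_lincomb[OF assms(1) left_module_axioms S.left_module_axioms, of "n 0" "F 0 j" g] assms(2)
  by (simp add: lincomb_regular)
qed

lemma hom_lincomb:
 assumes "f \<in> mod_hom R N (regular R)" "vec R (n 0) v"
 shows "f (lincomb N (n 0) v g) = dot R (n 0) v (%k. f (g k))"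
proof -
 interpret S: left_module R "regular R" by (rule left_module_regular[OF R.ring_axioms])
 show ?thesis
  using mod_hom_lincomb[OF assms(1) left_module_axioms S.left_module_axioms, of "n 0" v g] assms(2)
  by (simp add: lincomb_regular)
qed

lemma carrierE:
 assumes "x \<in> carrier N"
 obtains v where "vec R (n 0) v" "x = lincomb N (n 0) v g"
 by (rule spansE[OF gens assms])

text \<open>\<open>N\<close> is presented by the generators \<open>g\<close> with the rows of
  \<open>F 0\<close> as relations, so values on generators may be prescribed by any column over
  \<open>W\<close> that \<open>F 0\<close> kills.\<close>

lemma ex_hom:
 assumes "left_module R W" "vec W (n 0) w" "\<forall>j<n (Suc 0). lincomb W (n 0) (F 0 j) w = \<zero>\<^sub>W"
 obtains f where "f \<in> mod_hom R N W" "\<forall>v. vec R (n 0) v \<longrightarrow> f (lincomb N (n 0) v g) = lincomb W (n 0) v w"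
proof -
 interpret W: left_module R W by fact
 let ?X = "free_module R (n 0)"
 have lmX: "left_module R ?X" by (rule left_module_free[OF R.ring_axioms])
 let ?p = "\<lambda>v\<in>carrier ?X. lincomb N (n 0) v g" and ?h = "\<lambda>v\<in>carrier ?X. lincomb W (n 0) v w"
 have zero: "?h v = \<zero>\<^sub>W" if v: "v \<in> carrier ?X" "?p v = \<zero>" for v
 proof -
  have vc: "vec R (n 0) v" using v(1) by auto
  have "lincomb N (n 0) v g = \<zero>" using v by simp
  then obtain u where u: "vec R (n (Suc 0)) u" "\<forall>j<n 0. v j = dot R (n (Suc 0)) u (%i. F 0 i j)"
   unfolding relation_iff[OF vc] by (elim exE conjE)
  have "lincomb W (n 0) v w = lincomb W (n (Suc 0)) u (%i. lincomb W (n 0) (F 0 i) w)"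
   using W.lincomb_assoc[of "n (Suc 0)" u "n 0" "F 0" w] u assms(2) by (simp cong: lincomb_cong)
  also have "\<dots> = lincomb W (n (Suc 0)) u (%i. \<zero>\<^sub>W)"
   using assms(3) by (intro lincomb_cong) auto
  finally show ?thesis using u(1) v(1) by simp
 qed
 have p: "?p \<in> mod_hom R ?X N" by (rule free_hom[OF left_module_axioms]) simp
 have h: "?h \<in> mod_hom R ?X W" by (rule free_hom[OF assms(1)]) (use assms(2) in simp)
 obtain f where f: "f \<in> mod_hom R (N\<lparr>carrier := ?p ` carrier ?X\<rparr>) W" "\<forall>v\<in>carrier ?X. f (?p v) = ?h v"
  by (rule mod_hom_factor[OF lmX left_module_axioms assms(1) p h zero])
 have eq: "f (lincomb N (n 0) v g) = lincomb W (n 0) v w" if "vec R (n 0) v" for v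
  using bspec[OF f(2), of "restrict v {..<n 0}"] that by simp
 have "carrier N \<subseteq> ?p ` carrier ?X"
 proof
  fix x assume "x \<in> carrier N"
  then obtain v where v: "vec R (n 0) v" "x = lincomb N (n 0) v g" by (rule carrierE)
  show "x \<in> ?p ` carrier ?X" by (rule image_eqI[of _ _ "restrict v {..<n 0}"]) (use v in simp_all)
 qed
 then have im: "?p ` carrier ?X = carrier N" using mod_homD(1)[OF p] by blast
 have "f \<in> mod_hom R N W" using f(1) unfolding im by simp
 then show ?thesis using eq by (intro that[of f]) simp_all
qed

end

text \<open>A row that pairs to zero with all columns killed by \<open>F 0\<close> represents an
  element of the cokernel on which every functional vanishes. Injectivity of \<open>eval_map\<close>
  makes this element zero, i.e. the row a combination of rows of \<open>F 0\<close>.\<close>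

lemma weakly_Gorenstein_imp_mat:
 assumes "ring R" "weakly_Gorenstein R"
 shows "weakly_Gorenstein_mat R"
 unfolding weakly_Gorenstein_mat_def torsionless_mat_def
proof (intro allI impI, elim conjE)
 fix n F v
 assume acyc: "acyclic_seq R n F" and v: "vec R (n 0) v"
  and zero: "\<forall>w. vec R (n 0) w \<and> (\<forall>j<n (Suc 0). dot R (n 0) (F 0 j) w = \<zero>\<^sub>R)
   \<longrightarrow> dot R (n 0) v w = \<zero>\<^sub>R"
 interpret R: ring R by fact
 have seq: "mat_seq R n F" and cols: "cols_exact (regular R) n F"
  and rows: "rows_exact (regular (opposite R)) n F" using acyc by (simp_all add: acyclic_seq_def)
 have F0: "mat R (n (Suc 0)) (n 0) (F 0)" using mat_seqD(1)[OF seq] by simp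
 define N where "N = coker_rows R (n (Suc 0)) (n 0) (F 0)"
 define g where "g i = coset R (n 0) {v \<in> carrier (free_module R (n 0)).
   row_span R (n (Suc 0)) (n 0) (F 0) v} (unit_vec R i)" for i
 interpret N: matrix_resolution R N n g F
  unfolding N_def g_def
  by (intro matrix_resolution.intro matrix_resolution_axioms.intro
    coker_rows_left_module[OF assms(1) F0] mat_resolution_coker[OF assms(1) seq rows])
 have "Gorenstein_projective R N"
  using assms(2) cols N.semi_Gorenstein_projective_iff unfolding weakly_Gorenstein_def by simp
 then have inj: "inj_on (eval_map R N) (carrier N)"
  by (simp add: Gorenstein_projective_def reflexive_def bij_betw_def)
 let ?x = "lincomb N (n 0) v g"
 have x: "?x \<in> carrier N" using v by simp
 interpret S: left_module R "regular R" by (rule left_module_regular[OF assms(1)])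
 have "f ?x = f \<zero>\<^sub>N" if f: "f \<in> mod_hom R N (regular R)" for f
 proof -
  have "vec R (n 0) (%k. f (g k))" using mod_homD(1)[OF f] by simp
  then have "dot R (n 0) v (%k. f (g k)) = \<zero>\<^sub>R"
   using zero N.hom_relation[OF f] by simp
  then show ?thesis
   using N.hom_lincomb[OF f v] mod_hom_zero[OF f N.left_module_axioms S.left_module_axioms] by simp
 qed
 then have "eval_map R N ?x = eval_map R N \<zero>\<^sub>N"
  using x unfolding eval_map_def by (simp add: restrict_def fun_eq_iff)
 then have "?x = \<zero>\<^sub>N" using inj_onD[OF inj] x by simp
 then show "row_span R (n (Suc 0)) (n 0) (F 0) v"
  unfolding N.relation_iff[OF v] row_span_def .
qed

lemma a_inv_regular [simp]: "\<ominus>\<^bsub>regular R\<^esub> x = \<ominus>\<^sub>R x"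
 by (simp add: a_inv_def m_inv_def)

lemma a_inv_opposite [simp]: "\<ominus>\<^bsub>opposite R\<^esub> x = \<ominus>\<^sub>R x"
 by (simp add: a_inv_def m_inv_def)

text \<open>With places numbered by natural numbers, an infinite extension to the left is a family
  of sequences, each of which is its predecessor with one more term in front.\<close>

lemma acyclic_seq_extend_infinitely:
 fixes R :: "'r ring"
 assumes "left_noetherian (opposite R)" "weakly_Gorenstein_mat R" "acyclic_seq R n F"
 obtains N :: "nat => nat => nat" and G :: "nat => nat => nat => nat => 'r"
 where "N 0 = n" "G 0 = F" "\<forall>t. acyclic_seq R (N t) (G t)"
  "\<forall>t i. N (Suc t) (Suc i) = N t i" "\<forall>t i. G (Suc t) (Suc i) = G t i"
proof -
 define P where "P t s \<longleftrightarrow> acyclic_seq R (fst s) (snd s) \<and> (t = 0 \<longrightarrow> s = (n, F))"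
  for t :: nat and s :: "(nat => nat) \<times> (nat => nat => nat => 'r)"
 define Q where "Q t s s' \<longleftrightarrow> (\<forall>i. fst s' (Suc i) = fst s i) \<and> (\<forall>i. snd s' (Suc i) = snd s i)"
  for t :: nat and s s' :: "(nat => nat) \<times> (nat => nat => nat => 'r)"
 have "\<exists>s. \<forall>t. P t (s t) \<and> Q t (s t) (s (Suc t))"
 proof (rule dependent_nat_choice)
  show "\<exists>s. P 0 s" using assms(3) by (intro exI[of _ "(n, F)"]) (simp add: P_def)
 next
  fix s t assume "P t s"
  then have ac: "acyclic_seq R (fst s) (snd s)" by (simp add: P_def)
  then have "torsionless_mat R (fst s 0) (fst s (Suc 0)) (snd s 0)"
   using assms(2) by (simp add: weakly_Gorenstein_mat_def)
  then obtain m G where "acyclic_seq R (case_nat m (fst s)) (case_nat G (snd s))"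
   by (rule acyclic_seq_prepend[OF assms(1) ac])
  then show "\<exists>s'. P (Suc t) s' \<and> Q t s s'"
   by (intro exI[of _ "(case_nat m (fst s), case_nat G (snd s))"]) (simp add: P_def Q_def)
 qed
 then obtain s where s: "\<forall>t. P t (s t) \<and> Q t (s t) (s (Suc t))" by (elim exE)
 show ?thesis
 proof (rule that[of "%t. fst (s t)" "%t. snd (s t)"])
  show "fst (s 0) = n" "snd (s 0) = F" using s[rule_format, of 0] by (simp_all add: P_def)
  show "\<forall>t. acyclic_seq R (fst (s t)) (snd (s t))" using s by (simp add: P_def)
  show "\<forall>t i. fst (s (Suc t)) (Suc i) = fst (s t) i" "\<forall>t i. snd (s (Suc t)) (Suc i) = snd (s t) i"
   using s by (simp_all add: Q_def)
 qed
qed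

text \<open>A functional on the module is a column killed by \<open>F 0\<close>, hence a combination
  of columns of the first prepended matrix. So column exactness of the extension resolves the dual,
  and its row exactness says that the dual is semi-Gorenstein-projective. At the two places next to
  the old start, row exactness gives injectivity and surjectivity of the evaluation map.\<close>

lemma mat_imp_weakly_Gorenstein:
 fixes R :: "'r ring"
 assumes "left_noetherian R" "left_noetherian (opposite R)" "weakly_Gorenstein_mat R"
 shows "weakly_Gorenstein R"
 unfolding weakly_Gorenstein_def
proof (intro allI impI)
 fix N :: "'r small_module"
 assume sG: "semi_Gorenstein_projective R N"
 have R: "ring R" by (rule left_noetherian_ring[OF assms(1)])
 interpret R: ring R by (rule R)
 have fg: "fg_module R N" using sG by (simp add: semi_Gorenstein_projective_def left_perp_def)
 obtain n g F where res: "mat_resolution R N n g F" by (rule ex_mat_resolution[OF assms(1) fg])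
 interpret N: matrix_resolution R N n g F
  by (intro matrix_resolution.intro matrix_resolution_axioms.intro left_module_if_fg[OF fg] res)
 have acyc: "acyclic_seq R n F"
  using N.seq N.rows N.semi_Gorenstein_projective_iff sG by (simp add: acyclic_seq_def)
 obtain n' G where n'0: "n' 0 = n" "G 0 = F" and ac: "\<forall>t. acyclic_seq R (n' t) (G t)"
  and sh: "\<forall>t i. n' (Suc t) (Suc i) = n' t i" "\<forall>t i. G (Suc t) (Suc i) = G t i"
  by (rule acyclic_seq_extend_infinitely[OF assms(2,3) acyc])
 have seq: "mat_seq R (n' t) (G t)" and cols: "cols_exact (regular R) (n' t) (G t)"
  and rows: "rows_exact (regular (opposite R)) (n' t) (G t)" for t
  using ac by (simp_all add: acyclic_seq_def)
 note sh' = sh[rule_format]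
 \<comment> \<open>The ranks and matrices of the resolution of the dual sit at place 0 of the
   successive members of the family. Transposition turns them into matrices over the opposite
   ring.\<close>
 define m where "m i = n' (Suc i) 0" for i
 define D where "D i = tr (G (Suc (Suc i)) 0)" for i
 define G0 where "G0 = G (Suc 0) 0"
 have G0c: "G0 k j \<in> carrier R" if "k < n 0" "j < m 0" for k j
  using mat_seqD(1)[OF seq[of "Suc 0"], of k 0 j] that sh'(1)[of 0] n'0 by (simp add: G0_def m_def)
 have Dc: "D i j k \<in> carrier R" if "j < m (Suc i)" "k < m i" for i j k
  using mat_seqD(1)[OF seq[of "Suc (Suc i)"], of k 0 j] that sh'(1) by (simp add: D_def m_def)
 have FG0: "dot R (n 0) (F 0 k) (%l. G0 l j) = \<zero>\<^sub>R" if "k < n (Suc 0)" "j < m 0" for k j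
  using mat_seqD(2)[OF seq[of "Suc 0"], of k 0 j] that sh' n'0 by (simp add: G0_def m_def)
 have G0D: "dot R (m 0) (G0 k) (D 0 j) = \<zero>\<^sub>R" if "k < n 0" "j < m (Suc 0)" for k j
  using mat_seqD(2)[OF seq[of "Suc (Suc 0)"], of k 0 j] that sh' n'0 by (simp add: G0_def m_def D_def)
 \<comment> \<open>Place \<open>Suc 0\<close> of the first two extended members carries the ranks
   \<open>n 0\<close> and \<open>m 0\<close>; generators and relations of the dual as well as
   reflexivity come from exactness there.\<close>
 have row: "row_span R (n' t (Suc (Suc 0))) (n' t (Suc 0)) (G t (Suc 0)) v"
  if "vec R (n' t (Suc 0)) v" "\<forall>j<n' t 0. dot R (n' t (Suc 0)) v (%k. G t 0 k j) = \<zero>\<^sub>R" for t v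
  by (rule rows_exact_regularD[OF rows, of t 0 v]) (use that in \<open>simp_all add: row_spanI\<close>)
 have col: "\<exists>u. vec R (n' t 0) u \<and> (\<forall>k<n' t (Suc 0). w k = dot R (n' t 0) (G t 0 k) u)"
  if "vec R (n' t (Suc 0)) w" "\<forall>j<n' t (Suc (Suc 0)). dot R (n' t (Suc 0)) (G t (Suc 0) j) w = \<zero>\<^sub>R" for t w
  by (rule cols_exact_regularD[OF cols, of t 0 w]) (use that in \<open>auto intro: exI\<close>)
 note row0 = row[of "Suc 0"] and row1 = row[of "Suc (Suc 0)"] and col0 = col[of "Suc 0"] and col1 = col[of "Suc (Suc 0)"]
 note rowF = row0[unfolded sh' n'0, folded G0_def m_def] and colG0 = col0[unfolded sh' n'0, folded G0_def m_def]
 have nm: "n' (Suc 0) 0 = m 0" "n' (Suc (Suc 0)) 0 = m (Suc 0)" "n' (Suc (Suc 0)) (Suc 0) = m 0"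
  and D0: "G (Suc (Suc 0)) 0 k j = D 0 j k" for k j by (simp_all add: m_def sh' D_def)
 note rowG0 = row1[unfolded sh' n'0 nm D0, folded G0_def] and colD = col1[unfolded sh' n'0 nm D0, folded G0_def]
 let ?N' = "ring_dual R N"
 interpret N': left_module "opposite R" ?N' by (rule left_module_dual[OF N.left_module_axioms])
 interpret S: left_module R "regular R" by (rule left_module_regular[OF R])
 \<comment> \<open>\<open>Pf j\<close> describes the functional given by the \<open>j\<close>-th
   column of \<open>G0\<close>; these functionals generate the dual.\<close>
 define Pf where "Pf j f \<longleftrightarrow> f \<in> mod_hom R N (regular R) \<and>
   (\<forall>v. vec R (n 0) v \<longrightarrow> f (lincomb N (n 0) v g) = dot R (n 0) v (%k. G0 k j))" for j f
 have ex_Pf: "\<exists>f. Pf j f" if j: "j < m 0" for j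
 proof -
  have w: "vec (regular R) (n 0) (%k. G0 k j)" using G0c j by simp
  have z: "\<forall>i<n (Suc 0). lincomb (regular R) (n 0) (F 0 i) (%k. G0 k j) = \<zero>\<^bsub>regular R\<^esub>"
   using FG0 j by (simp add: lincomb_regular)
  obtain f where "f \<in> mod_hom R N (regular R)"
   "\<forall>v. vec R (n 0) v \<longrightarrow> f (lincomb N (n 0) v g) = lincomb (regular R) (n 0) v (%k. G0 k j)"
   by (rule N.ex_hom[OF S.left_module_axioms w z])
  then show ?thesis by (intro exI[of _ f]) (simp add: lincomb_regular Pf_def)
 qed
 obtain f where fj: "\<forall>j<m 0. Pf j (f j)" using ex_Pf by metis
 have f: "f j \<in> mod_hom R N (regular R)"
  and fv: "vec R (n 0) v ==> f j (lincomb N (n 0) v g) = dot R (n 0) v (%k. G0 k j)"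
  if "j < m 0" for j v using fj that by (simp_all add: Pf_def)
 have fg': "f j (g k) = G0 k j" if "j < m 0" "k < n 0" for j k
 proof -
  have "g k = lincomb N (n 0) (unit_vec R k) g" using that by (simp add: N.lincomb_unit_vec)
  then have "f j (g k) = dot R (n 0) (unit_vec R k) (%l. G0 l j)"
   using fv[OF that(1), of "unit_vec R k"] by simp
  also have "\<dots> = G0 k j"
   using S.lincomb_unit_vec[of k "n 0" "%l. G0 l j"] that G0c by (simp add: lincomb_regular)
  finally show ?thesis .
 qed
 have dual_comb_g: "lincomb ?N' (m 0) u f (g k) = dot R (m 0) (G0 k) u"
  if "vec R (m 0) u" "k < n 0" for u k
  using that fg' by (simp add: lincomb_dual cong: msum_cong)
 have dual_hom: "lincomb ?N' (m 0) u f \<in> mod_hom R N (regular R)" if "vec R (m 0) u" for u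
  using N'.lincomb_closed[of "m 0" u f] that f by simp
 have hom_eqI: "h = h'" if h: "h \<in> mod_hom R N (regular R)" "h' \<in> mod_hom R N (regular R)"
  "\<And>k. k < n 0 ==> h (g k) = h' (g k)" for h h'
 proof (rule mod_hom_eqI[OF h(1,2)])
  fix x assume "x \<in> carrier N"
  then obtain v where v: "vec R (n 0) v" "x = lincomb N (n 0) v g" by (rule N.carrierE)
  show "h x = h' x" unfolding v(2) N.hom_lincomb[OF h(1) v(1)] N.hom_lincomb[OF h(2) v(1)]
   by (rule msum_cong) (simp add: h(3))
 qed
 have spans': "spans (opposite R) ?N' (carrier ?N') (m 0) f"
  unfolding spans_def
 proof (intro conjI ballI)
  fix h assume "h \<in> carrier ?N'"
  then have h: "h \<in> mod_hom R N (regular R)" by simp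
  then have hc: "vec R (n 0) (%k. h (g k))" using mod_homD(1)[OF h] by simp
  obtain u where u: "vec R (m 0) u \<and> (\<forall>k<n 0. h (g k) = dot R (m 0) (G0 k) u)"
   using colG0[OF hc] N.hom_relation[OF h] by blast
  have "h = lincomb ?N' (m 0) u f"
   using u by (intro hom_eqI[OF h] dual_hom) (simp_all add: dual_comb_g)
  then show "\<exists>c. (\<forall>j<m 0. c j \<in> carrier (opposite R)) \<and> h = lincomb ?N' (m 0) c f"
   using u by (intro exI[of _ u]) simp
 qed (use f in simp)
 have dual_zero: "lincomb ?N' (m 0) u f = \<zero>\<^bsub>?N'\<^esub> \<longleftrightarrow> (\<forall>k<n 0. dot R (m 0) (G0 k) u = \<zero>\<^sub>R)"
  if u: "vec R (m 0) u" for u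
 proof
  assume z: "lincomb ?N' (m 0) u f = \<zero>\<^bsub>?N'\<^esub>"
  show "\<forall>k<n 0. dot R (m 0) (G0 k) u = \<zero>\<^sub>R"
   using dual_comb_g[OF u] unfolding z by simp
 next
  assume z: "\<forall>k<n 0. dot R (m 0) (G0 k) u = \<zero>\<^sub>R"
  have "\<zero>\<^bsub>?N'\<^esub> \<in> mod_hom R N (regular R)" using N'.M.zero_closed unfolding ring_dual_simps(1) .
  then show "lincomb ?N' (m 0) u f = \<zero>\<^bsub>?N'\<^esub>"
   using z dual_comb_g[OF u] by (intro hom_eqI dual_hom u) simp_all
 qed
 have res': "mat_resolution (opposite R) ?N' m f D"
  unfolding mat_resolution_def
 proof (intro conjI spans' allI impI)
  show "mat_seq (opposite R) m D"
   unfolding mat_seq_def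
  proof (intro conjI allI impI)
   fix i j k assume "j < m (Suc i)" "k < m i"
   then show "D i j k \<in> carrier (opposite R)" using Dc by simp
  next
   fix i k j assume "k < m (Suc (Suc i))" "j < m i"
   then show "dot (opposite R) (m (Suc i)) (D (Suc i) k) (%l. D i l j) = \<zero>\<^bsub>opposite R\<^esub>"
    using mat_seqD(2)[OF seq[of "Suc (Suc (Suc i))"], of j 0 k] sh' by (simp add: D_def m_def)
  qed
  have "exact_col (regular R) (m (Suc (Suc i))) (m (Suc i)) (m i) (tr (D (Suc i))) (tr (D i))" for i
   using cols[of "Suc (Suc (Suc i))", unfolded cols_exact_def, rule_format, of 0] sh'
   by (simp add: D_def m_def tr_def)
  then show "rows_exact (regular (opposite (opposite R))) m D"
   unfolding rows_exact_def by simp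
  fix u assume "vec (opposite R) (m 0) u"
  then have u: "vec R (m 0) u" by simp
  show "lincomb ?N' (m 0) u f = \<zero>\<^bsub>?N'\<^esub> \<longleftrightarrow> (\<exists>c. vec (opposite R) (m (Suc 0)) c \<and>
    (\<forall>j<m 0. u j = dot (opposite R) (m (Suc 0)) c (%i. D 0 i j)))"
  proof
   assume "lincomb ?N' (m 0) u f = \<zero>\<^bsub>?N'\<^esub>"
   then have "\<forall>k<n 0. dot R (m 0) (G0 k) u = \<zero>\<^sub>R" using dual_zero[OF u] by simp
   then show "\<exists>c. vec (opposite R) (m (Suc 0)) c \<and>
    (\<forall>j<m 0. u j = dot (opposite R) (m (Suc 0)) c (%i. D 0 i j))"
    using colD[OF u] by simp
  next
   assume "\<exists>c. vec (opposite R) (m (Suc 0)) c \<and>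
    (\<forall>j<m 0. u j = dot (opposite R) (m (Suc 0)) c (%i. D 0 i j))"
   then obtain c where c: "vec R (m (Suc 0)) c" "\<forall>j<m 0. u j = dot R (m (Suc 0)) (%i. D 0 i j) c"
    by (elim exE conjE) simp
   have "dot R (m 0) (G0 k) u = \<zero>\<^sub>R" if k: "k < n 0" for k
   proof -
    have "dot R (m 0) (G0 k) u = dot R (m 0) (G0 k) (%j. dot R (m (Suc 0)) (%i. D 0 i j) c)"
     using c(2) by (intro msum_cong) simp
    also have "\<dots> = dot R (m (Suc 0)) (%i. dot R (m 0) (G0 k) (D 0 i)) c"
     using R.msum_row_col[of "m 0" "G0 k" "m (Suc 0)" "%j i. D 0 i j" c] k G0c Dc c(1) by simp
    also have "\<dots> = msum R (m (Suc 0)) (%i. \<zero>\<^sub>R)"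
     using G0D k c(1) by (intro msum_cong) simp
    finally show ?thesis by simp
   qed
   then show "lincomb ?N' (m 0) u f = \<zero>\<^bsub>?N'\<^esub>" using dual_zero[OF u] by simp
  qed
 qed
 interpret N': matrix_resolution "opposite R" ?N' m f D
  by (intro matrix_resolution.intro matrix_resolution_axioms.intro N'.left_module_axioms res')
 have "exact_col (regular (opposite R)) (m i) (m (Suc i)) (m (Suc (Suc i))) (D i) (D (Suc i))" for i
  using rows[of "Suc (Suc (Suc i))", unfolded rows_exact_def, rule_format, of 0] sh'
  by (simp add: D_def m_def)
 then have dual_sG: "semi_Gorenstein_projective (opposite R) ?N'"
  unfolding N'.semi_Gorenstein_projective_iff cols_exact_def by simp
 have "bij_betw (eval_map R N) (carrier N) (carrier (ring_dual (opposite R) ?N'))"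
  unfolding bij_betw_def
 proof
  show "inj_on (eval_map R N) (carrier N)"
  proof (rule inj_onI)
   fix x y assume x: "x \<in> carrier N" and y: "y \<in> carrier N" and eq: "eval_map R N x = eval_map R N y"
   have fe: "f j x = f j y" if "j < m 0" for j
    using fun_cong[OF eq, of "f j"] eval_map_apply[OF x f[OF that]] eval_map_apply[OF y f[OF that]] by simp
   have d: "x \<ominus>\<^sub>N y \<in> carrier N" using x y by simp
   obtain v where v: "vec R (n 0) v" "x \<ominus>\<^sub>N y = lincomb N (n 0) v g" by (rule N.carrierE[OF d])
   have "dot R (n 0) v (%k. G0 k j) = \<zero>\<^sub>R" if j: "j < m 0" for j
   proof -
    have "dot R (n 0) v (%k. G0 k j) = f j (x \<ominus>\<^sub>N y)" using fv[OF j v(1)] v(2) by simp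
    also have "\<dots> = f j x \<ominus>\<^sub>R f j y"
     using mod_homD(2)[OF f[OF j] x, of "\<ominus>\<^sub>N y"] y
      mod_hom_minus[OF f[OF j] N.left_module_axioms S.left_module_axioms y]
     by (simp add: a_minus_def)
    finally show ?thesis using fe[OF j] mod_homD(1)[OF f[OF j] y] by (simp add: R.minus_eq_zero_iff)
   qed
   then have "row_span R (n (Suc 0)) (n 0) (F 0) v" using rowF[OF v(1)] by simp
   then have "x \<ominus>\<^sub>N y = \<zero>\<^sub>N" using N.relation_iff[OF v(1)] unfolding v(2) row_span_def by simp
   then show "x = y" using x y N.M.minus_eq_zero_iff by simp
  qed
  show "eval_map R N ` carrier N = carrier (ring_dual (opposite R) ?N')"
  proof
   show "eval_map R N ` carrier N \<subseteq> carrier (ring_dual (opposite R) ?N')"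
   proof (rule image_subsetI)
    fix x assume x: "x \<in> carrier N"
    have "restrict (%h. h x) (carrier ?N') \<in> mod_hom (opposite R) ?N' (regular (opposite R))"
     by (rule mod_hom_restrictI[OF N'.left_module_axioms])
      (use x mod_homD(1)[of _ R N "regular R"] in simp_all)
    then show "eval_map R N x \<in> carrier (ring_dual (opposite R) ?N')"
     using x by (simp add: eval_map_def)
   qed
   show "carrier (ring_dual (opposite R) ?N') \<subseteq> eval_map R N ` carrier N"
   proof
    fix h assume "h \<in> carrier (ring_dual (opposite R) ?N')"
    then have h: "h \<in> mod_hom (opposite R) ?N' (regular (opposite R))" by simp
    have hc: "vec R (m 0) (%j. h (f j))" using mod_homD(1)[OF h] f by simp
    have "\<forall>j<m (Suc 0). dot R (m 0) (%k. h (f k)) (D 0 j) = \<zero>\<^sub>R"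
     using N'.hom_relation[OF h] by simp
    \<comment> \<open>The values of \<open>h\<close> on the generators of the dual form a row killed
      by the next matrix, so they come from a row \<open>v\<close> over the original generators;
      evaluation at the element given by \<open>v\<close> is \<open>h\<close>.\<close>
    then have "row_span R (n 0) (m 0) G0 (%j. h (f j))" by (rule rowG0[OF hc])
    then obtain v where v: "vec R (n 0) v" "\<forall>j<m 0. h (f j) = dot R (n 0) v (%k. G0 k j)"
     by (rule row_spanE)
    have x: "lincomb N (n 0) v g \<in> carrier N" using v by simp
    have "h = eval_map R N (lincomb N (n 0) v g)"
    proof
     fix a show "h a = eval_map R N (lincomb N (n 0) v g) a"
     proof (cases "a \<in> carrier ?N'")
      case True
      then obtain u where u: "vec (opposite R) (m 0) u" "a = lincomb ?N' (m 0) u f" by (rule N'.carrierE)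
      then have u': "vec R (m 0) u" by simp
      have "h a = dot R (m 0) (%j. h (f j)) u"
       unfolding u(2) using N'.hom_lincomb[OF h u(1)] by simp
      also have "\<dots> = dot R (m 0) (%j. f j (lincomb N (n 0) v g)) u"
       using v(2) fv v(1) by (intro msum_cong) simp
      also have "\<dots> = a (lincomb N (n 0) v g)" unfolding u(2) using x by (simp add: lincomb_dual)
      finally show ?thesis using eval_map_apply[OF x, of a] True by simp
     next
      case False
      then show ?thesis using mod_homD(4)[OF h, of a] x by (simp add: eval_map_def)
     qed
    qed
    then show "h \<in> eval_map R N ` carrier N" using x by simp
   qed
  qed
 qed
 then show "Gorenstein_projective R N"
  unfolding Gorenstein_projective_def reflexive_def using sG dual_sG by simp
qed

theorem weakly_Gorenstein_iff_mat:
 assumes "left_noetherian R" "left_noetherian (opposite R)"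
 shows "weakly_Gorenstein R \<longleftrightarrow> weakly_Gorenstein_mat R"
 using weakly_Gorenstein_imp_mat[OF left_noetherian_ring[OF assms(1)]]
  mat_imp_weakly_Gorenstein[OF assms] by (intro iffI)

section \<open>Artin algebras are noetherian\<close>

lemma artinian_minimal_ideal:
 assumes "artinian_cring K" "S \<noteq> {}" "\<And>I. I \<in> S ==> ideal I K"
 obtains I where "I \<in> S" "\<forall>J\<in>S. J \<subseteq> I \<longrightarrow> J = I"
proof -
 have "\<exists>I\<in>S. \<forall>J\<in>S. J \<subseteq> I \<longrightarrow> J = I"
 proof (rule ccontr)
  assume no: "\<not> (\<exists>I\<in>S. \<forall>J\<in>S. J \<subseteq> I \<longrightarrow> J = I)"
  have "\<exists>f. \<forall>n. f n \<in> S \<and> f (Suc n) \<subset> f n"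
  proof (rule dependent_nat_choice)
   show "\<exists>I. I \<in> S" using assms(2) by blast
   show "\<exists>J. J \<in> S \<and> J \<subset> I" if "I \<in> S" for I using no that by blast
  qed
  then obtain f where f: "\<forall>n. f n \<in> S \<and> f (Suc n) \<subset> f n" by (elim exE)
  then have "\<forall>n. ideal (f n) K \<and> f (Suc n) \<subseteq> f n" using assms(3) by blast
  then have "\<exists>n. \<forall>m\<ge>n. f m = f n" using assms(1) unfolding artinian_cring_def by blast
  then obtain n where "\<forall>m\<ge>n. f m = f n" ..
  then have "f (Suc n) = f n" by (elim allE[of _ "Suc n"] impE) simp_all
  then show False using f by blast
 qed
 then show ?thesis by (elim bexE) (rule that)
qed

context cring
begin

text \<open>Zorn's lemma. For \<open>u\<close> equal to one it yields maximal ideals; for a nonzero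
  element of a given ideal it yields the large ideals in the proof that ideals are finitely
  generated.\<close>

lemma ex_ideal_maximal_avoiding:
 assumes "ideal I R" "u \<notin> I"
 obtains W where "ideal W R" "I \<subseteq> W" "u \<notin> W" "\<forall>V. ideal V R \<and> W \<subseteq> V \<and> u \<notin> V \<longrightarrow> V = W"
proof -
 let ?A = "{W. ideal W R \<and> I \<subseteq> W \<and> u \<notin> W}"
 have "\<exists>M\<in>?A. \<forall>X\<in>?A. M \<subseteq> X \<longrightarrow> X = M"
 proof (rule subset_Zorn_nonempty)
  show "?A \<noteq> {}" using assms by blast
  fix C assume C: "C \<noteq> {}" "subset.chain ?A C"
  then have "subset.chain {I. ideal I R} C" by (auto simp: pred_on.chain_def)
  then have "ideal (\<Union>C) R" using chain_Union_is_ideal[of C] C(1) by simp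
  then show "\<Union>C \<in> ?A" using C by (auto simp: pred_on.chain_def)
 qed
 then obtain M where M: "M \<in> ?A" "\<forall>X\<in>?A. M \<subseteq> X \<longrightarrow> X = M" by (elim bexE)
 then show ?thesis by (intro that[of M]) auto
qed

lemma ex_maximalideal:
 assumes "ideal I R" "\<one> \<notin> I"
 obtains W where "maximalideal W R" "I \<subseteq> W"
proof -
 obtain W where W: "ideal W R" "I \<subseteq> W" "\<one> \<notin> W" "\<forall>V. ideal V R \<and> W \<subseteq> V \<and> \<one> \<notin> V \<longrightarrow> V = W"
  by (rule ex_ideal_maximal_avoiding[OF assms])
 have "maximalideal W R"
 proof (rule maximalidealI[OF W(1)])
  show "carrier R \<noteq> W" using W(3) by auto
  fix J assume J: "ideal J R" "W \<subseteq> J" "J \<subseteq> carrier R"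
  show "J = W \<or> J = carrier R"
   using W(4) J ideal.one_imp_carrier[OF J(1)] by blast
 qed
 then show ?thesis using W(2) by (rule that)
qed

lemma add_ideals_supset:
 assumes "ideal I R" "ideal J R"
 shows "I \<subseteq> I <+>\<^sub>R J" "J \<subseteq> I <+>\<^sub>R J"
proof -
 have "I \<union> J \<subseteq> carrier R"
  using assms[THEN ideal.axioms(1), THEN additive_subgroup.a_subset] by simp
 then show "I \<subseteq> I <+>\<^sub>R J" "J \<subseteq> I <+>\<^sub>R J"
  using genideal_self[of "I \<union> J"] unfolding union_genideal[OF assms] by simp_all
qed

end

text \<open>Preimages of generators of the image, followed by generators of the kernel,
  generate.\<close>

lemma spans_extension:
 assumes X: "left_module R X" and Y: "left_module R Y" and f: "f \<in> mod_hom R X Y"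
  and k: "spans R Y (f ` carrier X) r k" and h: "spans R X {x \<in> carrier X. f x = \<zero>\<^sub>Y} m h"
 shows "\<exists>p g. spans R X (carrier X) p g"
proof -
 interpret X: left_module R X by (rule X)
 interpret Y: left_module R Y by (rule Y)
 have "\<forall>i. \<exists>x. i < r \<longrightarrow> x \<in> carrier X \<and> f x = k i"
 proof
  fix i show "\<exists>x. i < r \<longrightarrow> x \<in> carrier X \<and> f x = k i"
   using spansD(1)[OF k, of i] by (cases "i < r") (auto simp: image_iff)
 qed
 then obtain u where "\<forall>i. i < r \<longrightarrow> u i \<in> carrier X \<and> f (u i) = k i" by (rule choice[THEN exE])
 then have u: "u i \<in> carrier X" "f (u i) = k i" if "i < r" for i using that by simp_all
 have hc: "h i \<in> carrier X" "f (h i) = \<zero>\<^sub>Y" if "i < m" for i using spansD(1)[OF h that] by simp_all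
 have "spans R X (carrier X) (r + m) (%i. if i < r then u i else h (i - r))"
  unfolding spans_def
 proof (intro conjI ballI allI impI)
  fix x assume x: "x \<in> carrier X"
  obtain a where a: "\<forall>i<r. a i \<in> carrier R" "f x = lincomb Y r a k" by (rule spansE[OF k imageI[OF x]])
  let ?w = "lincomb X r a u"
  have wc: "?w \<in> carrier X" using a u by simp
  have "f ?w = lincomb Y r a (%i. f (u i))" by (rule mod_hom_lincomb[OF f X Y]) (use a u in simp_all)
  also have "\<dots> = f x" unfolding a(2) by (rule lincomb_cong) (use u in simp_all)
  finally have fx: "f (x \<oplus>\<^sub>X \<ominus>\<^sub>X ?w) = \<zero>\<^sub>Y"
   using mod_homD(2)[OF f x X.M.a_inv_closed[OF wc]] mod_hom_minus[OF f X Y wc] mod_homD(1)[OF f x] by (simp add: Y.M.r_neg)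
  obtain b where b: "\<forall>i<m. b i \<in> carrier R" "x \<oplus>\<^sub>X \<ominus>\<^sub>X ?w = lincomb X m b h"
   by (rule spansE[OF h, of "x \<oplus>\<^sub>X \<ominus>\<^sub>X ?w"]) (use fx x wc in simp)
  let ?c = "%i. if i < r then a i else b (i - r)"
  have "lincomb X (r + m) ?c (%i. if i < r then u i else h (i - r)) = ?w \<oplus>\<^sub>X lincomb X m b h"
   using a(1) b(1) u(1) hc(1) by (subst X.lincomb_split) (simp_all cong: lincomb_cong)
  also have "\<dots> = x" unfolding b(2)[symmetric] using x wc by (simp add: X.M.a_lcomm X.M.r_neg)
  finally show "\<exists>c. vec R (r + m) c \<and> x = lincomb X (r + m) c (%i. if i < r then u i else h (i - r))"
   using a(1) b(1) by (intro exI[of _ ?c]) auto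
 qed (use u hc in auto)
 then show ?thesis by blast
qed

lemma submodule_regular_iff_ideal:
 assumes "cring K"
 shows "submodule I K (regular K) \<longleftrightarrow> ideal I K"
proof
 interpret cring K by fact
 {
  assume H: "submodule I K (regular K)"
  note D = submoduleD[OF H]
  show "ideal I K"
  proof (rule idealI[OF ring_axioms])
   show "subgroup I (add_monoid K)"
    using D(1-3) D(5) by (intro subgroup.intro) (simp_all add: a_inv_def m_inv_def)
   fix a x assume ax: "a \<in> I" "x \<in> carrier K"
   show "x \<otimes>\<^sub>K a \<in> I" using D(4)[OF ax(2,1)] by simp
   then show "a \<otimes>\<^sub>K x \<in> I" using D(1) ax m_comm[of a x] by (simp add: subsetD[of I "carrier K" a])
  qed
 next
  assume "ideal I K"
  then interpret I: ideal I K .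
  show "submodule I K (regular K)"
   by (rule submoduleI[OF left_module_regular[OF ring_axioms]])
    (use I.a_subset I.I_l_closed I.a_closed I.zero_closed in simp_all)
 }
qed

text \<open>Let \<open>I\<close> be minimal among the ideals that are not finitely generated. Multiplication by \<open>x\<close>
 on \<open>I\<close> is surjective or zero, since otherwise its image and its kernel are finitely generated;
 if it is surjective, it is invertible. So every ideal that is maximal with respect to avoiding a
 given \<open>v \<in> I\<close> is, together with \<open>v\<close>, all of \<open>I\<close>.\<close>

lemma artinian_ideal_spans:
 assumes K: "artinian_cring K" and "submodule I K (regular K)"
 shows "\<exists>m g. spans K (regular K) I m g"
proof (rule ccontr)
 interpret cring K using K by (simp add: artinian_cring_def)
 let ?FG = "%I. \<exists>m g. spans K (regular K) I m g"
 note lmK = left_module_regular[OF ring_axioms] and submodule_iff = submodule_regular_iff_ideal[OF cring_axioms]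
 interpret S: left_module K "regular K" by (rule lmK)
 assume "\<not> ?FG I"
 then have "{I. ideal I K \<and> \<not> ?FG I} \<noteq> {}" using assms(2) submodule_iff by blast
 then obtain I where I: "I \<in> {I. ideal I K \<and> \<not> ?FG I}" and min: "\<forall>J\<in>{I. ideal I K \<and> \<not> ?FG I}. J \<subseteq> I \<longrightarrow> J = I"
  by (rule artinian_minimal_ideal[OF K]) simp
 have nfg: "\<not> ?FG I" and "ideal I K" using I by simp_all
 interpret I: ideal I K by fact
 have small: "?FG J" if "ideal J K" "J \<subseteq> I" "J \<noteq> I" for J using min that by blast
 have sub: "submodule I K (regular K)" using submodule_iff I.is_ideal by blast
 let ?X = "(regular K)\<lparr>carrier := I\<rparr>"
 have lmX: "left_module K ?X" by (rule submodule_left_module[OF sub lmK])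
 have dich: "(\<otimes>\<^sub>K) x ` I = I" if x: "x \<in> carrier K" and ne: "\<exists>i\<in>I. x \<otimes>\<^sub>K i \<noteq> \<zero>\<^sub>K" for x
 proof (rule ccontr)
  assume nI: "(\<otimes>\<^sub>K) x ` I \<noteq> I"
  let ?f = "\<lambda>i\<in>carrier ?X. x \<otimes>\<^sub>K i"
  have f: "?f \<in> mod_hom K ?X (regular K)"
   by (rule mod_hom_restrictI[OF lmX]) (use x I.Icarr in \<open>simp_all add: r_distr m_lcomm\<close>)
  have im: "?f ` carrier ?X = (\<otimes>\<^sub>K) x ` I" by simp
  have "?FG ((\<otimes>\<^sub>K) x ` I)"
  proof (rule small[OF _ _ nI])
   show "ideal ((\<otimes>\<^sub>K) x ` I) K"
    using image_submodule[OF f lmX lmK] unfolding im submodule_iff .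
   show "(\<otimes>\<^sub>K) x ` I \<subseteq> I" using x I.I_l_closed by blast
  qed
  moreover have "?FG {i \<in> I. x \<otimes>\<^sub>K i = \<zero>\<^sub>K}"
  proof (rule small)
   have "submodule {i \<in> I. x \<otimes>\<^sub>K i = \<zero>\<^sub>K} K (regular K)"
    by (rule submoduleI[OF lmK]) (use x I.Icarr I.I_l_closed in \<open>auto simp: r_distr m_lcomm\<close>)
   then show "ideal {i \<in> I. x \<otimes>\<^sub>K i = \<zero>\<^sub>K} K" unfolding submodule_iff .
  qed (use ne in auto)
  ultimately obtain r k m h where "spans K (regular K) ((\<otimes>\<^sub>K) x ` I) r k"
   "spans K (regular K) {i \<in> I. x \<otimes>\<^sub>K i = \<zero>\<^sub>K} m h" by (elim exE)
  then have "\<exists>p g. spans K ?X (carrier ?X) p g"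
   using im by (intro spans_extension[OF lmX lmK f, of r k m h]) (simp_all add: spans_def cong: conj_cong)
  then show False using nfg by (simp add: spans_def)
 qed
 have inverse: "\<exists>d\<in>carrier K. \<forall>i\<in>I. d \<otimes>\<^sub>K (c \<otimes>\<^sub>K i) = i"
  if c: "c \<in> carrier K" and ne: "\<exists>i\<in>I. c \<otimes>\<^sub>K i \<noteq> \<zero>\<^sub>K" for c
 proof -
  have cn: "c [^]\<^bsub>K\<^esub> n \<in> carrier K" for n :: nat using c by simp
  \<comment> \<open>The powers of \<open>c\<close> generate a descending chain of ideals, so one of
    them is a multiple of the next: \<open>c ^ n = d c ^ (n + 1)\<close>. Every element of
    \<open>I\<close> has the form \<open>c ^ n j\<close>, and on such elements \<open>d c\<close>
    acts as the identity.\<close>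
  define P where "P n = PIdl\<^bsub>K\<^esub> (c [^]\<^bsub>K\<^esub> n)" for n :: nat
  have P: "ideal (P n) K" "c [^]\<^bsub>K\<^esub> n \<in> P n" for n
   unfolding P_def by (rule cgenideal_ideal[OF cn], rule cgenideal_self[OF cn])
  have "P (Suc n) \<subseteq> P n" for n
   unfolding P_def[of "Suc n"] by (rule cgenideal_minimal[OF P(1)])
    (use ideal.I_r_closed[OF P(1) P(2) c] in simp)
  then have "\<forall>n. ideal (P n) K \<and> P (Suc n) \<subseteq> P n" using P(1) by (intro allI conjI)
  then have "\<exists>n. \<forall>m\<ge>n. P m = P n" by (rule K[unfolded artinian_cring_def, THEN conjunct2, THEN spec[of _ P], THEN mp])
  then obtain n where n: "\<forall>m\<ge>n. P m = P n" by (rule exE)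
  have "P (Suc n) = P n" by (rule n[rule_format]) simp
  then have "c [^]\<^bsub>K\<^esub> n \<in> PIdl\<^bsub>K\<^esub> (c [^]\<^bsub>K\<^esub> Suc n)" using P(2)[of n] by (simp only: P_def)
  then obtain d where d: "d \<in> carrier K" "c [^]\<^bsub>K\<^esub> n = d \<otimes>\<^sub>K (c [^]\<^bsub>K\<^esub> Suc n)" unfolding cgenideal_def by blast
  have surj: "\<exists>j\<in>I. i = c [^]\<^bsub>K\<^esub> k \<otimes>\<^sub>K j" if "i \<in> I" for i and k :: nat
   using that
  proof (induction k arbitrary: i)
   case 0
   then show ?case using I.Icarr by (intro bexI[of _ i]) simp_all
  next
   case (Suc k)
   obtain j where j: "j \<in> I" "i = c [^]\<^bsub>K\<^esub> k \<otimes>\<^sub>K j" by (rule bexE[OF Suc.IH[OF Suc.prems]])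
   have "j \<in> (\<otimes>\<^sub>K) c ` I" using j(1) by (simp only: dich[OF c ne])
   then obtain l where "l \<in> I" "j = c \<otimes>\<^sub>K l" by (rule imageE) simp
   then show ?case using j c cn[of k] I.Icarr by (intro bexI[of _ l]) (simp_all add: m_assoc)
  qed
  have "d \<otimes>\<^sub>K (c \<otimes>\<^sub>K i) = i" if i: "i \<in> I" for i
  proof -
   obtain j where j: "j \<in> I" "i = c [^]\<^bsub>K\<^esub> n \<otimes>\<^sub>K j" by (rule bexE[OF surj[OF i, of n]])
   have "d \<otimes>\<^sub>K (c \<otimes>\<^sub>K i) = (d \<otimes>\<^sub>K (c [^]\<^bsub>K\<^esub> Suc n)) \<otimes>\<^sub>K j"
    using d(1) c cn[of n] I.Icarr[OF j(1)] unfolding j(2) by (simp add: m_ac)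
   then show ?thesis unfolding d(2)[symmetric] j(2)[symmetric] .
  qed
  then show ?thesis using d(1) by blast
 qed
 have "I \<noteq> {\<zero>\<^sub>K}"
 proof
  assume "I = {\<zero>\<^sub>K}"
  then have "spans K (regular K) I 0 (%_. \<zero>\<^sub>K)" by (simp add: spans_def)
  then show False using nfg by blast
 qed
 then obtain v where v: "v \<in> I" "v \<noteq> \<zero>\<^sub>K" using I.zero_closed by blast
 obtain W where W: "ideal W K" "v \<notin> W" "\<forall>V. ideal V K \<and> W \<subseteq> V \<and> v \<notin> V \<longrightarrow> V = W"
  by (rule ex_ideal_maximal_avoiding[OF zeroideal, of v]) (use v in simp_all)
 interpret W: ideal W K by (rule W(1))
 \<comment> \<open>\<open>v\<close> lies in \<open>I\<close> but not in \<open>W\<close>, so the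
   intersection is a proper subideal of \<open>I\<close> and finitely generated by
   minimality.\<close>
 have "?FG (W \<inter> I)" by (rule small[OF i_intersect[OF W(1) I.is_ideal]]) (use v(1) W(2) in blast)+
 then obtain m h where h: "spans K (regular K) (W \<inter> I) m h" by (elim exE)
 have "spans K (regular K) I (Suc m) (%i. if i < m then h i else v)"
  unfolding spans_def
 proof (intro conjI ballI allI impI)
  fix t assume t: "t \<in> I"
  have "\<exists>d s. d \<in> carrier K \<and> s \<in> W \<inter> I \<and> t = s \<oplus>\<^sub>K d \<otimes>\<^sub>K v"
  proof (cases "t \<in> W")
   case True
   then show ?thesis using t v I.Icarr by (intro exI[of _ "\<zero>\<^sub>K"] exI[of _ t]) simp
  next
   case False
   have tc: "t \<in> carrier K" by (rule I.Icarr[OF t])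
   have vc: "v \<in> carrier K" by (rule I.Icarr[OF v(1)])
   have Vi: "ideal (W <+>\<^sub>K PIdl\<^bsub>K\<^esub> t) K" by (intro add_ideals W(1) cgenideal_ideal tc)
   have "W \<subseteq> W <+>\<^sub>K PIdl\<^bsub>K\<^esub> t" "t \<in> W <+>\<^sub>K PIdl\<^bsub>K\<^esub> t"
    using add_ideals_supset[OF W(1) cgenideal_ideal[OF tc]] cgenideal_self[OF tc] by blast+
   then have "v \<in> W <+>\<^sub>K PIdl\<^bsub>K\<^esub> t" using W(3) Vi False by blast
   \<comment> \<open>Maximality of \<open>W\<close> forces \<open>v\<close> into
     \<open>W + K t\<close>. As \<open>c\<close> is invertible on \<open>I\<close>, the equation can
     be solved for \<open>t\<close>, up to an element of \<open>W \<inter> I\<close>.\<close>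
   then obtain w c where w: "w \<in> W" and c: "c \<in> carrier K" and vw: "v = w \<oplus>\<^sub>K c \<otimes>\<^sub>K t"
    unfolding set_add_def set_mult_def cgenideal_def by auto
   have wc: "w \<in> carrier K" by (rule W.Icarr[OF w])
   have "w = v \<ominus>\<^sub>K c \<otimes>\<^sub>K t" using wc c tc unfolding vw by (simp add: a_minus_def a_assoc r_neg)
   then have wI: "w \<in> I" using v(1) I.I_l_closed[OF t c] I.a_closed I.a_inv_closed by (simp add: a_minus_def)
   have ct: "c \<otimes>\<^sub>K t \<noteq> \<zero>\<^sub>K"
   proof
    assume "c \<otimes>\<^sub>K t = \<zero>\<^sub>K"
    then have "v = w" using vw wc by simp
    then show False using w W(2) by simp
   qed
   have "\<exists>i\<in>I. c \<otimes>\<^sub>K i \<noteq> \<zero>\<^sub>K" using t ct by (intro bexI[of _ t])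
   from inverse[OF c this] obtain d where d: "d \<in> carrier K" "\<forall>i\<in>I. d \<otimes>\<^sub>K (c \<otimes>\<^sub>K i) = i" by (rule bexE)
   have dv: "d \<otimes>\<^sub>K v = d \<otimes>\<^sub>K w \<oplus>\<^sub>K t" unfolding vw using d t wc c tc by (simp add: r_distr)
   have "t = \<ominus>\<^sub>K (d \<otimes>\<^sub>K w) \<oplus>\<^sub>K d \<otimes>\<^sub>K v" unfolding dv using d wc tc by (simp add: r_neg1)
   moreover have "\<ominus>\<^sub>K (d \<otimes>\<^sub>K w) \<in> W \<inter> I"
    using W.a_inv_closed[OF W.I_l_closed[OF w d(1)]] I.a_inv_closed[OF I.I_l_closed[OF wI d(1)]] by blast
   ultimately show ?thesis
    by (intro exI[of _ d] exI[of _ "\<ominus>\<^sub>K (d \<otimes>\<^sub>K w)"] conjI d(1))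
  qed
  then obtain d s where d: "d \<in> carrier K" "s \<in> W \<inter> I" "t = s \<oplus>\<^sub>K d \<otimes>\<^sub>K v" by (elim exE conjE)
  obtain b where b: "\<forall>i<m. b i \<in> carrier K" "s = lincomb (regular K) m b h" by (rule spansE[OF h d(2)])
  let ?c = "%i. if i < m then b i else d"
  have "t = lincomb (regular K) (Suc m) ?c (%i. if i < m then h i else v)"
   unfolding d(3) b(2) by (simp cong: lincomb_cong)
  then show "\<exists>c. vec K (Suc m) c \<and> t = lincomb (regular K) (Suc m) c (%i. if i < m then h i else v)"
   using b(1) d(1) by (intro exI[of _ ?c]) simp
 qed (use spansD(1)[OF h] v in auto)
 then show False using nfg by blast
qed

text \<open>The last coordinates of the elements of \<open>U\<close> form a left ideal, which allows induction on
 the number of coordinates.\<close>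

lemma submodule_free_spans:
 assumes R: "ring R" and ideals: "\<And>I. submodule I R (regular R) ==> \<exists>m g. spans R (regular R) I m g"
  and "submodule U R (free_module R n)" "j \<le> n" "\<forall>v\<in>U. \<forall>i<n. j \<le> i \<longrightarrow> v i = \<zero>\<^sub>R"
 shows "\<exists>m h. spans R (free_module R n) U m h"
 using assms(3-5)
proof (induction j arbitrary: U)
 case 0
 have "U = {\<zero>\<^bsub>free_module R n\<^esub>}"
 proof -
  have "v = \<zero>\<^bsub>free_module R n\<^esub>" if v: "v \<in> U" for v
   using subsetD[OF submoduleD(1)[OF 0(1)] v] 0(3) v by (intro extensionalityI[of _ "{..<n}"]) (auto simp: PiE_def)
  then show ?thesis using submoduleD(2)[OF 0(1)] by blast
 qed
 then have "spans R (free_module R n) U 0 (%_. \<zero>\<^bsub>free_module R n\<^esub>)" by (simp add: spans_def lincomb_def)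
 then show ?case by blast
next
 case (Suc j)
 note D = submoduleD[OF Suc.prems(1)]
 have j: "j < n" using Suc.prems(2) by simp
 have lmF: "left_module R (free_module R n)" by (rule left_module_free[OF R])
 have lmR: "left_module R (regular R)" by (rule left_module_regular[OF R])
 let ?X = "(free_module R n)\<lparr>carrier := U\<rparr>"
 have lmX: "left_module R ?X" by (rule submodule_left_module[OF Suc.prems(1) lmF])
 have Uc: "v j \<in> carrier R" if "v \<in> U" for v using subsetD[OF D(1) that] j by auto
 let ?f = "\<lambda>v\<in>carrier ?X. v j"
 have f: "?f \<in> mod_hom R ?X (regular R)" by (rule mod_hom_restrictI[OF lmX]) (use j Uc in simp_all)
 obtain r k where k: "spans R (regular R) (?f ` carrier ?X) r k"
  using ideals[OF image_submodule[OF f lmX lmR]] by blast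
 let ?W = "{v \<in> carrier ?X. ?f v = \<zero>\<^bsub>regular R\<^esub>}"
 have "submodule ?W R (free_module R n)"
 proof (rule submoduleI[OF lmF])
  interpret ring R by (rule R)
  show "?W \<subseteq> carrier (free_module R n)" using D(1) by auto
  show "\<zero>\<^bsub>free_module R n\<^esub> \<in> ?W" using D(2) j by simp
  show "v \<oplus>\<^bsub>free_module R n\<^esub> w \<in> ?W" if "v \<in> ?W" "w \<in> ?W" for v w
   using that D(3)[of v w] j by (simp split: if_splits)
  show "r \<odot>\<^bsub>free_module R n\<^esub> v \<in> ?W" if "r \<in> carrier R" "v \<in> ?W" for r v
   using that D(4)[of r v] j by (simp split: if_splits)
 qed
 moreover have "\<forall>v\<in>?W. \<forall>i<n. j \<le> i \<longrightarrow> v i = \<zero>\<^sub>R"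
 proof (intro ballI allI impI)
  fix v i assume v: "v \<in> ?W" and i: "i < n" "j \<le> i"
  then show "v i = \<zero>\<^sub>R" using Suc.prems(3) by (cases "i = j") (simp_all split: if_splits)
 qed
 ultimately obtain m h where "spans R (free_module R n) ?W m h"
  using Suc.IH j less_imp_le by blast
 then have "spans R ?X ?W m h" unfolding spans_def lincomb_carrier_update .
 from spans_extension[OF lmX lmR f k this] show ?case by (simp add: spans_def)
qed

text \<open>The preimage of \<open>U\<close> under a surjection from a free module is finitely
  generated, and its generators are pushed forward.\<close>

lemma artinian_submodule_spans:
 assumes K: "artinian_cring K" and V: "fg_module K V" and U: "submodule U K V"
 shows "\<exists>m h. spans K V U m h"
proof -
 interpret K: cring K using K by (simp add: artinian_cring_def)
 have lmV: "left_module K V" by (rule left_module_if_fg[OF V])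
 interpret V: left_module K V by (rule lmV)
 obtain n g where g: "spans K V (carrier V) n g" by (rule fg_module_spans[OF V])
 have gc: "g i \<in> carrier V" if "i < n" for i using spansD(1)[OF g that] .
 let ?F = "free_module K n"
 have lmF: "left_module K ?F" by (rule left_module_free[OF K.ring_axioms])
 have vc: "v i \<in> carrier K" if "v \<in> carrier ?F" "i < n" for v i using that by auto
 note D = submoduleD[OF U]
 let ?p = "\<lambda>v\<in>carrier ?F. lincomb V n v g"
 have p: "?p \<in> mod_hom K ?F V" by (rule free_hom[OF lmV gc])
 have "submodule {v \<in> carrier ?F. ?p v \<in> U} K ?F" by (rule vimage_submodule[OF p lmF lmV U])
 then obtain m h where h: "spans K ?F {v \<in> carrier ?F. ?p v \<in> U} m h"
  using submodule_free_spans[OF K.ring_axioms artinian_ideal_spans[OF K], of _ n n] by force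
 have hc: "h i \<in> carrier ?F" "?p (h i) \<in> U" if "i < m" for i using spansD(1)[OF h that] by blast+
 have "spans K V U m (%i. ?p (h i))"
  unfolding spans_def
 proof (intro conjI allI impI ballI)
  fix x assume x: "x \<in> U"
  obtain c where c: "\<forall>i<n. c i \<in> carrier K" "x = lincomb V n c g" by (rule spansE[OF g subsetD[OF D(1) x]])
  let ?v = "restrict c {..<n}"
  have v: "?v \<in> carrier ?F" using c(1) by simp
  have pv: "?p ?v = x" using v unfolding c(2) by (simp cong: lincomb_cong)
  obtain b where b: "\<forall>i<m. b i \<in> carrier K" "?v = lincomb ?F m b h"
   by (rule spansE[OF h, of ?v]) (use v pv x in \<open>simp only: mem_Collect_eq\<close>)
  have "x = lincomb V m b (%i. ?p (h i))"
   unfolding pv[symmetric] b(2) by (rule mod_hom_lincomb[OF p lmF lmV]) (use b hc in simp_all)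
  then show "\<exists>c. vec K m c \<and> x = lincomb V m c (%i. ?p (h i))" using b(1) by (intro exI[of _ b] conjI)
 qed (use hc in blast)
 then show ?thesis by blast
qed

section \<open>Restriction of scalars to the base ring\<close>

lemma restrict_scalars_simps [simp]:
 "carrier (restrict_scalars \<eta> N) = carrier N" "\<zero>\<^bsub>restrict_scalars \<eta> N\<^esub> = \<zero>\<^sub>N"
 "add (restrict_scalars \<eta> N) = add N" "k \<odot>\<^bsub>restrict_scalars \<eta> N\<^esub> x = \<eta> k \<odot>\<^sub>N x"
 by (simp_all add: restrict_scalars_def)

lemma lincomb_restrict_scalars: "lincomb (restrict_scalars \<eta> N) n c g = lincomb N n (%i. \<eta> (c i)) g"
 by (induction n) simp_all

lemma left_module_restrict_scalars:
 assumes "\<eta> \<in> ring_hom K R" "ring K" "left_module R N"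
 shows "left_module K (restrict_scalars \<eta> N)"
proof -
 interpret N: left_module R N by fact
 note h = ring_hom_closed[OF assms(1)] ring_hom_mult[OF assms(1)] ring_hom_add[OF assms(1)] ring_hom_one[OF assms(1)]
 have "abelian_group (restrict_scalars \<eta> N)"
 proof (rule abelian_groupI)
  fix x assume "x \<in> carrier (restrict_scalars \<eta> N)"
  then show "\<exists>y\<in>carrier (restrict_scalars \<eta> N). y \<oplus>\<^bsub>restrict_scalars \<eta> N\<^esub> x = \<zero>\<^bsub>restrict_scalars \<eta> N\<^esub>"
   by (intro bexI[of _ "\<ominus>\<^sub>N x"]) (simp_all add: N.M.l_neg)
 qed (simp_all add: N.M.a_ac)
 then show ?thesis
  by (intro left_module.intro assms(2) left_module_axioms.intro)
   (simp_all add: h N.smult_l_distr N.smult_r_distr N.smult_assoc1)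
qed

text \<open>The image of \<open>K\<close> is central, so linear combinations with coefficients from
  \<open>K\<close> are the same in \<open>R\<close> and in its opposite.\<close>

lemma artin_algebra_over_opposite:
 assumes "artin_algebra_over K \<eta> R"
 shows "artin_algebra_over K \<eta> (opposite R)"
proof -
 have K: "artinian_cring K" and R: "ring R" and \<eta>: "\<eta> \<in> ring_hom K R"
  and central: "\<And>k r. k \<in> carrier K ==> r \<in> carrier R ==> \<eta> k \<otimes>\<^sub>R r = r \<otimes>\<^sub>R \<eta> k"
  and fg: "fg_module K (restrict_scalars \<eta> (regular R))"
  using assms by (auto simp: artin_algebra_over_def)
 interpret K: cring K using K by (simp add: artinian_cring_def)
 have Rop: "ring (opposite R)" by (rule ring_opposite[OF R])
 note h = ring_hom_closed[OF \<eta>] ring_hom_mult[OF \<eta>] ring_hom_add[OF \<eta>] ring_hom_one[OF \<eta>]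
 have \<eta>op: "\<eta> \<in> ring_hom K (opposite R)"
 proof (rule ring_hom_memI)
  fix x y assume x: "x \<in> carrier K" and y: "y \<in> carrier K"
  show "\<eta> (x \<otimes>\<^sub>K y) = \<eta> x \<otimes>\<^bsub>opposite R\<^esub> \<eta> y"
   using h(2)[OF x y] central[OF x h(1)[OF y]] by simp
  show "\<eta> (x \<oplus>\<^sub>K y) = \<eta> x \<oplus>\<^bsub>opposite R\<^esub> \<eta> y" using h(3)[OF x y] by simp
 qed (use h in simp_all)
 obtain m g where g: "spans K (restrict_scalars \<eta> (regular R)) (carrier R) m g"
  using fg_module_spans[OF fg] by auto
 have eq: "lincomb (restrict_scalars \<eta> (regular R)) m c g = lincomb (restrict_scalars \<eta> (regular (opposite R))) m c g"
  if "vec K m c" for c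
  unfolding lincomb_restrict_scalars lincomb_regular msum_opposite opposite_simps
  using that central h(1) spansD(1)[OF g] by (intro msum_cong) simp
 have "spans K (restrict_scalars \<eta> (regular (opposite R))) (carrier (restrict_scalars \<eta> (regular (opposite R)))) m g"
  unfolding spans_def
 proof (intro conjI ballI)
  fix x assume "x \<in> carrier (restrict_scalars \<eta> (regular (opposite R)))"
  then have "x \<in> carrier R" by simp
  then obtain c where c: "vec K m c" "x = lincomb (restrict_scalars \<eta> (regular R)) m c g" by (rule spansE[OF g])
  then show "\<exists>c. vec K m c \<and> x = lincomb (restrict_scalars \<eta> (regular (opposite R))) m c g"
   using eq[OF c(1)] by (intro exI[of _ c]) simp
 qed (use spansD(1)[OF g] in simp)
 then have "fg_module K (restrict_scalars \<eta> (regular (opposite R)))"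
  by (rule spans_fg_module[OF left_module_restrict_scalars[OF \<eta>op K.ring_axioms left_module_regular[OF Rop]]])
 then show ?thesis
  unfolding artin_algebra_over_def using K Rop \<eta>op central h(1) by simp
qed

text \<open>Products of generators of \<open>R\<close> over \<open>K\<close> with generators of
  \<open>N\<close> over \<open>R\<close> generate. They are collected in a set indexed by pairs,
  which fits the definition of \<open>fg_module\<close> directly.\<close>

lemma fg_module_restrict_scalars:
 assumes R: "artin_algebra_over K \<eta> R" and N: "fg_module R N"
 shows "fg_module K (restrict_scalars \<eta> N)"
proof -
 have K: "ring K" and \<eta>: "\<eta> \<in> ring_hom K R" and fgR: "fg_module K (restrict_scalars \<eta> (regular R))"
  using R by (simp_all add: artin_algebra_over_def artinian_cring_def cring.axioms(1))
 have lmN: "left_module R N" by (rule left_module_if_fg[OF N])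
 interpret N: left_module R N by (rule lmN)
 have lm: "left_module K (restrict_scalars \<eta> N)" by (rule left_module_restrict_scalars[OF \<eta> K lmN])
 obtain p s where s: "spans K (restrict_scalars \<eta> (regular R)) (carrier (restrict_scalars \<eta> (regular R))) p s"
  by (rule fg_module_spans[OF fgR])
 obtain n g where g: "spans R N (carrier N) n g" by (rule fg_module_spans[OF N])
 have sc: "s k \<in> carrier R" if "k < p" for k using spansD(1)[OF s that] by simp
 have gc: "g i \<in> carrier N" if "i < n" for i using spansD(1)[OF g that] .
 have \<eta>c: "\<eta> k \<in> carrier R" if "k \<in> carrier K" for k using ring_hom_closed[OF \<eta> that] .
 let ?S = "(%(k, i). s k \<odot>\<^sub>N g i) ` ({..<p} \<times> {..<n})"
 have "H = carrier N" if H: "submodule H K (restrict_scalars \<eta> N)" and S: "?S \<subseteq> H" for H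
 proof
  show "H \<subseteq> carrier N" using submoduleD(1)[OF H] by simp
  have H2: "x \<oplus>\<^sub>N y \<in> H" if "x \<in> H" "y \<in> H" for x y using submoduleD(3)[OF H that] by simp
  have H0: "\<zero>\<^sub>N \<in> H" using submoduleD(2)[OF H] by simp
  have Hs: "a \<odot>\<^sub>N g i \<in> H" if a: "a \<in> carrier R" and i: "i < n" for a i
  proof -
   obtain c where c: "\<forall>k<p. c k \<in> carrier K" "a = lincomb (restrict_scalars \<eta> (regular R)) p c s"
    by (rule spansE[OF s, of a]) (simp add: a)
   have "a \<odot>\<^sub>N g i = msum N p (%k. (\<eta> (c k) \<otimes>\<^sub>R s k) \<odot>\<^sub>N g i)"
    using c(1) sc gc[OF i] by (simp add: c(2) lincomb_restrict_scalars lincomb_regular N.msum_smult \<eta>c)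
   moreover have "(\<eta> (c k) \<otimes>\<^sub>R s k) \<odot>\<^sub>N g i \<in> H" if k: "k < p" for k
   proof -
    have "s k \<odot>\<^sub>N g i \<in> H" using S k i by (intro subsetD[OF S] image_eqI[of _ _ "(k, i)"]) simp_all
    then have "c k \<odot>\<^bsub>restrict_scalars \<eta> N\<^esub> (s k \<odot>\<^sub>N g i) \<in> H" using c(1) k by (intro submoduleD(4)[OF H]) simp_all
    then show ?thesis using c(1) k sc gc[OF i] by (simp add: N.smult_assoc1 \<eta>c)
   qed
   ultimately show ?thesis by (simp add: N.M.msum_subset_closed[OF H0 H2])
  qed
  show "carrier N \<subseteq> H"
  proof
   fix x assume "x \<in> carrier N"
   then obtain a where "\<forall>i<n. a i \<in> carrier R" "x = lincomb N n a g" by (rule spansE[OF g])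
   then show "x \<in> H" by (simp add: lincomb_def N.M.msum_subset_closed[OF H0 H2] Hs)
  qed
 qed
 then show ?thesis unfolding fg_module_def
  using lm sc gc by (intro conjI exI[of _ ?S] allI impI) auto
qed

text \<open>An \<open>R\<close>-submodule of a free module is a \<open>K\<close>-submodule of a
  module that is finitely generated over \<open>K\<close>; generators over \<open>K\<close> generate
  over \<open>R\<close>.\<close>

lemma artin_algebra_over_left_noetherian:
 assumes "artin_algebra_over K \<eta> R"
 shows "left_noetherian R"
 unfolding left_noetherian_def
proof (intro conjI allI impI)
 have K: "artinian_cring K" and \<eta>: "\<eta> \<in> ring_hom K R" using assms by (simp_all add: artin_algebra_over_def)
 show R: "ring R" using assms by (simp add: artin_algebra_over_def)
 fix n U assume U: "submodule U R (free_module R n)"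
 let ?V = "restrict_scalars \<eta> (free_module R n)"
 have V: "fg_module K ?V" by (rule fg_module_restrict_scalars[OF assms fg_module_free[OF R]])
 have "submodule U K ?V"
  using submoduleD[OF U] ring_hom_closed[OF \<eta>] by (intro submoduleI[OF left_module_if_fg[OF V]]) simp_all
 then obtain m h where h: "spans K ?V U m h" using artinian_submodule_spans[OF K V] by blast
 have "spans R (free_module R n) U m h"
  unfolding spans_def
 proof (intro conjI ballI)
  fix x assume "x \<in> U"
  then obtain c where c: "vec K m c" "x = lincomb ?V m c h" by (rule spansE[OF h])
  then show "\<exists>c. vec R m c \<and> x = lincomb (free_module R n) m c h"
   using ring_hom_closed[OF \<eta>] by (intro exI[of _ "%i. \<eta> (c i)"]) (simp add: lincomb_restrict_scalars)
 qed (use spansD(1)[OF h] in simp)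
 then show "\<exists>m g. spans R (free_module R n) U m g" by blast
qed

lemma artin_algebra_left_noetherian:
 fixes R :: "'a ring"
 assumes "artin_algebra R"
 shows "left_noetherian R" "left_noetherian (opposite R)"
proof -
 obtain K :: "'a ring" and \<eta> where "artin_algebra_over K \<eta> R"
  using assms unfolding artin_algebra_def by blast
 then show "left_noetherian R" "left_noetherian (opposite R)"
  using artin_algebra_over_left_noetherian artin_algebra_over_opposite by blast+
qed

section \<open>Finite projective and injective dimension\<close>

lemma left_module_if_projective: "projective_module R P ==> left_module R P"
 by (simp add: projective_module_def fg_module_def)

text \<open>The identity of \<open>P\<close> lifts along a surjection from a free module; the lift
  followed by the coordinates gives the functionals \<open>s\<close>.\<close>

lemma projective_dual_basis:
 assumes "projective_module R P"
 obtains k t s where "vec P k t" "\<forall>i<k. s i \<in> mod_hom R P (regular R)"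
  "\<forall>p\<in>carrier P. p = lincomb P k (%i. s i p) t"
proof -
 have fg: "fg_module R P" using assms by (simp add: projective_module_def)
 have P: "left_module R P" by (rule left_module_if_fg[OF fg])
 interpret P: left_module R P by (rule P)
 interpret S: left_module R "regular R" by (rule left_module_regular[OF P.R.ring_axioms])
 obtain k t where t: "spans R P (carrier P) k t" by (rule fg_module_spans[OF fg])
 have tc: "\<And>i. i < k ==> t i \<in> carrier P" by (rule spansD(1)[OF t])
 obtain f where f: "f \<in> mod_hom R (sfree R k) P" "\<forall>v. vec R k v \<longrightarrow> f (fvec R k v) = lincomb P k v t"
  by (rule sfree_hom[OF P.R.ring_axioms P tc])
 have id: "(\<lambda>p\<in>carrier P. p) \<in> mod_hom R P P" by (rule mod_hom_restrictI[OF P]) simp_all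
 have surj: "(\<lambda>p\<in>carrier P. p) ` carrier P \<subseteq> f ` carrier (sfree R k)"
 proof (rule image_subsetI)
  fix p assume p: "p \<in> carrier P"
  obtain c where c: "vec R k c" "p = lincomb P k c t" by (rule spansE[OF t p])
  have "fvec R k c \<in> carrier (sfree R k)" by (rule fvec_closed[OF P.R.ring_axioms]) (use c in simp)
  then show "(\<lambda>p\<in>carrier P. p) p \<in> f ` carrier (sfree R k)"
   using p f(2) c by (intro image_eqI[of _ _ "fvec R k c"]) simp_all
 qed
 obtain h where h: "h \<in> mod_hom R P (sfree R k)" "\<forall>p\<in>carrier P. f (h p) = (\<lambda>p\<in>carrier P. p) p"
  by (rule projective_lift[OF assms sfree_fg[OF P.R.ring_axioms] P f(1) id surj])
 define C where "C i c \<longleftrightarrow> c \<in> mod_hom R (sfree R k) (regular R) \<and> (\<forall>v. vec R k v \<longrightarrow> c (fvec R k v) = v i)" for i c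
 have "\<exists>c. C i c" if i: "i < k" for i
 proof -
  obtain c where c: "c \<in> mod_hom R (sfree R k) (regular R)"
   "\<forall>v. vec R k v \<longrightarrow> c (fvec R k v) = lincomb (regular R) k v (%j. if j = i then \<one>\<^sub>R else \<zero>\<^sub>R)"
   by (rule sfree_hom[OF P.R.ring_axioms S.left_module_axioms, of k "%j. if j = i then \<one>\<^sub>R else \<zero>\<^sub>R"]) auto
  have "lincomb (regular R) k v (%j. if j = i then \<one>\<^sub>R else \<zero>\<^sub>R) = v i" if "vec R k v" for v
  proof -
   have "lincomb (regular R) k v (%j. if j = i then \<one>\<^sub>R else \<zero>\<^sub>R) = msum R k (%j. if j = i then v i else \<zero>\<^sub>R)"
    unfolding lincomb_regular using that by (intro msum_cong) auto
   then show ?thesis using that i by (simp add: P.R.msum_single)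
  qed
  then show ?thesis using c unfolding C_def by (intro exI[of _ c]) simp
 qed
 then obtain c where c: "\<forall>i<k. C i (c i)" by metis
 show ?thesis
 proof (rule that)
  show "vec P k t" using tc by simp
  show "\<forall>i<k. (\<lambda>p\<in>carrier P. c i (h p)) \<in> mod_hom R P (regular R)"
  proof (intro allI impI)
   fix i assume "i < k"
   then have "c i \<in> mod_hom R (sfree R k) (regular R)" using c by (simp add: C_def)
   then show "(\<lambda>p\<in>carrier P. c i (h p)) \<in> mod_hom R P (regular R)" by (rule mod_hom_compose[OF h(1) _ P])
  qed
  show "\<forall>p\<in>carrier P. p = lincomb P k (%i. (\<lambda>p\<in>carrier P. c i (h p)) p) t"
  proof
   fix p assume p: "p \<in> carrier P"
   obtain v where v: "\<forall>i<k. v i \<in> carrier R" "h p = fvec R k v"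
    by (rule sfreeE[OF P.R.ring_axioms mod_homD(1)[OF h(1) p]])
   have "p = f (h p)" using h(2) p by simp
   also have "\<dots> = lincomb P k v t" using f(2) v by simp
   also have "\<dots> = lincomb P k (%i. (\<lambda>p\<in>carrier P. c i (h p)) p) t"
    using c v p by (intro lincomb_cong) (simp_all add: C_def)
   finally show "p = lincomb P k (%i. (\<lambda>p\<in>carrier P. c i (h p)) p) t" .
  qed
 qed
qed

text \<open>Each functional of a dual basis carries the linear system over \<open>P\<close> to one
  over the ring; the solutions are reassembled along \<open>t\<close>.\<close>

lemma exact_col_projective:
 assumes "projective_module R P" "mat R m l F" "mat R n m G" "exact_col (regular R) l m n F G"
 shows "exact_col P l m n F G"
 unfolding exact_col_def
proof (intro allI impI, elim conjE)
 fix v assume v: "vec P m v" and z: "\<forall>k<n. lincomb P m (G k) v = \<zero>\<^sub>P"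
 have P: "left_module R P" by (rule left_module_if_projective[OF assms(1)])
 interpret P: left_module R P by (rule P)
 have S: "left_module R (regular R)" by (rule left_module_regular[OF P.R.ring_axioms])
 obtain r t s where t: "vec P r t" and s: "\<forall>i<r. s i \<in> mod_hom R P (regular R)"
  and ts: "\<forall>p\<in>carrier P. p = lincomb P r (%i. s i p) t"
  by (rule projective_dual_basis[OF assms(1)])
 define Q where "Q i u \<longleftrightarrow> vec R l u \<and> (\<forall>j<m. s i (v j) = lincomb (regular R) l (F j) u)" for i u
 have "\<exists>u. Q i u" if i: "i < r" for i
 proof -
  have si: "s i \<in> mod_hom R P (regular R)" using s i by simp
  have 1: "vec (regular R) m (%j. s i (v j))" using mod_homD(1)[OF si] v by simp
  have 2: "\<forall>k<n. lincomb (regular R) m (G k) (%j. s i (v j)) = \<zero>\<^bsub>regular R\<^esub>"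
  proof (intro allI impI)
   fix k assume k: "k < n"
   have "lincomb (regular R) m (G k) (%j. s i (v j)) = s i (lincomb P m (G k) v)"
    by (rule mod_hom_lincomb[OF si P S, symmetric]) (use assms(3) k v in simp_all)
   then show "lincomb (regular R) m (G k) (%j. s i (v j)) = \<zero>\<^bsub>regular R\<^esub>"
    using z k mod_hom_zero[OF si P S] by simp
  qed
  obtain u where "vec (regular R) l u" "\<forall>j<m. s i (v j) = lincomb (regular R) l (F j) u"
   by (rule exact_colD[OF assms(4) 1 2])
  then show ?thesis unfolding Q_def by (intro exI[of _ u]) simp
 qed
 then obtain u where u: "\<forall>i<r. Q i (u i)" by metis
 have uc: "u i j \<in> carrier R" if "i < r" "j < l" for i j using u that by (simp add: Q_def)
 let ?w = "%j. lincomb P r (%i. u i j) t"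
 have "v j = lincomb P l (F j) ?w" if j: "j < m" for j
 proof -
  have "lincomb P l (F j) ?w = lincomb P r (%i. dot R l (F j) (u i)) t"
   using assms(2) uc t j by (intro P.lincomb_assoc) simp_all
  also have "\<dots> = lincomb P r (%i. s i (v j)) t"
   using u j by (intro lincomb_cong) (simp_all add: Q_def lincomb_regular)
  also have "\<dots> = v j" using ts v j by simp
  finally show ?thesis by simp
 qed
 moreover have "vec P l ?w" using uc t by simp
 ultimately show "\<exists>u. vec P l u \<and> (\<forall>j<m. v j = lincomb P l (F j) u)"
  by (intro exI[of _ ?w]) simp
qed

text \<open>A piece of the long exact sequence for the kernel of \<open>g\<close>, \<open>P\<close>
  and \<open>W\<close>: exactness over \<open>W\<close> follows from exactness over \<open>P\<close>
  at the same place and over the kernel one place further on.\<close>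

lemma exact_col_quotient:
 assumes "left_module R P" "left_module R W" "g \<in> mod_hom R P W" "g ` carrier P = carrier W"
  and mats: "mat R m l F" "mat R n m G" "mat R p n H"
  and HG: "\<forall>k<p. \<forall>j<m. dot R n (H k) (%i. G i j) = \<zero>\<^sub>R"
  and P: "exact_col P l m n F G"
  and ker: "exact_col (P\<lparr>carrier := {x \<in> carrier P. g x = \<zero>\<^sub>W}\<rparr>) m n p G H"
 shows "exact_col W l m n F G"
 unfolding exact_col_def
proof (intro allI impI, elim conjE)
 fix v assume v: "vec W m v" and z: "\<forall>k<n. lincomb W m (G k) v = \<zero>\<^sub>W"
 interpret P: left_module R P by (rule assms(1))
 interpret W: left_module R W by (rule assms(2))
 obtain x where xc: "vec P m x" and gx: "\<forall>j<m. g (x j) = v j"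
  by (rule ex_preimages[of m v g "carrier P"]) (use v assms(4) in simp_all)
 \<comment> \<open>The lift \<open>x\<close> of \<open>v\<close> need not satisfy the equations of
   \<open>G\<close>. The defect lies in the kernel of \<open>g\<close>, where exactness at the next
   place writes it as \<open>G\<close> applied to some \<open>w\<close>; then \<open>x - w\<close>
   satisfies them and still lifts \<open>v\<close>.\<close>
 let ?y = "%k. lincomb P m (G k) x"
 have yc: "vec P n ?y" using mats xc by simp
 have gy: "g (?y k) = \<zero>\<^sub>W" if k: "k < n" for k
 proof -
  have "g (?y k) = lincomb W m (G k) (%j. g (x j))"
   by (rule mod_hom_lincomb[OF assms(3,1,2)]) (use mats k xc in simp_all)
  also have "\<dots> = lincomb W m (G k) v" using gx by (intro lincomb_cong) simp_all
  finally show ?thesis using z k by simp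
 qed
 have Hy: "\<forall>k<p. lincomb P n (H k) ?y = \<zero>\<^sub>P"
  by (intro allI impI, rule P.lincomb_assoc_zero) (use mats xc HG in simp_all)
 obtain w where w: "vec (P\<lparr>carrier := {x \<in> carrier P. g x = \<zero>\<^sub>W}\<rparr>) m w"
  "\<forall>j<n. ?y j = lincomb (P\<lparr>carrier := {x \<in> carrier P. g x = \<zero>\<^sub>W}\<rparr>) m (G j) w"
  by (rule exact_colD[OF ker, of ?y]) (use yc gy Hy in simp_all)
 have wc: "vec P m w" and gw: "\<And>j. j < m ==> g (w j) = \<zero>\<^sub>W" using w(1) by simp_all
 let ?d = "%j. x j \<oplus>\<^sub>P \<ominus>\<^sub>P w j"
 have dc: "vec P m ?d" using xc wc by simp
 have "\<forall>k<n. lincomb P m (G k) ?d = \<zero>\<^sub>P"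
 proof (intro allI impI)
  fix k assume k: "k < n"
  have "lincomb P m (G k) ?d = ?y k \<oplus>\<^sub>P \<ominus>\<^sub>P lincomb P m (G k) w"
   using mats xc wc k by (simp add: P.lincomb_add_right P.lincomb_minus_right)
  also have "\<dots> = ?y k \<oplus>\<^sub>P \<ominus>\<^sub>P ?y k" using w(2) k by simp
  finally show "lincomb P m (G k) ?d = \<zero>\<^sub>P" using yc k by (simp add: P.M.r_neg)
 qed
 then obtain u where u: "vec P l u" "\<forall>j<m. ?d j = lincomb P l (F j) u"
  by (rule exact_colD[OF P dc])
 have "v j = lincomb W l (F j) (%i. g (u i))" if j: "j < m" for j
 proof -
  have "g (?d j) = v j"
   using mod_homD(2)[OF assms(3), of "x j" "\<ominus>\<^sub>P w j"] mod_hom_minus[OF assms(3,1,2), of "w j"]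
    xc wc gx gw v j mod_homD(1)[OF assms(3)] by simp
  moreover have "g (lincomb P l (F j) u) = lincomb W l (F j) (%i. g (u i))"
   by (rule mod_hom_lincomb[OF assms(3,1,2)]) (use mats j u(1) in simp_all)
  ultimately show ?thesis using u(2) j by simp
 qed
 then show "\<exists>u. vec W l u \<and> (\<forall>j<m. v j = lincomb W l (F j) u)"
  using u(1) mod_homD(1)[OF assms(3)] by (intro exI[of _ "%i. g (u i)"]) simp
qed

lemma exact_col_trivial:
 assumes "carrier V = {\<zero>\<^sub>V}" "left_module R V" "mat R m l F"
 shows "exact_col V l m n F G"
 unfolding exact_col_def
proof (intro allI impI, elim conjE)
 fix v assume v: "vec V m v"
 interpret V: left_module R V by fact
 show "\<exists>u. vec V l u \<and> (\<forall>j<m. v j = lincomb V l (F j) u)"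
  using v assms(1,3) by (intro exI[of _ "%_. \<zero>\<^sub>V"]) simp
qed

lemma enat_less_Inf:
 assumes "Inf {enat n | n. P n} < \<infinity>"
 obtains n where "P n"
proof -
 have "\<exists>n. P n"
 proof (rule ccontr)
  assume "\<not> (\<exists>n. P n)"
  then have "{enat n | n. P n} = {}" by simp
  then show False using assms by (simp add: Inf_enat_def)
 qed
 then show ?thesis using that by (elim exE)
qed

text \<open>Dimension shifting: each syzygy of \<open>W\<close> moves the question one place
  further, until the syzygy is zero. The pairs of matrices form a class \<open>Q\<close> closed
  under successors instead of a fixed sequence, since in \<open>tor_vanishing_proj_dim\<close> the
  successor has to be produced by prepending a matrix.\<close>

lemma exact_col_proj_dim:
 assumes W: "left_module R W" and pd: "proj_dim R W < \<infinity>"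
  and Q: "\<And>l m n F G. Q l m n F G ==> mat R m l F \<and> mat R n m G \<and>
   (\<forall>k<n. \<forall>j<l. dot R m (G k) (%i. F i j) = \<zero>\<^sub>R) \<and>
   exact_col (regular R) l m n F G \<and> (\<exists>p H. Q m n p G H)"
  and "Q l m n F G"
 shows "exact_col W l m n F G"
proof -
 obtain N where "\<exists>P d e. projective_resolution R W P d e \<and> (\<forall>i>N. carrier (P i) = {\<zero>\<^bsub>P i\<^esub>})"
  using pd unfolding proj_dim_def by (rule enat_less_Inf)
 then obtain P d e where res: "projective_resolution R W P d e" and N: "\<forall>i>N. carrier (P i) = {\<zero>\<^bsub>P i\<^esub>}"
  by (elim exE conjE)
 note P = projective_resolutionD[OF res]
 define Z where "Z j = (P j)\<lparr>carrier := d j ` carrier (P (Suc j))\<rparr>" for j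
 have Zl: "left_module R (Z j)" for j
  unfolding Z_def by (rule submodule_left_module[OF image_submodule[OF P(4) P(3) P(3)] P(3)])
 have step: "exact_col V l m n F G"
  if V: "left_module R V" "f \<in> mod_hom R (P j) V" "f ` carrier (P j) = carrier V"
   and ker: "{x \<in> carrier (P j). f x = \<zero>\<^sub>V} = d j ` carrier (P (Suc j))"
   and Zex: "\<And>l m n F G. Q l m n F G ==> exact_col (Z j) l m n F G" and q: "Q l m n F G"
  for V :: "('a, 'v) module" and f j l m n F G
 proof -
  obtain p H where q': "Q m n p G H" using Q[OF q] by blast
  show ?thesis
  proof (rule exact_col_quotient[OF P(3) V(1-3), where n = n and p = p and H = H])
   show "exact_col (P j) l m n F G" by (rule exact_col_projective[OF P(1)]) (use Q[OF q] in simp_all)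
   show "exact_col ((P j)\<lparr>carrier := {x \<in> carrier (P j). f x = \<zero>\<^sub>V}\<rparr>) m n p G H"
    unfolding ker using Zex[OF q'] by (simp add: Z_def)
  qed (use Q[OF q] Q[OF q'] in simp_all)
 qed
 have Zex: "exact_col (Z j) l m n F G" if "Q l m n F G" for j l m n F G
  using that
 proof (induction "N - j" arbitrary: j l m n F G)
  case 0
  \<comment> \<open>Here \<open>N - j = 0\<close> means that \<open>j\<close> is at least
    \<open>N\<close>, so the term of degree \<open>Suc j\<close> is zero and with it the image of
    \<open>d j\<close>.\<close>
  then have "carrier (P (Suc j)) = {\<zero>\<^bsub>P (Suc j)\<^esub>}" using N by simp
  then have "carrier (Z j) = {\<zero>\<^bsub>Z j\<^esub>}"
   using mod_hom_zero[OF P(4) P(3) P(3)] by (simp add: Z_def)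
  then show ?case using Q[OF 0(2)] by (intro exact_col_trivial[OF _ Zl]) simp_all
 next
  case (Suc k)
  have IH: "\<And>l m n F G. Q l m n F G ==> exact_col (Z (Suc j)) l m n F G"
   by (rule Suc.hyps(1)) (use Suc.hyps(2) in simp)
  have dZ: "d j \<in> mod_hom R (P (Suc j)) (Z j)"
   using mod_homD[OF P(4)] by (intro mod_homI) (simp_all add: Z_def)
  show ?case
  proof (rule step[OF Zl dZ _ _ IH Suc.prems])
   show "d j ` carrier (P (Suc j)) = carrier (Z j)" by (simp add: Z_def)
   show "{x \<in> carrier (P (Suc j)). d j x = \<zero>\<^bsub>Z j\<^esub>} = d (Suc j) ` carrier (P (Suc (Suc j)))"
    using res by (simp add: Z_def projective_resolution_def mod_ker_def)
  qed
 qed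
 show ?thesis
 proof (rule step[OF W P(5) P(6) _ Zex assms(4)])
  show "{x \<in> carrier (P 0). e x = \<zero>\<^sub>W} = d 0 ` carrier (P (Suc 0))"
   using res by (simp add: projective_resolution_def mod_ker_def)
 qed
qed

lemma cols_exact_proj_dim:
 assumes "left_module R W" "proj_dim R W < \<infinity>" "mat_seq R n F" "cols_exact (regular R) n F"
 shows "cols_exact W n F"
 unfolding cols_exact_def
proof
 fix i
 define Q where "Q a b c G H \<longleftrightarrow> (\<exists>i. a = n i \<and> b = n (Suc i) \<and> c = n (Suc (Suc i)) \<and> G = F i \<and> H = F (Suc i))"
  for a b c G H
 show "exact_col W (n i) (n (Suc i)) (n (Suc (Suc i))) (F i) (F (Suc i))"
 proof (rule exact_col_proj_dim[OF assms(1,2), where Q = Q])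
  fix a b c G H assume "Q a b c G H"
  then obtain i where i: "a = n i" "b = n (Suc i)" "c = n (Suc (Suc i))" "G = F i" "H = F (Suc i)"
   unfolding Q_def by (elim exE conjE)
  have q: "Q (n (Suc i)) (n (Suc (Suc i))) (n (Suc (Suc (Suc i)))) (F (Suc i)) (F (Suc (Suc i)))"
   unfolding Q_def by (intro exI[of _ "Suc i"]) simp
  show "mat R b a G \<and> mat R c b H \<and> (\<forall>k<c. \<forall>j<a. dot R b (H k) (%i. G i j) = \<zero>\<^sub>R) \<and>
   exact_col (regular R) a b c G H \<and> (\<exists>p K. Q b c p H K)"
   unfolding i
  proof (intro conjI exI[of _ "n (Suc (Suc (Suc i)))"] exI[of _ "F (Suc (Suc i))"] q)
   show "exact_col (regular R) (n i) (n (Suc i)) (n (Suc (Suc i))) (F i) (F (Suc i))"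
    using assms(4) by (simp add: cols_exact_def)
  qed (use mat_seqD[OF assms(3)] in simp_all)
 next
  show "Q (n i) (n (Suc i)) (n (Suc (Suc i))) (F i) (F (Suc i))"
   unfolding Q_def by (intro exI[of _ i]) simp
 qed
qed

text \<open>The column \<open>z\<close> is a map on row vectors of length \<open>m\<close>. It
  vanishes on the rows of \<open>G\<close>, which by row exactness generate the kernel of
  multiplication by \<open>F\<close>; so it descends to the image of \<open>F\<close> and extends
  from there by injectivity. The values on unit vectors solve the system.\<close>

lemma exact_col_injective:
 assumes I: "injective_module R I" and mats: "mat R m l F" "mat R n m G"
  and rows: "exact_col (regular (opposite R)) n m l (tr G) (tr F)"
 shows "exact_col I l m n F G"
 unfolding exact_col_def
proof (intro allI impI, elim conjE)
 fix z assume z: "vec I m z" and Gz: "\<forall>k<n. lincomb I m (G k) z = \<zero>\<^sub>I"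
 have lmI: "left_module R I" using I by (simp add: injective_module_def fg_module_def)
 interpret I: left_module R I by (rule lmI)
 have R: "ring R" by (rule I.R.ring_axioms)
 have lms: "left_module R (sfree R k)" for k by (rule sfree_left_module[OF R])
 have Fc: "fvec R l (F j) \<in> carrier (sfree R l)" if "j < m" for j
  by (rule fvec_closed[OF R]) (use mats that in simp)
 obtain \<phi> where \<phi>: "\<phi> \<in> mod_hom R (sfree R m) (sfree R l)"
  "\<forall>v. vec R m v \<longrightarrow> \<phi> (fvec R m v) = lincomb (sfree R l) m v (%j. fvec R l (F j))"
  by (rule sfree_hom[OF R lms Fc])
 have \<phi>v: "\<phi> (fvec R m v) = fvec R l (%i. dot R m v (%j. F j i))" if v: "vec R m v" for v
 proof -
  have "lincomb (sfree R l) m v (%j. fvec R l (F j)) = fvec R l (%i. dot R m v (%j. F j i))"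
   unfolding sfree_def fvec_def
   by (rule coset_lincomb[OF R sfree_submodule[OF R]]) (use v mats in simp_all)
  then show ?thesis using \<phi>(2) v by simp
 qed
 obtain h where h: "h \<in> mod_hom R (sfree R m) I" "\<forall>v. vec R m v \<longrightarrow> h (fvec R m v) = lincomb I m v z"
  by (rule sfree_hom[OF R lmI, of m z]) (use z in simp)
 have ker: "h x = \<zero>\<^sub>I" if x: "x \<in> carrier (sfree R m)" "\<phi> x = \<zero>\<^bsub>sfree R l\<^esub>" for x
 proof -
  obtain v where v: "\<forall>i<m. v i \<in> carrier R" "x = fvec R m v" by (rule sfreeE[OF R x(1)])
  have vF: "\<forall>i<l. dot R m v (%j. F j i) = \<zero>\<^sub>R"
   using x(2) fvec_eq_zero_iff[OF R, of l "%i. dot R m v (%j. F j i)"] v mats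
   unfolding v(2) \<phi>v[OF v(1)] by simp
  obtain u where u: "vec (regular (opposite R)) n u"
   "\<forall>j<m. v j = lincomb (regular (opposite R)) n (tr G j) u"
   by (rule exact_colD[OF rows, of v]) (use v vF in \<open>simp_all add: lincomb_regular_opposite\<close>)
  have "h x = lincomb I m v z" using h(2) v by simp
  also have "\<dots> = lincomb I m (%j. dot R n u (%k. G k j)) z"
   using u by (intro lincomb_cong) (simp_all add: lincomb_regular_opposite)
  also have "\<dots> = lincomb I n u (%k. lincomb I m (G k) z)"
   using u(1) mats z by (intro I.lincomb_assoc[symmetric]) simp_all
  also have "\<dots> = lincomb I n u (%k. \<zero>\<^sub>I)" using Gz by (intro lincomb_cong) simp_all
  finally show ?thesis using u(1) by simp
 qed
 let ?X = "(sfree R l)\<lparr>carrier := \<phi> ` carrier (sfree R m)\<rparr>"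
 obtain f where f: "f \<in> mod_hom R ?X I" "\<forall>x\<in>carrier (sfree R m). f (\<phi> x) = h x"
  by (rule mod_hom_factor[OF lms lms lmI \<phi>(1) h(1) ker])
 have fgX: "fg_module R ?X" by (rule image_fg_module[OF \<phi>(1) sfree_fg[OF R] lms])
 have incl: "(\<lambda>x\<in>carrier ?X. x) \<in> mod_hom R ?X (sfree R l)"
  using mod_homD(1)[OF \<phi>(1)] by (intro mod_hom_restrictI left_module_if_fg[OF fgX]) auto
 have inj: "inj_on (\<lambda>x\<in>carrier ?X. x) (carrier ?X)" by (simp add: inj_on_def)
 obtain e where e: "e \<in> mod_hom R (sfree R l) I" "\<forall>x\<in>carrier ?X. e ((\<lambda>x\<in>carrier ?X. x) x) = f x"
  by (rule injective_extend[OF I fgX sfree_fg[OF R] incl inj f(1)])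
 have un: "fvec R k (unit_vec R i) \<in> carrier (sfree R k)" for k i
  by (rule fvec_closed[OF R]) simp
 have "z j = lincomb I l (F j) (%i. e (fvec R l (unit_vec R i)))" if j: "j < m" for j
 proof -
  have "z j = h (fvec R m (unit_vec R j))" using h(2) I.lincomb_unit_vec[of j m z] j z by simp
  also have "\<dots> = e (\<phi> (fvec R m (unit_vec R j)))" using f(2) e(2) un by simp
  also have "\<phi> (fvec R m (unit_vec R j)) = fvec R l (F j)"
  proof -
   have "dot R m (unit_vec R j) (%q. F q i) = F j i" if "i < l" for i
    using left_module.lincomb_unit_vec[OF left_module_regular[OF R], of j m "%q. F q i"] mats that j
    by (simp add: lincomb_regular)
   then show ?thesis using \<phi>v[of "unit_vec R j"] unfolding fvec_def by (simp cong: fvec_cong)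
  qed
  also have "e (fvec R l (F j)) = lincomb I l (F j) (%i. e (fvec R l (unit_vec R i)))"
   by (rule sfree_hom_eq[OF R lmI e(1)]) (use mats j in simp)
  finally show ?thesis .
 qed
 then show "\<exists>u. vec I l u \<and> (\<forall>j<m. z j = lincomb I l (F j) u)"
  using mod_homD(1)[OF e(1) un] by (intro exI[of _ "%i. e (fvec R l (unit_vec R i))"]) simp
qed

text \<open>The mirror image of \<open>exact_col_quotient\<close>: exactness over the kernel of
  \<open>g\<close> follows from exactness over \<open>P\<close> at the same place and over the image
  of \<open>g\<close> one place earlier.\<close>

lemma exact_col_kernel:
 assumes "left_module R P" "left_module R V" "g \<in> mod_hom R P V"
  and mats: "mat R l p E" "mat R m l F" "mat R n m G"
  and FE: "\<forall>k<m. \<forall>j<p. dot R l (F k) (%i. E i j) = \<zero>\<^sub>R"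
  and P: "exact_col P l m n F G"
  and im: "exact_col (V\<lparr>carrier := g ` carrier P\<rparr>) p l m E F"
 shows "exact_col (P\<lparr>carrier := {x \<in> carrier P. g x = \<zero>\<^sub>V}\<rparr>) l m n F G"
 unfolding exact_col_def
proof (intro allI impI, elim conjE)
 let ?K = "P\<lparr>carrier := {x \<in> carrier P. g x = \<zero>\<^sub>V}\<rparr>"
 interpret P: left_module R P by (rule assms(1))
 interpret V: left_module R V by (rule assms(2))
 fix z assume z: "vec ?K m z" and Gz: "\<forall>k<n. lincomb ?K m (G k) z = \<zero>\<^bsub>?K\<^esub>"
 have zc: "vec P m z" and gz: "\<And>j. j < m ==> g (z j) = \<zero>\<^sub>V" using z by simp_all
 obtain u where u: "vec P l u" "\<forall>j<m. z j = lincomb P l (F j) u"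
  by (rule exact_colD[OF P zc]) (use Gz in simp)
 have gu: "g (lincomb P l (F j) u) = lincomb V l (F j) (%i. g (u i))" if "j < m" for j
  by (rule mod_hom_lincomb[OF assms(3,1,2)]) (use mats that u(1) in simp_all)
 obtain w where w: "vec (V\<lparr>carrier := g ` carrier P\<rparr>) p w"
  "\<forall>j<l. g (u j) = lincomb (V\<lparr>carrier := g ` carrier P\<rparr>) p (E j) w"
  by (rule exact_colD[OF im, of "%i. g (u i)"]) (use u gu gz in simp_all)
 obtain x where xc: "vec P p x" and gx: "\<forall>j<p. g (x j) = w j"
  by (rule ex_preimages[of p w g "carrier P"]) (use w(1) in simp_all)
 \<comment> \<open>Subtracting an image under \<open>E\<close> preserves \<open>z = F u\<close>, as
   \<open>F\<close> times \<open>E\<close> vanishes, and moves the solution into the kernel of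
   \<open>g\<close>.\<close>
 let ?d = "%i. u i \<oplus>\<^sub>P \<ominus>\<^sub>P lincomb P p (E i) x"
 have Ex: "vec P l (%i. lincomb P p (E i) x)" using mats xc by simp
 have "g (?d i) = \<zero>\<^sub>V" if i: "i < l" for i
 proof -
  have "g (lincomb P p (E i) x) = lincomb V p (E i) (%j. g (x j))"
   by (rule mod_hom_lincomb[OF assms(3,1,2)]) (use mats i xc in simp_all)
  also have "\<dots> = lincomb V p (E i) w" using gx by (intro lincomb_cong) simp_all
  also have "\<dots> = g (u i)" using w(2) i by simp
  finally show ?thesis
   using mod_homD(1,2)[OF assms(3)] mod_hom_minus[OF assms(3,1,2)] u(1) Ex i by (simp add: V.M.r_neg)
 qed
 then have "vec ?K l ?d" using u(1) Ex by simp
 moreover have "z j = lincomb ?K l (F j) ?d" if j: "j < m" for j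
 proof -
  have 0: "lincomb P l (F j) (%i. lincomb P p (E i) x) = \<zero>\<^sub>P"
   by (rule P.lincomb_assoc_zero) (use mats xc j FE in simp_all)
  have "lincomb P l (F j) ?d = lincomb P l (F j) u \<oplus>\<^sub>P \<ominus>\<^sub>P lincomb P l (F j) (%i. lincomb P p (E i) x)"
   using mats u(1) Ex j by (simp add: P.lincomb_add_right P.lincomb_minus_right)
  then show ?thesis using u mats j by (simp add: 0)
 qed
 ultimately show "\<exists>u. vec ?K l u \<and> (\<forall>j<m. z j = lincomb ?K l (F j) u)" by (intro exI[of _ ?d]) simp
qed

text \<open>Dimension shifting along cosyzygies goes backwards, so the class \<open>Q\<close> is
  closed under predecessors. The shift ends at an injective cosyzygy, where row exactness of the
  matrices takes over.\<close>

lemma exact_col_inj_dim: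
 assumes W: "left_module R W" and id: "inj_dim R W < \<infinity>"
  and Q: "\<And>l m n F G. Q l m n F G ==> mat R m l F \<and> mat R n m G \<and>
   (\<forall>k<n. \<forall>j<l. dot R m (G k) (%i. F i j) = \<zero>\<^sub>R) \<and>
   exact_col (regular (opposite R)) n m l (tr G) (tr F) \<and> (\<exists>p E. Q p l m E F)"
  and "Q l m n F G"
 shows "exact_col W l m n F G"
proof -
 obtain N where "\<exists>I d e. injective_resolution R W I d e \<and> (\<forall>i>N. carrier (I i) = {\<zero>\<^bsub>I i\<^esub>})"
  using id unfolding inj_dim_def by (rule enat_less_Inf)
 then obtain I d e where res: "injective_resolution R W I d e" and N: "\<forall>i>N. carrier (I i) = {\<zero>\<^bsub>I i\<^esub>}"
  by (elim exE conjE)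
 have inj: "injective_module R (I i)" and d: "d i \<in> mod_hom R (I i) (I (Suc i))" for i
  using res by (simp_all add: injective_resolution_def)
 have I: "left_module R (I i)" for i using inj[of i] by (simp add: injective_module_def fg_module_def)
 have e: "e \<in> mod_hom R W (I 0)" "inj_on e (carrier W)"
  "{x \<in> carrier (I 0). d 0 x = \<zero>\<^bsub>I (Suc 0)\<^esub>} = e ` carrier W"
  using res by (simp_all add: injective_resolution_def mod_ker_def)
 define Z where "Z j = (I j)\<lparr>carrier := {x \<in> carrier (I j). d j x = \<zero>\<^bsub>I (Suc j)\<^esub>}\<rparr>" for j
 have Zim: "(I (Suc j))\<lparr>carrier := d j ` carrier (I j)\<rparr> = Z (Suc j)" for j
  using res by (simp add: Z_def injective_resolution_def mod_ker_def)
 have Zex: "exact_col (Z j) l m n F G" if "Q l m n F G" for j l m n F G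
  using that
 proof (induction "N - j" arbitrary: j l m n F G)
  case 0
  \<comment> \<open>For \<open>j\<close> at least \<open>N\<close> the next term is zero, so the
    cosyzygy \<open>Z j\<close> is all of the injective module \<open>I j\<close>.\<close>
  then have "carrier (I (Suc j)) = {\<zero>\<^bsub>I (Suc j)\<^esub>}" using N by simp
  then have "{x \<in> carrier (I j). d j x = \<zero>\<^bsub>I (Suc j)\<^esub>} = carrier (I j)"
   using mod_homD(1)[OF d[of j]] by auto
  then have "Z j = I j" unfolding Z_def by (intro module.equality) simp_all
  then show ?case using exact_col_injective[OF inj[of j]] Q[OF 0(2)] by simp
 next
  case (Suc k)
  have IH: "\<And>l m n F G. Q l m n F G ==> exact_col (Z (Suc j)) l m n F G"
   by (rule Suc.hyps(1)) (use Suc.hyps(2) in simp)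
  obtain p E where q: "Q p l m E F" using Q[OF Suc.prems] by blast
  show ?case
   unfolding Z_def
  proof (rule exact_col_kernel[OF I I d, where p = p and E = E])
   show "exact_col ((I (Suc j))\<lparr>carrier := d j ` carrier (I j)\<rparr>) p l m E F"
    unfolding Zim by (rule IH[OF q])
   show "exact_col (I j) l m n F G" by (rule exact_col_injective[OF inj]) (use Q[OF Suc.prems] in simp_all)
  qed (use Q[OF Suc.prems] Q[OF q] in simp_all)
 qed
 show ?thesis
  unfolding exact_col_def
 proof (intro allI impI, elim conjE)
  fix v assume v: "vec W m v" and Gv: "\<forall>k<n. lincomb W m (G k) v = \<zero>\<^sub>W"
  have mats: "mat R m l F" "mat R n m G" using Q[OF assms(4)] by simp_all
  have im: "e x \<in> carrier (Z 0)" if "x \<in> carrier W" for x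
  proof -
   have "e x \<in> e ` carrier W" using that by simp
   then show ?thesis unfolding e(3)[symmetric] by (simp add: Z_def)
  qed
  have "\<forall>k<n. lincomb (Z 0) m (G k) (%j. e (v j)) = \<zero>\<^bsub>Z 0\<^esub>"
  proof (intro allI impI)
   fix k assume k: "k < n"
   have "e (lincomb W m (G k) v) = lincomb (I 0) m (G k) (%j. e (v j))"
    by (rule mod_hom_lincomb[OF e(1) W I]) (use mats k v in simp_all)
   then show "lincomb (Z 0) m (G k) (%j. e (v j)) = \<zero>\<^bsub>Z 0\<^esub>"
    using Gv k mod_hom_zero[OF e(1) W I] by (simp add: Z_def)
  qed
  \<comment> \<open>The embedding \<open>e\<close> identifies \<open>W\<close> with the cosyzygy
    \<open>Z 0\<close>, over which the system is solvable; the solution is pulled back.\<close>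
  then obtain u where u: "vec (Z 0) l u" "\<forall>j<m. e (v j) = lincomb (Z 0) l (F j) u"
   using exact_colD[OF Zex[OF assms(4), of 0], of "%j. e (v j)"] v im by metis
  obtain x where xc: "vec W l x" and x: "\<forall>j<l. e (x j) = u j"
   by (rule ex_preimages[of l u e "carrier W"]) (use u(1) in \<open>simp_all add: Z_def e(3)[symmetric]\<close>)
  interpret W: left_module R W by (rule W)
  have "v j = lincomb W l (F j) x" if j: "j < m" for j
  proof -
   have "e (lincomb W l (F j) x) = lincomb (I 0) l (F j) (%i. e (x i))"
    by (rule mod_hom_lincomb[OF e(1) W I]) (use mats j xc in simp_all)
   also have "\<dots> = lincomb (I 0) l (F j) u" using x by (intro lincomb_cong) simp_all
   also have "\<dots> = e (v j)" using u(2) j by (simp add: Z_def)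
   finally show ?thesis using e(2) v j mats xc by (intro inj_onD[OF e(2), symmetric]) simp_all
  qed
  then show "\<exists>u. vec W l u \<and> (\<forall>j<m. v j = lincomb W l (F j) u)" using xc by (intro exI[of _ x]) simp
 qed
qed

text \<open>After a column-exact matrix \<open>G\<close> is put in front, torsionlessness asks for
  row exactness at the old start. This is \<open>exact_col_inj_dim\<close> for the transposed
  matrices over the opposite ring, where predecessors are the later matrices of the sequence and
  column exactness plays the part of row exactness.\<close>

theorem Gorenstein_imp_weakly_Gorenstein_mat:
 assumes "left_noetherian R" "left_noetherian (opposite R)" "Gorenstein R"
 shows "weakly_Gorenstein_mat R"
 unfolding weakly_Gorenstein_mat_def torsionless_mat_def
proof (intro allI impI, elim conjE)
 fix n F v
 assume acyc: "acyclic_seq R n F" and v: "vec R (n 0) v"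
  and zero: "\<forall>w. vec R (n 0) w \<and> (\<forall>j<n (Suc 0). dot R (n 0) (F 0 j) w = \<zero>\<^sub>R)
   \<longrightarrow> dot R (n 0) v w = \<zero>\<^sub>R"
 have Rop: "ring (opposite R)" by (rule left_noetherian_ring[OF assms(2)])
 have "mat_seq R n F" "cols_exact (regular R) n F" using acyc by (simp_all add: acyclic_seq_def)
 then obtain m G where seq: "mat_seq R (case_nat m n) (case_nat G F)"
  and cols: "cols_exact (regular R) (case_nat m n) (case_nat G F)"
  by (rule cols_exact_prepend[OF assms(2)])
 let ?n = "case_nat m n" and ?F = "case_nat G F"
 have Gc: "mat R (n 0) m G" using mat_seqD(1)[OF seq, of _ 0] by simp
 have FG: "dot R (n 0) (F 0 k) (%l. G l j) = \<zero>\<^sub>R" if "k < n (Suc 0)" "j < m" for k j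
  using mat_seqD(2)[OF seq, of k 0 j] that by simp
 define Q where "Q a b c A A' \<longleftrightarrow> (\<exists>i. a = ?n (Suc (Suc i)) \<and> b = ?n (Suc i) \<and> c = ?n i \<and>
   A = tr (?F (Suc i)) \<and> A' = tr (?F i))" for a b c A A'
 have "exact_col (regular (opposite R)) (?n (Suc (Suc 0))) (?n (Suc 0)) (?n 0) (tr (?F (Suc 0))) (tr (?F 0))"
 proof (rule exact_col_inj_dim[OF left_module_regular[OF Rop], where Q = Q])
  show "inj_dim (opposite R) (regular (opposite R)) < \<infinity>" using assms(3) by (simp add: Gorenstein_def)
  show "Q (?n (Suc (Suc 0))) (?n (Suc 0)) (?n 0) (tr (?F (Suc 0))) (tr (?F 0))"
   unfolding Q_def by (intro exI[of _ 0]) simp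
  fix a b c A A' assume "Q a b c A A'"
  then obtain i where i: "a = ?n (Suc (Suc i))" "b = ?n (Suc i)" "c = ?n i"
   "A = tr (?F (Suc i))" "A' = tr (?F i)" unfolding Q_def by (elim exE conjE)
  have q: "Q (?n (Suc (Suc (Suc i)))) (?n (Suc (Suc i))) (?n (Suc i)) (tr (?F (Suc (Suc i)))) (tr (?F (Suc i)))"
   unfolding Q_def by (intro exI[of _ "Suc i"]) simp
  have tt: "tr (tr X) = X" for X :: "nat => nat => 'a" by (simp add: tr_def)
  show "mat (opposite R) b a A \<and> mat (opposite R) c b A' \<and>
   (\<forall>k<c. \<forall>j<a. dot (opposite R) b (A' k) (%i. A i j) = \<zero>\<^bsub>opposite R\<^esub>) \<and>
   exact_col (regular (opposite (opposite R))) c b a (tr A') (tr A) \<and> (\<exists>p E. Q p a b E A)"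
   unfolding i tt opposite_opposite'
  proof (intro conjI exI[of _ "?n (Suc (Suc (Suc i)))"] exI[of _ "tr (?F (Suc (Suc i)))"] q)
   show "exact_col (regular R) (?n i) (?n (Suc i)) (?n (Suc (Suc i))) (?F i) (?F (Suc i))"
    using cols unfolding cols_exact_def by (rule spec)
   show "mat (opposite R) (?n (Suc i)) (?n (Suc (Suc i))) (tr (?F (Suc i)))"
    "mat (opposite R) (?n i) (?n (Suc i)) (tr (?F i))"
    using mat_seqD(1)[OF seq] by (simp_all del: nat.case)
   show "\<forall>k<?n i. \<forall>j<?n (Suc (Suc i)). msum (opposite R) (?n (Suc i))
     (%l. tr (?F i) k l \<otimes>\<^bsub>opposite R\<^esub> tr (?F (Suc i)) l j) = \<zero>\<^bsub>opposite R\<^esub>"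
    using mat_seqD(2)[OF seq] by (simp del: nat.case)
  qed
 qed
 then have ex: "exact_col (regular (opposite R)) (n (Suc 0)) (n 0) m (tr (F 0)) (tr G)" by simp
 have "dot R (n 0) v (%k. G k j) = \<zero>\<^sub>R" if "j < m" for j
  using zero Gc FG that by simp
 then obtain u where "vec (regular (opposite R)) (n (Suc 0)) u"
  "\<forall>j<n 0. v j = lincomb (regular (opposite R)) (n (Suc 0)) (tr (F 0) j) u"
  using exact_colD[OF ex, of v] v by (auto simp: lincomb_regular_opposite)
 then show "row_span R (n (Suc 0)) (n 0) (F 0) v"
  by (intro row_spanI[where u = u]) (simp_all add: lincomb_regular_opposite)
qed

section \<open>Vanishing of Tor against acyclic sequences\<close>

text \<open>For a right module \<open>W\<close>: \<open>Tor\<^sub>1(W, Y) = 0\<close> for every semi-Gorenstein-projective \<open>Y\<close> that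
 is a first syzygy, read off a free resolution of \<open>Y\<close>.\<close>

definition tor_vanishing :: "'r ring => ('r, 'v) module => bool" where
 "tor_vanishing R W \<longleftrightarrow> (\<forall>n F. acyclic_seq R n F \<longrightarrow>
  exact_col W (n (Suc (Suc 0))) (n (Suc 0)) (n 0) (tr (F (Suc 0))) (tr (F 0)))"

lemma tor_vanishingD:
 assumes "tor_vanishing R W" "acyclic_seq R n F"
 shows "exact_col W (n (Suc (Suc 0))) (n (Suc 0)) (n 0) (tr (F (Suc 0))) (tr (F 0))"
 using assms by (simp add: tor_vanishing_def)

lemma acyclic_seq_row_mats:
 assumes "acyclic_seq R n F"
 shows "mat (opposite R) (n (Suc 0)) (n (Suc (Suc 0))) (tr (F (Suc 0)))"
  "mat (opposite R) (n 0) (n (Suc 0)) (tr (F 0))"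
  "exact_col (regular (opposite R)) (n (Suc (Suc 0))) (n (Suc 0)) (n 0) (tr (F (Suc 0))) (tr (F 0))"
  "\<forall>k<n 0. \<forall>j<n (Suc (Suc 0)). msum (opposite R) (n (Suc 0))
     (%l. tr (F 0) k l \<otimes>\<^bsub>opposite R\<^esub> tr (F (Suc 0)) l j) = \<zero>\<^bsub>opposite R\<^esub>"
proof -
 have seq: "mat_seq R n F" and rows: "rows_exact (regular (opposite R)) n F"
  using assms by (simp_all add: acyclic_seq_def)
 show "mat (opposite R) (n (Suc 0)) (n (Suc (Suc 0))) (tr (F (Suc 0)))"
  "mat (opposite R) (n 0) (n (Suc 0)) (tr (F 0))"
  using mat_seqD(1)[OF seq] by simp_all
 show "exact_col (regular (opposite R)) (n (Suc (Suc 0))) (n (Suc 0)) (n 0) (tr (F (Suc 0))) (tr (F 0))"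
  using rows by (simp add: rows_exact_def)
 show "\<forall>k<n 0. \<forall>j<n (Suc (Suc 0)). msum (opposite R) (n (Suc 0))
     (%l. tr (F 0) k l \<otimes>\<^bsub>opposite R\<^esub> tr (F (Suc 0)) l j) = \<zero>\<^bsub>opposite R\<^esub>"
  using mat_seqD(2)[OF seq] by simp
qed

lemma tor_vanishing_projective:
 assumes "projective_module (opposite R) W"
 shows "tor_vanishing R W"
 unfolding tor_vanishing_def
proof (intro allI impI)
 fix n F assume a: "acyclic_seq R n F"
 show "exact_col W (n (Suc (Suc 0))) (n (Suc 0)) (n 0) (tr (F (Suc 0))) (tr (F 0))"
  by (rule exact_col_projective[OF assms acyclic_seq_row_mats(1-3)[OF a]])
qed

text \<open>In the dimension shift for rows the successor of a pair lies to the left of the start of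
  the sequence. Weak Gorensteinness supplies it, since every acyclic sequence can be prolonged
  there.\<close>

lemma tor_vanishing_proj_dim:
 assumes "left_noetherian (opposite R)" "weakly_Gorenstein_mat R"
  "left_module (opposite R) W" "proj_dim (opposite R) W < \<infinity>"
 shows "tor_vanishing R W"
 unfolding tor_vanishing_def
proof (intro allI impI)
 fix n F assume a: "acyclic_seq R n F"
 define Q where "Q a b c A A' \<longleftrightarrow> (\<exists>n F. acyclic_seq R n F \<and> a = n (Suc (Suc 0)) \<and> b = n (Suc 0) \<and> c = n 0 \<and>
   A = tr (F (Suc 0)) \<and> A' = tr (F 0))" for a b c A A'
 show "exact_col W (n (Suc (Suc 0))) (n (Suc 0)) (n 0) (tr (F (Suc 0))) (tr (F 0))"
 proof (rule exact_col_proj_dim[OF assms(3,4), where Q = Q])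
  show "Q (n (Suc (Suc 0))) (n (Suc 0)) (n 0) (tr (F (Suc 0))) (tr (F 0))"
   unfolding Q_def by (intro exI[of _ n] exI[of _ F]) (simp add: a)
  fix l m p A A' assume "Q l m p A A'"
  then obtain n F where a: "acyclic_seq R n F" and e: "l = n (Suc (Suc 0))" "m = n (Suc 0)" "p = n 0"
   "A = tr (F (Suc 0))" "A' = tr (F 0)" unfolding Q_def by (elim exE conjE)
  have "torsionless_mat R (n 0) (n (Suc 0)) (F 0)"
   using assms(2) a by (simp add: weakly_Gorenstein_mat_def)
  then obtain q G where G: "acyclic_seq R (case_nat q n) (case_nat G F)"
   by (rule acyclic_seq_prepend[OF assms(1) a])
  have q: "Q (n (Suc 0)) (n 0) q (tr (F 0)) (tr G)"
   unfolding Q_def by (intro exI[of _ "case_nat q n"] exI[of _ "case_nat G F"]) (simp add: G)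
  show "mat (opposite R) m l A \<and> mat (opposite R) p m A' \<and>
   (\<forall>k<p. \<forall>j<l. dot (opposite R) m (A' k) (%i. A i j) = \<zero>\<^bsub>opposite R\<^esub>) \<and>
   exact_col (regular (opposite R)) l m p A A' \<and> (\<exists>p' H. Q m p p' A' H)"
   unfolding e
   by (intro conjI acyclic_seq_row_mats[OF a] exI[of _ q] exI[of _ "tr G"] q)
 qed
qed

lemma acyclic_seq_shift:
 assumes "acyclic_seq R n F"
 shows "acyclic_seq R (%i. n (Suc i)) (%i. F (Suc i))"
 using assms unfolding acyclic_seq_def mat_seq_def cols_exact_def rows_exact_def by simp

lemma tor_vanishing_rows_exact:
 assumes "tor_vanishing R W" "acyclic_seq R n F"
 shows "rows_exact W n F"
 unfolding rows_exact_def
proof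
 fix i
 show "exact_col W (n (Suc (Suc i))) (n (Suc i)) (n i) (tr (F (Suc i))) (tr (F i))"
  using assms(2)
 proof (induction i arbitrary: n F)
  case 0
  show ?case by (rule tor_vanishingD[OF assms(1) 0])
 next
  case (Suc i)
  show ?case using Suc.IH[OF acyclic_seq_shift[OF Suc.prems]] by simp
 qed
qed

section \<open>The dualizing module\<close>

text \<open>An ideal minimal among those not contained in \<open>m\<close> lies in every other
  maximal ideal \<open>n\<close>, as \<open>m\<close> is prime and so does not contain the
  intersection with \<open>n\<close> either. An element \<open>e\<close> of it outside
  \<open>m\<close> has a nonzero class modulo the radical that \<open>m\<close> annihilates, so
  \<open>K / m\<close> embeds in \<open>K / rad K\<close>.\<close>

lemma artinian_maximal_complement:
 assumes "artinian_cring K" "maximalideal m K"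
 obtains e where "e \<in> carrier K" "e \<notin> m" "\<forall>x\<in>m. x \<otimes>\<^sub>K e \<in> jacobson_radical K"
proof -
 interpret cring K using assms(1) by (simp add: artinian_cring_def)
 interpret m: maximalideal m K by fact
 interpret prime: primeideal m K by (rule maximalideal_prime[OF assms(2)])
 let ?S = "{I. ideal I K \<and> \<not> I \<subseteq> m}"
 have "\<not> carrier K \<subseteq> m" using m.I_notcarr m.a_subset by blast
 then have "?S \<noteq> {}" using oneideal by blast
 then obtain I where I: "I \<in> ?S" and min: "\<forall>J\<in>?S. J \<subseteq> I \<longrightarrow> J = I"
  by (rule artinian_minimal_ideal[OF assms(1)]) simp
 then obtain e where e: "e \<in> I" "e \<notin> m" by blast
 interpret I: ideal I K using I by simp
 have ec: "e \<in> carrier K" using I.Icarr[OF e(1)] .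
 have other: "I \<subseteq> n" if n: "maximalideal n K" "n \<noteq> m" for n
 proof -
  interpret n: maximalideal n K by (rule n(1))
  have "\<not> n \<subseteq> m" using n.I_maximal[OF m.is_ideal _ m.a_subset] n(2) m.I_notcarr by blast
  then obtain y where y: "y \<in> n" "y \<notin> m" by blast
  have yc: "y \<in> carrier K" using n.Icarr[OF y(1)] .
  have "e \<otimes>\<^sub>K y \<notin> m" using prime.I_prime[OF ec yc] e(2) y(2) by blast
  moreover have "e \<otimes>\<^sub>K y \<in> I \<inter> n" using I.I_r_closed[OF e(1) yc] n.I_l_closed[OF y(1) ec] by blast
  ultimately have "I \<inter> n \<in> ?S" using i_intersect[OF I.is_ideal n.is_ideal] by blast
  then show ?thesis using min by blast
 qed
 have "x \<otimes>\<^sub>K e \<in> jacobson_radical K" if x: "x \<in> m" for x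
 proof -
  have xc: "x \<in> carrier K" using m.Icarr[OF x] .
  have "x \<otimes>\<^sub>K e \<in> n" if n: "maximalideal n K" for n
  proof (cases "n = m")
   case True
   then show ?thesis using m.I_r_closed[OF x ec] by simp
  next
   case False
   then show ?thesis using other[OF n] I.I_l_closed[OF e(1) xc] by blast
  qed
  then show ?thesis using xc ec by (simp add: jacobson_radical_def)
 qed
 then show ?thesis using ec e(2) by (intro that[of e]) simp_all
qed

lemma jacobson_radical_submodule:
 assumes "cring K"
 shows "submodule (jacobson_radical K) K (regular K)"
proof -
 interpret cring K by fact
 have "x \<oplus>\<^sub>K y \<in> n" if "maximalideal n K" "x \<in> n" "y \<in> n" for x y n
  using that by (meson additive_subgroup.a_closed ideal.axioms(1) maximalideal.axioms(1))
 moreover have "r \<otimes>\<^sub>K x \<in> n" if "maximalideal n K" "x \<in> n" "r \<in> carrier K" for r x n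
  using that by (meson ideal.I_l_closed maximalideal.axioms(1))
 moreover have "\<zero>\<^sub>K \<in> n" if "maximalideal n K" for n
  using that by (meson additive_subgroup.zero_closed ideal.axioms(1) maximalideal.axioms(1))
 ultimately show ?thesis
  by (intro submoduleI[OF left_module_regular[OF ring_axioms]]) (simp_all add: jacobson_radical_def)
qed

text \<open>\<open>J\<close> is a cogenerator: it contains \<open>K / rad K\<close>, in which a copy
  of every simple module is found, and by injectivity a nonzero map on the cyclic module of the
  class of \<open>v\<close> extends.\<close>

lemma dualizing_module_separates:
 assumes K: "artinian_cring K" and J: "dualizing_module K J" and V: "fg_module K V"
  and U: "submodule U K V" and v: "v \<in> carrier V" "v \<notin> U"
 obtains h where "h \<in> mod_hom K V J" "\<forall>x\<in>U. h x = \<zero>\<^sub>J" "h v \<noteq> \<zero>\<^sub>J"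
proof -
 interpret K: cring K using K by (simp add: artinian_cring_def)
 have lmV: "left_module K V" by (rule left_module_if_fg[OF V])
 interpret V: left_module K V by (rule lmV)
 have injJ: "injective_module K J" using J by (simp add: dualizing_module_def injective_envelope_def)
 have lmJ: "left_module K J" using injJ by (simp add: injective_module_def fg_module_def)
 note rad = jacobson_radical_submodule[OF K.cring_axioms]
 have lmK: "left_module K (regular K)" by (rule left_module_regular[OF K.ring_axioms])
 let ?r = "jacobson_radical K"
 let ?Q = "quot_module (regular K) ?r" and ?W = "quot_module V U"
 have lmQ: "left_module K ?Q" by (rule left_module_quot[OF rad lmK])
 have lmW: "left_module K ?W" and fgW: "fg_module K ?W" by (rule left_module_quot[OF U lmV], rule quot_fg[OF U lmV V])
 interpret W: left_module K ?W by (rule lmW)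
 obtain \<iota> where \<iota>: "\<iota> \<in> mod_hom K ?Q J" "inj_on \<iota> (carrier ?Q)"
  using J unfolding dualizing_module_def injective_envelope_def by blast
 note p = quot_proj[OF U lmV]
 define w where "w = U +>\<^sub>V v"
 have wc: "w \<in> carrier ?W" using mod_homD(1)[OF p v(1)] v(1) by (simp add: w_def)
 have "w \<noteq> \<zero>\<^bsub>?W\<^esub>"
  using coset_eq_iff[OF U lmV v(1) V.M.zero_closed] v V.M.diff_zero[OF v(1)] unfolding quot_zero[OF U lmV] w_def by simp
 \<comment> \<open>The annihilator of the class of \<open>v\<close> is proper because this class is
   nonzero. A maximal ideal above it selects the simple module through which the cyclic module is
   mapped to \<open>J\<close>.\<close>
 let ?a = "{k \<in> carrier K. k \<odot>\<^bsub>?W\<^esub> w = \<zero>\<^bsub>?W\<^esub>}"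
 have "submodule ?a K (regular K)"
  by (rule submoduleI[OF lmK]) (use wc in \<open>auto simp: W.smult_l_distr W.smult_assoc1\<close>)
 then have "ideal ?a K" using submodule_regular_iff_ideal[OF K.cring_axioms] by blast
 moreover have "\<one>\<^sub>K \<notin> ?a" using W.smult_one[OF wc] \<open>w \<noteq> \<zero>\<^bsub>?W\<^esub>\<close> by simp
 ultimately obtain m where m: "maximalideal m K" "?a \<subseteq> m" by (rule K.ex_maximalideal)
 interpret m: maximalideal m K by (rule m(1))
 obtain e where e: "e \<in> carrier K" "e \<notin> m" "\<forall>x\<in>m. x \<otimes>\<^sub>K e \<in> ?r"
  by (rule artinian_maximal_complement[OF K m(1)])
 have er: "e \<notin> ?r" using e(2) m(1) by (auto simp: jacobson_radical_def)
 note q = quot_proj[OF rad lmK]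
 have q0: "?r +>\<^bsub>regular K\<^esub> x = \<zero>\<^bsub>?Q\<^esub> \<longleftrightarrow> x \<in> ?r" if "x \<in> carrier K" for x
  using coset_eq_iff[OF rad lmK, of x "\<zero>\<^sub>K"] that K.diff_zero[OF that]
  unfolding quot_zero[OF rad lmK] by (simp add: a_minus_def)
 let ?q = "\<lambda>x\<in>carrier (regular K). ?r +>\<^bsub>regular K\<^esub> x"
 \<comment> \<open>The map sends \<open>k\<close> to the class of \<open>k e\<close> modulo the
   radical, embedded in \<open>J\<close>. By the choice of \<open>e\<close> it kills
   \<open>m\<close>, hence the annihilator, but it does not kill one.\<close>
 define \<theta> where "\<theta> = (\<lambda>k\<in>carrier K. \<iota> (?q (k \<otimes>\<^sub>K e)))"
 have "restrict (%k. \<iota> (?q (k \<otimes>\<^sub>K e))) (carrier (regular K)) \<in> mod_hom K (regular K) J"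
 proof (rule mod_hom_restrictI[OF lmK])
  fix k assume "k \<in> carrier (regular K)"
  then have k: "k \<otimes>\<^sub>K e \<in> carrier (regular K)" "k \<in> carrier K" using e(1) by simp_all
  note qk = mod_homD(1)[OF q k(1)]
  show "\<iota> (?q (k \<otimes>\<^sub>K e)) \<in> carrier J" by (rule mod_homD(1)[OF \<iota>(1) qk])
  {
   fix l assume "l \<in> carrier (regular K)"
   then have l: "l \<otimes>\<^sub>K e \<in> carrier (regular K)" "l \<in> carrier K" using e(1) by simp_all
   show "\<iota> (?q ((k \<oplus>\<^bsub>regular K\<^esub> l) \<otimes>\<^sub>K e)) = \<iota> (?q (k \<otimes>\<^sub>K e)) \<oplus>\<^sub>J \<iota> (?q (l \<otimes>\<^sub>K e))"
    using mod_homD(2)[OF q k(1) l(1)] mod_homD(2)[OF \<iota>(1) qk mod_homD(1)[OF q l(1)]] k l e(1)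
    by (simp add: K.l_distr)
  next
   fix r assume r: "r \<in> carrier K"
   show "\<iota> (?q ((r \<odot>\<^bsub>regular K\<^esub> k) \<otimes>\<^sub>K e)) = r \<odot>\<^sub>J \<iota> (?q (k \<otimes>\<^sub>K e))"
    using mod_homD(3)[OF q r k(1)] mod_homD(3)[OF \<iota>(1) r qk] k r e(1) by (simp add: K.m_assoc)
  }
 qed
 then have \<theta>: "\<theta> \<in> mod_hom K (regular K) J" by (simp add: \<theta>_def)
 have \<theta>m: "\<theta> k = \<zero>\<^sub>J" if "k \<in> m" for k
 proof -
  have kc: "k \<in> carrier K" by (rule m.Icarr[OF that])
  have "?q (k \<otimes>\<^sub>K e) = \<zero>\<^bsub>?Q\<^esub>" using e kc that q0[of "k \<otimes>\<^sub>K e"] by simp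
  then show ?thesis using kc mod_hom_zero[OF \<iota>(1) lmQ lmJ] by (simp only: \<theta>_def restrict_apply if_True)
 qed
 have \<theta>1: "\<theta> \<one>\<^sub>K \<noteq> \<zero>\<^sub>J"
 proof
  assume "\<theta> \<one>\<^sub>K = \<zero>\<^sub>J"
  then have "\<iota> (?q e) = \<iota> \<zero>\<^bsub>?Q\<^esub>" using e(1) mod_hom_zero[OF \<iota>(1) lmQ lmJ] by (simp add: \<theta>_def)
  moreover have "?q e \<in> carrier ?Q" using mod_homD(1)[OF q, of e] e(1) by simp
  moreover have "\<zero>\<^bsub>?Q\<^esub> \<in> carrier ?Q" using abelian_group.axioms(1)[OF left_module.axioms(2)[OF lmQ]] by (rule abelian_monoid.zero_closed)
  ultimately have "?q e = \<zero>\<^bsub>?Q\<^esub>" by (rule inj_onD[OF \<iota>(2)])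
  then show False using q0[OF e(1)] e(1) er by simp
 qed
 let ?\<phi> = "\<lambda>k\<in>carrier (regular K). k \<odot>\<^bsub>?W\<^esub> w"
 have \<phi>: "?\<phi> \<in> mod_hom K (regular K) ?W"
  by (rule mod_hom_restrictI[OF lmK]) (use wc in \<open>simp_all add: W.smult_l_distr W.smult_assoc1\<close>)
 have ker: "\<theta> k = \<zero>\<^sub>J" if "k \<in> carrier (regular K)" "?\<phi> k = \<zero>\<^bsub>?W\<^esub>" for k
  using that m(2) by (intro \<theta>m) auto
 obtain f where f: "f \<in> mod_hom K (?W\<lparr>carrier := ?\<phi> ` carrier (regular K)\<rparr>) J" "\<forall>k\<in>carrier (regular K). f (?\<phi> k) = \<theta> k"
  by (rule mod_hom_factor[OF lmK lmW lmJ \<phi> \<theta> ker])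
 let ?X = "?W\<lparr>carrier := ?\<phi> ` carrier (regular K)\<rparr>"
 have fgX: "fg_module K ?X" by (rule image_fg_module[OF \<phi> fg_module_regular[OF K.ring_axioms] lmW])
 have incl: "(\<lambda>x\<in>carrier ?X. x) \<in> mod_hom K ?X ?W"
  by (rule mod_hom_restrictI[OF left_module_if_fg[OF fgX]]) (use wc in auto)
 have inj: "inj_on (\<lambda>x\<in>carrier ?X. x) (carrier ?X)" by (simp add: inj_on_def)
 obtain h where h: "h \<in> mod_hom K ?W J" "\<forall>x\<in>carrier ?X. h ((\<lambda>x\<in>carrier ?X. x) x) = f x"
  by (rule injective_extend[OF injJ fgX fgW incl inj f(1)])
 let ?h = "\<lambda>x\<in>carrier V. h ((\<lambda>x\<in>carrier V. U +>\<^sub>V x) x)"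
 have h': "?h \<in> mod_hom K V J" by (rule mod_hom_compose[OF p h(1) lmV])
 have "?h x = \<zero>\<^sub>J" if x: "x \<in> U" for x
 proof -
  have xc: "x \<in> carrier V" using x submoduleD(1)[OF U] by blast
  have "U +>\<^sub>V x = \<zero>\<^bsub>?W\<^esub>"
   using coset_eq_iff[OF U lmV xc V.M.zero_closed] x V.M.diff_zero[OF xc] unfolding quot_zero[OF U lmV] by simp
  then show ?thesis using xc mod_hom_zero[OF h(1) lmW lmJ] by (simp only: restrict_apply if_True)
 qed
 moreover have "?h v \<noteq> \<zero>\<^sub>J"
 proof -
  have 1: "?\<phi> \<one>\<^sub>K = w" using W.smult_one[OF wc] by simp
  have "w \<in> ?\<phi> ` carrier (regular K)" by (rule image_eqI[where x = "\<one>\<^sub>K"], rule 1[symmetric]) simp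
  then have wX: "w \<in> carrier ?X" by simp
  have "h w = f w" using h(2)[rule_format, OF wX] wX by (simp only: restrict_apply if_True)
  also have "f w = \<theta> \<one>\<^sub>K" using f(2)[rule_format, of "\<one>\<^sub>K"] unfolding 1 by simp
  finally have "h w = \<theta> \<one>\<^sub>K" .
  then show ?thesis using v(1) \<theta>1 by (simp add: w_def)
 qed
 ultimately show ?thesis using h' by (intro that[of ?h]) simp_all
qed

section \<open>Powers of a module and Tor against the standard dual\<close>

lemma msum_power: "i < n ==> msum (power_module V n) m f i = msum V m (%j. f j i)"
 by (induction m) simp_all

definition single :: "('r, 'v) module => nat => nat => 'v => nat => 'v" where
 "single V n j x = (\<lambda>i\<in>{..<n}. if i = j then x else \<zero>\<^sub>V)"

lemma single_closed [simp]: "left_module R V ==> x \<in> carrier V ==> single V n j x \<in> carrier (power_module V n)"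
 using abelian_monoid.zero_closed[OF abelian_group.axioms(1)[OF left_module.axioms(2)]] by (auto simp: single_def)

lemma power_decomp:
 assumes "left_module R V" "v \<in> carrier (power_module V n)"
 shows "msum (power_module V n) n (%j. single V n j (v j)) = v"
proof (rule PiE_ext[of _ "{..<n}" "%_. carrier V"])
 interpret V: left_module R V by fact
 interpret P: left_module R "power_module V n" by (rule left_module_fun[OF assms(1)])
 have v: "v j \<in> carrier V" if "j < n" for j using assms(2) that by auto
 have "msum (power_module V n) n (%j. single V n j (v j)) \<in> carrier (power_module V n)"
  by (rule P.M.msum_closed) (rule single_closed[OF assms(1) v])
 then show "msum (power_module V n) n (%j. single V n j (v j)) \<in> {..<n} \<rightarrow>\<^sub>E carrier V" by simp
 fix i assume "i \<in> {..<n}"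
 then have i: "i < n" by simp
 have "msum (power_module V n) n (%j. single V n j (v j)) i = msum V n (%j. if j = i then v i else \<zero>\<^sub>V)"
  unfolding msum_power[OF i] by (rule msum_cong) (use i in \<open>auto simp: single_def\<close>)
 then show "msum (power_module V n) n (%j. single V n j (v j)) i = v i" using i v by (simp add: V.M.msum_single)
qed (use assms(2) in simp)

lemma single_hom:
 assumes "left_module R V"
 shows "(\<lambda>x\<in>carrier V. single V n j x) \<in> mod_hom R V (power_module V n)"
proof -
 interpret V: left_module R V by fact
 show ?thesis
  by (rule mod_hom_restrictI[OF assms]) (simp_all add: single_closed[OF assms, simplified], auto simp: single_def fun_eq_iff)
qed

lemma fg_module_power:
 assumes "fg_module R V"
 shows "fg_module R (power_module V n)"
proof -
 let ?P = "power_module V n"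
 have lmV: "left_module R V" by (rule left_module_if_fg[OF assms])
 have lmP: "left_module R ?P" by (rule left_module_fun[OF lmV])
 interpret P: left_module R ?P by (rule lmP)
 obtain m g where g: "spans R V (carrier V) m g" by (rule fg_module_spans[OF assms])
 have gc: "g k \<in> carrier V" if "k < m" for k using spansD(1)[OF g that] .
 let ?S = "(%(j, k). single V n j (g k)) ` ({..<n} \<times> {..<m})"
 have "H = carrier ?P" if H: "submodule H R ?P" and S: "?S \<subseteq> H" for H
 proof
  show "H \<subseteq> carrier ?P" by (rule submoduleD(1)[OF H])
  have single: "single V n j x \<in> H" if j: "j < n" and x: "x \<in> carrier V" for j x
  proof -
   obtain c where c: "vec R m c" "x = lincomb V m c g" by (rule spansE[OF g x])
   have "single V n j x = lincomb ?P m c (%k. single V n j (g k))"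
    using mod_hom_lincomb[OF single_hom[OF lmV, of n j] lmV lmP, of m c g] c gc x by (simp cong: lincomb_cong)
   then show ?thesis using c S j by (auto intro!: submodule_lincomb[OF H])
  qed
  show "carrier ?P \<subseteq> H"
  proof
   fix v assume v: "v \<in> carrier ?P"
   have "msum ?P n (%j. single V n j (v j)) \<in> H"
    by (rule P.M.msum_subset_closed[OF submoduleD(2,3)[OF H]]) (use single v in auto)
   then show "v \<in> H" unfolding power_decomp[OF lmV v] .
  qed
 qed
 moreover have "?S \<subseteq> carrier ?P" using single_closed[OF lmV gc] by auto
 ultimately show ?thesis unfolding fg_module_def
  by (intro conjI exI[of _ ?S] allI impI lmP) auto
qed

lemma standard_dual_simps [simp]:
 "carrier (standard_dual K \<eta> J N) = mod_hom K (restrict_scalars \<eta> N) J"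
 "\<zero>\<^bsub>standard_dual K \<eta> J N\<^esub> = (\<lambda>x\<in>carrier N. \<zero>\<^sub>J)"
 "f \<oplus>\<^bsub>standard_dual K \<eta> J N\<^esub> g = (\<lambda>x\<in>carrier N. f x \<oplus>\<^sub>J g x)"
 "r \<odot>\<^bsub>standard_dual K \<eta> J N\<^esub> f = (\<lambda>x\<in>carrier N. f (r \<odot>\<^sub>N x))"
 by (simp_all add: standard_dual_def hom_module_def hom_group_def)

lemma lincomb_standard_dual:
 "x \<in> carrier N ==> lincomb (standard_dual K \<eta> J N) m a w x = msum J m (%i. w i (a i \<odot>\<^sub>N x))"
 by (induction m) simp_all

lemma msum_restrict_scalars [simp]: "msum (restrict_scalars \<eta> N) n f = msum N n f"
 by (induction n) simp_all

text \<open>An elementwise form of the duality between Ext into \<open>D(N)\<close> and Tor with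
  \<open>N\<close>. A row outside the image of \<open>F (Suc 0)\<close> would be separated from it
  by a map \<open>h\<close> to \<open>J\<close>. The components of \<open>h\<close> are a column
  over the dual killed by \<open>F (Suc 0)\<close>; as Ext in degree one vanishes, this column is
  \<open>F 0\<close> times a column \<open>u\<close>, so \<open>h\<close> vanishes on rows killed by
  \<open>F 0\<close>.\<close>

lemma tor_vanishing_dual:
 fixes B :: "'b ring"
 assumes B: "artin_algebra_over K \<eta> B" and J: "dualizing_module K J" and N: "fg_module (opposite B) N"
  and D: "standard_dual K \<eta> J N \<in> right_perp B (left_perp B (regular B) :: 'b small_module set)"
 shows "tor_vanishing B N"
 unfolding tor_vanishing_def
proof (intro allI impI)
 fix n F assume F: "acyclic_seq B n F"
 have seq: "mat_seq B n F" and cols: "cols_exact (regular B) n F"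
  and rows: "rows_exact (regular (opposite B)) n F" using F by (simp_all add: acyclic_seq_def)
 have K: "artinian_cring K" and rB: "ring B" and \<eta>: "\<eta> \<in> ring_hom K B" using B by (simp_all add: artin_algebra_over_def)
 have central: "\<eta> k \<otimes>\<^sub>B b = b \<otimes>\<^sub>B \<eta> k" if "k \<in> carrier K" "b \<in> carrier B" for k b
  using B that by (simp add: artin_algebra_over_def)
 have rK: "ring K" using K by (simp add: artinian_cring_def cring.axioms(1))
 let ?D = "standard_dual K \<eta> J N" and ?N = "restrict_scalars \<eta> N"
 note res = mat_resolution_coker[OF rB seq rows]
 let ?Y = "coker_rows B (n (Suc 0)) (n 0) (F 0)"
 have lmY: "left_module B ?Y" by (rule coker_rows_left_module[OF rB]) (use mat_seqD(1)[OF seq, of _ 0] in simp)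
 interpret Y: matrix_resolution B ?Y n "%i. coset B (n 0) {v \<in> carrier (free_module B (n 0)). row_span B (n (Suc 0)) (n 0) (F 0) v} (unit_vec B i)" F
  by (intro matrix_resolution.intro lmY matrix_resolution_axioms.intro res)
 have "?Y \<in> left_perp B (regular B)"
  using Y.semi_Gorenstein_projective_iff cols by (simp add: semi_Gorenstein_projective_def)
 then have "\<forall>i\<ge>1. trivial_group (Ext B i ?Y ?D)" using D unfolding right_perp_def by blast
 moreover have lmD: "left_module B ?D" using D by (simp add: right_perp_def fg_module_def)
 ultimately have Dcols: "cols_exact ?D n F" using Y.Ext_vanish_iff_cols_exact[OF lmD] by blast
 have lmN: "left_module (opposite B) N" by (rule left_module_if_fg[OF N])
 interpret N: left_module "opposite B" N by (rule lmN)
 have fgN: "fg_module K ?N" by (rule fg_module_restrict_scalars[OF artin_algebra_over_opposite[OF B] N])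
 have lmKN: "left_module K ?N" by (rule left_module_if_fg[OF fgN])
 interpret KN: left_module K ?N by (rule lmKN)
 have \<eta>c: "\<eta> k \<in> carrier B" if "k \<in> carrier K" for k by (rule ring_hom_closed[OF \<eta> that])
 have lmJ: "left_module K J"
  using J by (simp add: dualizing_module_def injective_envelope_def injective_module_def fg_module_def)
 interpret J: left_module K J by (rule lmJ)
 let ?a = "n 0" and ?b = "n (Suc 0)" and ?c = "n (Suc (Suc 0))"
 let ?P = "power_module ?N ?b"
 have lmP: "left_module K ?P" by (rule left_module_fun[OF lmKN])
 interpret P: left_module K ?P by (rule lmP)
 have F0: "F 0 j k \<in> carrier B" if "j < ?b" "k < ?a" for j k by (rule mat_seqD(1)[OF seq]) (use that in simp_all)
 have F1: "F (Suc 0) l j \<in> carrier B" if "l < ?c" "j < ?b" for l j by (rule mat_seqD(1)[OF seq]) (use that in simp_all)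
 \<comment> \<open>\<open>im u\<close> is the row \<open>u\<close> times \<open>F (Suc 0)\<close>,
   restricted so as to be an element of the power module. The base ring acts centrally, which makes
   the set \<open>?U\<close> of all these a submodule over \<open>K\<close>.\<close>
 define im where "im u = (\<lambda>j\<in>{..<?b}. lincomb N ?c (%l. F (Suc 0) l j) u)" for u
 have im_closed: "im u \<in> carrier ?P" if "vec N ?c u" for u using that F1 by (auto simp: im_def)
 let ?U = "{im u | u. vec N ?c u}"
 have comm: "\<eta> r \<odot>\<^sub>N (b \<odot>\<^sub>N x) = b \<odot>\<^sub>N (\<eta> r \<odot>\<^sub>N x)"
  if "r \<in> carrier K" "b \<in> carrier B" "x \<in> carrier N" for r b x
  using that central[of r b] N.smult_assoc1[of "\<eta> r" b x] N.smult_assoc1[of b "\<eta> r" x] \<eta>c by simp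
 have U: "submodule ?U K ?P"
 proof (rule submoduleI[OF lmP])
  show "?U \<subseteq> carrier ?P" using im_closed by blast
  have "\<zero>\<^bsub>?P\<^esub> = im (%_. \<zero>\<^sub>N)" by (rule ext) (auto simp: im_def F1)
  then show "\<zero>\<^bsub>?P\<^esub> \<in> ?U" by (intro CollectI exI[of _ "%_. \<zero>\<^sub>N"]) simp
 next
  fix x y assume "x \<in> ?U" "y \<in> ?U"
  then obtain u w where u: "vec N ?c u" "x = im u" and w: "vec N ?c w" "y = im w" by blast
  have "x \<oplus>\<^bsub>?P\<^esub> y = im (%l. u l \<oplus>\<^sub>N w l)"
   by (rule ext) (use u w F1 in \<open>simp add: im_def N.lincomb_add_right\<close>)
  then show "x \<oplus>\<^bsub>?P\<^esub> y \<in> ?U" by (intro CollectI exI[of _ "%l. u l \<oplus>\<^sub>N w l"]) (simp add: u w)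
 next
  fix r x assume r: "r \<in> carrier K" and "x \<in> ?U"
  then obtain u where u: "vec N ?c u" "x = im u" by blast
  have "r \<odot>\<^bsub>?P\<^esub> x = im (%l. \<eta> r \<odot>\<^sub>N u l)"
  proof (rule ext)
   fix j show "(r \<odot>\<^bsub>?P\<^esub> x) j = im (%l. \<eta> r \<odot>\<^sub>N u l) j"
    using u F1 r by (simp add: im_def lincomb_def N.smult_msum \<eta>c comm cong: msum_cong)
  qed
  then show "r \<odot>\<^bsub>?P\<^esub> x \<in> ?U" using u r by (intro CollectI exI[of _ "%l. \<eta> r \<odot>\<^sub>N u l"]) (simp add: \<eta>c)
 qed
 show "exact_col N ?c ?b ?a (tr (F (Suc 0))) (tr (F 0))"
  unfolding exact_col_def
 proof (intro allI impI, elim conjE)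
  fix v assume v: "vec N ?b v" and zero: "\<forall>k<?a. lincomb N ?b (tr (F 0) k) v = \<zero>\<^sub>N"
  have vP: "restrict v {..<?b} \<in> carrier ?P" using v by simp
  have "restrict v {..<?b} \<in> ?U"
  proof (rule ccontr)
   assume nU: "restrict v {..<?b} \<notin> ?U"
   obtain h where h: "h \<in> mod_hom K ?P J" "\<forall>x\<in>?U. h x = \<zero>\<^sub>J" "h (restrict v {..<?b}) \<noteq> \<zero>\<^sub>J"
    by (rule dualizing_module_separates[OF K J fg_module_power[OF fgN] U vP nU])
   let ?e = "%j. single ?N ?b j"
   note ec = single_closed[OF lmKN, of _ ?b]
   have he: "h x = msum J ?b (%j. h (?e j (x j)))" if x: "x \<in> carrier ?P" for x
   proof -
    have "h (msum ?P ?b (%j. ?e j (x j))) = msum J ?b (%j. h (?e j (x j)))"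
     by (rule msum_hom[where f = h, OF P.M.abelian_group_axioms mod_hom_zero[OF h(1) lmP lmJ] mod_homD(2)[OF h(1)]])
      (use x in \<open>auto intro!: ec[simplified]\<close>)
    then show ?thesis unfolding power_decomp[OF lmKN x] .
   qed
   \<comment> \<open>The components of \<open>h\<close> along the embeddings of the factors; as
     elements of the dual they form a column.\<close>
   define w where "w j = (\<lambda>x\<in>carrier N. h (?e j x))" for j
   have w: "w j \<in> mod_hom K ?N J" for j
    using mod_hom_compose[OF single_hom[OF lmKN, of ?b j] h(1) lmKN] by (simp add: w_def cong: restrict_cong)
   have "lincomb ?D ?b (F (Suc 0) l) w = \<zero>\<^bsub>?D\<^esub>" if l: "l < ?c" for l
   proof -
    have "lincomb ?D ?b (F (Suc 0) l) w x = \<zero>\<^sub>J" if x: "x \<in> carrier N" for x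
    proof -
     let ?y = "\<lambda>j\<in>{..<?b}. F (Suc 0) l j \<odot>\<^sub>N x"
     have "lincomb ?D ?b (F (Suc 0) l) w x = msum J ?b (%j. h (?e j (?y j)))"
      unfolding lincomb_standard_dual[OF x] by (rule msum_cong) (use x l F1 in \<open>simp add: w_def\<close>)
     also have "\<dots> = h ?y" by (rule he[of ?y, symmetric]) (use x l F1 in simp)
     \<comment> \<open>Rows with the single entry \<open>x\<close> at place \<open>l\<close> realise
       \<open>?y\<close> as an element of \<open>?U\<close>, on which \<open>h\<close> is
       zero.\<close>
     also have "?y = im (%i. if i = l then x else \<zero>\<^sub>N)"
     proof (rule ext)
      fix j
      have "lincomb N ?c (%i. F (Suc 0) i j) (%i. if i = l then x else \<zero>\<^sub>N) = F (Suc 0) l j \<odot>\<^sub>N x" if j: "j < ?b"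
      proof -
       have "lincomb N ?c (%i. F (Suc 0) i j) (%i. if i = l then x else \<zero>\<^sub>N)
        = msum N ?c (%i. if i = l then F (Suc 0) l j \<odot>\<^sub>N x else \<zero>\<^sub>N)"
        unfolding lincomb_def by (rule msum_cong) (use F1 j in simp)
       then show ?thesis using N.M.msum_single[OF l] F1[OF l j] x by simp
      qed
      then show "?y j = im (%i. if i = l then x else \<zero>\<^sub>N) j" by (simp add: im_def)
     qed
     also have "h \<dots> = \<zero>\<^sub>J"
      by (rule bspec[OF h(2)], intro CollectI exI[of _ "%i. if i = l then x else \<zero>\<^sub>N"]) (simp add: x)
     finally show ?thesis .
    qed
    moreover have "lincomb ?D ?b (F (Suc 0) l) w \<in> carrier ?D"
     by (rule left_module.lincomb_closed[OF lmD]) (use F1 l w in simp_all)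
    ultimately show ?thesis
     using mod_homD(4)[of "lincomb ?D ?b (F (Suc 0) l) w" K ?N J] by (intro ext) simp
   qed
   then obtain u where u: "vec ?D ?a u" "\<forall>j<?b. w j = lincomb ?D ?a (F 0 j) u"
    using exact_colD[of ?D ?a ?b ?c "F 0" "F (Suc 0)" w] Dcols w unfolding cols_exact_def
    by (metis standard_dual_simps(1))
   have uk: "u k \<in> mod_hom K ?N J" if "k < ?a" for k using u(1) that by simp
   have "h (restrict v {..<?b}) = msum J ?b (%j. msum J ?a (%k. u k (F 0 j k \<odot>\<^sub>N v j)))"
   proof -
    have "h (restrict v {..<?b}) = msum J ?b (%j. h (?e j (restrict v {..<?b} j)))"
     by (rule he) (use v in simp)
    also have "\<dots> = msum J ?b (%j. w j (v j))" by (rule msum_cong) (use v in \<open>simp add: w_def\<close>)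
    also have "\<dots> = msum J ?b (%j. msum J ?a (%k. u k (F 0 j k \<odot>\<^sub>N v j)))"
     by (rule msum_cong) (use u v in \<open>simp add: lincomb_standard_dual\<close>)
    finally show ?thesis .
   qed
   \<comment> \<open>With the sums exchanged, each \<open>u k\<close> is applied to an entry of
     \<open>v\<close> times \<open>F 0\<close>, which is zero.\<close>
   also have "\<dots> = msum J ?a (%k. msum J ?b (%j. u k (F 0 j k \<odot>\<^sub>N v j)))"
    by (rule J.M.msum_swap) (use F0 v mod_homD(1)[OF uk] in simp)
   also have "\<dots> = msum J ?a (%k. \<zero>\<^sub>J)"
   proof (rule msum_cong)
    fix k assume k: "k < ?a"
    have "msum J ?b (%j. u k (F 0 j k \<odot>\<^sub>N v j)) = u k (msum ?N ?b (%j. F 0 j k \<odot>\<^sub>N v j))"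
     by (rule msum_hom[OF KN.M.abelian_group_axioms, symmetric])
      (use mod_hom_zero[OF uk[OF k] lmKN lmJ] mod_homD(2)[OF uk[OF k]] F0 k v in simp_all)
    moreover have "msum ?N ?b (%j. F 0 j k \<odot>\<^sub>N v j) = lincomb N ?b (tr (F 0) k) v"
     by (simp add: lincomb_def)
    ultimately show "msum J ?b (%j. u k (F 0 j k \<odot>\<^sub>N v j)) = \<zero>\<^sub>J"
     using zero k mod_hom_zero[OF uk[OF k] lmKN lmJ] by simp
   qed
   finally show False using h(3) by simp
  qed
  then obtain u where u: "vec N ?c u" "restrict v {..<?b} = im u" by blast
  have "v j = lincomb N ?c (tr (F (Suc 0)) j) u" if "j < ?b" for j
   using fun_cong[OF u(2), of j] that by (simp add: im_def tr_def)
  then show "\<exists>u. vec N ?c u \<and> (\<forall>j<?b. v j = lincomb N ?c (tr (F (Suc 0)) j) u)"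
   using u(1) by (intro exI[of _ u]) simp
 qed
qed

section \<open>Matrices over the triangular ring\<close>

lemma left_part_simps [simp]:
 "carrier (left_part M) = carrier M" "\<zero>\<^bsub>left_part M\<^esub> = \<zero>\<^sub>M" "add (left_part M) = add M"
 "smult (left_part M) = smult M"
 by (simp_all add: left_part_def module.defs)

lemma right_part_simps [simp]:
 "carrier (right_part M) = carrier M" "\<zero>\<^bsub>right_part M\<^esub> = \<zero>\<^sub>M" "add (right_part M) = add M"
 "b \<odot>\<^bsub>right_part M\<^esub> x = rsmult M x b"
 by (simp_all add: right_part_def)

lemma a_inv_part [simp]: "\<ominus>\<^bsub>left_part M\<^esub> x = \<ominus>\<^sub>M x" "\<ominus>\<^bsub>right_part M\<^esub> x = \<ominus>\<^sub>M x"
 by (simp_all add: a_inv_def m_inv_def)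

lemma msum_part [simp]: "msum (left_part M) n f = msum M n f" "msum (right_part M) n f = msum M n f"
 by (induction n) simp_all

lemma triangular_ring_simps [simp]:
 "carrier (triangular_ring A B M) = carrier A \<times> carrier M \<times> carrier B"
 "\<zero>\<^bsub>triangular_ring A B M\<^esub> = (\<zero>\<^sub>A, \<zero>\<^sub>M, \<zero>\<^sub>B)"
 "\<one>\<^bsub>triangular_ring A B M\<^esub> = (\<one>\<^sub>A, \<zero>\<^sub>M, \<one>\<^sub>B)"
 "(a, m, b) \<oplus>\<^bsub>triangular_ring A B M\<^esub> (a', m', b') = (a \<oplus>\<^sub>A a', m \<oplus>\<^sub>M m', b \<oplus>\<^sub>B b')"
 "(a, m, b) \<otimes>\<^bsub>triangular_ring A B M\<^esub> (a', m', b') =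
  (a \<otimes>\<^sub>A a', a \<odot>\<^sub>M m' \<oplus>\<^sub>M rsmult M m b', b \<otimes>\<^sub>B b')"
 by (simp_all add: triangular_ring_def)

lemma msum_triangular:
 "msum (triangular_ring A B M) n f =
  (msum A n (%i. fst (f i)), msum M n (%i. fst (snd (f i))), msum B n (%i. snd (snd (f i))))"
proof (induction n)
 case (Suc n)
 then show ?case by (cases "f n") simp
qed simp

definition comp_A :: "(nat => nat => nat => 'a \<times> 'm \<times> 'b) => nat => nat => nat => 'a" where
 "comp_A F = (%i j k. fst (F i j k))"

definition comp_M :: "(nat => nat => nat => 'a \<times> 'm \<times> 'b) => nat => nat => nat => 'm" where
 "comp_M F = (%i j k. fst (snd (F i j k)))"

definition comp_B :: "(nat => nat => nat => 'a \<times> 'm \<times> 'b) => nat => nat => nat => 'b" where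
 "comp_B F = (%i j k. snd (snd (F i j k)))"

locale triangular =
 fixes A :: "'a ring" and B :: "'b ring" and M :: "('a, 'b, 'm) bimodule"
 assumes A: "ring A" and B: "ring B" and bimodule: "is_bimodule A B M"
begin

abbreviation "\<Lambda> \<equiv> triangular_ring A B M"
abbreviation "L \<equiv> left_part M"
abbreviation "N \<equiv> right_part M"

sublocale A: ring A by (rule A)
sublocale B: ring B by (rule B)
sublocale L: left_module A L using bimodule by (simp add: is_bimodule_def)
sublocale N: left_module "opposite B" N using bimodule by (simp add: is_bimodule_def)

text \<open>\<open>L\<close> and \<open>N\<close> are two records on the same additive group.
  Stating the group axioms for \<open>M\<close> itself gives sums of left and right combinations a
  common normal form.\<close>

lemma abelian_group_M: "abelian_group M"
proof (rule abelian_groupI)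
 fix x assume "x \<in> carrier M"
 then show "\<exists>y\<in>carrier M. y \<oplus>\<^sub>M x = \<zero>\<^sub>M" using L.M.l_neg[of x] L.M.a_inv_closed[of x] by auto
qed (use L.M.a_closed L.M.zero_closed L.M.a_assoc L.M.a_comm L.M.l_zero in simp_all)

sublocale M: abelian_group M by (rule abelian_group_M)

lemma M_smult_closed [simp]:
 "a \<in> carrier A ==> x \<in> carrier M ==> a \<odot>\<^sub>M x \<in> carrier M"
 "b \<in> carrier B ==> x \<in> carrier M ==> rsmult M x b \<in> carrier M"
 using L.smult_closed[of a x] N.smult_closed[of b x] by simp_all

lemma M_smult_zero [simp]:
 "a \<in> carrier A ==> a \<odot>\<^sub>M \<zero>\<^sub>M = \<zero>\<^sub>M" "b \<in> carrier B ==> rsmult M \<zero>\<^sub>M b = \<zero>\<^sub>M"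
 "x \<in> carrier M ==> \<zero>\<^sub>A \<odot>\<^sub>M x = \<zero>\<^sub>M" "x \<in> carrier M ==> rsmult M x \<zero>\<^sub>B = \<zero>\<^sub>M"
 using L.smult_zero[of a] N.smult_zero[of b] L.zero_smult[of x] N.zero_smult[of x] by simp_all

lemma L_lincomb_closed [simp]:
 "(\<And>i. i < n ==> a i \<in> carrier A) ==> (\<And>i. i < n ==> x i \<in> carrier M) ==> lincomb L n a x \<in> carrier M"
 using L.lincomb_closed[of n a x] by simp

lemma N_lincomb_closed [simp]:
 "(\<And>i. i < n ==> b i \<in> carrier B) ==> (\<And>i. i < n ==> x i \<in> carrier M) ==> lincomb N n b x \<in> carrier M"
 using N.lincomb_closed[of n b x] by simp

lemma L_zero [simp]:
 "(\<And>i. i < n ==> x i \<in> carrier M) ==> lincomb L n (%i. \<zero>\<^sub>A) x = \<zero>\<^sub>M"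
 "(\<And>i. i < n ==> a i \<in> carrier A) ==> lincomb L n a (%i. \<zero>\<^sub>M) = \<zero>\<^sub>M"
 using L.lincomb_zero_left[of n x] L.lincomb_zero_right[of n a] by simp_all

lemma N_zero [simp]:
 "(\<And>i. i < n ==> x i \<in> carrier M) ==> lincomb N n (%i. \<zero>\<^sub>B) x = \<zero>\<^sub>M"
 "(\<And>i. i < n ==> b i \<in> carrier B) ==> lincomb N n b (%i. \<zero>\<^sub>M) = \<zero>\<^sub>M"
 using N.lincomb_zero_left[of n x] N.lincomb_zero_right[of n b] by simp_all

lemmas L_minus_left = L.lincomb_minus_left[unfolded left_part_simps a_inv_part]
lemmas L_minus_right = L.lincomb_minus_right[unfolded left_part_simps a_inv_part]
lemmas N_minus_right = N.lincomb_minus_right[unfolded right_part_simps a_inv_part opposite_simps]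
lemmas L_add_right = L.lincomb_add_right[unfolded left_part_simps]
lemmas N_add_right = N.lincomb_add_right[unfolded right_part_simps opposite_simps]
lemmas L_assoc = L.lincomb_assoc[unfolded left_part_simps]

lemma N_assoc:
 assumes "\<And>j. j < m ==> b j \<in> carrier B" "\<And>i j. j < m ==> i < n ==> G i j \<in> carrier B"
  "\<And>i. i < n ==> x i \<in> carrier M"
 shows "lincomb N m b (%j. lincomb N n (%i. G i j) x) = lincomb N n (%i. dot B m (G i) b) x"
 using N.lincomb_assoc[of m b n "%j i. G i j" x] assms by simp

text \<open>Associativity of \<open>(a X) b\<close> for a matrix \<open>X\<close> over
  \<open>M\<close>, from the compatibility of the left and right actions.\<close>

lemma LN_assoc:
 assumes "\<And>j. j < m ==> a j \<in> carrier A" "\<And>i. i < n ==> b i \<in> carrier B"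
  "\<And>i j. j < m ==> i < n ==> X j i \<in> carrier M"
 shows "lincomb L m a (%j. lincomb N n b (X j)) = lincomb N n b (%i. lincomb L m a (%j. X j i))"
proof -
 have b: "a j \<odot>\<^sub>M rsmult M (X j i) (b i) = rsmult M (a j \<odot>\<^sub>M X j i) (b i)" if "j < m" "i < n" for i j
  using bimodule assms that by (simp add: is_bimodule_def)
 have "lincomb L m a (%j. lincomb N n b (X j)) = msum M m (%j. msum M n (%i. a j \<odot>\<^sub>M rsmult M (X j i) (b i)))"
  unfolding lincomb_def msum_part left_part_simps right_part_simps
  by (rule msum_cong) (use assms L.smult_msum[of _ n] in simp)
 also have "\<dots> = msum M n (%i. msum M m (%j. rsmult M (a j \<odot>\<^sub>M X j i) (b i)))"
  by (subst M.msum_swap) (use assms in \<open>simp_all add: b cong: msum_cong\<close>)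
 also have "\<dots> = lincomb N n b (%i. lincomb L m a (%j. X j i))"
  unfolding lincomb_def msum_part left_part_simps right_part_simps
  by (rule msum_cong) (use assms N.smult_msum[of _ m] in simp)
 finally show ?thesis .
qed

lemma msum_row:
 assumes "\<forall>j<p. v j \<in> carrier \<Lambda>" "\<forall>j<p. F j \<in> carrier \<Lambda>"
 shows "dot \<Lambda> p v F =
  (dot A p (%j. fst (v j)) (%j. fst (F j)),
  lincomb L p (%j. fst (v j)) (%j. fst (snd (F j))) \<oplus>\<^sub>M lincomb N p (%j. snd (snd (F j))) (%j. fst (snd (v j))),
  dot B p (%j. snd (snd (v j))) (%j. snd (snd (F j))))"
proof -
 have c: "fst (v j) \<in> carrier A" "fst (snd (v j)) \<in> carrier M" "snd (snd (v j)) \<in> carrier B"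
  "fst (F j) \<in> carrier A" "fst (snd (F j)) \<in> carrier M" "snd (snd (F j)) \<in> carrier B" if "j < p" for j
  using assms that by (auto simp: mem_Times_iff)
 have m: "v j \<otimes>\<^sub>\<Lambda> F j = (fst (v j) \<otimes>\<^sub>A fst (F j),
  fst (v j) \<odot>\<^sub>M fst (snd (F j)) \<oplus>\<^sub>M rsmult M (fst (snd (v j))) (snd (snd (F j))),
  snd (snd (v j)) \<otimes>\<^sub>B snd (snd (F j)))" for j
  by (cases "v j"; cases "F j") simp
 show ?thesis unfolding m msum_triangular lincomb_def
  using c by (simp add: M.msum_add)
qed

end

section \<open>Acyclic sequences over the triangular ring\<close>

locale triangular_seq = triangular A B M
 for A :: "'a ring" and B :: "'b ring" and M :: "('a, 'b, 'm) bimodule" +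
 fixes n F
 assumes acyclic: "acyclic_seq (triangular_ring A B M) n F"
begin

abbreviation "FA \<equiv> comp_A F"
abbreviation "FM \<equiv> comp_M F"
abbreviation "FB \<equiv> comp_B F"

lemma seq: "mat_seq \<Lambda> n F" and cols: "cols_exact (regular \<Lambda>) n F"
 and rows: "rows_exact (regular (opposite \<Lambda>)) n F"
 using acyclic by (simp_all add: acyclic_seq_def)

lemma F_carrier: "j < n (Suc i) ==> k < n i ==> F i j k \<in> carrier \<Lambda>"
 by (rule mat_seqD(1)[OF seq])

lemma F_closed [simp]:
 assumes "j < n (Suc i)" "k < n i"
 shows "FA i j k \<in> carrier A" "FM i j k \<in> carrier M" "FB i j k \<in> carrier B"
 using F_carrier[OF assms] by (auto simp: comp_A_def comp_M_def comp_B_def mem_Times_iff)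

lemma products:
 assumes k: "k < n (Suc (Suc i))" and j: "j < n i"
 shows "dot A (n (Suc i)) (FA (Suc i) k) (%l. FA i l j) = \<zero>\<^sub>A"
  "lincomb L (n (Suc i)) (FA (Suc i) k) (%l. FM i l j)
   \<oplus>\<^sub>M lincomb N (n (Suc i)) (%l. FB i l j) (FM (Suc i) k) = \<zero>\<^sub>M"
  "dot B (n (Suc i)) (FB (Suc i) k) (%l. FB i l j) = \<zero>\<^sub>B"
proof -
 have "dot \<Lambda> (n (Suc i)) (F (Suc i) k) (%l. F i l j) = \<zero>\<^sub>\<Lambda>"
  by (rule mat_seqD(2)[OF seq k j])
 moreover have "\<forall>l<n (Suc i). F (Suc i) k l \<in> carrier \<Lambda>" "\<forall>l<n (Suc i). F i l j \<in> carrier \<Lambda>"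
  using F_carrier k j by simp_all
 ultimately show "dot A (n (Suc i)) (FA (Suc i) k) (%l. FA i l j) = \<zero>\<^sub>A"
  "lincomb L (n (Suc i)) (FA (Suc i) k) (%l. FM i l j)
   \<oplus>\<^sub>M lincomb N (n (Suc i)) (%l. FB i l j) (FM (Suc i) k) = \<zero>\<^sub>M"
  "dot B (n (Suc i)) (FB (Suc i) k) (%l. FB i l j) = \<zero>\<^sub>B"
  by (simp_all add: msum_row comp_A_def comp_M_def comp_B_def cong: msum_cong)
qed

lemma mat_seq_A: "mat_seq A n FA" and mat_seq_B: "mat_seq B n FB"
 using products by (simp_all add: mat_seq_def)

text \<open>Row exactness over \<open>\<Lambda>\<close> at vectors whose \<open>B\<close>-component
  is zero; the \<open>A\<close>- and \<open>M\<close>-components of the equations remain.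
  \<open>col_exact\<close> treats columns whose \<open>A\<close>-component is zero in the same
  way.\<close>

lemma row_exact:
 assumes "vec A (n (Suc i)) a" "vec M (n (Suc i)) m"
  "\<forall>k<n i. dot A (n (Suc i)) a (%j. FA i j k) = \<zero>\<^sub>A"
  "\<forall>k<n i. lincomb L (n (Suc i)) a (%j. FM i j k) \<oplus>\<^sub>M lincomb N (n (Suc i)) (%j. FB i j k) m = \<zero>\<^sub>M"
 obtains a' m' where "vec A (n (Suc (Suc i))) a'" "vec M (n (Suc (Suc i))) m'"
  "\<forall>j<n (Suc i). a j = msum A (n (Suc (Suc i))) (%l. a' l \<otimes>\<^sub>A FA (Suc i) l j)"
  "\<forall>j<n (Suc i). m j = lincomb L (n (Suc (Suc i))) a' (%l. FM (Suc i) l j)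
   \<oplus>\<^sub>M lincomb N (n (Suc (Suc i))) (%l. FB (Suc i) l j) m'"
proof -
 let ?v = "%j. (a j, m j, \<zero>\<^sub>B)"
 have v: "\<forall>j<n (Suc i). ?v j \<in> carrier \<Lambda>" using assms by simp
 have "dot \<Lambda> (n (Suc i)) ?v (%j. F i j k) = \<zero>\<^sub>\<Lambda>" if "k < n i" for k
  using assms that F_carrier F_closed by (subst msum_row) (simp_all add: comp_A_def comp_M_def comp_B_def cong: msum_cong)
 then obtain u where u: "vec \<Lambda> (n (Suc (Suc i))) u"
  "\<forall>j<n (Suc i). ?v j = msum \<Lambda> (n (Suc (Suc i))) (%l. u l \<otimes>\<^sub>\<Lambda> F (Suc i) l j)"
  using rows_exact_regularD[OF rows v] by blast
 have uc: "fst (u l) \<in> carrier A" "fst (snd (u l)) \<in> carrier M" if "l < n (Suc (Suc i))" for l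
  using u(1) that by (auto simp: mem_Times_iff)
 show ?thesis
  by (rule that[of "%l. fst (u l)" "%l. fst (snd (u l))"])
   (use u F_carrier uc in \<open>simp_all add: msum_row comp_A_def comp_M_def comp_B_def cong: msum_cong\<close>)
qed

text \<open>A row with only a \<open>B\<close>-component stays so after multiplication by
  \<open>F\<close>, and likewise a column with only an \<open>A\<close>-component, so for these
  exactness over \<open>\<Lambda>\<close> restricts. For rows over \<open>A\<close> and columns over
  \<open>B\<close> the entries of \<open>FM\<close> interfere; \<open>acyclic_A\<close> and
  \<open>acyclic_B\<close> deal with them.\<close>

lemma rows_exact_B: "rows_exact (regular (opposite B)) n FB"
 unfolding rows_exact_def exact_col_def lincomb_regular_opposite
proof (intro allI impI, elim conjE)
 fix i b assume b: "vec (regular (opposite B)) (n (Suc i)) b"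
  and z: "\<forall>k<n i. dot B (n (Suc i)) b (tr (FB i) k) = \<zero>\<^bsub>regular (opposite B)\<^esub>"
 let ?v = "%j. (\<zero>\<^sub>A, \<zero>\<^sub>M, b j)"
 have v: "\<forall>j<n (Suc i). ?v j \<in> carrier \<Lambda>" using b by simp
 have "dot \<Lambda> (n (Suc i)) ?v (%j. F i j k) = \<zero>\<^sub>\<Lambda>" if "k < n i" for k
  using z b that F_carrier F_closed[of _ i k] by (subst msum_row) (simp_all add: b comp_A_def comp_M_def comp_B_def cong: msum_cong)
 then obtain u where u: "vec \<Lambda> (n (Suc (Suc i))) u"
  "\<forall>j<n (Suc i). ?v j = msum \<Lambda> (n (Suc (Suc i))) (%l. u l \<otimes>\<^sub>\<Lambda> F (Suc i) l j)"
  using rows_exact_regularD[OF rows v] by blast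
 have uc: "snd (snd (u l)) \<in> carrier B" if "l < n (Suc (Suc i))" for l
  using u(1) that by (auto simp: mem_Times_iff)
 show "\<exists>u. vec (regular (opposite B)) (n (Suc (Suc i))) u \<and>
   (\<forall>j<n (Suc i). b j = msum B (n (Suc (Suc i))) (%l. u l \<otimes>\<^sub>B tr (FB (Suc i)) j l))"
  by (rule exI[of _ "%l. snd (snd (u l))"])
   (use u F_carrier uc in \<open>simp add: msum_row comp_B_def cong: msum_cong\<close>)
qed

lemma col_exact:
 assumes "vec M (n (Suc i)) m" "vec B (n (Suc i)) b"
  "\<forall>k<n (Suc (Suc i)). lincomb L (n (Suc i)) (FA (Suc i) k) m \<oplus>\<^sub>M lincomb N (n (Suc i)) b (FM (Suc i) k) = \<zero>\<^sub>M"
  "\<forall>k<n (Suc (Suc i)). dot B (n (Suc i)) (FB (Suc i) k) b = \<zero>\<^sub>B"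
 obtains m' b' where "vec M (n i) m'" "vec B (n i) b'"
  "\<forall>j<n (Suc i). m j = lincomb L (n i) (FA i j) m' \<oplus>\<^sub>M lincomb N (n i) b' (FM i j)"
  "\<forall>j<n (Suc i). b j = dot B (n i) (FB i j) b'"
proof -
 let ?w = "%j. (\<zero>\<^sub>A, m j, b j)"
 have w: "\<forall>j<n (Suc i). ?w j \<in> carrier \<Lambda>" using assms by simp
 have "dot \<Lambda> (n (Suc i)) (F (Suc i) k) ?w = \<zero>\<^sub>\<Lambda>" if "k < n (Suc (Suc i))" for k
  using assms that F_carrier F_closed[of k "Suc i"] by (subst msum_row) (simp_all add: comp_A_def comp_M_def comp_B_def cong: msum_cong)
 then obtain u where u: "vec \<Lambda> (n i) u"
  "\<forall>j<n (Suc i). ?w j = dot \<Lambda> (n i) (F i j) u"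
  using cols_exact_regularD[OF cols w] by blast
 have uc: "fst (snd (u l)) \<in> carrier M" "snd (snd (u l)) \<in> carrier B" if "l < n i" for l
  using u(1) that by (auto simp: mem_Times_iff)
 show ?thesis
  by (rule that[of "%l. fst (snd (u l))" "%l. snd (snd (u l))"])
   (use u F_carrier uc in \<open>simp_all add: msum_row comp_A_def comp_M_def comp_B_def cong: msum_cong\<close>)
qed

lemma cols_exact_A: "cols_exact (regular A) n FA"
 unfolding cols_exact_def exact_col_def lincomb_regular
proof (intro allI impI, elim conjE)
 fix i a assume a: "vec (regular A) (n (Suc i)) a"
  and z: "\<forall>k<n (Suc (Suc i)). dot A (n (Suc i)) (FA (Suc i) k) a = \<zero>\<^bsub>regular A\<^esub>"
 let ?w = "%j. (a j, \<zero>\<^sub>M, \<zero>\<^sub>B)"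
 have w: "\<forall>j<n (Suc i). ?w j \<in> carrier \<Lambda>" using a by simp
 have "dot \<Lambda> (n (Suc i)) (F (Suc i) k) ?w = \<zero>\<^sub>\<Lambda>" if "k < n (Suc (Suc i))" for k
  using z a that F_carrier F_closed[of k "Suc i"] by (subst msum_row) (simp_all add: comp_A_def comp_M_def comp_B_def cong: msum_cong)
 then obtain u where u: "vec \<Lambda> (n i) u"
  "\<forall>j<n (Suc i). ?w j = dot \<Lambda> (n i) (F i j) u"
  using cols_exact_regularD[OF cols w] by blast
 have uc: "fst (u l) \<in> carrier A" if "l < n i" for l
  using u(1) that by (auto simp: mem_Times_iff)
 show "\<exists>u. vec (regular A) (n i) u \<and> (\<forall>j<n (Suc i). a j = dot A (n i) (FA i j) u)"
  by (rule exI[of _ "%l. fst (u l)"])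
   (use u F_carrier uc in \<open>simp add: msum_row comp_A_def cong: msum_cong\<close>)
qed

end

lemma comp_case_nat [simp]:
 "comp_A (case_nat G F) (Suc i) = comp_A F i" "comp_M (case_nat G F) (Suc i) = comp_M F i"
 "comp_B (case_nat G F) (Suc i) = comp_B F i"
 by (simp_all add: comp_A_def comp_M_def comp_B_def)

text \<open>For a matrix \<open>(F\<^sub>A, F\<^sub>M; 0, F\<^sub>B)\<close> this says that its cokernel is a monic module: the kernel of
 \<open>M \<otimes> Y \<rightarrow> X\<close> consists of the \<open>x F\<^sub>M\<close> with \<open>x F\<^sub>A = 0\<close>, taken modulo \<open>M\<^sup>q F\<^sub>B\<close>.\<close>

definition monic_mat ::
 "'a ring => ('a, 'b, 'm) bimodule => nat => nat => (nat => nat => 'a) => (nat => nat => 'm)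
  => (nat => nat => 'b) => bool" where
 "monic_mat A M p q FA FM FB \<longleftrightarrow>
  (\<forall>x. vec A q x \<and> (\<forall>k<p. dot A q x (%j. FA j k) = \<zero>\<^sub>A) \<longrightarrow>
   (\<exists>m. vec M q m \<and> (\<forall>k<p. lincomb (left_part M) q x (%j. FM j k)
     = lincomb (right_part M) q (%j. FB j k) m)))"

lemma monic_matE:
 assumes "monic_mat A M p q FA FM FB" "vec A q x" "\<forall>k<p. dot A q x (%j. FA j k) = \<zero>\<^sub>A"
 obtains m where "vec M q m"
  "\<forall>k<p. lincomb (left_part M) q x (%j. FM j k) = lincomb (right_part M) q (%j. FB j k) m"
proof -
 have "\<exists>m. vec M q m \<and> (\<forall>k<p. lincomb (left_part M) q x (%j. FM j k) = lincomb (right_part M) q (%j. FB j k) m)"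
  by (rule assms(1)[unfolded monic_mat_def, THEN spec, THEN mp, OF conjI[OF assms(2,3)]])
 then show ?thesis by (elim exE conjE) (rule that)
qed

context triangular_seq
begin

abbreviation "n0 \<equiv> n 0"
abbreviation "n1 \<equiv> n (Suc 0)"

lemma mixed_product:
 assumes "k < n (Suc (Suc i))" "j < n i"
 shows "lincomb L (n (Suc i)) (FA (Suc i) k) (%l. FM i l j)
  = \<ominus>\<^sub>M lincomb N (n (Suc i)) (%l. FB i l j) (FM (Suc i) k)"
 by (rule M.minus_equality[symmetric, OF products(2)[OF assms]]) (use assms in simp_all)

text \<open>By the mixed component of \<open>F (Suc i) F i = 0\<close>, the product
  \<open>FA FM b\<close> equals \<open>- FM FB b\<close>, and \<open>FB b\<close> is zero.\<close>

lemma FA_FM_kernel: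
 assumes b: "vec B (n i) b" and z: "\<forall>k<n (Suc i). dot B (n i) (FB i k) b = \<zero>\<^sub>B"
  and l: "l < n (Suc (Suc i))"
 shows "lincomb L (n (Suc i)) (FA (Suc i) l) (%k. lincomb N (n i) b (FM i k)) = \<zero>\<^sub>M"
proof -
 have "lincomb L (n (Suc i)) (FA (Suc i) l) (%k. lincomb N (n i) b (FM i k))
  = lincomb N (n i) b (%j. lincomb L (n (Suc i)) (FA (Suc i) l) (%k. FM i k j))"
  by (rule LN_assoc) (use b l in simp_all)
 also have "\<dots> = lincomb N (n i) b (%j. \<ominus>\<^sub>M lincomb N (n (Suc i)) (%k. FB i k j) (FM (Suc i) l))"
  by (rule lincomb_cong) (use mixed_product[OF l] in simp_all)
 also have "\<dots> = \<ominus>\<^sub>M lincomb N (n i) b (%j. lincomb N (n (Suc i)) (%k. FB i k j) (FM (Suc i) l))"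
  by (rule N_minus_right) (use b l in simp_all)
 also have "lincomb N (n i) b (%j. lincomb N (n (Suc i)) (%k. FB i k j) (FM (Suc i) l))
  = lincomb N (n (Suc i)) (%k. dot B (n i) (FB i k) b) (FM (Suc i) l)"
  by (rule N_assoc) (use b l in simp_all)
 also have "\<dots> = lincomb N (n (Suc i)) (%k. \<zero>\<^sub>B) (FM (Suc i) l)"
  by (rule lincomb_cong) (use z in simp_all)
 finally show ?thesis using l by simp
qed

text \<open>The column \<open>FM b\<close> over \<open>M\<close> is killed by the next
  \<open>FA\<close>. Columns over \<open>\<^sub>AM\<close> are exact by finite projective dimension,
  so \<open>FM b = FA u\<close>, and \<open>- u\<close> completes \<open>b\<close> to a column over
  \<open>\<Lambda>\<close> killed by \<open>F\<close>.\<close>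

lemma kernel_lift:
 assumes pd: "proj_dim A L < \<infinity>" and b: "vec B (n i) b"
  and z: "\<forall>k<n (Suc i). dot B (n i) (FB i k) b = \<zero>\<^sub>B"
 obtains m where "vec M (n i) m"
  "\<forall>k<n (Suc i). lincomb L (n i) (FA i k) m \<oplus>\<^sub>M lincomb N (n i) b (FM i k) = \<zero>\<^sub>M"
proof -
 have "cols_exact L n FA" by (rule cols_exact_proj_dim[OF L.left_module_axioms pd mat_seq_A cols_exact_A])
 then have ex: "exact_col L (n i) (n (Suc i)) (n (Suc (Suc i))) (FA i) (FA (Suc i))"
  by (simp add: cols_exact_def)
 obtain u where u: "vec L (n i) u" "\<forall>k<n (Suc i). lincomb N (n i) b (FM i k) = lincomb L (n i) (FA i k) u"
  by (rule exact_colD[OF ex, of "%k. lincomb N (n i) b (FM i k)"]) (use b FA_FM_kernel[OF b z] in simp_all)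
 show ?thesis
  by (rule that[of "%j. \<ominus>\<^sub>M u j"]) (use u in \<open>simp_all add: L_minus_right M.l_neg\<close>)
qed

text \<open>A column killed by \<open>FB\<close> lifts to one over \<open>\<Lambda>\<close> killed
  by \<open>F\<close>; the \<open>B\<close>-component of a preimage of the lift is a preimage of the
  given column.\<close>

lemma acyclic_B:
 assumes pd: "proj_dim A L < \<infinity>"
 shows "acyclic_seq B n FB"
 unfolding acyclic_seq_def
proof (intro conjI mat_seq_B rows_exact_B)
 show "cols_exact (regular B) n FB"
  unfolding cols_exact_def exact_col_def lincomb_regular
 proof (intro allI impI, elim conjE)
  fix i b assume b: "vec (regular B) (n (Suc i)) b"
   and z: "\<forall>k<n (Suc (Suc i)). dot B (n (Suc i)) (FB (Suc i) k) b = \<zero>\<^bsub>regular B\<^esub>"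
  have b': "vec B (n (Suc i)) b"
   and z': "\<forall>k<n (Suc (Suc i)). dot B (n (Suc i)) (FB (Suc i) k) b = \<zero>\<^sub>B"
   using b z by simp_all
  obtain m where m: "vec M (n (Suc i)) m" "\<forall>k<n (Suc (Suc i)).
    lincomb L (n (Suc i)) (FA (Suc i) k) m \<oplus>\<^sub>M lincomb N (n (Suc i)) b (FM (Suc i) k) = \<zero>\<^sub>M"
   by (rule kernel_lift[OF pd b' z'])
  obtain m' b'' where "vec M (n i) m'" and b'': "vec B (n i) b''"
   and "\<forall>j<n (Suc i). m j = lincomb L (n i) (FA i j) m' \<oplus>\<^sub>M lincomb N (n i) b'' (FM i j)"
   and bb: "\<forall>j<n (Suc i). b j = dot B (n i) (FB i j) b''"
   by (rule col_exact[OF m(1) b' m(2) z'])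
  show "\<exists>u. vec (regular B) (n i) u \<and> (\<forall>j<n (Suc i). b j = dot B (n i) (FB i j) u)"
   by (intro exI[of _ b'']) (simp add: b'' bb)
 qed
qed

text \<open>With a matrix \<open>G\<close> in front, a row \<open>x\<close> satisfying
  \<open>x FA = 0\<close> gives \<open>x FM G\<^sub>B = - x FA G\<^sub>M = 0\<close>. The prolonged
  \<open>B\<close>-sequence is acyclic, so \<open>tor_vanishing\<close> writes \<open>x FM\<close>
  as \<open>m FB\<close>.\<close>

lemma monic_if_weakly_Gorenstein:
 assumes pd: "proj_dim A L < \<infinity>" and tv: "tor_vanishing B N"
  and "left_noetherian (opposite \<Lambda>)" "weakly_Gorenstein_mat \<Lambda>"
 shows "monic_mat A M n0 n1 (FA 0) (FM 0) (FB 0)"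
 unfolding monic_mat_def
proof (intro allI impI, elim conjE)
 fix x assume x: "vec A n1 x" and z: "\<forall>k<n0. dot A n1 x (%j. FA 0 j k) = \<zero>\<^sub>A"
 have "torsionless_mat \<Lambda> n0 n1 (F 0)"
  using assms(4) acyclic by (simp add: weakly_Gorenstein_mat_def)
 then obtain p G where "acyclic_seq \<Lambda> (case_nat p n) (case_nat G F)"
  by (rule acyclic_seq_prepend[OF assms(3) acyclic])
 then interpret P: triangular_seq A B M "case_nat p n" "case_nat G F"
  by unfold_locales
 have ex: "exact_col N n1 n0 p (tr (FB 0)) (tr (P.FB 0))"
  using tor_vanishingD[OF tv P.acyclic_B[OF pd]] by simp
 let ?y = "%k. lincomb L n1 x (%j. FM 0 j k)"
 have Gc: "P.FA 0 j k \<in> carrier A" "P.FM 0 j k \<in> carrier M" "P.FB 0 j k \<in> carrier B" if "j < n0" "k < p" for j k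
  using P.F_closed[of j 0 k] that by simp_all
 have "lincomb N n0 (tr (P.FB 0) l) ?y = \<zero>\<^sub>N" if l: "l < p" for l
 proof -
  have mix: "lincomb L n0 (FA 0 j) (%k. P.FM 0 k l) = \<ominus>\<^sub>M lincomb N n0 (%k. P.FB 0 k l) (FM 0 j)"
   if "j < n1" for j
   using P.mixed_product[of j 0 l] that l by simp
  have "lincomb N n0 (%k. P.FB 0 k l) ?y = lincomb L n1 x (%j. lincomb N n0 (%k. P.FB 0 k l) (FM 0 j))"
   by (rule LN_assoc[symmetric]) (use x l Gc in simp_all)
  also have "\<dots> = lincomb L n1 x (%j. \<ominus>\<^sub>M lincomb L n0 (FA 0 j) (%k. P.FM 0 k l))"
   by (rule lincomb_cong) (use mix x l Gc in simp_all)
  also have "\<dots> = \<ominus>\<^sub>M lincomb L n1 x (%j. lincomb L n0 (FA 0 j) (%k. P.FM 0 k l))"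
   by (rule L_minus_right) (use x l Gc in simp_all)
  also have "lincomb L n1 x (%j. lincomb L n0 (FA 0 j) (%k. P.FM 0 k l))
   = lincomb L n0 (%k. dot A n1 x (%j. FA 0 j k)) (%k. P.FM 0 k l)"
   by (rule L_assoc) (use x l Gc in simp_all)
  also have "\<dots> = lincomb L n0 (%k. \<zero>\<^sub>A) (%k. P.FM 0 k l)"
   by (rule lincomb_cong) (use z in simp_all)
  finally show ?thesis using l Gc by (simp add: tr_def)
 qed
 then have Gz: "\<forall>k<p. lincomb N n0 (tr (P.FB 0) k) ?y = \<zero>\<^sub>N" by simp
 obtain m where "vec N n1 m" "\<forall>k<n0. ?y k = lincomb N n1 (tr (FB 0) k) m"
  by (rule exact_colD[OF ex _ Gz]) (use x in simp)
 then show "\<exists>m. vec M n1 m \<and> (\<forall>k<n0. ?y k = lincomb N n1 (%j. FB 0 j k) m)"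
  by (intro exI[of _ m]) (simp add: tr_def)
qed

text \<open>Monicity supplies \<open>m\<close> with \<open>a FM = m FB\<close>; the row
  \<open>(a, - m, 0)\<close> over \<open>\<Lambda>\<close> is then killed by \<open>F\<close>, and
  the \<open>A\<close>-component of a preimage solves the problem over \<open>A\<close>.\<close>

lemma acyclic_A:
 assumes "\<And>i. monic_mat A M (n i) (n (Suc i)) (FA i) (FM i) (FB i)"
 shows "acyclic_seq A n FA"
 unfolding acyclic_seq_def
proof (intro conjI mat_seq_A cols_exact_A)
 show "rows_exact (regular (opposite A)) n FA"
  unfolding rows_exact_def exact_col_def lincomb_regular_opposite
 proof (intro allI impI, elim conjE)
  fix i a assume a: "vec (regular (opposite A)) (n (Suc i)) a"
   and z: "\<forall>k<n i. dot A (n (Suc i)) a (tr (FA i) k) = \<zero>\<^bsub>regular (opposite A)\<^esub>"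
  have a': "vec A (n (Suc i)) a" and z': "\<forall>k<n i. dot A (n (Suc i)) a (%j. FA i j k) = \<zero>\<^sub>A"
   using a z by simp_all
  obtain m where m: "vec M (n (Suc i)) m"
   "\<forall>k<n i. lincomb L (n (Suc i)) a (%j. FM i j k) = lincomb N (n (Suc i)) (%j. FB i j k) m"
   by (rule monic_matE[OF assms[of i] a' z'])
  have nm: "vec M (n (Suc i)) (%j. \<ominus>\<^sub>M m j)" using m(1) by simp
  have nz: "\<forall>k<n i. lincomb L (n (Suc i)) a (%j. FM i j k) \<oplus>\<^sub>M lincomb N (n (Suc i)) (%j. FB i j k) (%j. \<ominus>\<^sub>M m j) = \<zero>\<^sub>M"
  proof (intro allI impI)
   fix k assume k: "k < n i"
   show "lincomb L (n (Suc i)) a (%j. FM i j k) \<oplus>\<^sub>M lincomb N (n (Suc i)) (%j. FB i j k) (%j. \<ominus>\<^sub>M m j) = \<zero>\<^sub>M"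
    using m(1) k by (simp add: m(2)[rule_format, OF k] N_minus_right M.r_neg)
  qed
  obtain u m' where u: "vec A (n (Suc (Suc i))) u" and "vec M (n (Suc (Suc i))) m'"
   and au: "\<forall>j<n (Suc i). a j = msum A (n (Suc (Suc i))) (%l. u l \<otimes>\<^sub>A FA (Suc i) l j)"
   "\<forall>j<n (Suc i). \<ominus>\<^sub>M m j = lincomb L (n (Suc (Suc i))) u (%l. FM (Suc i) l j)
    \<oplus>\<^sub>M lincomb N (n (Suc (Suc i))) (%l. FB (Suc i) l j) m'"
   by (rule row_exact[OF a' nm z' nz])
  show "\<exists>u. vec (regular (opposite A)) (n (Suc (Suc i))) u \<and>
    (\<forall>j<n (Suc i). a j = msum A (n (Suc (Suc i))) (%l. u l \<otimes>\<^sub>A tr (FA (Suc i)) j l))"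
   by (intro exI[of _ u]) (simp add: u au)
 qed
qed

text \<open>A row \<open>(a, m, b)\<close> is treated by components. Torsionlessness over
  \<open>A\<close> gives \<open>a = u FA\<close> and over \<open>B\<close> gives
  \<open>b = w FB\<close>. What remains is \<open>m - u FM\<close>, which annihilates all columns
  killed by \<open>FB\<close>; by \<open>tor_vanishing\<close> it is \<open>y FB\<close>, and
  \<open>(u, y, w)\<close> is the required combination.\<close>

lemma torsionless_if_monic:
 assumes pd: "proj_dim A L < \<infinity>" and tv: "tor_vanishing B N"
  and "left_noetherian (opposite B)" "weakly_Gorenstein_mat A" "weakly_Gorenstein_mat B"
  and monic: "\<And>i. monic_mat A M (n i) (n (Suc i)) (FA i) (FM i) (FB i)"
 shows "torsionless_mat \<Lambda> n0 n1 (F 0)"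
 unfolding torsionless_mat_def
proof (intro allI impI, elim conjE)
 fix v assume v: "vec \<Lambda> n0 v" and zero: "\<forall>w. vec \<Lambda> n0 w \<and>
   (\<forall>j<n1. dot \<Lambda> n0 (F 0 j) w = \<zero>\<^sub>\<Lambda>) \<longrightarrow> dot \<Lambda> n0 v w = \<zero>\<^sub>\<Lambda>"
 define a m b where "a j = fst (v j)" and "m j = fst (snd (v j))" and "b j = snd (snd (v j))" for j
 have vc: "vec A n0 a" "vec M n0 m" "vec B n0 b"
 proof -
  have "a j \<in> carrier A \<and> m j \<in> carrier M \<and> b j \<in> carrier B" if "j < n0" for j
   using v[rule_format, OF that] by (cases "v j") (simp add: a_def m_def b_def)
  then show "vec A n0 a" "vec M n0 m" "vec B n0 b" by simp_all
 qed
 have pairing: "dot A n0 a x = \<zero>\<^sub>A \<and>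
   lincomb L n0 a y \<oplus>\<^sub>M lincomb N n0 c m = \<zero>\<^sub>M \<and> dot B n0 b c = \<zero>\<^sub>B"
  if c: "vec A n0 x" "vec M n0 y" "vec B n0 c"
   "\<forall>j<n1. dot A n0 (FA 0 j) x = \<zero>\<^sub>A"
   "\<forall>j<n1. lincomb L n0 (FA 0 j) y \<oplus>\<^sub>M lincomb N n0 c (FM 0 j) = \<zero>\<^sub>M"
   "\<forall>j<n1. dot B n0 (FB 0 j) c = \<zero>\<^sub>B" for x y c
 proof -
  let ?w = "%k. (x k, y k, c k)"
  have "dot \<Lambda> n0 (F 0 j) ?w = \<zero>\<^sub>\<Lambda>" if j: "j < n1" for j
   using c j F_carrier[of j 0] by (subst msum_row) (simp_all add: comp_A_def comp_M_def comp_B_def)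
  then have "dot \<Lambda> n0 v ?w = \<zero>\<^sub>\<Lambda>" using zero[rule_format, of ?w] c by simp
  then show ?thesis using v c by (simp add: msum_row a_def[abs_def] m_def[abs_def] b_def[abs_def])
 qed
 have "torsionless_mat A n0 n1 (FA 0)"
  using assms(4) acyclic_A[OF monic] by (simp add: weakly_Gorenstein_mat_def)
 then obtain u where u: "vec A n1 u" "\<forall>j<n0. a j = dot A n1 u (%i. FA 0 i j)"
 proof (rule torsionless_matD[OF _ vc(1)])
  show "\<forall>w. vec A n0 w \<and> (\<forall>j<n1. dot A n0 (FA 0 j) w = \<zero>\<^sub>A) \<longrightarrow>
    dot A n0 a w = \<zero>\<^sub>A"
  proof (intro allI impI, elim conjE)
   fix w assume "vec A n0 w" "\<forall>j<n1. dot A n0 (FA 0 j) w = \<zero>\<^sub>A"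
   then show "dot A n0 a w = \<zero>\<^sub>A"
    using pairing[of w "%_. \<zero>\<^sub>M" "%_. \<zero>\<^sub>B"] by (simp cong: msum_cong)
  qed
 qed
 let ?uM = "%k. lincomb L n1 u (%j. FM 0 j k)"
 let ?m = "%k. m k \<oplus>\<^sub>M \<ominus>\<^sub>M ?uM k"
 \<comment> \<open>A column \<open>c\<close> killed by \<open>FB\<close> lifts to
   \<open>(0, y, c)\<close>, so \<open>a y + m c = 0\<close>. Since
   \<open>a y = u FA y = - u FM c\<close>, the corrected middle component annihilates
   \<open>c\<close>.\<close>
 have kill: "lincomb N n0 c ?m = \<zero>\<^sub>M \<and> dot B n0 b c = \<zero>\<^sub>B"
  if c: "vec B n0 c" "\<forall>j<n1. dot B n0 (FB 0 j) c = \<zero>\<^sub>B" for c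
 proof -
  obtain y where y: "vec M n0 y"
   "\<forall>k<n1. lincomb L n0 (FA 0 k) y \<oplus>\<^sub>M lincomb N n0 c (FM 0 k) = \<zero>\<^sub>M"
   by (rule kernel_lift[OF pd c])
  have p: "lincomb L n0 a y \<oplus>\<^sub>M lincomb N n0 c m = \<zero>\<^sub>M" "dot B n0 b c = \<zero>\<^sub>B"
   using pairing[of "%_. \<zero>\<^sub>A" y c] y c by (simp_all cong: msum_cong)
  have "lincomb L n0 a y = lincomb L n0 (%k. dot A n1 u (%i. FA 0 i k)) y"
   by (rule lincomb_cong) (use u in simp_all)
  also have "\<dots> = lincomb L n1 u (%j. lincomb L n0 (FA 0 j) y)"
   by (rule L_assoc[symmetric]) (use u y in simp_all)
  also have "\<dots> = lincomb L n1 u (%j. \<ominus>\<^sub>M lincomb N n0 c (FM 0 j))"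
   by (rule lincomb_cong) (use u y c in \<open>simp_all add: M.minus_equality[symmetric]\<close>)
  also have "\<dots> = \<ominus>\<^sub>M lincomb L n1 u (%j. lincomb N n0 c (FM 0 j))"
   by (rule L_minus_right) (use u c in simp_all)
  also have "lincomb L n1 u (%j. lincomb N n0 c (FM 0 j)) = lincomb N n0 c ?uM"
   by (rule LN_assoc) (use u c in simp_all)
  finally have "lincomb L n0 a y = \<ominus>\<^sub>M lincomb N n0 c ?uM" .
  then have "lincomb N n0 c m \<oplus>\<^sub>M \<ominus>\<^sub>M lincomb N n0 c ?uM = \<zero>\<^sub>M"
   using p(1) u c vc by (simp add: M.a_comm)
  then show ?thesis using p(2) u c vc by (simp add: N_add_right N_minus_right)
 qed
 note aB = acyclic_B[OF pd]
 have tlB: "torsionless_mat B n0 n1 (FB 0)"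
  using assms(5) aB by (simp add: weakly_Gorenstein_mat_def)
 then obtain w where w: "vec B n1 w" "\<forall>j<n0. b j = dot B n1 w (%i. FB 0 i j)"
  by (rule torsionless_matD[OF _ vc(3)]) (use kill in simp)
 \<comment> \<open>The columns of \<open>G\<close> are killed by \<open>FB\<close>, so
   \<open>kill\<close> applies to each of them, and row exactness over \<open>M\<^sub>B\<close> at
   this place yields \<open>y\<close>.\<close>
 obtain p G where G: "acyclic_seq B (case_nat p n) (case_nat G FB)"
  by (rule acyclic_seq_prepend[OF assms(3) aB tlB])
 have ex: "exact_col N n1 n0 p (tr (FB 0)) (tr G)" using tor_vanishingD[OF tv G] by simp
 have seqG: "mat_seq B (case_nat p n) (case_nat G FB)" using G by (simp add: acyclic_seq_def)
 have "lincomb N n0 (tr G l) ?m = \<zero>\<^sub>N" if "l < p" for l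
 proof -
  have "vec B n0 (tr G l)" using mat_seqD(1)[OF seqG, of _ 0 l] that by simp
  moreover have "\<forall>j<n1. dot B n0 (FB 0 j) (tr G l) = \<zero>\<^sub>B"
   using mat_seqD(2)[OF seqG, of _ 0 l] that by simp
  ultimately show ?thesis using kill[of "tr G l"] by simp
 qed
 then have Gz: "\<forall>l<p. lincomb N n0 (tr G l) ?m = \<zero>\<^sub>N" by simp
 obtain y where y: "vec N n1 y" "\<forall>k<n0. ?m k = lincomb N n1 (tr (FB 0) k) y"
  by (rule exact_colD[OF ex _ Gz]) (use vc u in simp)
 show "row_span \<Lambda> n1 n0 (F 0) v"
 proof (rule row_spanI[where u = "%i. (u i, y i, w i)"])
  show "vec \<Lambda> n1 (%i. (u i, y i, w i))" using u y w by simp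
  fix j assume j: "j < n0"
  have "m j = ?uM j \<oplus>\<^sub>M ?m j" using vc u j by (simp add: M.r_neg1 M.a_lcomm M.r_neg)
  then have "m j = ?uM j \<oplus>\<^sub>M lincomb N n1 (%i. FB 0 i j) y" using y j by (simp add: tr_def)
  then show "v j = dot \<Lambda> n1 (%i. (u i, y i, w i)) (%i. F 0 i j)"
   using j u y w F_carrier[of _ 0 j]
   by (subst msum_row) (simp_all add: prod_eq_iff a_def m_def b_def comp_A_def comp_M_def comp_B_def)
 qed
qed

end

section \<open>Contractible sequences\<close>

definition block_diag ::
 "'r ring => nat => nat => (nat => nat => 'r) => (nat => nat => 'r) => nat => nat => 'r" where
 "block_diag R p q F G = (%j k. if j < p then (if k < q then F j k else \<zero>\<^sub>R)
  else (if k < q then \<zero>\<^sub>R else G (j - p) (k - q)))"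

lemma tr_block_diag: "tr (block_diag R p q F G) = block_diag R q p (tr F) (tr G)"
 by (intro ext) (simp add: block_diag_def)

lemma block_diag_opposite [simp]: "block_diag (opposite R) = block_diag R"
 by (intro ext) (simp add: block_diag_def)

lemma block_diag_closed:
 assumes "ring R" "mat R p q F" "mat R p' q' G" "j < p + p'" "k < q + q'"
 shows "block_diag R p q F G j k \<in> carrier R"
 using assms by (auto simp: block_diag_def ring.ring_simprules(2))

lemma lincomb_block_diag:
 assumes "left_module R V" "mat R p q F" "mat R p' q' G" "j < p + p'" "vec V (q + q') v"
 shows "lincomb V (q + q') (block_diag R p q F G j) v =
  (if j < p then lincomb V q (F j) v else lincomb V q' (G (j - p)) (%k. v (q + k)))"
proof -
 interpret left_module R V by fact
 have c: "block_diag R p q F G j k \<in> carrier R" if "k < q + q'" for k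
  by (rule block_diag_closed[OF R.ring_axioms assms(2-4) that])
 have v: "v k \<in> carrier V" if "k < q" for k using assms(5) that by simp
 have v': "v (q + k) \<in> carrier V" if "k < q'" for k using assms(5) that by simp
 have jp: "j - p < p'" if "\<not> j < p" using assms(4) that by simp
 have "lincomb V (q + q') (block_diag R p q F G j) v = lincomb V q (block_diag R p q F G j) v
   \<oplus>\<^sub>V lincomb V q' (%i. block_diag R p q F G j (q + i)) (%i. v (q + i))"
  using c assms(5) by (intro lincomb_split) simp_all
 moreover have "lincomb V q (block_diag R p q F G j) v = (if j < p then lincomb V q (F j) v else \<zero>\<^sub>V)"
  using v by (auto simp: block_diag_def cong: lincomb_cong)
 moreover have "lincomb V q' (%i. block_diag R p q F G j (q + i)) (%i. v (q + i))
   = (if j < p then \<zero>\<^sub>V else lincomb V q' (G (j - p)) (%k. v (q + k)))"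
  using v' by (auto simp: block_diag_def cong: lincomb_cong)
 ultimately show ?thesis using assms(2,3) v v' jp by simp
qed

lemma exact_col_block_diag:
 assumes V: "left_module R V" and mats: "mat R m l F" "mat R n m G" "mat R m' l' F'" "mat R n' m' G'"
  and ex: "exact_col V l m n F G" "exact_col V l' m' n' F' G'"
 shows "exact_col V (l + l') (m + m') (n + n') (block_diag R m l F F') (block_diag R n m G G')"
 unfolding exact_col_def
proof (intro allI impI, elim conjE)
 fix v assume v: "vec V (m + m') v"
  and z: "\<forall>k<n + n'. lincomb V (m + m') (block_diag R n m G G' k) v = \<zero>\<^sub>V"
 have z1: "\<forall>k<n. lincomb V m (G k) v = \<zero>\<^sub>V"
 proof (intro allI impI)
  fix k assume "k < n"
  then show "lincomb V m (G k) v = \<zero>\<^sub>V"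
   using z[rule_format, of k] lincomb_block_diag[OF V mats(2,4) _ v, of k] by simp
 qed
 have z2: "\<forall>k<n'. lincomb V m' (G' k) (%j. v (m + j)) = \<zero>\<^sub>V"
 proof (intro allI impI)
  fix k assume "k < n'"
  then show "lincomb V m' (G' k) (%j. v (m + j)) = \<zero>\<^sub>V"
   using z[rule_format, of "n + k"] lincomb_block_diag[OF V mats(2,4) _ v, of "n + k"] by simp
 qed
 obtain u where u: "vec V l u" "\<forall>j<m. v j = lincomb V l (F j) u"
  by (rule exact_colD[OF ex(1) _ z1]) (use v in simp)
 obtain w where w: "vec V l' w" "\<forall>j<m'. v (m + j) = lincomb V l' (F' j) w"
  by (rule exact_colD[OF ex(2) _ z2]) (use v in simp)
 let ?x = "%j. if j < l then u j else w (j - l)"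
 have x: "vec V (l + l') ?x" using u(1) w(1) by simp
 have "v j = lincomb V (l + l') (block_diag R m l F F' j) ?x" if j: "j < m + m'" for j
 proof (cases "j < m")
  case True
  have "lincomb V l (F j) ?x = lincomb V l (F j) u" by (rule lincomb_cong) simp_all
  then show ?thesis using lincomb_block_diag[OF V mats(1,3) j x] True u(2) by simp
 next
  case False
  then show ?thesis using lincomb_block_diag[OF V mats(1,3) j x] w(2)[rule_format, of "j - m"] j by simp
 qed
 then show "\<exists>x. vec V (l + l') x \<and> (\<forall>j<m + m'. v j = lincomb V (l + l') (block_diag R m l F F' j) x)"
  by (intro exI[of _ ?x] conjI x allI impI)
qed

lemma acyclic_seq_block_diag:
 assumes F: "acyclic_seq R n F" and G: "acyclic_seq R m G" and "ring R"
 shows "acyclic_seq R (%i. n i + m i) (%i. block_diag R (n (Suc i)) (n i) (F i) (G i))"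
proof -
 have seq: "mat_seq R n F" "mat_seq R m G" using F G by (simp_all add: acyclic_seq_def)
 note lm = left_module_regular[OF \<open>ring R\<close>] left_module_regular[OF ring_opposite[OF \<open>ring R\<close>]]
 have mF: "mat R (n (Suc i)) (n i) (F i)" and mG: "mat R (m (Suc i)) (m i) (G i)" for i
  using mat_seqD(1)[OF seq(1)] mat_seqD(1)[OF seq(2)] by simp_all
 have "mat_seq R (%i. n i + m i) (%i. block_diag R (n (Suc i)) (n i) (F i) (G i))"
  unfolding mat_seq_def
 proof (intro conjI allI impI)
  fix i j k assume "j < n (Suc i) + m (Suc i)" "k < n i + m i"
  then show "block_diag R (n (Suc i)) (n i) (F i) (G i) j k \<in> carrier R"
   by (rule block_diag_closed[OF \<open>ring R\<close> mF mG])
 next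
  fix i k j assume k: "k < n (Suc (Suc i)) + m (Suc (Suc i))" and j: "j < n i + m i"
  let ?c = "%l. block_diag R (n (Suc i)) (n i) (F i) (G i) l j"
  have c: "vec (regular R) (n (Suc i) + m (Suc i)) ?c"
   using block_diag_closed[OF \<open>ring R\<close> mF mG _ j] by simp
  have Fc: "F (Suc i) k l \<in> carrier R" if "k < n (Suc (Suc i))" "l < n (Suc i)" for l
   using mF[of "Suc i"] that by simp
  have Gc: "G (Suc i) (k - n (Suc (Suc i))) l \<in> carrier R" if "\<not> k < n (Suc (Suc i))" "l < m (Suc i)" for l
   using mG[of "Suc i"] that k by simp
  have jj: "j - n i < m i" if "\<not> j < n i" using j that by simp
  have kk: "k - n (Suc (Suc i)) < m (Suc (Suc i))" if "\<not> k < n (Suc (Suc i))" using k that by simp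
  interpret R: ring R by fact
  show "dot R (n (Suc i) + m (Suc i)) (block_diag R (n (Suc (Suc i))) (n (Suc i)) (F (Suc i)) (G (Suc i)) k) ?c = \<zero>\<^sub>R"
   using lincomb_block_diag[OF lm(1) mF[of "Suc i"] mG[of "Suc i"] k c] mat_seqD(2)[OF seq(1), of k i j]
    mat_seqD(2)[OF seq(2) kk jj]
   by (cases "k < n (Suc (Suc i))"; cases "j < n i") (simp_all add: lincomb_regular block_diag_def Fc Gc cong: msum_cong)
 qed
 moreover have "cols_exact (regular R) (%i. n i + m i) (%i. block_diag R (n (Suc i)) (n i) (F i) (G i))"
  unfolding cols_exact_def
  by (intro allI exact_col_block_diag[OF lm(1) mF mF mG mG])
   (use F G in \<open>simp_all add: acyclic_seq_def cols_exact_def\<close>)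
 moreover have "rows_exact (regular (opposite R)) (%i. n i + m i) (%i. block_diag R (n (Suc i)) (n i) (F i) (G i))"
  unfolding rows_exact_def tr_block_diag block_diag_opposite[of R, symmetric]
  by (intro allI exact_col_block_diag[OF lm(2)])
   (use F G mF mG in \<open>simp_all add: acyclic_seq_def rows_exact_def\<close>)
 ultimately show ?thesis by (simp add: acyclic_seq_def)
qed

text \<open>The map \<open>(x, y) \<mapsto> (y, 0)\<close>; its powers form a contractible sequence.\<close>

definition shift_mat :: "'r ring => nat => nat => nat => nat => 'r" where
 "shift_mat R p q = (%j k. if j < p \<and> k = q + j then \<one>\<^sub>R else \<zero>\<^sub>R)"

lemma shift_mat_opposite [simp]: "shift_mat (opposite R) = shift_mat R"
 by (intro ext) (simp add: shift_mat_def)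

lemma lincomb_shift_mat:
 assumes "left_module R V" "vec V (q + p) v"
 shows "lincomb V (q + p) (shift_mat R p q j) v = (if j < p then v (q + j) else \<zero>\<^sub>V)"
proof -
 interpret left_module R V by fact
 have "shift_mat R p q j = (if j < p then unit_vec R (q + j) else (%_. \<zero>\<^sub>R))"
  by (intro ext) (auto simp: shift_mat_def unit_vec_def)
 then show ?thesis using assms(2) lincomb_unit_vec[of "q + j" "q + p" v] by simp
qed

lemma lincomb_tr_shift_mat:
 assumes "left_module R V" "vec V (p + s) v" "k < q + p"
 shows "lincomb V (p + s) (tr (shift_mat R p q) k) v = (if q \<le> k then v (k - q) else \<zero>\<^sub>V)"
proof -
 interpret left_module R V by fact
 have "tr (shift_mat R p q) k = (if q \<le> k then unit_vec R (k - q) else (%_. \<zero>\<^sub>R))"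
  using assms(3) by (intro ext) (auto simp: shift_mat_def unit_vec_def)
 then show ?thesis using assms(2,3) lincomb_unit_vec[of "k - q" "p + s" v] by simp
qed

lemma acyclic_seq_shift_mat:
 assumes "ring R"
 shows "acyclic_seq R (%i. n i + n (Suc i)) (%i. shift_mat R (n (Suc i)) (n i))"
proof -
 interpret ring R by fact
 have closed: "shift_mat R p q j k \<in> carrier R" for p q j k by (simp add: shift_mat_def)
 note lm = left_module_regular[OF \<open>ring R\<close>] left_module_regular[OF ring_opposite[OF \<open>ring R\<close>]]
 have "mat_seq R (%i. n i + n (Suc i)) (%i. shift_mat R (n (Suc i)) (n i))"
  unfolding mat_seq_def
 proof (intro conjI allI impI)
  fix i k j
  have "lincomb (regular R) (n (Suc i) + n (Suc (Suc i))) (shift_mat R (n (Suc (Suc i))) (n (Suc i)) k)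
   (%l. shift_mat R (n (Suc i)) (n i) l j) = \<zero>\<^bsub>regular R\<^esub>"
   by (subst lincomb_shift_mat[OF lm(1)]) (simp_all add: closed, simp add: shift_mat_def)
  then show "msum R (n (Suc i) + n (Suc (Suc i))) (%l. shift_mat R (n (Suc (Suc i))) (n (Suc i)) k l \<otimes>\<^sub>R
   shift_mat R (n (Suc i)) (n i) l j) = \<zero>\<^sub>R" by (simp add: lincomb_regular)
 qed (rule closed)
 moreover have "exact_col V (n i + n (Suc i)) (n (Suc i) + n (Suc (Suc i))) (n (Suc (Suc i)) + n (Suc (Suc (Suc i))))
   (shift_mat S (n (Suc i)) (n i)) (shift_mat S (n (Suc (Suc i))) (n (Suc i)))"
  if V: "left_module S V" for S V i
  unfolding exact_col_def
 proof (intro allI impI, elim conjE)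
  interpret V: left_module S V by (rule V)
  fix v assume v: "vec V (n (Suc i) + n (Suc (Suc i))) v"
   and z: "\<forall>k<n (Suc (Suc i)) + n (Suc (Suc (Suc i))).
    lincomb V (n (Suc i) + n (Suc (Suc i))) (shift_mat S (n (Suc (Suc i))) (n (Suc i)) k) v = \<zero>\<^sub>V"
  have z': "v (n (Suc i) + k) = \<zero>\<^sub>V" if "k < n (Suc (Suc i))" for k
   using z[rule_format, of k] that lincomb_shift_mat[OF V v, of k] by simp
  \<comment> \<open>On columns the matrix moves the second block to the first place and puts zero in
    the second. A column it kills has zero second block and is reached by moving its first block
    back to second place.\<close>
  let ?u = "%k. if k < n i then \<zero>\<^sub>V else v (k - n i)"
  have u: "vec V (n i + n (Suc i)) ?u" using v by simp
  have "v j = lincomb V (n i + n (Suc i)) (shift_mat S (n (Suc i)) (n i) j) ?u"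
   if j: "j < n (Suc i) + n (Suc (Suc i))" for j
   using lincomb_shift_mat[OF V u, of j] z'[of "j - n (Suc i)"] j by (cases "j < n (Suc i)") simp_all
  then show "\<exists>u. vec V (n i + n (Suc i)) u \<and> (\<forall>j<n (Suc i) + n (Suc (Suc i)).
    v j = lincomb V (n i + n (Suc i)) (shift_mat S (n (Suc i)) (n i) j) u)"
   by (intro exI[of _ ?u] conjI u allI impI)
 qed
 from this[OF lm(1)] have "cols_exact (regular R) (%i. n i + n (Suc i)) (%i. shift_mat R (n (Suc i)) (n i))"
  by (simp add: cols_exact_def)
 moreover have "exact_col V (n (Suc (Suc i)) + n (Suc (Suc (Suc i)))) (n (Suc i) + n (Suc (Suc i))) (n i + n (Suc i))
   (tr (shift_mat S (n (Suc (Suc i))) (n (Suc i)))) (tr (shift_mat S (n (Suc i)) (n i)))"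
  if V: "left_module S V" for S V i
  unfolding exact_col_def
 proof (intro allI impI, elim conjE)
  interpret V: left_module S V by (rule V)
  fix v assume v: "vec V (n (Suc i) + n (Suc (Suc i))) v"
   and z: "\<forall>k<n i + n (Suc i).
    lincomb V (n (Suc i) + n (Suc (Suc i))) (tr (shift_mat S (n (Suc i)) (n i)) k) v = \<zero>\<^sub>V"
  have z': "v k = \<zero>\<^sub>V" if "k < n (Suc i)" for k
   using z[rule_format, of "n i + k"] that lincomb_tr_shift_mat[OF V v, of "n i + k" "n i"] by simp
  \<comment> \<open>On rows the blocks move the other way: a row that is killed has zero first
    block, and its second block is moved back to the front.\<close>
  let ?u = "%k. if k < n (Suc (Suc i)) then v (n (Suc i) + k) else \<zero>\<^sub>V"
  have u: "vec V (n (Suc (Suc i)) + n (Suc (Suc (Suc i)))) ?u" using v by simp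
  have "v j = lincomb V (n (Suc (Suc i)) + n (Suc (Suc (Suc i)))) (tr (shift_mat S (n (Suc (Suc i))) (n (Suc i))) j) ?u"
   if j: "j < n (Suc i) + n (Suc (Suc i))" for j
   using lincomb_tr_shift_mat[OF V u j] z'[of j] j by (cases "j < n (Suc i)") (simp_all split: if_splits, linarith?)
  then show "\<exists>u. vec V (n (Suc (Suc i)) + n (Suc (Suc (Suc i)))) u \<and> (\<forall>j<n (Suc i) + n (Suc (Suc i)).
    v j = lincomb V (n (Suc (Suc i)) + n (Suc (Suc (Suc i)))) (tr (shift_mat S (n (Suc (Suc i))) (n (Suc i))) j) u)"
   by (intro exI[of _ ?u] conjI u allI impI)
 qed
 from this[OF lm(2)] have "rows_exact (regular (opposite R)) (%i. n i + n (Suc i)) (%i. shift_mat R (n (Suc i)) (n i))"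
  by (simp add: rows_exact_def)
 ultimately show ?thesis by (simp add: acyclic_seq_def)
qed

text \<open>A complex extended by its own shift, so that its ranks match a contractible complex.\<close>

lemma acyclic_seq_doubling:
 assumes "ring R" "acyclic_seq R n F"
 shows "acyclic_seq R (%i. n i + n (Suc i)) (%i. block_diag R (n (Suc i)) (n i) (F i) (F (Suc i)))"
 by (rule acyclic_seq_block_diag[OF assms(2) acyclic_seq_shift[OF assms(2)] assms(1)])

lemma msum_extend_zero:
 assumes "ring R" "vec R (p + q) w" "vec R p a"
 shows "dot R (p + q) (%k. (if k < p then a k else \<zero>\<^sub>R)) w = dot R p a w"
proof -
 interpret ring R by fact
 show ?thesis using assms(2,3) by (subst msum_split) (auto cong: msum_cong)
qed

text \<open>The coefficients on the rows of the first block alone produce the first \<open>q\<close>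
  entries. Conclusions about a doubled sequence return to the original one in this way.\<close>

lemma row_span_block_diag:
 assumes R: "ring R" and mats: "mat R p q F" "mat R p' q' G"
  and "row_span R (p + p') (q + q') (block_diag R p q F G) (%k. if k < q then a k else \<zero>\<^sub>R)"
 shows "row_span R p q F a"
proof -
 interpret ring R by fact
 obtain u where u: "vec R (p + p') u" "\<forall>k<q + q'. (if k < q then a k else \<zero>\<^sub>R) =
   dot R (p + p') u (%j. block_diag R p q F G j k)"
  by (rule row_spanE[OF assms(4)])
 show ?thesis
 proof (rule row_spanI[where u = u])
  show "vec R p u" using u(1) by simp
  fix k assume k: "k < q"
  have "dot R (p + p') u (%j. block_diag R p q F G j k) = dot R p u (%j. F j k)"
   using u(1) k mats block_diag_closed[OF R mats]
   by (subst msum_split) (auto simp: block_diag_def cong: msum_cong)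
  then show "a k = dot R p u (%j. F j k)" using u(2)[rule_format, of k] k by simp
 qed
qed

text \<open>Composing the embedding into a projective module with a dual basis of that module gives
  enough functionals to detect an element.\<close>

lemma torsionless_separates:
 fixes R :: "'r ring"
 assumes "torsionless R W" "left_module R W" "x \<in> carrier W"
  and zero: "\<And>f. f \<in> mod_hom R W (regular R) ==> f x = \<zero>\<^sub>R"
 shows "x = \<zero>\<^sub>W"
proof -
 obtain P :: "'r small_module" and \<iota> where P: "projective_module R P" and \<iota>: "\<iota> \<in> mod_hom R W P"
  and inj: "inj_on \<iota> (carrier W)"
  using assms(1) unfolding torsionless_def by blast
 have lmP: "left_module R P" by (rule left_module_if_projective[OF P])
 interpret P: left_module R P by (rule lmP)
 interpret W: left_module R W by (rule assms(2))
 obtain k t s where t: "vec P k t" and s: "\<forall>i<k. s i \<in> mod_hom R P (regular R)"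
  and basis: "\<forall>p\<in>carrier P. p = lincomb P k (%i. s i p) t"
  by (rule projective_dual_basis[OF P])
 have "s i (\<iota> x) = \<zero>\<^sub>R" if "i < k" for i
  using zero[OF mod_hom_compose[OF \<iota> s[rule_format, OF that] assms(2)]] assms(3) by simp
 then have "lincomb P k (%i. s i (\<iota> x)) t = lincomb P k (%i. \<zero>\<^sub>R) t" by (intro lincomb_cong) simp_all
 then have "\<iota> x = \<zero>\<^sub>P" using basis[rule_format, OF mod_homD(1)[OF \<iota> assms(3)]] t by simp
 then have "\<iota> x = \<iota> \<zero>\<^sub>W" using mod_hom_zero[OF \<iota> assms(2) lmP] by simp
 then show ?thesis using inj_onD[OF inj] assms(3) by simp
qed

lemma acyclic_seq_shift_add:
 assumes "acyclic_seq R n F"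
 shows "acyclic_seq R (%i. n (i + k)) (%i. F (i + k))"
proof (induction k)
 case 0
 show ?case using assms by simp
next
 case (Suc k)
 show ?case using acyclic_seq_shift[OF Suc] by simp
qed

context triangular_seq
begin

text \<open>As in \<open>monic_if_weakly_Gorenstein\<close>, it has to be shown that
  \<open>x FM\<close> annihilates the columns of a prepended matrix, but this matrix now exists over
  \<open>B\<close> alone. With \<open>c\<close> denoting \<open>FM\<close> times such a column,
  \<open>x c = 0\<close> is tested by functionals \<open>f\<close> on the torsionless module:
  \<open>f c\<close> is a column over \<open>A\<close> killed by the next \<open>FA\<close>, hence
  \<open>FA u\<close>, and \<open>x FA\<close> is zero.\<close>

lemma monic_if_torsionless:
 assumes pd: "proj_dim A L < \<infinity>" and tv: "tor_vanishing B N"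
  and "left_noetherian (opposite B)" "weakly_Gorenstein_mat B" "torsionless A L"
 shows "monic_mat A M n0 n1 (FA 0) (FM 0) (FB 0)"
 unfolding monic_mat_def
proof (intro allI impI, elim conjE)
 fix x assume x: "vec A n1 x" and z: "\<forall>k<n0. dot A n1 x (%j. FA 0 j k) = \<zero>\<^sub>A"
 note aB = acyclic_B[OF pd]
 have "torsionless_mat B n0 n1 (FB 0)"
  using assms(4) aB by (simp add: weakly_Gorenstein_mat_def)
 then obtain p G where G: "acyclic_seq B (case_nat p n) (case_nat G FB)"
  by (rule acyclic_seq_prepend[OF assms(3) aB])
 have ex: "exact_col N n1 n0 p (tr (FB 0)) (tr G)" using tor_vanishingD[OF tv G] by simp
 have seqG: "mat_seq B (case_nat p n) (case_nat G FB)" using G by (simp add: acyclic_seq_def)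
 let ?y = "%k. lincomb L n1 x (%j. FM 0 j k)"
 have "lincomb N n0 (tr G l) ?y = \<zero>\<^sub>N" if l: "l < p" for l
 proof -
  have b: "vec B n0 (tr G l)" using mat_seqD(1)[OF seqG, of _ 0 l] l by simp
  have Gz: "\<forall>j<n1. dot B n0 (FB 0 j) (tr G l) = \<zero>\<^sub>B"
   using mat_seqD(2)[OF seqG, of _ 0 l] l by simp
  let ?c = "%j. lincomb N n0 (tr G l) (FM 0 j)"
  have c: "vec M n1 ?c" using b by simp
  have "lincomb N n0 (tr G l) ?y = lincomb L n1 x ?c"
   by (rule LN_assoc[symmetric]) (use x b in simp_all)
  moreover have "lincomb L n1 x ?c = \<zero>\<^sub>L"
  proof (rule torsionless_separates[OF assms(5) L.left_module_axioms])
   show "lincomb L n1 x ?c \<in> carrier L" using x c by simp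
   fix f assume f: "f \<in> mod_hom A L (regular A)"
   have fl: "f (lincomb L n1 a ?c) = dot A n1 a (%j. f (?c j))"
    if "vec A n1 a" for a
    using mod_hom_lincomb[OF f L.left_module_axioms left_module_regular[OF A], of "n1" a ?c] that c
    by (simp add: lincomb_regular)
   have fc: "vec A n1 (%j. f (?c j))" using mod_homD(1)[OF f] c by simp
   have "dot A n1 (FA (Suc 0) k) (%j. f (?c j)) = \<zero>\<^sub>A" if k: "k < n (Suc (Suc 0))" for k
    using fl[of "FA (Suc 0) k"] k FA_FM_kernel[OF b Gz k]
     mod_hom_zero[OF f L.left_module_axioms left_module_regular[OF A]] by simp
   then have kz: "\<forall>k<n (Suc (Suc 0)). dot A n1 (FA (Suc 0) k) (%j. f (?c j)) = \<zero>\<^sub>A" by simp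
   obtain u where u: "vec A n0 u" "\<forall>j<n1. f (?c j) = dot A n0 (FA 0 j) u"
    by (rule cols_exact_regularD[OF cols_exact_A fc kz])
   have "dot A n1 x (%j. f (?c j))
    = dot A n1 x (%j. dot A n0 (FA 0 j) u)"
    by (rule msum_cong) (use u(2) in simp)
   also have "\<dots> = dot A n0 (%l. dot A n1 x (%j. FA 0 j l)) u"
    by (rule A.msum_row_col) (use x u in simp_all)
   also have "\<dots> = msum A n0 (%l. \<zero>\<^sub>A)" by (rule msum_cong) (use z u in simp)
   finally show "f (lincomb L n1 x ?c) = \<zero>\<^sub>A" using fl[OF x] by simp
  qed
  ultimately show ?thesis by simp
 qed
 then have Gz: "\<forall>l<p. lincomb N n0 (tr G l) ?y = \<zero>\<^sub>N" by simp
 obtain m where "vec N n1 m" "\<forall>k<n0. ?y k = lincomb N n1 (tr (FB 0) k) m"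
  by (rule exact_colD[OF ex _ Gz]) (use x in simp)
 then show "\<exists>m. vec M n1 m \<and> (\<forall>k<n0. ?y k = lincomb N n1 (%j. FB 0 j k) m)"
  by (intro exI[of _ m]) (simp add: tr_def)
qed

end

section \<open>Completion of sequences over \<open>A\<close> or \<open>B\<close> to sequences over
  the triangular ring\<close>

context triangular
begin

text \<open>With zero \<open>M\<close>-components the equations decouple. In the middle component,
  columns see \<open>FA\<close> acting on \<open>\<^sub>AM\<close>, which is exact by finite
  projective dimension, and rows see \<open>FB\<close> acting on \<open>M\<^sub>B\<close>, which is
  exact by \<open>tor_vanishing\<close>.\<close>

lemma acyclic_diagonal:
 assumes pd: "proj_dim A L < \<infinity>" and tv: "tor_vanishing B N"
  and FA: "acyclic_seq A n FA" and FB: "acyclic_seq B n FB"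
 shows "acyclic_seq \<Lambda> n (%i j k. (FA i j k, \<zero>\<^sub>M, FB i j k))"
proof -
 let ?F = "%i j k. (FA i j k, \<zero>\<^sub>M, FB i j k)"
 have seqA: "mat_seq A n FA" and seqB: "mat_seq B n FB" using FA FB by (simp_all add: acyclic_seq_def)
 note closed = mat_seqD(1)[OF seqA] mat_seqD(1)[OF seqB]
 have seq: "mat_seq \<Lambda> n ?F"
  unfolding mat_seq_def
 proof (intro conjI allI impI)
  fix i j k assume "j < n (Suc i)" "k < n i"
  then show "?F i j k \<in> carrier \<Lambda>" using closed by simp
 next
  fix i k j assume "k < n (Suc (Suc i))" "j < n i"
  then show "dot \<Lambda> (n (Suc i)) (?F (Suc i) k) (%l. ?F i l j) = \<zero>\<^sub>\<Lambda>"
   using closed mat_seqD(2)[OF seqA] mat_seqD(2)[OF seqB] by (subst msum_row) simp_all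
 qed
 have "cols_exact L n FA"
  using cols_exact_proj_dim[OF L.left_module_axioms pd seqA] FA by (simp add: acyclic_seq_def)
 then have colL: "exact_col L (n i) (n (Suc i)) (n (Suc (Suc i))) (FA i) (FA (Suc i))" for i
  by (simp add: cols_exact_def)
 have rowN: "exact_col N (n (Suc (Suc i))) (n (Suc i)) (n i) (tr (FB (Suc i))) (tr (FB i))" for i
  using tor_vanishing_rows_exact[OF tv FB] by (simp add: rows_exact_def)
 have colA: "cols_exact (regular A) n FA" and rowA: "rows_exact (regular (opposite A)) n FA"
  and colB: "cols_exact (regular B) n FB" and rowB: "rows_exact (regular (opposite B)) n FB"
  using FA FB by (simp_all add: acyclic_seq_def)
 have split: "vec A p (%j. fst (v j)) \<and> vec M p (%j. fst (snd (v j))) \<and> vec B p (%j. snd (snd (v j)))"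
  if "vec \<Lambda> p v" for p v
 proof -
  have "fst (v j) \<in> carrier A \<and> fst (snd (v j)) \<in> carrier M \<and> snd (snd (v j)) \<in> carrier B" if "j < p" for j
   using \<open>vec \<Lambda> p v\<close>[rule_format, OF that] by (cases "v j") simp
  then show ?thesis by simp
 qed
 have "cols_exact (regular \<Lambda>) n ?F"
  unfolding cols_exact_def exact_col_def lincomb_regular
 proof (intro allI impI, elim conjE)
  fix i v
  let ?a = "n i" and ?b = "n (Suc i)" and ?c = "n (Suc (Suc i))"
  assume v: "vec (regular \<Lambda>) ?b v"
   and z: "\<forall>k<?c. dot \<Lambda> ?b (?F (Suc i) k) v = \<zero>\<^bsub>regular \<Lambda>\<^esub>"
  have v': "vec \<Lambda> ?b v" using v by simp
  note sv = split[OF v', THEN conjunct1] split[OF v', THEN conjunct2, THEN conjunct1]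
   split[OF v', THEN conjunct2, THEN conjunct2]
  have z': "dot A ?b (FA (Suc i) k) (%j. fst (v j)) = \<zero>\<^sub>A \<and>
    lincomb L ?b (FA (Suc i) k) (%j. fst (snd (v j))) = \<zero>\<^sub>L \<and>
    dot B ?b (FB (Suc i) k) (%j. snd (snd (v j))) = \<zero>\<^sub>B" if k: "k < ?c" for k
  proof -
   have "dot \<Lambda> ?b (?F (Suc i) k) v = \<zero>\<^sub>\<Lambda>" using z k by simp
   then show ?thesis using v' sv k closed by (subst (asm) msum_row) simp_all
  qed
  obtain u where u: "vec A ?a u" "\<forall>j<?b. fst (v j) = dot A ?a (FA i j) u"
   by (rule cols_exact_regularD[OF colA sv(1)]) (use z' in simp)
  obtain m where m: "vec L ?a m" "\<forall>j<?b. fst (snd (v j)) = lincomb L ?a (FA i j) m"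
   by (rule exact_colD[OF colL, of i "%j. fst (snd (v j))"]) (use z' sv(2) in simp_all)
  obtain w where w: "vec B ?a w" "\<forall>j<?b. snd (snd (v j)) = dot B ?a (FB i j) w"
   by (rule cols_exact_regularD[OF colB sv(3)]) (use z' in simp)
  have "v j = dot \<Lambda> ?a (?F i j) (%l. (u l, m l, w l))" if j: "j < ?b" for j
   using u m w j closed by (subst msum_row) (simp_all add: prod_eq_iff)
  then show "\<exists>x. vec (regular \<Lambda>) ?a x \<and> (\<forall>j<?b. v j = dot \<Lambda> ?a (?F i j) x)"
   using u m w by (intro exI[of _ "%l. (u l, m l, w l)"] conjI allI impI) simp_all
 qed
 moreover have "rows_exact (regular (opposite \<Lambda>)) n ?F"
  unfolding rows_exact_def exact_col_def lincomb_regular_opposite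
 proof (intro allI impI, elim conjE)
  fix i v
  let ?a = "n i" and ?b = "n (Suc i)" and ?c = "n (Suc (Suc i))"
  assume v: "vec (regular (opposite \<Lambda>)) ?b v"
   and z: "\<forall>k<?a. dot \<Lambda> ?b v (tr (?F i) k) = \<zero>\<^bsub>regular (opposite \<Lambda>)\<^esub>"
  have v': "vec \<Lambda> ?b v" using v by simp
  note sv = split[OF v', THEN conjunct1] split[OF v', THEN conjunct2, THEN conjunct1]
   split[OF v', THEN conjunct2, THEN conjunct2]
  have z': "dot A ?b (%j. fst (v j)) (%j. FA i j k) = \<zero>\<^sub>A \<and>
    lincomb N ?b (tr (FB i) k) (%j. fst (snd (v j))) = \<zero>\<^sub>N \<and>
    dot B ?b (%j. snd (snd (v j))) (%j. FB i j k) = \<zero>\<^sub>B" if k: "k < ?a" for k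
  proof -
   have "dot \<Lambda> ?b v (%j. ?F i j k) = \<zero>\<^sub>\<Lambda>" using z k by simp
   then show ?thesis using v' sv k closed by (subst (asm) msum_row) (simp_all add: tr_def)
  qed
  obtain u where u: "vec A ?c u"
   "\<forall>j<?b. fst (v j) = msum A ?c (%l. u l \<otimes>\<^sub>A FA (Suc i) l j)"
   by (rule rows_exact_regularD[OF rowA sv(1)]) (use z' in simp)
  obtain m where m: "vec N ?c m"
   "\<forall>j<?b. fst (snd (v j)) = lincomb N ?c (tr (FB (Suc i)) j) m"
   by (rule exact_colD[OF rowN, of i "%j. fst (snd (v j))"]) (use z' sv(2) in simp_all)
  obtain w where w: "vec B ?c w"
   "\<forall>j<?b. snd (snd (v j)) = msum B ?c (%l. w l \<otimes>\<^sub>B FB (Suc i) l j)"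
   by (rule rows_exact_regularD[OF rowB sv(3)]) (use z' in simp)
  have "v j = msum \<Lambda> ?c (%l. (u l, m l, w l) \<otimes>\<^sub>\<Lambda> ?F (Suc i) l j)" if j: "j < ?b" for j
   using u m w j closed by (subst msum_row) (simp_all add: prod_eq_iff tr_def)
  then show "\<exists>x. vec (regular (opposite \<Lambda>)) ?c x \<and>
    (\<forall>j<?b. v j = msum \<Lambda> ?c (%l. x l \<otimes>\<^sub>\<Lambda> tr (?F (Suc i)) j l))"
   using u m w by (intro exI[of _ "%l. (u l, m l, w l)"] conjI allI impI) simp_all
 qed
 ultimately show ?thesis using seq by (simp add: acyclic_seq_def)
qed

text \<open>Pairing the row \<open>(a, 0, 0)\<close> with columns over \<open>\<Lambda>\<close>
  would involve columns over \<open>M\<close>, about which the hypothesis on \<open>a\<close> makes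
  no direct statement. Instead a matrix is prepended to the completed sequence; \<open>a\<close>
  annihilates its \<open>A\<close>-component, and monicity of the prolonged sequence turns
  \<open>a\<close> into a row over \<open>\<Lambda>\<close> to which exactness applies.\<close>

lemma weakly_Gorenstein_mat_A:
 assumes pd: "proj_dim A L < \<infinity>" and tv: "tor_vanishing B N"
  and noeth: "left_noetherian (opposite \<Lambda>)" and wg: "weakly_Gorenstein_mat \<Lambda>"
 shows "weakly_Gorenstein_mat A"
 unfolding weakly_Gorenstein_mat_def torsionless_mat_def
proof (intro allI impI, elim conjE)
 fix n F a
 assume F: "acyclic_seq A n F" and a: "vec A (n 0) a"
  and zero: "\<forall>w. vec A (n 0) w \<and> (\<forall>j<n (Suc 0). dot A (n 0) (F 0 j) w = \<zero>\<^sub>A) \<longrightarrow>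
   dot A (n 0) a w = \<zero>\<^sub>A"
 have Fc: "mat A (n (Suc i)) (n i) (F i)" for i
  using mat_seqD(1)[of A n F] F by (simp add: acyclic_seq_def)
 let ?n = "%i. n i + n (Suc i)"
 let ?H = "%i j k. (block_diag A (n (Suc i)) (n i) (F i) (F (Suc i)) j k, \<zero>\<^sub>M, shift_mat B (n (Suc i)) (n i) j k)"
 have H: "acyclic_seq \<Lambda> ?n ?H"
  by (rule acyclic_diagonal[OF pd tv acyclic_seq_doubling[OF A F] acyclic_seq_shift_mat[OF B]])
 have "torsionless_mat \<Lambda> (?n 0) (?n (Suc 0)) (?H 0)"
  using wg[unfolded weakly_Gorenstein_mat_def, rule_format, OF H] .
 then obtain p G where G: "acyclic_seq \<Lambda> (case_nat p ?n) (case_nat G ?H)"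
  by (rule acyclic_seq_prepend[OF noeth H])
 interpret P: triangular_seq A B M "case_nat p ?n" "case_nat G ?H"
  by unfold_locales (rule G)
 have FA: "P.FA (Suc 0) = block_diag A (n (Suc 0)) (n 0) (F 0) (F (Suc 0))"
  by (intro ext) (simp add: comp_A_def)
 have Gc: "P.FA 0 j k \<in> carrier A" "P.FM 0 j k \<in> carrier M" "P.FB 0 j k \<in> carrier B" if "j < ?n 0" "k < p" for j k
  using P.F_closed[of j 0 k] that by simp_all
 let ?a = "%k. if k < n 0 then a k else \<zero>\<^sub>A"
 have av: "vec A (case_nat p ?n (Suc 0)) ?a" using a by simp
 \<comment> \<open>The first \<open>n 0\<close> entries of a column of the prepended
   \<open>A\<close>-matrix are killed by \<open>F 0\<close>, since the first block of the doubled
   matrix is \<open>F 0\<close>; so \<open>a\<close> annihilates them, and the padding with zeros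
   ignores the rest.\<close>
 have aG: "\<forall>k<case_nat p ?n 0. dot A (case_nat p ?n (Suc 0)) ?a (%j. P.FA 0 j k) = \<zero>\<^sub>A"
 proof (intro allI impI)
  fix k assume "k < case_nat p ?n 0"
  then have k: "k < p" by simp
  have Gk: "vec A (n 0 + n (Suc 0)) (%l. P.FA 0 l k)" using Gc k by simp
  have Gr: "vec (regular A) (n 0 + n (Suc 0)) (%l. P.FA 0 l k)" using Gk by simp
  have "dot A (n 0) (F 0 j) (%l. P.FA 0 l k) = \<zero>\<^sub>A" if j: "j < n (Suc 0)" for j
   using P.products(1)[of j 0 k] j k FA
    lincomb_block_diag[OF left_module_regular[OF A] Fc[of 0] Fc[of "Suc 0"] _ Gr, of j]
   by (simp add: lincomb_regular)
  then have "dot A (n 0) a (%l. P.FA 0 l k) = \<zero>\<^sub>A" using zero[rule_format, of "%l. P.FA 0 l k"] Gk by simp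
  then show "dot A (case_nat p ?n (Suc 0)) ?a (%j. P.FA 0 j k) = \<zero>\<^sub>A"
   using msum_extend_zero[OF A Gk a] by simp
 qed
 obtain m where m: "vec M (case_nat p ?n (Suc 0)) m" "\<forall>k<case_nat p ?n 0.
   lincomb L (case_nat p ?n (Suc 0)) ?a (%j. P.FM 0 j k) = lincomb N (case_nat p ?n (Suc 0)) (%j. P.FB 0 j k) m"
  by (rule monic_matE[OF P.monic_if_weakly_Gorenstein[OF pd tv noeth wg] av aG])
 have mv: "vec M (case_nat p ?n (Suc 0)) (%j. \<ominus>\<^sub>M m j)" using m(1) by simp
 have mz: "\<forall>k<case_nat p ?n 0. lincomb L (case_nat p ?n (Suc 0)) ?a (%j. P.FM 0 j k)
   \<oplus>\<^sub>M lincomb N (case_nat p ?n (Suc 0)) (%j. P.FB 0 j k) (%j. \<ominus>\<^sub>M m j) = \<zero>\<^sub>M"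
 proof (intro allI impI)
  fix k assume k: "k < case_nat p ?n 0"
  show "lincomb L (case_nat p ?n (Suc 0)) ?a (%j. P.FM 0 j k)
   \<oplus>\<^sub>M lincomb N (case_nat p ?n (Suc 0)) (%j. P.FB 0 j k) (%j. \<ominus>\<^sub>M m j) = \<zero>\<^sub>M"
   unfolding m(2)[rule_format, OF k] using m(1) k Gc by (simp add: N_minus_right M.r_neg)
 qed
 obtain u m' where u: "vec A (case_nat p ?n (Suc (Suc 0))) u" and "vec M (case_nat p ?n (Suc (Suc 0))) m'"
  and au: "\<forall>j<case_nat p ?n (Suc 0). ?a j = msum A (case_nat p ?n (Suc (Suc 0))) (%l. u l \<otimes>\<^sub>A P.FA (Suc 0) l j)"
  and "\<forall>j<case_nat p ?n (Suc 0). \<ominus>\<^sub>M m j = lincomb L (case_nat p ?n (Suc (Suc 0))) u (%l. P.FM (Suc 0) l j)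
   \<oplus>\<^sub>M lincomb N (case_nat p ?n (Suc (Suc 0))) (%l. P.FB (Suc 0) l j) m'"
  by (rule P.row_exact[OF av mv aG mz])
 have "row_span A (n (Suc 0) + n (Suc (Suc 0))) (n 0 + n (Suc 0)) (block_diag A (n (Suc 0)) (n 0) (F 0) (F (Suc 0))) ?a"
  by (rule row_spanI[where u = u]) (use u au FA in simp_all)
 then show "row_span A (n (Suc 0)) (n 0) (F 0) a"
  by (rule row_span_block_diag[OF A Fc Fc])
qed

text \<open>The row \<open>(0, 0, b)\<close> meets only the \<open>B\<close>-component of a column,
  so the hypothesis on \<open>b\<close> passes to \<open>\<Lambda>\<close> and torsionlessness there
  applies directly.\<close>

lemma weakly_Gorenstein_mat_B:
 assumes pd: "proj_dim A L < \<infinity>" and tv: "tor_vanishing B N" and wg: "weakly_Gorenstein_mat \<Lambda>"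
 shows "weakly_Gorenstein_mat B"
 unfolding weakly_Gorenstein_mat_def torsionless_mat_def
proof (intro allI impI, elim conjE)
 fix n F b
 assume F: "acyclic_seq B n F" and b: "vec B (n 0) b"
  and zero: "\<forall>w. vec B (n 0) w \<and> (\<forall>j<n (Suc 0). dot B (n 0) (F 0 j) w = \<zero>\<^sub>B) \<longrightarrow>
   dot B (n 0) b w = \<zero>\<^sub>B"
 have Fc: "mat B (n (Suc i)) (n i) (F i)" for i
  using mat_seqD(1)[of B n F] F by (simp add: acyclic_seq_def)
 let ?n = "%i. n i + n (Suc i)"
 let ?FB = "block_diag B (n (Suc 0)) (n 0) (F 0) (F (Suc 0))"
 let ?H = "%i j k. (shift_mat A (n (Suc i)) (n i) j k, \<zero>\<^sub>M, block_diag B (n (Suc i)) (n i) (F i) (F (Suc i)) j k)"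
 have H: "acyclic_seq \<Lambda> ?n ?H"
  by (rule acyclic_diagonal[OF pd tv acyclic_seq_shift_mat[OF A] acyclic_seq_doubling[OF B F]])
 interpret P: triangular_seq A B M ?n ?H
  by unfold_locales (rule H)
 have Hc: "?H 0 j k \<in> carrier \<Lambda>" if "j < ?n (Suc 0)" "k < ?n 0" for j k by (rule P.F_carrier[OF that])
 let ?b = "%k. if k < n 0 then b k else \<zero>\<^sub>B"
 let ?v = "%k. (\<zero>\<^sub>A, \<zero>\<^sub>M, ?b k)"
 have v: "vec \<Lambda> (?n 0) ?v" using b by simp
 have "torsionless_mat \<Lambda> (?n 0) (?n (Suc 0)) (?H 0)"
  using wg[unfolded weakly_Gorenstein_mat_def, rule_format, OF H] .
 then obtain u where u: "vec \<Lambda> (?n (Suc 0)) u" "\<forall>j<?n 0. ?v j = dot \<Lambda> (?n (Suc 0)) u (%i. ?H 0 i j)"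
 proof (rule torsionless_matD[OF _ v])
  show "\<forall>w. vec \<Lambda> (?n 0) w \<and> (\<forall>j<?n (Suc 0). dot \<Lambda> (?n 0) (?H 0 j) w = \<zero>\<^sub>\<Lambda>) \<longrightarrow>
    dot \<Lambda> (?n 0) ?v w = \<zero>\<^sub>\<Lambda>"
  proof (intro allI impI, elim conjE)
   fix w assume w: "vec \<Lambda> (?n 0) w"
    and wz: "\<forall>j<?n (Suc 0). dot \<Lambda> (?n 0) (?H 0 j) w = \<zero>\<^sub>\<Lambda>"
   let ?c = "%k. snd (snd (w k))"
   have wc: "fst (w k) \<in> carrier A" "fst (snd (w k)) \<in> carrier M" "?c k \<in> carrier B" if "k < ?n 0" for k
    using w[rule_format, OF that] by (cases "w k"; simp)+
   have c: "vec B (n 0 + n (Suc 0)) ?c" using wc by simp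
   have cr: "vec (regular B) (n 0 + n (Suc 0)) ?c" using c by simp
   have "dot B (n 0) (F 0 j) ?c = \<zero>\<^sub>B" if j: "j < n (Suc 0)" for j
   proof -
    have jj: "j < ?n (Suc 0)" using j by simp
    have "dot \<Lambda> (?n 0) (?H 0 j) w = \<zero>\<^sub>\<Lambda>" using wz jj by simp
    moreover have "\<forall>k<?n 0. ?H 0 j k \<in> carrier \<Lambda>" using Hc[OF jj] by simp
    ultimately have "dot B (n 0 + n (Suc 0)) (?FB j) ?c = \<zero>\<^sub>B"
     using w by (simp add: msum_row)
    then show ?thesis
     using lincomb_block_diag[OF left_module_regular[OF B] Fc[of 0] Fc[of "Suc 0"] _ cr, of j] j
     by (simp add: lincomb_regular)
   qed
   then have "dot B (n 0) b ?c = \<zero>\<^sub>B" using zero[rule_format, of ?c] c by simp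
   then have "dot B (?n 0) ?b ?c = \<zero>\<^sub>B" using msum_extend_zero[OF B c b] by simp
   then show "dot \<Lambda> (?n 0) ?v w = \<zero>\<^sub>\<Lambda>"
    using v w wc by (subst msum_row) (simp_all cong: msum_cong lincomb_cong)
  qed
 qed
 have uc: "snd (snd (u k)) \<in> carrier B" if "k < ?n (Suc 0)" for k
  using u(1)[rule_format, OF that] by (cases "u k") simp
 have "row_span B (n (Suc 0) + n (Suc (Suc 0))) (n 0 + n (Suc 0)) ?FB ?b"
 proof (rule row_spanI[where u = "%i. snd (snd (u i))"])
  show "vec B (n (Suc 0) + n (Suc (Suc 0))) (%i. snd (snd (u i)))" using uc by simp
  fix j assume j: "j < n 0 + n (Suc 0)"
  have "?v j = dot \<Lambda> (?n (Suc 0)) u (%i. ?H 0 i j)" using u(2) j by simp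
  moreover have "\<forall>i<?n (Suc 0). ?H 0 i j \<in> carrier \<Lambda>" using Hc[OF _ j] by simp
  ultimately show "?b j = msum B (n (Suc 0) + n (Suc (Suc 0))) (%i. snd (snd (u i)) \<otimes>\<^sub>B ?FB i j)"
   using msum_row[of "?n (Suc 0)" u "%i. ?H 0 i j"] u(1) by (simp only: fst_conv snd_conv prod.inject)
 qed
 then show "row_span B (n (Suc 0)) (n 0) (F 0) b"
  by (rule row_span_block_diag[OF B Fc Fc])
qed

text \<open>\<open>torsionless_if_monic\<close> asks for monicity at every place; shifted sequences
  are again acyclic and carry the condition at place 0 to all others.\<close>

lemma weakly_Gorenstein_mat_if_monic:
 assumes pd: "proj_dim A L < \<infinity>" and tv: "tor_vanishing B N"
  and "left_noetherian (opposite B)" "weakly_Gorenstein_mat A" "weakly_Gorenstein_mat B"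
  and monic: "\<And>n F. acyclic_seq \<Lambda> n F ==>
   monic_mat A M (n 0) (n (Suc 0)) (comp_A F 0) (comp_M F 0) (comp_B F 0)"
 shows "weakly_Gorenstein_mat \<Lambda>"
 unfolding weakly_Gorenstein_mat_def
proof (intro allI impI)
 fix n F assume F: "acyclic_seq \<Lambda> n F"
 then interpret triangular_seq A B M n F by unfold_locales
 show "torsionless_mat \<Lambda> (n 0) (n (Suc 0)) (F 0)"
 proof (rule torsionless_if_monic[OF assms(1-5)])
  fix i
  show "monic_mat A M (n i) (n (Suc i)) (FA i) (FM i) (FB i)"
   using monic[OF acyclic_seq_shift_add[OF F, of i]] by (simp add: comp_A_def comp_M_def comp_B_def)
 qed
qed

end

section \<open>Tensor products and monic modules\<close>

lemma tensor_simps: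
 "\<zero>\<^bsub>tensor B M Y\<^esub> = tensor_kernel B M Y"
 "carrier (tensor B M Y) = tensor_class B M Y ` {c. Poly_Mapping.keys c \<subseteq> carrier M \<times> carrier Y}"
 "add (tensor B M Y) = set_mult (free_Abelian_group (carrier M \<times> carrier Y))"
 "a \<odot>\<^bsub>tensor B M Y\<^esub> T = (\<Union>c\<in>T. tensor_class B M Y (frag_extend (%(m, y). frag_of (a \<odot>\<^sub>M m, y)) c))"
 by (simp_all add: tensor_def Let_def carrier_FactGroup tensor_class_def free_Abelian_group_def image_def)

text \<open>Addition in the free abelian group is that of the whole type of finitely supported
  functions, so classes are plain translates of the kernel.\<close>

lemma tensor_class_eq: "tensor_class B M Y c = (%k. k + c) ` tensor_kernel B M Y"
 by (auto simp: tensor_class_def r_coset_def)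

lemma ex_frag_hom:
 assumes "abelian_group X" "\<And>s. s \<in> S ==> f s \<in> carrier X"
 obtains h where "\<And>c. Poly_Mapping.keys c \<subseteq> S ==> h c \<in> carrier X" "h 0 = \<zero>\<^sub>X"
  "\<And>c d. Poly_Mapping.keys c \<subseteq> S ==> Poly_Mapping.keys d \<subseteq> S ==> h (c + d) = h c \<oplus>\<^sub>X h d"
  "\<And>c d. Poly_Mapping.keys c \<subseteq> S ==> Poly_Mapping.keys d \<subseteq> S ==> h (c - d) = h c \<oplus>\<^sub>X \<ominus>\<^sub>X h d"
  "\<And>s. s \<in> S ==> h (frag_of s) = f s"
proof -
 interpret X: abelian_group X by fact
 have "f ` S \<subseteq> carrier (add_monoid X)" using assms(2) by auto
 then obtain h where h: "h \<in> hom (free_Abelian_group S) (add_monoid X)" "\<forall>s\<in>S. h (frag_of s) = f s"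
  by (rule comm_group.free_Abelian_group_universal[OF X.a_comm_group]) blast
 have c: "h c \<in> carrier X" if "Poly_Mapping.keys c \<subseteq> S" for c using hom_in_carrier[OF h(1), of c] that by simp
 have a: "h (c + d) = h c \<oplus>\<^sub>X h d" if "Poly_Mapping.keys c \<subseteq> S" "Poly_Mapping.keys d \<subseteq> S" for c d
  using hom_mult[OF h(1), of c d] that by simp
 have z: "h 0 = \<zero>\<^sub>X" using a[of 0 0] c[of 0] X.add.r_cancel_one[of "h 0" "h 0"] by simp
 have m: "h (- d) = \<ominus>\<^sub>X h d" if "Poly_Mapping.keys d \<subseteq> S" for d
  using a[of "- d" d] that z c[of d] c[of "- d"] by (intro X.minus_equality[symmetric]) simp_all
 have "h (c - d) = h c \<oplus>\<^sub>X \<ominus>\<^sub>X h d" if "Poly_Mapping.keys c \<subseteq> S" "Poly_Mapping.keys d \<subseteq> S" for c d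
  using a[of c "- d"] m[of d] that by simp
 then show ?thesis using c a z h(2) by (intro that[of h]) simp_all
qed

locale tensor_product = triangular A B M + Y: left_module B Y
 for A :: "'a ring" and B :: "'b ring" and M :: "('a, 'b, 'm) bimodule" and Y :: "('b, 'y) module"
begin

abbreviation "T \<equiv> tensor B M Y"
abbreviation "ker \<equiv> tensor_kernel B M Y"
abbreviation "cls \<equiv> tensor_class B M Y"
abbreviation "\<tau> \<equiv> pure_tensor B M Y"
abbreviation "supp c \<equiv> Poly_Mapping.keys c \<subseteq> carrier M \<times> carrier Y"

lemma supp_add: "supp c ==> supp d ==> supp (c + d)"
 using keys_add[of c d] by blast

lemma supp_diff: "supp c ==> supp d ==> supp (c - d)"
 using keys_diff[of c d] by blast

lemma supp_frag_of: "m \<in> carrier M ==> y \<in> carrier Y ==> supp (frag_of (m, y))"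
 by simp

lemma supp_relator: "r \<in> tensor_relators B M Y ==> supp r"
 unfolding tensor_relators_def
 by (elim UnE CollectE exE conjE; hypsubst; intro supp_diff supp_frag_of) simp_all

lemma kernel_subgroup: "subgroup ker (free_Abelian_group (carrier M \<times> carrier Y))"
 unfolding tensor_kernel_def
 by (rule group.generate_is_subgroup) (use supp_relator in \<open>auto simp: subset_iff\<close>)

lemma supp_kernel: "c \<in> ker ==> supp c"
 using subgroup.subset[OF kernel_subgroup] by (auto simp: subset_iff)

lemma kernel_closed:
 shows "0 \<in> ker" "c \<in> ker ==> d \<in> ker ==> c + d \<in> ker" "c \<in> ker ==> - c \<in> ker" "c \<in> ker ==> d \<in> ker ==> c - d \<in> ker"
proof -
 note K = kernel_subgroup
 show "0 \<in> ker" using subgroup.one_closed[OF K] by simp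
 show add: "c + d \<in> ker" if "c \<in> ker" "d \<in> ker" for c d using subgroup.m_closed[OF K that] by simp
 show minus: "- c \<in> ker" if "c \<in> ker" for c using subgroup.m_inv_closed[OF K that] supp_kernel[OF that] by simp
 show "c - d \<in> ker" if "c \<in> ker" "d \<in> ker" using add[OF that(1) minus[OF that(2)]] by simp
qed

text \<open>Closure under differences covers both sums and inverses in a generated subgroup, and it
  matches the cases of \<open>frag_induction\<close>.\<close>

lemma kernel_induct [consumes 1, case_names zero relator diff]:
 assumes "c \<in> ker" and zero: "P 0" and relator: "\<And>r. r \<in> tensor_relators B M Y ==> P r"
  and diff: "\<And>c d. P c ==> P d ==> P (c - d)"
 shows "P c"
 using assms(1) unfolding tensor_kernel_def
proof (induction c rule: generate.induct)
 case (inv r)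
 then show ?case using diff[OF zero relator[OF inv]] supp_relator[OF inv] by simp
next
 case (eng c d)
 then show ?case using diff[OF eng.IH(1) diff[OF zero eng.IH(2)]] by simp
qed (use zero relator in simp_all)

lemma cls_eq_iff: "cls c = cls d \<longleftrightarrow> c - d \<in> ker"
proof
 assume "cls c = cls d"
 moreover have "c \<in> cls c" unfolding tensor_class_eq using kernel_closed(1) by (intro image_eqI[of _ _ 0]) simp_all
 ultimately show "c - d \<in> ker" unfolding tensor_class_eq by auto
next
 assume cd: "c - d \<in> ker"
 have "cls c' \<subseteq> cls d'" if "c' - d' \<in> ker" for c' d'
  unfolding tensor_class_eq
 proof
  fix x assume "x \<in> (%k. k + c') ` ker"
  then obtain k where "k \<in> ker" "x = k + c'" by (rule imageE) simp
  then show "x \<in> (%k. k + d') ` ker"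
   using kernel_closed(2)[OF _ that, of k] by (intro image_eqI[of _ _ "k + (c' - d')"]) simp_all
 qed
 from this[OF cd] this[of d c] show "cls c = cls d" using kernel_closed(3)[OF cd] by auto
qed

lemma cls_add: "cls c \<oplus>\<^sub>T cls d = cls (c + d)"
proof
 show "cls c \<oplus>\<^sub>T cls d \<subseteq> cls (c + d)"
 proof
  fix x assume "x \<in> cls c \<oplus>\<^sub>T cls d"
  then obtain k l where "k \<in> ker" "l \<in> ker" "x = (k + c) + (l + d)"
   by (auto simp: tensor_simps tensor_class_eq set_mult_def)
  then show "x \<in> cls (c + d)" unfolding tensor_class_eq
   using kernel_closed(2)[of k l] by (intro image_eqI[of _ _ "k + l"]) (simp_all add: algebra_simps)
 qed
 show "cls (c + d) \<subseteq> cls c \<oplus>\<^sub>T cls d"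
 proof
  fix x assume "x \<in> cls (c + d)"
  then obtain k where "k \<in> ker" "x = k + (c + d)" by (auto simp: tensor_class_eq)
  then have "x = (k + c) + (0 + d)" "k + c \<in> cls c" "0 + d \<in> cls d"
   using kernel_closed(1) by (auto simp: tensor_class_eq algebra_simps)
  then show "x \<in> cls c \<oplus>\<^sub>T cls d" by (auto simp: tensor_simps set_mult_def)
 qed
qed

lemma cls_closed: "supp c ==> cls c \<in> carrier T"
 by (simp add: tensor_simps)

lemma tensorE:
 assumes "t \<in> carrier T"
 obtains c where "supp c" "t = cls c"
 using assms by (auto simp: tensor_simps)

lemma cls_zero: "\<zero>\<^sub>T = cls 0"
 by (simp add: tensor_simps tensor_class_eq)

lemma abelian_group_tensor: "abelian_group T"
proof (rule abelian_groupI)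
 show "\<zero>\<^sub>T \<in> carrier T" unfolding cls_zero by (rule cls_closed) simp
next
 fix x y z assume "x \<in> carrier T" "y \<in> carrier T" "z \<in> carrier T"
 then obtain c d e where c: "supp c" "x = cls c" and d: "supp d" "y = cls d" and e: "supp e" "z = cls e"
  by (elim tensorE)
 show "x \<oplus>\<^sub>T y \<in> carrier T" unfolding c d cls_add by (rule cls_closed[OF supp_add[OF c(1) d(1)]])
 show "x \<oplus>\<^sub>T y \<oplus>\<^sub>T z = x \<oplus>\<^sub>T (y \<oplus>\<^sub>T z)" unfolding c d e cls_add by (simp add: add.assoc)
 show "x \<oplus>\<^sub>T y = y \<oplus>\<^sub>T x" unfolding c d cls_add by (simp add: add.commute)
next
 fix x assume "x \<in> carrier T"
 then obtain c where c: "supp c" "x = cls c" by (rule tensorE)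
 show "\<zero>\<^sub>T \<oplus>\<^sub>T x = x" unfolding cls_zero c cls_add by simp
 have "cls (- c) \<in> carrier T" by (rule cls_closed) (use c in simp)
 moreover have "cls (- c) \<oplus>\<^sub>T x = \<zero>\<^sub>T" unfolding cls_zero c cls_add by simp
 ultimately show "\<exists>y\<in>carrier T. y \<oplus>\<^sub>T x = \<zero>\<^sub>T" by (intro bexI[of _ "cls (- c)"])
qed

sublocale T: abelian_group T by (rule abelian_group_tensor)

lemma \<tau>_closed [simp]: "m \<in> carrier M ==> y \<in> carrier Y ==> \<tau> m y \<in> carrier T"
 unfolding pure_tensor_def by (rule cls_closed) simp

lemma \<tau>_add_left:
 assumes "m \<in> carrier M" "m' \<in> carrier M" "y \<in> carrier Y"
 shows "\<tau> (m \<oplus>\<^sub>M m') y = \<tau> m y \<oplus>\<^sub>T \<tau> m' y"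
proof -
 have "frag_of (m \<oplus>\<^sub>M m', y) - frag_of (m, y) - frag_of (m', y) \<in> tensor_relators B M Y"
  unfolding tensor_relators_def using assms by (intro UnI1 CollectI exI[of _ m] exI[of _ m'] exI[of _ y]) simp
 then have "frag_of (m \<oplus>\<^sub>M m', y) - frag_of (m, y) - frag_of (m', y) \<in> ker"
  unfolding tensor_kernel_def by (rule generate.incl)
 then show ?thesis unfolding pure_tensor_def cls_add cls_eq_iff by (simp add: algebra_simps)
qed

lemma \<tau>_add_right:
 assumes "m \<in> carrier M" "y \<in> carrier Y" "y' \<in> carrier Y"
 shows "\<tau> m (y \<oplus>\<^sub>Y y') = \<tau> m y \<oplus>\<^sub>T \<tau> m y'"
proof -
 have "frag_of (m, y \<oplus>\<^sub>Y y') - frag_of (m, y) - frag_of (m, y') \<in> tensor_relators B M Y"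
  unfolding tensor_relators_def using assms by (intro UnI1 UnI2 CollectI exI[of _ m] exI[of _ y] exI[of _ y']) simp
 then have "frag_of (m, y \<oplus>\<^sub>Y y') - frag_of (m, y) - frag_of (m, y') \<in> ker"
  unfolding tensor_kernel_def by (rule generate.incl)
 then show ?thesis unfolding pure_tensor_def cls_add cls_eq_iff by (simp add: algebra_simps)
qed

lemma \<tau>_balanced:
 assumes "m \<in> carrier M" "b \<in> carrier B" "y \<in> carrier Y"
 shows "\<tau> (rsmult M m b) y = \<tau> m (b \<odot>\<^sub>Y y)"
proof -
 have "frag_of (rsmult M m b, y) - frag_of (m, b \<odot>\<^sub>Y y) \<in> tensor_relators B M Y"
  unfolding tensor_relators_def using assms by (intro UnI2 CollectI exI conjI) auto
 then have "frag_of (rsmult M m b, y) - frag_of (m, b \<odot>\<^sub>Y y) \<in> ker"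
  unfolding tensor_kernel_def by (rule generate.incl)
 then show ?thesis unfolding pure_tensor_def cls_eq_iff .
qed

lemma \<tau>_zero [simp]:
 shows "y \<in> carrier Y ==> \<tau> \<zero>\<^sub>M y = \<zero>\<^sub>T" "m \<in> carrier M ==> \<tau> m \<zero>\<^sub>Y = \<zero>\<^sub>T"
 using \<tau>_add_left[of "\<zero>\<^sub>M" "\<zero>\<^sub>M" y] \<tau>_add_right[of m "\<zero>\<^sub>Y" "\<zero>\<^sub>Y"]
  T.add.r_cancel_one'[of "\<tau> \<zero>\<^sub>M y" "\<tau> \<zero>\<^sub>M y"] T.add.r_cancel_one'[of "\<tau> m \<zero>\<^sub>Y" "\<tau> m \<zero>\<^sub>Y"] by simp_all

definition act :: "'a => ('m \<times> 'y \<Rightarrow>\<^sub>0 int) => 'm \<times> 'y \<Rightarrow>\<^sub>0 int" where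
 "act a = frag_extend (%(m, y). frag_of (a \<odot>\<^sub>M m, y))"

lemma supp_act: "a \<in> carrier A ==> supp c ==> supp (act a c)"
proof -
 assume a: "a \<in> carrier A" and c: "supp c"
 show "supp (act a c)"
  unfolding act_def by (rule order_trans[OF keys_frag_extend]) (use a c in \<open>auto split: prod.splits\<close>)
qed

text \<open>The left action takes each relator to another one: it is additive in \<open>m\<close>
  and commutes with the right action.\<close>

lemma act_kernel:
 assumes a: "a \<in> carrier A" and "c \<in> ker"
 shows "act a c \<in> ker"
 using assms(2)
proof (induction rule: kernel_induct)
 case zero
 then show ?case by (simp add: act_def kernel_closed(1))
next
 case (diff c d)
 then show ?case by (simp add: act_def frag_extend_diff kernel_closed(4))
next
 case (relator r)
 have bi: "a \<odot>\<^sub>M rsmult M m b = rsmult M (a \<odot>\<^sub>M m) b" if "m \<in> carrier M" "b \<in> carrier B" for m b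
  using bimodule a that by (simp add: is_bimodule_def)
 have di: "a \<odot>\<^sub>M (m \<oplus>\<^sub>M m') = a \<odot>\<^sub>M m \<oplus>\<^sub>M a \<odot>\<^sub>M m'" if "m \<in> carrier M" "m' \<in> carrier M" for m m'
  using L.smult_r_distr[of a m m'] a that by simp
 note M_smult_closed(1)[OF a, simp]
 from relator show ?case
  unfolding tensor_relators_def
 proof (elim UnE CollectE exE conjE; hypsubst)
  fix m m' y assume "m \<in> carrier M" "m' \<in> carrier M" "y \<in> carrier Y"
  then show "act a (frag_of (m \<oplus>\<^sub>M m', y) - frag_of (m, y) - frag_of (m', y)) \<in> ker"
   using \<tau>_add_left[of "a \<odot>\<^sub>M m" "a \<odot>\<^sub>M m'" y]
   by (simp add: act_def frag_extend_diff di pure_tensor_def cls_add cls_eq_iff frag_extend_add algebra_simps)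
 next
  fix m y y' assume "m \<in> carrier M" "y \<in> carrier Y" "y' \<in> carrier Y"
  then show "act a (frag_of (m, y \<oplus>\<^sub>Y y') - frag_of (m, y) - frag_of (m, y')) \<in> ker"
   using \<tau>_add_right[of "a \<odot>\<^sub>M m" y y']
   by (simp add: act_def frag_extend_diff pure_tensor_def cls_add cls_eq_iff frag_extend_add algebra_simps)
 next
  fix m b y assume "m \<in> carrier M" "b \<in> carrier B" "y \<in> carrier Y"
  then show "act a (frag_of (rsmult M m b, y) - frag_of (m, b \<odot>\<^sub>Y y)) \<in> ker"
   using \<tau>_balanced[of "a \<odot>\<^sub>M m" b y]
   by (simp add: act_def frag_extend_diff bi pure_tensor_def cls_eq_iff)
 qed
qed

lemma smult_cls:
 assumes "a \<in> carrier A"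
 shows "a \<odot>\<^sub>T cls c = cls (act a c)"
proof -
 have "cls (act a d) = cls (act a c)" if "d \<in> cls c" for d
 proof -
  have "d - c \<in> ker" using that by (auto simp: tensor_class_eq)
  from act_kernel[OF assms this] show ?thesis by (simp add: cls_eq_iff act_def frag_extend_diff)
 qed
 moreover have "c \<in> cls c" unfolding tensor_class_eq using kernel_closed(1) by (intro image_eqI[of _ _ 0]) simp_all
 ultimately show ?thesis unfolding tensor_simps act_def[symmetric] by blast
qed

text \<open>The universal property. A balanced biadditive map extends to the free abelian group and
  kills the relators; compatibility with the left action is checked on the basis and propagated
  through differences.\<close>

lemma ex_tensor_hom:
 assumes X: "left_module A X"
  and closed: "\<And>m y. m \<in> carrier M ==> y \<in> carrier Y ==> \<gamma> m y \<in> carrier X"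
  and add_left: "\<And>m m' y. m \<in> carrier M ==> m' \<in> carrier M ==> y \<in> carrier Y ==>
   \<gamma> (m \<oplus>\<^sub>M m') y = \<gamma> m y \<oplus>\<^sub>X \<gamma> m' y"
  and add_right: "\<And>m y y'. m \<in> carrier M ==> y \<in> carrier Y ==> y' \<in> carrier Y ==>
   \<gamma> m (y \<oplus>\<^sub>Y y') = \<gamma> m y \<oplus>\<^sub>X \<gamma> m y'"
  and balanced: "\<And>m b y. m \<in> carrier M ==> b \<in> carrier B ==> y \<in> carrier Y ==>
   \<gamma> (rsmult M m b) y = \<gamma> m (b \<odot>\<^sub>Y y)"
  and linear: "\<And>a m y. a \<in> carrier A ==> m \<in> carrier M ==> y \<in> carrier Y ==>
   \<gamma> (a \<odot>\<^sub>M m) y = a \<odot>\<^sub>X \<gamma> m y"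
 obtains \<phi> where "\<phi> \<in> mod_hom A T X" "\<forall>m\<in>carrier M. \<forall>y\<in>carrier Y. \<phi> (\<tau> m y) = \<gamma> m y"
proof -
 interpret X: left_module A X by (rule X)
 obtain h where h: "\<And>c. supp c ==> h c \<in> carrier X" "h 0 = \<zero>\<^sub>X"
  "\<And>c d. supp c ==> supp d ==> h (c + d) = h c \<oplus>\<^sub>X h d"
  "\<And>c d. supp c ==> supp d ==> h (c - d) = h c \<oplus>\<^sub>X \<ominus>\<^sub>X h d"
  "\<And>s. s \<in> carrier M \<times> carrier Y ==> h (frag_of s) = (case s of (m, y) => \<gamma> m y)"
  by (rule ex_frag_hom[OF X.M.abelian_group_axioms, of "carrier M \<times> carrier Y" "%(m, y). \<gamma> m y"])
   (use closed in auto)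
 have hf: "h (frag_of (m, y)) = \<gamma> m y" if "m \<in> carrier M" "y \<in> carrier Y" for m y
  using h(5)[of "(m, y)"] that by simp
 have "supp c \<and> h c = \<zero>\<^sub>X" if "c \<in> ker" for c
  using that
 proof (induction rule: kernel_induct)
  case zero
  then show ?case using h(2) by simp
 next
  case (diff c d)
  then show ?case using h(4)[of c d] supp_diff[of c d] by simp
 next
  case (relator r)
  have "h r = \<zero>\<^sub>X"
   using relator unfolding tensor_relators_def
  proof (elim UnE CollectE exE conjE; hypsubst)
   fix m m' y assume "m \<in> carrier M" "m' \<in> carrier M" "y \<in> carrier Y"
   then show "h (frag_of (m \<oplus>\<^sub>M m', y) - frag_of (m, y) - frag_of (m', y)) = \<zero>\<^sub>X"
    using closed by (simp add: h(4) supp_diff hf add_left X.M.a_ac X.M.r_neg1 X.M.r_neg)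
  next
   fix m y y' assume "m \<in> carrier M" "y \<in> carrier Y" "y' \<in> carrier Y"
   then show "h (frag_of (m, y \<oplus>\<^sub>Y y') - frag_of (m, y) - frag_of (m, y')) = \<zero>\<^sub>X"
    using closed by (simp add: h(4) supp_diff hf add_right X.M.a_ac X.M.r_neg1 X.M.r_neg)
  next
   fix m b y assume "m \<in> carrier M" "b \<in> carrier B" "y \<in> carrier Y"
   then show "h (frag_of (rsmult M m b, y) - frag_of (m, b \<odot>\<^sub>Y y)) = \<zero>\<^sub>X"
    using closed by (simp add: h(4) hf balanced X.M.r_neg)
  qed
  then show ?case using supp_relator[OF relator] by simp
 qed
 then have hker: "h c = \<zero>\<^sub>X" if "c \<in> ker" for c using that by simp
 have hcls: "h c = h d" if "supp c" "supp d" "cls c = cls d" for c d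
 proof -
  have "h (c - d) = \<zero>\<^sub>X" using that(3) by (intro hker) (simp add: cls_eq_iff)
  then show ?thesis using h(3)[OF supp_diff[OF that(1,2)] that(2)] h(1) that by simp
 qed
 define \<phi> where "\<phi> = (\<lambda>t\<in>carrier T. h (SOME c. supp c \<and> t = cls c))"
 have \<phi>: "\<phi> (cls c) = h c" if "supp c" for c
 proof -
  let ?d = "SOME d. supp d \<and> cls c = cls d"
  have d: "supp ?d \<and> cls c = cls ?d" by (rule someI[of _ c]) (use that in simp)
  have "\<phi> (cls c) = h ?d" unfolding \<phi>_def using cls_closed[OF that] by simp
  also have "\<dots> = h c" by (rule hcls[OF conjunct1[OF d] that conjunct2[OF d, symmetric]])
  finally show ?thesis .
 qed
 have hact: "h (act a c) = a \<odot>\<^sub>X h c" if a: "a \<in> carrier A" and c: "supp c" for a c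
 proof -
  have "supp c \<and> h (act a c) = a \<odot>\<^sub>X h c"
   using c
  proof (induction c rule: frag_induction)
   case zero
   then show ?case using a by (simp add: act_def h(2))
  next
   case (one s)
   then obtain m y where "s = (m, y)" "m \<in> carrier M" "y \<in> carrier Y" by blast
   then show ?case using a by (simp add: act_def hf linear)
  next
   case (diff c d)
   then have "h (act a (c - d)) = h (act a c) \<oplus>\<^sub>X \<ominus>\<^sub>X h (act a d)"
    using h(4)[OF supp_act[OF a] supp_act[OF a], of c d] by (simp add: act_def frag_extend_diff)
   then show ?case using diff h(1,4) a by (simp add: supp_diff X.smult_r_distr X.smult_minus)
  qed
  then show ?thesis by simp
 qed
 have "\<phi> \<in> mod_hom A T X"
 proof (rule mod_homI)
  fix t assume "t \<in> carrier T"
  then obtain c where c: "supp c" "t = cls c" by (rule tensorE)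
  show "\<phi> t \<in> carrier X" using c h(1) \<phi> by simp
  {
   fix t' assume "t' \<in> carrier T"
   then obtain d where d: "supp d" "t' = cls d" by (rule tensorE)
   show "\<phi> (t \<oplus>\<^sub>T t') = \<phi> t \<oplus>\<^sub>X \<phi> t'"
    unfolding c d cls_add \<phi>[OF c(1)] \<phi>[OF d(1)] \<phi>[OF supp_add[OF c(1) d(1)]] by (rule h(3)[OF c(1) d(1)])
  next
   fix a assume a: "a \<in> carrier A"
   show "\<phi> (a \<odot>\<^sub>T t) = a \<odot>\<^sub>X \<phi> t"
    unfolding c smult_cls[OF a] \<phi>[OF c(1)] \<phi>[OF supp_act[OF a c(1)]] by (rule hact[OF a c(1)])
  }
 qed (simp add: \<phi>_def)
 moreover have "\<phi> (\<tau> m y) = \<gamma> m y" if "m \<in> carrier M" "y \<in> carrier Y" for m y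
  unfolding pure_tensor_def using that by (simp add: \<phi> hf)
 ultimately show ?thesis by (intro that[of \<phi>]) simp_all
qed

end

section \<open>Tensor products with finitely presented modules\<close>

context tensor_product
begin

lemma \<tau>_msum_left:
 "vec M n f ==> y \<in> carrier Y ==> \<tau> (msum M n f) y = msum T n (%i. \<tau> (f i) y)"
 by (rule msum_hom[where f = "%m. \<tau> m y", OF M.abelian_group_axioms]) (simp_all add: \<tau>_add_left)

lemma \<tau>_msum_right:
 "vec Y n f ==> m \<in> carrier M ==> \<tau> m (msum Y n f) = msum T n (%i. \<tau> m (f i))"
 by (rule msum_hom[where f = "\<tau> m", OF Y.M.abelian_group_axioms]) (simp_all add: \<tau>_add_right)

lemma \<tau>_lincomb:
 assumes "m \<in> carrier M" "vec B p b" "vec Y p y"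
 shows "\<tau> m (lincomb Y p b y) = msum T p (%k. \<tau> (rsmult M m (b k)) (y k))"
 unfolding lincomb_def using assms by (simp add: \<tau>_msum_right \<tau>_balanced cong: msum_cong)

text \<open>Expanding right factors in the generators \<open>y\<close> and moving the coefficients
  across by balancedness turns elements of the tensor product into vectors over
  \<open>M\<close>.\<close>

lemma tensor_spanned:
 assumes y: "spans B Y (carrier Y) p y" and t: "t \<in> carrier T"
 obtains z where "vec M p z" "t = msum T p (%k. \<tau> (z k) (y k))"
proof -
 have yc: "vec Y p y" using spansD(1)[OF y] by simp
 obtain c where c: "supp c" "t = cls c" using t by (rule tensorE)
 from c(1) have "supp c \<and> (\<exists>z. vec M p z \<and> cls c = msum T p (%k. \<tau> (z k) (y k)))"
 proof (induction c rule: frag_induction)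
  case zero
  have "cls 0 = msum T p (%k. \<tau> \<zero>\<^sub>M (y k))" unfolding cls_zero[symmetric] using yc by (simp cong: msum_cong)
  then show ?case by (intro conjI exI[of _ "%k. \<zero>\<^sub>M"]) simp_all
 next
  case (one s)
  then obtain m yy where s: "s = (m, yy)" "m \<in> carrier M" "yy \<in> carrier Y" by blast
  obtain b where b: "\<forall>j<p. b j \<in> carrier B" "yy = lincomb Y p b y" by (rule spansE[OF y s(3)])
  have "cls (frag_of s) = \<tau> m yy" by (simp add: s pure_tensor_def)
  also have "\<dots> = msum T p (%k. \<tau> (rsmult M m (b k)) (y k))"
   unfolding b(2) by (rule \<tau>_lincomb[OF s(2) b(1) yc])
  finally show ?case using s b(1) by (intro conjI exI[of _ "%k. rsmult M m (b k)"]) simp_all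
 next
  case (diff c d)
  obtain z w where z: "vec M p z" "cls c = msum T p (%k. \<tau> (z k) (y k))"
   and w: "vec M p w" "cls d = msum T p (%k. \<tau> (w k) (y k))"
   using diff by (elim exE conjE)
  let ?x = "%k. z k \<oplus>\<^sub>M \<ominus>\<^sub>M w k"
  have cd: "supp c" "supp d" using diff by simp_all
  have zk: "z k = ?x k \<oplus>\<^sub>M w k" if "k < p" for k using z w that by (simp add: M.a_assoc M.l_neg)
  have "cls c = msum T p (%k. \<tau> (?x k \<oplus>\<^sub>M w k) (y k))"
   unfolding z(2) by (rule msum_cong) (use zk in simp)
  also have "\<dots> = msum T p (%k. \<tau> (?x k) (y k)) \<oplus>\<^sub>T cls d"
   unfolding w(2) using z w yc by (simp add: \<tau>_add_left T.msum_add[symmetric] cong: msum_cong)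
  finally have "cls (c - d) \<oplus>\<^sub>T cls d = msum T p (%k. \<tau> (?x k) (y k)) \<oplus>\<^sub>T cls d"
   by (simp add: cls_add)
  moreover have "msum T p (%k. \<tau> (?x k) (y k)) \<in> carrier T" using z w yc by (intro T.msum_closed) simp
  ultimately have "cls (c - d) = msum T p (%k. \<tau> (?x k) (y k))"
   using T.add.r_cancel[OF _ cls_closed[OF supp_diff[OF cd]] _ , of "cls d" "msum T p (%k. \<tau> (?x k) (y k))"]
    cls_closed[OF cd(2)] by (simp add: T.add.right_cancel cls_closed supp_diff cd)
  then show ?case using z w supp_diff[OF cd] by (intro conjI exI[of _ ?x]) simp_all
 qed
 then show ?thesis using that c(2) by blast
qed

text \<open>If \<open>Y\<close> is the cokernel of \<open>G\<close>, then \<open>M \<otimes> Y\<close> is the cokernel of \<open>M\<^sup>q \<rightarrow> M\<^sup>p\<close>, \<open>m \<mapsto> m G\<close>.\<close>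

lemma tensor_vanishing:
 assumes y: "spans B Y (carrier Y) p y" and G: "mat B q p G"
  and rel: "\<forall>b. vec B p b \<longrightarrow> (lincomb Y p b y = \<zero>\<^sub>Y \<longleftrightarrow> row_span B q p G b)"
  and z: "vec M p z"
 shows "msum T p (%k. \<tau> (z k) (y k)) = \<zero>\<^sub>T \<longleftrightarrow>
  (\<exists>m. vec M q m \<and> (\<forall>k<p. z k = lincomb N q (%j. G j k) m))"
proof
 have yc: "vec Y p y" using spansD(1)[OF y] by simp
 assume "\<exists>m. vec M q m \<and> (\<forall>k<p. z k = lincomb N q (%j. G j k) m)"
 then obtain m where m: "vec M q m" "\<forall>k<p. z k = lincomb N q (%j. G j k) m" by (elim exE conjE)
 have "msum T p (%k. \<tau> (z k) (y k)) = msum T p (%k. msum T q (%j. \<tau> (rsmult M (m j) (G j k)) (y k)))"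
  using m G yc by (intro msum_cong) (simp add: lincomb_def \<tau>_msum_left)
 also have "\<dots> = msum T q (%j. msum T p (%k. \<tau> (rsmult M (m j) (G j k)) (y k)))"
  by (rule T.msum_swap) (use m G yc in simp)
 also have "\<dots> = msum T q (%j. \<zero>\<^sub>T)"
 proof (rule msum_cong)
  fix j assume j: "j < q"
  have "lincomb Y p (G j) y = \<zero>\<^sub>Y"
   using rel G j B.row_span_unit[OF G j] by simp
  then show "msum T p (%k. \<tau> (rsmult M (m j) (G j k)) (y k)) = \<zero>\<^sub>T"
   using \<tau>_lincomb[of "m j" p "G j" y] m G j yc by simp
 qed
 finally show "msum T p (%k. \<tau> (z k) (y k)) = \<zero>\<^sub>T" by simp
next
 have yc: "vec Y p y" using spansD(1)[OF y] by simp
 assume zero: "msum T p (%k. \<tau> (z k) (y k)) = \<zero>\<^sub>T"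
 let ?P = "power_module L p"
 \<comment> \<open>For the converse an inverse map is built from the tensor product to the quotient
   of the \<open>p\<close>-th power of \<open>M\<close> by \<open>U\<close>, the set of all
   \<open>m G\<close>. It sends the given element to the class of \<open>z\<close>.\<close>
 define U where "U = {(\<lambda>k\<in>{..<p}. lincomb N q (%j. G j k) m) | m. vec M q m}"
 have lmP: "left_module A ?P" by (rule left_module_fun[OF L.left_module_axioms])
 interpret P: left_module A ?P by (rule lmP)
 have bi: "a \<odot>\<^sub>M rsmult M m b = rsmult M (a \<odot>\<^sub>M m) b" if "a \<in> carrier A" "m \<in> carrier M" "b \<in> carrier B" for a m b
  using bimodule that by (simp add: is_bimodule_def)
 have U: "submodule U A ?P"
 proof (rule submoduleI[OF lmP])
  show "U \<subseteq> carrier ?P" unfolding U_def using G by (auto split: if_splits)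
  have "\<zero>\<^bsub>?P\<^esub> = (\<lambda>k\<in>{..<p}. lincomb N q (%j. G j k) (%_. \<zero>\<^sub>M))" using G by (intro ext) simp
  then show "\<zero>\<^bsub>?P\<^esub> \<in> U" unfolding U_def by (intro CollectI exI[of _ "%_. \<zero>\<^sub>M"]) simp
 next
  fix v w assume "v \<in> U" "w \<in> U"
  then obtain m m' where m: "vec M q m" "v = (\<lambda>k\<in>{..<p}. lincomb N q (%j. G j k) m)"
   and m': "vec M q m'" "w = (\<lambda>k\<in>{..<p}. lincomb N q (%j. G j k) m')" unfolding U_def by blast
  have "v \<oplus>\<^bsub>?P\<^esub> w = (\<lambda>k\<in>{..<p}. lincomb N q (%j. G j k) (%j. m j \<oplus>\<^sub>M m' j))"
   using m m' G by (intro ext) (simp add: N_add_right)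
  then show "v \<oplus>\<^bsub>?P\<^esub> w \<in> U" unfolding U_def using m m' by (intro CollectI exI[of _ "%j. m j \<oplus>\<^sub>M m' j"]) simp
 next
  fix a v assume a: "a \<in> carrier A" and "v \<in> U"
  then obtain m where m: "vec M q m" "v = (\<lambda>k\<in>{..<p}. lincomb N q (%j. G j k) m)" unfolding U_def by blast
  have "a \<odot>\<^bsub>?P\<^esub> v = (\<lambda>k\<in>{..<p}. lincomb N q (%j. G j k) (%j. a \<odot>\<^sub>M m j))"
  proof (rule ext)
   fix k
   have "a \<odot>\<^sub>M lincomb N q (%j. G j k) m = lincomb N q (%j. G j k) (%j. a \<odot>\<^sub>M m j)" if "k < p"
    using L.smult_msum[of a q "%j. rsmult M (m j) (G j k)"] a m G that
    by (simp add: lincomb_def bi cong: msum_cong)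
   then show "(a \<odot>\<^bsub>?P\<^esub> v) k = (\<lambda>k\<in>{..<p}. lincomb N q (%j. G j k) (%j. a \<odot>\<^sub>M m j)) k"
    using m by simp
  qed
  then show "a \<odot>\<^bsub>?P\<^esub> v \<in> U" unfolding U_def using m a by (intro CollectI exI[of _ "%j. a \<odot>\<^sub>M m j"]) simp
 qed
 let ?Q = "quot_module ?P U"
 have lmQ: "left_module A ?Q" by (rule left_module_quot[OF U lmP])
 interpret Q: left_module A ?Q by (rule lmQ)
 \<comment> \<open>The intended image of \<open>m\<close> tensored with the combination of the
   \<open>y k\<close> with coefficients \<open>b\<close>.\<close>
 define row where "row m b = (\<lambda>k\<in>{..<p}. rsmult M m (b k))" for m and b :: "nat => 'b"
 have rowc: "row m b \<in> carrier ?P" if "m \<in> carrier M" "vec B p b" for m b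
  using that by (simp add: row_def)
 have rowU: "row m b \<in> U" if m: "m \<in> carrier M" and b: "vec B p b" "lincomb Y p b y = \<zero>\<^sub>Y" for m b
 proof -
  have "row_span B q p G b" using rel b by simp
  then obtain u where u: "vec B q u" "\<forall>k<p. b k = dot B q u (%j. G j k)" by (rule row_spanE)
  have "row m b = (\<lambda>k\<in>{..<p}. lincomb N q (%j. G j k) (%j. rsmult M m (u j)))"
  proof (rule ext)
   fix k
   have "rsmult M m (b k) = lincomb N q (%j. G j k) (%j. rsmult M m (u j))" if k: "k < p"
    using N.msum_smult[of m q "%j. u j \<otimes>\<^sub>B G j k"] N.smult_assoc1[of _ _ m] m u G k
    by (simp add: lincomb_def cong: msum_cong)
   then show "row m b k = (\<lambda>k\<in>{..<p}. lincomb N q (%j. G j k) (%j. rsmult M m (u j))) k" by (simp add: row_def)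
  qed
  then show ?thesis unfolding U_def using m u by (intro CollectI exI[of _ "%j. rsmult M m (u j)"]) simp
 qed
 \<comment> \<open>Coefficients of one element of \<open>Y\<close> differ by a relation, i.e. by a
   combination of rows of \<open>G\<close>, and such a difference contributes an element of
   \<open>U\<close>. Coefficients may therefore be chosen arbitrarily.\<close>
 have row_cong: "U +>\<^bsub>?P\<^esub> row m b = U +>\<^bsub>?P\<^esub> row m b'"
  if m: "m \<in> carrier M" and b: "vec B p b" "vec B p b'" "lincomb Y p b y = lincomb Y p b' y" for m b b'
 proof -
  have d: "vec B p (%k. b k \<oplus>\<^sub>B \<ominus>\<^sub>B b' k)" using b by simp
  have "lincomb Y p (%k. b k \<oplus>\<^sub>B \<ominus>\<^sub>B b' k) y = \<zero>\<^sub>Y"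
   using b yc by (simp add: Y.lincomb_add_left Y.lincomb_minus_left Y.M.r_neg)
  from rowU[OF m d this] have "row m (%k. b k \<oplus>\<^sub>B \<ominus>\<^sub>B b' k) \<in> U" .
  moreover have "row m b = row m (%k. b k \<oplus>\<^sub>B \<ominus>\<^sub>B b' k) \<oplus>\<^bsub>?P\<^esub> row m b'"
  proof (rule ext)
   fix k
   have "rsmult M m (b k) = rsmult M m (b k \<oplus>\<^sub>B \<ominus>\<^sub>B b' k) \<oplus>\<^sub>M rsmult M m (b' k)" if k: "k < p"
   proof -
    have bk: "b k \<in> carrier B" "b' k \<in> carrier B" using b k by simp_all
    have "b k = (b k \<oplus>\<^sub>B \<ominus>\<^sub>B b' k) \<oplus>\<^sub>B b' k" using bk by (simp add: B.a_assoc B.l_neg)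
    then show ?thesis using m bk N.smult_l_distr[of "b k \<oplus>\<^sub>B \<ominus>\<^sub>B b' k" "b' k" m] by simp
   qed
   then show "row m b k = (row m (%k. b k \<oplus>\<^sub>B \<ominus>\<^sub>B b' k) \<oplus>\<^bsub>?P\<^esub> row m b') k" by (simp add: row_def)
  qed
  ultimately have "row m b \<ominus>\<^bsub>?P\<^esub> row m b' \<in> U"
   using rowc[OF m d] rowc[OF m b(2)] by (simp only: P.M.minus_eq P.M.a_assoc P.M.a_inv_closed P.M.r_neg P.M.r_zero)
  then show ?thesis using coset_eq_iff[OF U lmP rowc[OF m b(1)] rowc[OF m b(2)]] by blast
 qed
 have "\<exists>c. yy \<in> carrier Y \<longrightarrow> vec B p c \<and> yy = lincomb Y p c y" for yy
  using spansD(2)[OF y, of yy] by (cases "yy \<in> carrier Y") simp_all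
 then have "\<exists>c. \<forall>yy. yy \<in> carrier Y \<longrightarrow> vec B p (c yy) \<and> yy = lincomb Y p (c yy) y" by (rule choice[OF allI])
 then obtain c where c: "\<forall>yy. yy \<in> carrier Y \<longrightarrow> vec B p (c yy) \<and> yy = lincomb Y p (c yy) y" by (rule exE)
 have cv: "vec B p (c yy)" and cl: "lincomb Y p (c yy) y = yy" if "yy \<in> carrier Y" for yy
  using c that by simp_all
 define \<gamma> where "\<gamma> m yy = U +>\<^bsub>?P\<^esub> row m (c yy)" for m yy
 have row_add: "row (m \<oplus>\<^sub>M m') b = row m b \<oplus>\<^bsub>?P\<^esub> row m' b"
  if "m \<in> carrier M" "m' \<in> carrier M" "vec B p b" for m m' b
  using that N.smult_r_distr[of _ m m'] by (intro ext) (simp add: row_def)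
 obtain \<phi> where \<phi>: "\<phi> \<in> mod_hom A T ?Q" "\<forall>m\<in>carrier M. \<forall>yy\<in>carrier Y. \<phi> (\<tau> m yy) = \<gamma> m yy"
 proof (rule ex_tensor_hom[OF lmQ, of \<gamma>])
  fix m yy assume m: "m \<in> carrier M" and yy: "yy \<in> carrier Y"
  show "\<gamma> m yy \<in> carrier ?Q"
   unfolding \<gamma>_def quot_carrier[OF U lmP] by (rule imageI[OF rowc[OF m cv[OF yy]]])
  {
   fix m' assume m': "m' \<in> carrier M"
   show "\<gamma> (m \<oplus>\<^sub>M m') yy = \<gamma> m yy \<oplus>\<^bsub>?Q\<^esub> \<gamma> m' yy"
    unfolding \<gamma>_def quot_add[OF U lmP rowc[OF m cv[OF yy]] rowc[OF m' cv[OF yy]]] row_add[OF m m' cv[OF yy]] ..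
  next
   fix y' assume y': "y' \<in> carrier Y"
   have s: "vec B p (%k. c yy k \<oplus>\<^sub>B c y' k)" using cv[OF yy] cv[OF y'] by simp
   have "row m (%k. c yy k \<oplus>\<^sub>B c y' k) = row m (c yy) \<oplus>\<^bsub>?P\<^esub> row m (c y')"
    using m cv[OF yy] cv[OF y'] N.smult_l_distr[of _ _ m] by (intro ext) (simp add: row_def)
   moreover have "lincomb Y p (%k. c yy k \<oplus>\<^sub>B c y' k) y = yy \<oplus>\<^sub>Y y'"
    using cv[OF yy] cv[OF y'] yc by (simp add: Y.lincomb_add_left cl yy y')
   then have "\<gamma> m (yy \<oplus>\<^sub>Y y') = U +>\<^bsub>?P\<^esub> row m (%k. c yy k \<oplus>\<^sub>B c y' k)"
    unfolding \<gamma>_def using yy y' s by (intro row_cong[OF m]) (simp_all add: cv cl)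
   ultimately show "\<gamma> m (yy \<oplus>\<^sub>Y y') = \<gamma> m yy \<oplus>\<^bsub>?Q\<^esub> \<gamma> m y'"
    unfolding \<gamma>_def quot_add[OF U lmP rowc[OF m cv[OF yy]] rowc[OF m cv[OF y']]] by simp
  next
   fix b assume b: "b \<in> carrier B"
   have s: "vec B p (%k. b \<otimes>\<^sub>B c yy k)" using b cv[OF yy] by simp
   have "row (rsmult M m b) (c yy) = row m (%k. b \<otimes>\<^sub>B c yy k)"
    using m b cv[OF yy] N.smult_assoc1[of _ _ m] by (intro ext) (simp add: row_def)
   moreover have "lincomb Y p (%k. b \<otimes>\<^sub>B c yy k) y = b \<odot>\<^sub>Y yy"
    using b cv[OF yy] yc by (simp add: Y.lincomb_smult_left cl yy)
   then have "\<gamma> m (b \<odot>\<^sub>Y yy) = U +>\<^bsub>?P\<^esub> row m (%k. b \<otimes>\<^sub>B c yy k)"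
    unfolding \<gamma>_def using yy b s by (intro row_cong[OF m]) (simp_all add: cv cl)
   ultimately show "\<gamma> (rsmult M m b) yy = \<gamma> m (b \<odot>\<^sub>Y yy)" unfolding \<gamma>_def by simp
  next
   fix a assume a: "a \<in> carrier A"
   have "row (a \<odot>\<^sub>M m) (c yy) = a \<odot>\<^bsub>?P\<^esub> row m (c yy)"
    using m a cv[OF yy] by (intro ext) (simp add: row_def bi)
   then show "\<gamma> (a \<odot>\<^sub>M m) yy = a \<odot>\<^bsub>?Q\<^esub> \<gamma> m yy"
    unfolding \<gamma>_def quot_smult[OF U lmP a rowc[OF m cv[OF yy]]] by simp
  }
 qed
 \<comment> \<open>The coefficients chosen for \<open>y k\<close> need not be the unit vector, but
   modulo \<open>U\<close> they may be replaced by it.\<close>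
 have ue: "\<gamma> (z k) (y k) = U +>\<^bsub>?P\<^esub> row (z k) (unit_vec B k)" if k: "k < p" for k
  unfolding \<gamma>_def using z yc k by (intro row_cong) (simp_all add: cv cl Y.lincomb_unit_vec)
 let ?proj = "\<lambda>v\<in>carrier ?P. U +>\<^bsub>?P\<^esub> v"
 have proj: "?proj \<in> mod_hom A ?P ?Q" by (rule quot_proj[OF U lmP])
 have rz: "row (z k) (unit_vec B k) \<in> carrier ?P" if "k < p" for k using rowc z that by simp
 have "row (z k) (unit_vec B k) = single L p k (restrict z {..<p} k)" if "k < p" for k
  using that z N.smult_one[of "z k"] by (intro ext) (simp add: row_def unit_vec_def single_def)
 then have sumz: "msum ?P p (%k. row (z k) (unit_vec B k)) = restrict z {..<p}"
  using power_decomp[OF L.left_module_axioms, of "restrict z {..<p}" p] z by (simp cong: msum_cong)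
 have "\<phi> (msum T p (%k. \<tau> (z k) (y k))) = msum ?Q p (%k. \<phi> (\<tau> (z k) (y k)))"
 proof (rule msum_hom[where f = \<phi>, OF T.abelian_group_axioms])
  have "\<phi> \<zero>\<^sub>T \<oplus>\<^bsub>?Q\<^esub> \<phi> \<zero>\<^sub>T = \<phi> \<zero>\<^sub>T"
   using mod_homD(2)[OF \<phi>(1) T.zero_closed T.zero_closed] by simp
  then show "\<phi> \<zero>\<^sub>T = \<zero>\<^bsub>?Q\<^esub>"
   using mod_homD(1)[OF \<phi>(1) T.zero_closed] by (simp add: Q.M.add.r_cancel_one)
  show "\<phi> (s \<oplus>\<^sub>T t) = \<phi> s \<oplus>\<^bsub>?Q\<^esub> \<phi> t" if "s \<in> carrier T" "t \<in> carrier T" for s t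
   by (rule mod_homD(2)[OF \<phi>(1) that])
 qed (use z yc in simp)
 also have "\<dots> = msum ?Q p (%k. ?proj (row (z k) (unit_vec B k)))"
 proof (rule msum_cong)
  fix k assume k: "k < p"
  have "\<phi> (\<tau> (z k) (y k)) = \<gamma> (z k) (y k)" using \<phi>(2) z yc k by blast
  then show "\<phi> (\<tau> (z k) (y k)) = ?proj (row (z k) (unit_vec B k))" unfolding ue[OF k] using rz[OF k] by (simp only: restrict_apply if_True)
 qed
 also have "\<dots> = ?proj (msum ?P p (%k. row (z k) (unit_vec B k)))"
  by (rule msum_hom[symmetric, OF P.M.abelian_group_axioms mod_hom_zero[OF proj lmP lmQ] mod_homD(2)[OF proj] rz])
 finally have "\<phi> (msum T p (%k. \<tau> (z k) (y k))) = ?proj (restrict z {..<p})" unfolding sumz .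
 moreover have "\<phi> \<zero>\<^sub>T = \<zero>\<^bsub>?Q\<^esub>"
  using mod_homD(2)[OF \<phi>(1) T.zero_closed T.zero_closed] mod_homD(1)[OF \<phi>(1) T.zero_closed] by (simp add: Q.M.add.r_cancel_one)
 moreover have zP: "restrict z {..<p} \<in> carrier ?P" using z by simp
 ultimately have "U +>\<^bsub>?P\<^esub> restrict z {..<p} = U +>\<^bsub>?P\<^esub> \<zero>\<^bsub>?P\<^esub>"
  unfolding zero quot_zero[OF U lmP, symmetric] by (simp only: restrict_apply if_True)
 then have "restrict z {..<p} \<ominus>\<^bsub>?P\<^esub> \<zero>\<^bsub>?P\<^esub> \<in> U" using coset_eq_iff[OF U lmP zP P.M.zero_closed] by blast
 then have "restrict z {..<p} \<in> U" using P.M.diff_zero[OF zP] by (simp only:)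
 then obtain m where m: "vec M q m" "restrict z {..<p} = (\<lambda>k\<in>{..<p}. lincomb N q (%j. G j k) m)"
  unfolding U_def by blast
 have "z k = lincomb N q (%j. G j k) m" if "k < p" for k
  using fun_cong[OF m(2), of k] that by simp
 then show "\<exists>m. vec M q m \<and> (\<forall>k<p. z k = lincomb N q (%j. G j k) m)" using m(1) by (intro exI[of _ m]) simp
qed

end

section \<open>Modules given by triples\<close>

lemma triple_module_simps [simp]:
 "carrier (triple_module B M X Y \<phi>) = carrier X \<times> carrier Y"
 "\<zero>\<^bsub>triple_module B M X Y \<phi>\<^esub> = (\<zero>\<^sub>X, \<zero>\<^sub>Y)"
 "(x, y) \<oplus>\<^bsub>triple_module B M X Y \<phi>\<^esub> (x', y') = (x \<oplus>\<^sub>X x', y \<oplus>\<^sub>Y y')"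
 "(a, m, b) \<odot>\<^bsub>triple_module B M X Y \<phi>\<^esub> (x, y) =
  (a \<odot>\<^sub>X x \<oplus>\<^sub>X \<phi> (pure_tensor B M Y m y), b \<odot>\<^sub>Y y)"
 by (simp_all add: triple_module_def)

text \<open>Membership in a row span over \<open>\<Lambda>\<close>, written out in components. The
  witnesses \<open>x\<close>, \<open>y\<close> and \<open>w\<close> are arguments so that single
  components can be set to zero later.\<close>

definition (in triangular) row_sol where
 "row_sol q p G a m b x y w \<longleftrightarrow> vec A q x \<and> vec M q y \<and> vec B q w \<and>
  (\<forall>k<p. a k = dot A q x (%j. fst (G j k)) \<and>
   m k = lincomb L q x (%j. fst (snd (G j k))) \<oplus>\<^sub>M lincomb N q (%j. snd (snd (G j k))) y \<and>
   b k = dot B q w (%j. snd (snd (G j k))))"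

lemma (in triangular) row_span_iff:
 assumes "\<forall>j<q. \<forall>k<p. G j k \<in> carrier \<Lambda>"
 shows "row_span \<Lambda> q p G (%k. (a k, m k, b k)) \<longleftrightarrow> (\<exists>x y w. row_sol q p G a m b x y w)"
proof
 assume "row_span \<Lambda> q p G (%k. (a k, m k, b k))"
 then obtain u where u: "vec \<Lambda> q u" "\<forall>k<p. (a k, m k, b k) = dot \<Lambda> q u (%j. G j k)" by (rule row_spanE)
 have c: "fst (u j) \<in> carrier A" "fst (snd (u j)) \<in> carrier M" "snd (snd (u j)) \<in> carrier B" if "j < q" for j
  using u(1)[rule_format, OF that] by (cases "u j"; simp)+
 have "row_sol q p G a m b (%j. fst (u j)) (%j. fst (snd (u j))) (%j. snd (snd (u j)))"
  unfolding row_sol_def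
 proof (intro conjI[OF _ conjI[OF _ conjI]] allI impI)
  fix k assume k: "k < p"
  have "\<forall>j<q. G j k \<in> carrier \<Lambda>" using assms k by simp
  from msum_row[OF u(1) this] u(2)[rule_format, OF k]
  show "a k = dot A q (%j. fst (u j)) (%j. fst (G j k)) \<and>
   m k = lincomb L q (%j. fst (u j)) (%j. fst (snd (G j k))) \<oplus>\<^sub>M lincomb N q (%j. snd (snd (G j k))) (%j. fst (snd (u j))) \<and>
   b k = dot B q (%j. snd (snd (u j))) (%j. snd (snd (G j k)))" by simp
 qed (use c in simp_all)
 then show "\<exists>x y w. row_sol q p G a m b x y w" by (intro exI)
next
 assume "\<exists>x y w. row_sol q p G a m b x y w"
 then obtain x y w where xyw: "row_sol q p G a m b x y w" by (elim exE)
 show "row_span \<Lambda> q p G (%k. (a k, m k, b k))"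
 proof (rule row_spanI[where u = "%j. (x j, y j, w j)"])
  fix k assume k: "k < p"
  have "vec \<Lambda> q (%j. (x j, y j, w j))" "\<forall>j<q. G j k \<in> carrier \<Lambda>" using xyw assms k by (simp_all add: row_sol_def)
  from msum_row[OF this] k xyw
  show "(a k, m k, b k) = dot \<Lambda> q (%j. (x j, y j, w j)) (%j. G j k)" by (simp add: row_sol_def)
 qed (use xyw in \<open>simp add: row_sol_def\<close>)
qed

locale triple = tensor_product A B M Y + X: left_module A X
 for A :: "'a ring" and B :: "'b ring" and M :: "('a, 'b, 'm) bimodule" and Y :: "('b, 'y) module"
  and X :: "('a, 'x) module" +
 fixes \<phi>
 assumes \<phi>: "\<phi> \<in> mod_hom A (tensor B M Y) X"
begin

abbreviation "XY \<equiv> triple_module B M X Y \<phi>"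

lemma \<phi>_closed [simp]: "t \<in> carrier T ==> \<phi> t \<in> carrier X"
 by (rule mod_homD(1)[OF \<phi>])

lemma \<phi>_zero [simp]: "\<phi> \<zero>\<^sub>T = \<zero>\<^sub>X"
 using mod_homD(2)[OF \<phi> T.zero_closed T.zero_closed] \<phi>_closed[OF T.zero_closed] by (simp add: X.M.add.r_cancel_one)

lemma \<phi>_msum: "vec T p t ==> \<phi> (msum T p t) = msum X p (%k. \<phi> (t k))"
 by (rule msum_hom[where f = \<phi>, OF T.abelian_group_axioms \<phi>_zero mod_homD(2)[OF \<phi>]]) simp_all

lemma lincomb_triple:
 assumes "vec \<Lambda> p l" "\<forall>k<p. v k \<in> carrier X \<times> carrier Y"
 shows "lincomb XY p l v = (lincomb X p (%k. fst (l k)) (%k. fst (v k))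
   \<oplus>\<^sub>X msum X p (%k. \<phi> (\<tau> (fst (snd (l k))) (snd (v k)))),
  lincomb Y p (%k. snd (snd (l k))) (%k. snd (v k)))"
 using assms
proof (induction p)
 case (Suc p)
 have c: "fst (l k) \<in> carrier A" "fst (snd (l k)) \<in> carrier M" "snd (snd (l k)) \<in> carrier B"
  "fst (v k) \<in> carrier X" "snd (v k) \<in> carrier Y" if "k < Suc p" for k
  using Suc.prems(1)[rule_format, OF that] Suc.prems(2)[rule_format, OF that] by (cases "l k"; cases "v k"; simp)+
 have s: "l p \<odot>\<^bsub>XY\<^esub> v p = (fst (l p) \<odot>\<^sub>X fst (v p) \<oplus>\<^sub>X \<phi> (\<tau> (fst (snd (l p))) (snd (v p))),
  snd (snd (l p)) \<odot>\<^sub>Y snd (v p))"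
  by (cases "l p"; cases "v p") simp
 have "lincomb X p (%k. fst (l k)) (%k. fst (v k)) \<in> carrier X"
  "msum X p (%k. \<phi> (\<tau> (fst (snd (l k))) (snd (v k)))) \<in> carrier X" using c by simp_all
 moreover have "\<phi> (\<tau> (fst (snd (l p))) (snd (v p))) \<in> carrier X" "fst (l p) \<odot>\<^sub>X fst (v p) \<in> carrier X"
  using c[of p] by simp_all
 ultimately show ?case using Suc by (simp add: s X.M.a_ac)
qed simp

end

locale resolved_triple = triple A B M Y X \<phi> + Z: matrix_resolution "triangular_ring A B M" Z n g F
 for A :: "'a ring" and B :: "'b ring" and M :: "('a, 'b, 'm) bimodule" and Y :: "('b, 'y) module"
  and X :: "('a, 'x) module" and \<phi> and Z :: "('a \<times> 'm \<times> 'b, 'z) module" and n g F +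
 fixes f
 assumes f: "f \<in> mod_hom (triangular_ring A B M) Z (triple_module B M X Y \<phi>)"
  and bij: "bij_betw f (carrier Z) (carrier (triple_module B M X Y \<phi>))"
begin

abbreviation "p \<equiv> n 0"
abbreviation "q \<equiv> n (Suc 0)"
abbreviation "y k \<equiv> snd (f (g k))"

lemma F0: "\<forall>j<q. \<forall>k<p. F 0 j k \<in> carrier \<Lambda>"
 using mat_seqD(1)[OF Z.seq, of _ 0] by simp

lemma comp_closed:
 assumes "j < q" "k < p"
 shows "comp_A F 0 j k \<in> carrier A" "comp_M F 0 j k \<in> carrier M" "comp_B F 0 j k \<in> carrier B"
 using F0[rule_format, OF assms] by (cases "F 0 j k"; simp add: comp_A_def comp_M_def comp_B_def)+

lemma fg: "k < p ==> f (g k) \<in> carrier X \<times> carrier Y"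
 using mod_homD(1)[OF f, of "g k"] by simp

lemma y_closed: "k < p ==> y k \<in> carrier Y"
 using fg[of k] by (cases "f (g k)") simp

lemma x_closed: "k < p ==> fst (f (g k)) \<in> carrier X"
 using fg[of k] by (cases "f (g k)") simp

lemma f_zero: "f \<zero>\<^sub>Z = (\<zero>\<^sub>X, \<zero>\<^sub>Y)"
proof -
 have c: "f \<zero>\<^sub>Z \<in> carrier X \<times> carrier Y" using mod_homD(1)[OF f, of "\<zero>\<^sub>Z"] by simp
 have "f \<zero>\<^sub>Z = f (\<zero>\<^sub>\<Lambda> \<odot>\<^sub>Z \<zero>\<^sub>Z)" by simp
 also have "\<dots> = \<zero>\<^sub>\<Lambda> \<odot>\<^bsub>XY\<^esub> f \<zero>\<^sub>Z" by (rule mod_homD(3)[OF f]) simp_all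
 also have "\<dots> = (\<zero>\<^sub>X, \<zero>\<^sub>Y)" using c by (cases "f \<zero>\<^sub>Z") simp
 finally show ?thesis .
qed

lemma f_lincomb:
 assumes l: "vec \<Lambda> p l"
 shows "f (lincomb Z p l g) = lincomb XY p l (%k. f (g k))"
proof -
 have "f (lincomb Z p l g) = msum XY p (%k. f (l k \<odot>\<^sub>Z g k))"
  unfolding lincomb_def
  by (rule msum_hom[where f = f, OF Z.M.abelian_group_axioms _ mod_homD(2)[OF f]]) (use l f_zero in simp_all)
 also have "\<dots> = msum XY p (%k. l k \<odot>\<^bsub>XY\<^esub> f (g k))"
  by (rule msum_cong, rule mod_homD(3)[OF f]) (use l in simp_all)
 finally show ?thesis by (simp add: lincomb_def)
qed

lemma lincomb_zero_iff:
 assumes l: "vec \<Lambda> p l"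
 shows "lincomb XY p l (%k. f (g k)) = (\<zero>\<^sub>X, \<zero>\<^sub>Y) \<longleftrightarrow> row_span \<Lambda> q p (F 0) l"
proof -
 have c: "lincomb Z p l g \<in> carrier Z" using l by simp
 have "inj_on f (carrier Z)" using bij by (rule bij_betw_imp_inj_on)
 then have "f (lincomb Z p l g) = f \<zero>\<^sub>Z \<longleftrightarrow> lincomb Z p l g = \<zero>\<^sub>Z"
  using c by (auto dest: inj_onD)
 then show ?thesis using Z.relation_iff[OF l] by (simp add: f_lincomb[OF l] f_zero row_span_def)
qed

lemma spans_y: "spans B Y (carrier Y) p y"
 unfolding spans_def
proof (intro conjI allI impI ballI)
 fix w assume w: "w \<in> carrier Y"
 have "(\<zero>\<^sub>X, w) \<in> f ` carrier Z" using bij w by (simp add: bij_betw_imp_surj_on)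
 then obtain z where z: "z \<in> carrier Z" "f z = (\<zero>\<^sub>X, w)" by auto
 obtain l where l: "vec \<Lambda> p l" "z = lincomb Z p l g" by (rule Z.carrierE[OF z(1)])
 have "(\<zero>\<^sub>X, w) = lincomb XY p l (%k. f (g k))" using z l f_lincomb[OF l(1)] by simp
 then have "w = lincomb Y p (%k. snd (snd (l k))) y"
  using lincomb_triple[OF l(1), of "%k. f (g k)"] fg by simp
 moreover have "snd (snd (l k)) \<in> carrier B" if "k < p" for k
  using l(1)[rule_format, OF that] by (cases "l k") simp
 ultimately show "\<exists>c. (\<forall>j<p. c j \<in> carrier B) \<and> w = lincomb Y p c y"
  by (intro exI[of _ "%k. snd (snd (l k))"]) simp
qed (rule y_closed)

text \<open>On the generators, coefficients \<open>(0, 0, b)\<close> act through \<open>Y\<close>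
  alone, so the relations among the \<open>y k\<close> are the \<open>B\<close>-components of the
  relations of \<open>Z\<close>.\<close>

lemma relation_y:
 assumes b: "vec B p b"
 shows "lincomb Y p b y = \<zero>\<^sub>Y \<longleftrightarrow> row_span B q p (comp_B F 0) b"
proof -
 let ?l = "%k. (\<zero>\<^sub>A, \<zero>\<^sub>M, b k)"
 have l: "vec \<Lambda> p ?l" using b by simp
 have "lincomb XY p ?l (%k. f (g k)) = (\<zero>\<^sub>X, lincomb Y p b y)"
  using lincomb_triple[OF l, of "%k. f (g k)"] fg x_closed y_closed by (simp cong: msum_cong)
 then have "lincomb Y p b y = \<zero>\<^sub>Y \<longleftrightarrow> row_span \<Lambda> q p (F 0) ?l"
  using lincomb_zero_iff[OF l] by simp
 also have "\<dots> \<longleftrightarrow> row_span B q p (comp_B F 0) b"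
  unfolding row_span_iff[OF F0]
 proof
  assume "\<exists>x m w. row_sol q p (F 0) (%_. \<zero>\<^sub>A) (%_. \<zero>\<^sub>M) b x m w"
  then obtain x m w where s: "row_sol q p (F 0) (%_. \<zero>\<^sub>A) (%_. \<zero>\<^sub>M) b x m w" by (elim exE)
  show "row_span B q p (comp_B F 0) b"
   by (rule row_spanI[where u = w]) (use s in \<open>simp_all add: row_sol_def comp_B_def\<close>)
 next
  assume "row_span B q p (comp_B F 0) b"
  then obtain w where "vec B q w" "\<forall>k<p. b k = dot B q w (%j. comp_B F 0 j k)"
   by (rule row_spanE)
  then show "\<exists>x m w. row_sol q p (F 0) (%_. \<zero>\<^sub>A) (%_. \<zero>\<^sub>M) b x m w"
   using comp_closed
   by (intro exI[of _ "%_. \<zero>\<^sub>A"] exI[of _ "%_. \<zero>\<^sub>M"] exI[of _ w])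
    (simp add: row_sol_def comp_A_def comp_M_def comp_B_def cong: msum_cong)
 qed
 finally show ?thesis .
qed

text \<open>Coefficients \<open>(0, z k, 0)\<close> on the generators produce precisely the value of
  \<open>\<phi>\<close> on the tensor with coordinates \<open>z\<close>. Its vanishing is therefore
  a relation of \<open>Z\<close> whose outer components are zero.\<close>

lemma kernel_iff:
 assumes z: "vec M p z"
 shows "\<phi> (msum T p (%k. \<tau> (z k) (y k))) = \<zero>\<^sub>X \<longleftrightarrow>
  (\<exists>x m. vec A q x \<and> vec M q m \<and>
   (\<forall>k<p. dot A q x (%j. comp_A F 0 j k) = \<zero>\<^sub>A \<and>
    z k = lincomb L q x (%j. comp_M F 0 j k) \<oplus>\<^sub>M lincomb N q (%j. comp_B F 0 j k) m))" (is "_ \<longleftrightarrow> ?R")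
proof -
 let ?l = "%k. (\<zero>\<^sub>A, z k, \<zero>\<^sub>B)"
 have l: "vec \<Lambda> p ?l" using z by simp
 have tc: "vec T p (%k. \<tau> (z k) (y k))" using z y_closed by simp
 have "lincomb XY p ?l (%k. f (g k)) = (\<phi> (msum T p (%k. \<tau> (z k) (y k))), \<zero>\<^sub>Y)"
  using lincomb_triple[OF l, of "%k. f (g k)"] fg x_closed y_closed tc by (simp add: \<phi>_msum)
 then have "\<phi> (msum T p (%k. \<tau> (z k) (y k))) = \<zero>\<^sub>X \<longleftrightarrow> row_span \<Lambda> q p (F 0) ?l"
  using lincomb_zero_iff[OF l] by simp
 also have "\<dots> \<longleftrightarrow> ?R"
  unfolding row_span_iff[OF F0]
 proof
  assume "\<exists>x m w. row_sol q p (F 0) (%_. \<zero>\<^sub>A) z (%_. \<zero>\<^sub>B) x m w"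
  then obtain x m w where "row_sol q p (F 0) (%_. \<zero>\<^sub>A) z (%_. \<zero>\<^sub>B) x m w" by (elim exE)
  then show ?R
   by (intro exI[of _ x] exI[of _ m]) (simp add: row_sol_def comp_A_def comp_M_def comp_B_def)
 next
  assume ?R
  then obtain x m where xm: "vec A q x" "vec M q m"
   "\<forall>k<p. dot A q x (%j. comp_A F 0 j k) = \<zero>\<^sub>A \<and>
    z k = lincomb L q x (%j. comp_M F 0 j k) \<oplus>\<^sub>M lincomb N q (%j. comp_B F 0 j k) m"
   by (elim exE conjE)
  then show "\<exists>x m w. row_sol q p (F 0) (%_. \<zero>\<^sub>A) z (%_. \<zero>\<^sub>B) x m w"
   using comp_closed
   by (intro exI[of _ x] exI[of _ m] exI[of _ "%_. \<zero>\<^sub>B"])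
    (simp add: row_sol_def comp_A_def comp_M_def comp_B_def cong: msum_cong)
 qed
 finally show ?thesis .
qed

text \<open>By \<open>kernel_iff\<close> the kernel of \<open>\<phi>\<close> consists of the tensors
  with coordinates \<open>x FM + m FB\<close> where \<open>x FA = 0\<close>, and by
  \<open>tensor_vanishing\<close> such a tensor is zero when its coordinates have the form
  \<open>m FB\<close>.\<close>

lemma inj_iff_monic_mat:
 "inj_on \<phi> (carrier T) \<longleftrightarrow> monic_mat A M p q (comp_A F 0) (comp_M F 0) (comp_B F 0)"
proof
 have FB: "mat B q p (comp_B F 0)" using comp_closed by simp
 have rel: "\<forall>b. vec B p b \<longrightarrow> (lincomb Y p b y = \<zero>\<^sub>Y \<longleftrightarrow> row_span B q p (comp_B F 0) b)"
  by (intro allI impI, rule relation_y) simp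
 note vanish = tensor_vanishing[OF spans_y FB rel]
 {
  assume inj: "inj_on \<phi> (carrier T)"
  show "monic_mat A M p q (comp_A F 0) (comp_M F 0) (comp_B F 0)"
   unfolding monic_mat_def
  proof (intro allI impI, elim conjE)
   fix x assume x: "vec A q x"
    and zero: "\<forall>k<p. dot A q x (%j. comp_A F 0 j k) = \<zero>\<^sub>A"
   let ?z = "%k. lincomb L q x (%j. comp_M F 0 j k)"
   have z: "vec M p ?z" using x comp_closed by simp
   have tc: "msum T p (%k. \<tau> (?z k) (y k)) \<in> carrier T" using z y_closed by (intro T.msum_closed) simp
   have "\<phi> (msum T p (%k. \<tau> (?z k) (y k))) = \<zero>\<^sub>X"
    unfolding kernel_iff[OF z] using x zero z comp_closed
    by (intro exI[of _ x] exI[of _ "%_. \<zero>\<^sub>M"]) simp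
   then have "\<phi> (msum T p (%k. \<tau> (?z k) (y k))) = \<phi> \<zero>\<^sub>T" by simp
   then have "msum T p (%k. \<tau> (?z k) (y k)) = \<zero>\<^sub>T" by (rule inj_onD[OF inj _ tc T.zero_closed])
   then show "\<exists>m. vec M q m \<and> (\<forall>k<p. ?z k = lincomb N q (%j. comp_B F 0 j k) m)"
    by (rule iffD1[OF vanish[OF z]])
  qed
 next
  assume monic: "monic_mat A M p q (comp_A F 0) (comp_M F 0) (comp_B F 0)"
  have zero: "t = \<zero>\<^sub>T" if t: "t \<in> carrier T" "\<phi> t = \<zero>\<^sub>X" for t
  proof -
   obtain z where z: "vec M p z" "t = msum T p (%k. \<tau> (z k) (y k))"
    by (rule tensor_spanned[OF spans_y t(1)])
   obtain x m where xm: "vec A q x" "vec M q m"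
    and e: "\<forall>k<p. dot A q x (%j. comp_A F 0 j k) = \<zero>\<^sub>A \<and>
     z k = lincomb L q x (%j. comp_M F 0 j k) \<oplus>\<^sub>M lincomb N q (%j. comp_B F 0 j k) m"
    using iffD1[OF kernel_iff[OF z(1)] t(2)[unfolded z(2)]] by (elim exE conjE) (rule that)
   have xz: "\<forall>k<p. dot A q x (%j. comp_A F 0 j k) = \<zero>\<^sub>A" using e by simp
   obtain m' where m': "vec M q m'"
    "\<forall>k<p. lincomb L q x (%j. comp_M F 0 j k) = lincomb N q (%j. comp_B F 0 j k) m'"
    by (rule monic_matE[OF monic xm(1) xz])
   have "z k = lincomb N q (%j. comp_B F 0 j k) (%j. m' j \<oplus>\<^sub>M m j)" if k: "k < p" for k
    using e m' xm k comp_closed by (simp add: N_add_right)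
   then have "\<exists>m. vec M q m \<and> (\<forall>k<p. z k = lincomb N q (%j. comp_B F 0 j k) m)"
    using m'(1) xm(2) by (intro exI[of _ "%j. m' j \<oplus>\<^sub>M m j"]) simp
   then show ?thesis unfolding z(2) vanish[OF z(1)] .
  qed
  show "inj_on \<phi> (carrier T)"
  proof (rule inj_onI)
   fix s t assume st: "s \<in> carrier T" "t \<in> carrier T" "\<phi> s = \<phi> t"
   have d: "s \<oplus>\<^sub>T \<ominus>\<^sub>T t \<in> carrier T" using st by simp
   have s: "(s \<oplus>\<^sub>T \<ominus>\<^sub>T t) \<oplus>\<^sub>T t = s" using st by (simp add: T.a_assoc T.l_neg)
   have "\<phi> s = \<phi> (s \<oplus>\<^sub>T \<ominus>\<^sub>T t) \<oplus>\<^sub>X \<phi> t" using mod_homD(2)[OF \<phi> d st(2)] s by simp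
   then have "\<phi> (s \<oplus>\<^sub>T \<ominus>\<^sub>T t) = \<zero>\<^sub>X" using st d by (simp add: X.M.add.l_cancel_one')
   then have "s \<oplus>\<^sub>T \<ominus>\<^sub>T t = \<zero>\<^sub>T" by (rule zero[OF d])
   then show "s = t" using s st by simp
  qed
 }
qed

end

section \<open>Decomposition of a module into a triple\<close>

text \<open>The corner \<open>e Z\<close> for the idempotent \<open>e = j 1\<close> of a non-unital embedding \<open>j\<close>.\<close>

definition corner :: "('r => 's) => 'r ring => ('s, 'z) module => ('r, 'z) module" where
 "corner j R Z = \<lparr>carrier = {x \<in> carrier Z. j \<one>\<^sub>R \<odot>\<^sub>Z x = x}, monoid.mult = undefined, one = undefined,
  ring.zero = \<zero>\<^sub>Z, add = add Z, smult = (%r. smult Z (j r))\<rparr>"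

lemma corner_simps [simp]:
 "x \<in> carrier (corner j R Z) \<longleftrightarrow> x \<in> carrier Z \<and> j \<one>\<^sub>R \<odot>\<^sub>Z x = x"
 "\<zero>\<^bsub>corner j R Z\<^esub> = \<zero>\<^sub>Z" "add (corner j R Z) = add Z" "r \<odot>\<^bsub>corner j R Z\<^esub> x = j r \<odot>\<^sub>Z x"
 by (simp_all add: corner_def)

lemma left_module_corner:
 assumes R: "ring R" and Z: "left_module S Z"
  and j: "\<And>r. r \<in> carrier R ==> j r \<in> carrier S"
   "\<And>r s. r \<in> carrier R ==> s \<in> carrier R ==> j (r \<oplus>\<^sub>R s) = j r \<oplus>\<^sub>S j s"
   "\<And>r s. r \<in> carrier R ==> s \<in> carrier R ==> j (r \<otimes>\<^sub>R s) = j r \<otimes>\<^sub>S j s"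
 shows "left_module R (corner j R Z)"
proof -
 interpret R: ring R by (rule R)
 interpret Z: left_module S Z by (rule Z)
 have "abelian_group (corner j R Z)"
 proof (rule abelian_groupI)
  fix x assume x: "x \<in> carrier (corner j R Z)"
  then have "\<ominus>\<^sub>Z x \<in> carrier (corner j R Z)" "\<ominus>\<^sub>Z x \<oplus>\<^sub>Z x = \<zero>\<^sub>Z" by (simp_all add: j(1) Z.smult_minus Z.M.l_neg)
  then show "\<exists>y\<in>carrier (corner j R Z). y \<oplus>\<^bsub>corner j R Z\<^esub> x = \<zero>\<^bsub>corner j R Z\<^esub>" by (intro bexI[of _ "\<ominus>\<^sub>Z x"]) simp_all
 qed (simp_all add: j(1) Z.smult_r_distr Z.M.a_ac)
 then show ?thesis
 proof (intro left_module.intro R left_module_axioms.intro)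
  fix a x assume a: "a \<in> carrier R" and x: "x \<in> carrier (corner j R Z)"
  have "j \<one>\<^sub>R \<odot>\<^sub>Z (j a \<odot>\<^sub>Z x) = j a \<odot>\<^sub>Z x"
   using a x j(3)[of "\<one>\<^sub>R" a] Z.smult_assoc1[of "j \<one>\<^sub>R" "j a" x] by (simp add: j(1))
  then show "a \<odot>\<^bsub>corner j R Z\<^esub> x \<in> carrier (corner j R Z)" using a x by (simp add: j(1))
 qed (simp_all add: j Z.smult_l_distr Z.smult_r_distr Z.smult_assoc1)
qed

context triangular
begin

abbreviation "jA a \<equiv> (a, \<zero>\<^sub>M, \<zero>\<^sub>B)"
abbreviation "jM m \<equiv> (\<zero>\<^sub>A, m, \<zero>\<^sub>B)"
abbreviation "jB b \<equiv> (\<zero>\<^sub>A, \<zero>\<^sub>M, b)"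

text \<open>The right ideal generated by the idempotent consists of \<open>A\<close> and
  \<open>M\<close>. So besides the projections of the generators of \<open>Z\<close>, their
  multiples by generators of \<open>M\<close> over \<open>A\<close> are required.\<close>

lemma fg_module_corner_A:
 fixes Z :: "('a \<times> 'm \<times> 'b, 'z) module"
 assumes Z: "fg_module \<Lambda> Z" and M: "fg_module A L"
  and X: "left_module A (corner jA A Z)"
 shows "fg_module A (corner jA A Z)"
proof -
 let ?X = "corner jA A Z"
 have lmZ: "left_module \<Lambda> Z" by (rule left_module_if_fg[OF Z])
 interpret Z: left_module \<Lambda> Z by (rule lmZ)
 obtain p g where g: "spans \<Lambda> Z (carrier Z) p g" by (rule fg_module_spans[OF Z])
 obtain q \<mu> where \<mu>: "spans A L (carrier L) q \<mu>" by (rule fg_module_spans[OF M])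
 have gc: "g k \<in> carrier Z" if "k < p" for k using spansD(1)[OF g that] .
 have \<mu>c: "\<mu> i \<in> carrier M" if "i < q" for i using spansD(1)[OF \<mu> that] by simp
 let ?e = "jA \<one>\<^sub>A"
 have e: "?e \<in> carrier \<Lambda>" by simp
 define S where "S = (%k. ?e \<odot>\<^sub>Z g k) ` {..<p} \<union> (%(i, k). jM (\<mu> i) \<odot>\<^sub>Z g k) ` ({..<q} \<times> {..<p})"
 have eS: "(a, m, \<zero>\<^sub>B) \<odot>\<^sub>Z z \<in> carrier ?X" if "a \<in> carrier A" "m \<in> carrier M" "z \<in> carrier Z" for a m z
  using that Z.smult_assoc1[of ?e "(a, m, \<zero>\<^sub>B)" z] L.smult_one[of m] Z.smult_closed[of "(a, m, \<zero>\<^sub>B)" z] by simp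
 have SX: "S \<subseteq> carrier ?X"
  unfolding S_def using eS gc \<mu>c by (auto simp del: corner_simps)
 have "H = carrier ?X" if H: "submodule H A ?X" and SH: "S \<subseteq> H" for H
 proof
  show "H \<subseteq> carrier ?X" by (rule submoduleD(1)[OF H])
  have H0: "\<zero>\<^sub>Z \<in> H" and H2: "x \<oplus>\<^sub>Z y \<in> H" if "x \<in> H" "y \<in> H" for x y
   using submoduleD(2)[OF H] submoduleD(3)[OF H that] by simp_all
  have H0: "\<zero>\<^sub>Z \<in> H" using submoduleD(2)[OF H] by simp
  have Hs: "jA a \<odot>\<^sub>Z x \<in> H" if "a \<in> carrier A" "x \<in> H" for a x
   using submoduleD(4)[OF H that] by simp
  have HM: "jM m \<odot>\<^sub>Z g k \<in> H" if m: "m \<in> carrier M" and k: "k < p" for m k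
  proof -
   obtain c where c: "\<forall>i<q. c i \<in> carrier A" "m = lincomb L q c \<mu>" by (rule spansE[OF \<mu>, of m]) (simp add: m)
   have "jM m \<odot>\<^sub>Z g k = msum Z q (%i. jM (c i \<odot>\<^sub>M \<mu> i) \<odot>\<^sub>Z g k)"
    unfolding c(2) lincomb_def msum_part left_part_simps
   proof (rule msum_hom[where f = "%m. jM m \<odot>\<^sub>Z g k", OF M.abelian_group_axioms])
    show "(\<zero>\<^sub>A, \<zero>\<^sub>M, \<zero>\<^sub>B) \<odot>\<^sub>Z g k = \<zero>\<^sub>Z" using Z.zero_smult[OF gc[OF k]] by simp
    show "jM (x \<oplus>\<^sub>M y) \<odot>\<^sub>Z g k = jM x \<odot>\<^sub>Z g k \<oplus>\<^sub>Z jM y \<odot>\<^sub>Z g k"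
     if "x \<in> carrier M" "y \<in> carrier M" for x y
     using Z.smult_l_distr[of "jM x" "jM y" "g k"] that gc[OF k] by simp
   qed (use c(1) \<mu>c in simp)
   moreover have "jM (c i \<odot>\<^sub>M \<mu> i) \<odot>\<^sub>Z g k \<in> H" if i: "i < q" for i
   proof -
    have "jM (\<mu> i) \<odot>\<^sub>Z g k \<in> H"
     unfolding S_def by (rule subsetD[OF SH], unfold S_def, rule UnI2, rule image_eqI[of _ _ "(i, k)"]) (use i k in simp_all)
    then have "jA (c i) \<odot>\<^sub>Z (jM (\<mu> i) \<odot>\<^sub>Z g k) \<in> H" using c(1) i by (intro Hs) simp_all
    then show ?thesis
     using Z.smult_assoc1[of "jA (c i)" "jM (\<mu> i)" "g k"] c(1) i \<mu>c[OF i] gc[OF k] by simp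
   qed
   ultimately show ?thesis using Z.M.msum_subset_closed[OF H0 H2] by simp
  qed
  show "carrier ?X \<subseteq> H"
  proof
   fix x assume x: "x \<in> carrier ?X"
   then have xZ: "x \<in> carrier Z" and ex: "?e \<odot>\<^sub>Z x = x" by simp_all
   obtain l where l: "\<forall>k<p. l k \<in> carrier \<Lambda>" "x = lincomb Z p l g" by (rule spansE[OF g xZ])
   have "x = msum Z p (%k. ?e \<odot>\<^sub>Z (l k \<odot>\<^sub>Z g k))"
    using ex Z.smult_msum[OF e, of p "%k. l k \<odot>\<^sub>Z g k"] l gc by (simp add: lincomb_def)
   moreover have "?e \<odot>\<^sub>Z (l k \<odot>\<^sub>Z g k) \<in> H" if k: "k < p" for k
   proof -
    obtain a m b where lk: "l k = (a, m, b)" and c: "a \<in> carrier A" "m \<in> carrier M" "b \<in> carrier B"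
     using l(1)[rule_format, OF k] by (cases "l k") simp
    have "?e \<odot>\<^sub>Z (l k \<odot>\<^sub>Z g k) = (a, m, \<zero>\<^sub>B) \<odot>\<^sub>Z g k"
     using Z.smult_assoc1[of ?e "l k" "g k"] c gc[OF k] L.smult_one[of m] by (simp add: lk)
    also have "\<dots> = jA a \<odot>\<^sub>Z (?e \<odot>\<^sub>Z g k) \<oplus>\<^sub>Z jM m \<odot>\<^sub>Z g k"
     using Z.smult_assoc1[of "jA a" ?e "g k"]
      Z.smult_l_distr[of "jA a" "jM m" "g k"] c gc[OF k] by simp
    also have "\<dots> \<in> H"
    proof (rule H2[OF Hs[OF c(1)] HM[OF c(2) k]])
     show "?e \<odot>\<^sub>Z g k \<in> H" by (rule subsetD[OF SH], unfold S_def, rule UnI1, rule imageI) (use k in simp)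
    qed
    finally show ?thesis .
   qed
   ultimately show "x \<in> H" using Z.M.msum_subset_closed[OF H0 H2, of p "%k. ?e \<odot>\<^sub>Z (l k \<odot>\<^sub>Z g k)"] by simp
  qed
 qed
 moreover have "finite S" by (simp add: S_def)
 ultimately show ?thesis unfolding fg_module_def using X SX by blast
qed

text \<open>Multiplying \<open>(a, m, b)\<close> from the left by the idempotent of \<open>B\<close>
  leaves only \<open>b\<close>, so the projections of the generators of \<open>Z\<close>
  suffice.\<close>

lemma fg_module_corner_B:
 fixes Z :: "('a \<times> 'm \<times> 'b, 'z) module"
 assumes Z: "fg_module \<Lambda> Z"
  and Y: "left_module B (corner jB B Z)"
 shows "fg_module B (corner jB B Z)"
proof -
 let ?Y = "corner jB B Z"
 have lmZ: "left_module \<Lambda> Z" by (rule left_module_if_fg[OF Z])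
 interpret Z: left_module \<Lambda> Z by (rule lmZ)
 obtain p g where g: "spans \<Lambda> Z (carrier Z) p g" by (rule fg_module_spans[OF Z])
 have gc: "g k \<in> carrier Z" if "k < p" for k using spansD(1)[OF g that] .
 let ?e = "jB \<one>\<^sub>B"
 have e: "?e \<in> carrier \<Lambda>" by simp
 have "spans B ?Y (carrier ?Y) p (%k. ?e \<odot>\<^sub>Z g k)"
  unfolding spans_def
 proof (intro conjI allI impI ballI)
  fix k assume k: "k < p"
  show "?e \<odot>\<^sub>Z g k \<in> carrier ?Y" using Z.smult_assoc1[of ?e ?e "g k"] gc[OF k] by simp
 next
  fix x assume x: "x \<in> carrier ?Y"
  then have xZ: "x \<in> carrier Z" and ex: "?e \<odot>\<^sub>Z x = x" by simp_all
  obtain l where l: "\<forall>k<p. l k \<in> carrier \<Lambda>" "x = lincomb Z p l g" by (rule spansE[OF g xZ])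
  have lb: "snd (snd (l k)) \<in> carrier B" if "k < p" for k
   using l(1)[rule_format, OF that] by (cases "l k") simp
  have "x = msum Z p (%k. ?e \<odot>\<^sub>Z (l k \<odot>\<^sub>Z g k))"
   using ex Z.smult_msum[OF e, of p "%k. l k \<odot>\<^sub>Z g k"] l gc by (simp add: lincomb_def)
  also have "\<dots> = msum Z p (%k. snd (snd (l k)) \<odot>\<^bsub>?Y\<^esub> (?e \<odot>\<^sub>Z g k))"
  proof (rule msum_cong)
   fix k assume k: "k < p"
   obtain a m b where lk: "l k = (a, m, b)" and c: "a \<in> carrier A" "m \<in> carrier M" "b \<in> carrier B"
    using l(1)[rule_format, OF k] by (cases "l k") simp
   show "?e \<odot>\<^sub>Z (l k \<odot>\<^sub>Z g k) = snd (snd (l k)) \<odot>\<^bsub>?Y\<^esub> (?e \<odot>\<^sub>Z g k)"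
    using Z.smult_assoc1[of ?e "l k" "g k"] Z.smult_assoc1[of "jB b" ?e "g k"] c gc[OF k]
    by (simp add: lk)
  qed
  also have "\<dots> = lincomb ?Y p (%k. snd (snd (l k))) (%k. ?e \<odot>\<^sub>Z g k)"
  proof -
   have "msum Z p f = msum ?Y p f" for f by (induction p) simp_all
   then show ?thesis by (simp add: lincomb_def)
  qed
  finally show "\<exists>c. (\<forall>k<p. c k \<in> carrier B) \<and> x = lincomb ?Y p c (%k. ?e \<odot>\<^sub>Z g k)"
   using lb by (intro exI[of _ "%k. snd (snd (l k))"]) simp
 qed
 then show ?thesis by (rule spans_fg_module[OF Y])
qed

text \<open>The Peirce decomposition: the two idempotents split \<open>Z\<close> into corners, and
  the action of \<open>M\<close> carries the second corner into the first. The maps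
  \<open>\<alpha>\<close> and \<open>\<beta>\<close> replace the corners by small modules.\<close>

lemma ex_triple:
 fixes Z :: "('a \<times> 'm \<times> 'b, 'z) module"
 assumes Z: "fg_module \<Lambda> Z" and M: "fg_module A L"
 obtains X :: "'a small_module" and Y :: "'b small_module" and \<phi>
 where "module_triple A B M X Y \<phi>" "mod_iso \<Lambda> Z (triple_module B M X Y \<phi>)"
proof -
 have lmZ: "left_module \<Lambda> Z" by (rule left_module_if_fg[OF Z])
 interpret Z: left_module \<Lambda> Z by (rule lmZ)
 let ?X = "corner jA A Z" and ?Y = "corner jB B Z"
 let ?e = "jA \<one>\<^sub>A" and ?d = "jB \<one>\<^sub>B"
 have lmX: "left_module A ?X" and lmY: "left_module B ?Y"
  by (rule left_module_corner[OF A lmZ] left_module_corner[OF B lmZ]; simp)+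
 obtain X :: "'a small_module" where X: "fg_module A X" "mod_iso A ?X X"
  using fg_module_small[OF fg_module_corner_A[OF Z M lmX]] by blast
 obtain Y :: "'b small_module" where Y: "fg_module B Y" "mod_iso B ?Y Y"
  using fg_module_small[OF fg_module_corner_B[OF Z lmY]] by blast
 have lmX': "left_module A X" and lmY': "left_module B Y"
  by (rule left_module_if_fg[OF X(1)], rule left_module_if_fg[OF Y(1)])
 obtain \<alpha> where \<alpha>: "\<alpha> \<in> mod_hom A ?X X" "bij_betw \<alpha> (carrier ?X) (carrier X)" using X(2) by (auto simp: mod_iso_def)
 obtain \<beta> where \<beta>: "\<beta> \<in> mod_hom B ?Y Y" "bij_betw \<beta> (carrier ?Y) (carrier Y)" using Y(2) by (auto simp: mod_iso_def)
 obtain \<alpha>' where \<alpha>': "\<alpha>' \<in> mod_hom A X ?X" "\<forall>x\<in>carrier ?X. \<alpha>' (\<alpha> x) = x" "\<forall>x\<in>carrier X. \<alpha> (\<alpha>' x) = x"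
  by (rule mod_hom_inverse[OF \<alpha> lmX lmX'])
 obtain \<delta> where \<delta>: "\<delta> \<in> mod_hom B Y ?Y" "\<forall>x\<in>carrier ?Y. \<delta> (\<beta> x) = x" "\<forall>x\<in>carrier Y. \<beta> (\<delta> x) = x"
  by (rule mod_hom_inverse[OF \<beta> lmY lmY'])
 interpret X: left_module A X by (rule lmX')
 interpret tensor_product A B M Y
  by (intro tensor_product.intro triangular_axioms lmY')
 have \<delta>c: "\<delta> y \<in> carrier Z" "?d \<odot>\<^sub>Z \<delta> y = \<delta> y" if "y \<in> carrier Y" for y
  using mod_homD(1)[OF \<delta>(1) that] by simp_all
 have \<epsilon>X: "jM m \<odot>\<^sub>Z z \<in> carrier ?X" if "m \<in> carrier M" "z \<in> carrier Z" for m z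
  using that Z.smult_assoc1[of ?e "jM m" z] L.smult_one[of m] Z.smult_closed[of "jM m" z] by simp
 have eX: "?e \<odot>\<^sub>Z z \<in> carrier ?X" if "z \<in> carrier Z" for z
  using that Z.smult_assoc1[of ?e ?e z] Z.smult_closed[of ?e z] by simp
 have dY: "?d \<odot>\<^sub>Z z \<in> carrier ?Y" if "z \<in> carrier Z" for z
  using that Z.smult_assoc1[of ?d ?d z] Z.smult_closed[of ?d z] by simp
 have \<alpha>add: "\<alpha> (x \<oplus>\<^sub>Z y) = \<alpha> x \<oplus>\<^sub>X \<alpha> y" if "x \<in> carrier ?X" "y \<in> carrier ?X" for x y
  using mod_homD(2)[OF \<alpha>(1) that] by simp
 have \<beta>add: "\<beta> (x \<oplus>\<^sub>Z y) = \<beta> x \<oplus>\<^sub>Y \<beta> y" if "x \<in> carrier ?Y" "y \<in> carrier ?Y" for x y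
  using mod_homD(2)[OF \<beta>(1) that] by simp
 \<comment> \<open>The structure map is the action of \<open>M\<close> on the second corner,
   transported along \<open>\<delta>\<close> and \<open>\<alpha>\<close>.\<close>
 obtain \<phi> where \<phi>: "\<phi> \<in> mod_hom A T X" "\<forall>m\<in>carrier M. \<forall>y\<in>carrier Y. \<phi> (\<tau> m y) = \<alpha> (jM m \<odot>\<^sub>Z \<delta> y)"
 proof (rule ex_tensor_hom[OF lmX', of "%m y. \<alpha> (jM m \<odot>\<^sub>Z \<delta> y)"])
  fix m y assume m: "m \<in> carrier M" and y: "y \<in> carrier Y"
  show "\<alpha> (jM m \<odot>\<^sub>Z \<delta> y) \<in> carrier X" by (rule mod_homD(1)[OF \<alpha>(1) \<epsilon>X[OF m \<delta>c(1)[OF y]]])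
  {
   fix m' assume m': "m' \<in> carrier M"
   show "\<alpha> (jM (m \<oplus>\<^sub>M m') \<odot>\<^sub>Z \<delta> y) = \<alpha> (jM m \<odot>\<^sub>Z \<delta> y) \<oplus>\<^sub>X \<alpha> (jM m' \<odot>\<^sub>Z \<delta> y)"
    using \<alpha>add[OF \<epsilon>X[OF m \<delta>c(1)[OF y]] \<epsilon>X[OF m' \<delta>c(1)[OF y]]]
     Z.smult_l_distr[of "jM m" "jM m'" "\<delta> y"] m m' \<delta>c(1)[OF y] by simp
  next
   fix y' assume y': "y' \<in> carrier Y"
   show "\<alpha> (jM m \<odot>\<^sub>Z \<delta> (y \<oplus>\<^sub>Y y')) = \<alpha> (jM m \<odot>\<^sub>Z \<delta> y) \<oplus>\<^sub>X \<alpha> (jM m \<odot>\<^sub>Z \<delta> y')"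
    using \<alpha>add[OF \<epsilon>X[OF m \<delta>c(1)[OF y]] \<epsilon>X[OF m \<delta>c(1)[OF y']]] mod_homD(2)[OF \<delta>(1) y y']
     Z.smult_r_distr[of "jM m" "\<delta> y" "\<delta> y'"] m \<delta>c(1)[OF y] \<delta>c(1)[OF y'] by simp
  next
   fix b assume b: "b \<in> carrier B"
   show "\<alpha> (jM (rsmult M m b) \<odot>\<^sub>Z \<delta> y) = \<alpha> (jM m \<odot>\<^sub>Z \<delta> (b \<odot>\<^sub>Y y))"
    using Z.smult_assoc1[of "jM m" "jB b" "\<delta> y"] mod_homD(3)[OF \<delta>(1) b y] m b \<delta>c(1)[OF y] by simp
  next
   fix a assume a: "a \<in> carrier A"
   show "\<alpha> (jM (a \<odot>\<^sub>M m) \<odot>\<^sub>Z \<delta> y) = a \<odot>\<^sub>X \<alpha> (jM m \<odot>\<^sub>Z \<delta> y)"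
    using mod_homD(3)[OF \<alpha>(1) a \<epsilon>X[OF m \<delta>c(1)[OF y]]]
     Z.smult_assoc1[of "jA a" "jM m" "\<delta> y"] m a \<delta>c(1)[OF y] by simp
  }
 qed
 have triple: "module_triple A B M X Y \<phi>" using X(1) Y(1) \<phi>(1) by (simp add: module_triple_def)
 let ?XY = "triple_module B M X Y \<phi>"
 define f where "f = (\<lambda>z\<in>carrier Z. (\<alpha> (?e \<odot>\<^sub>Z z), \<beta> (?d \<odot>\<^sub>Z z)))"
 have fz: "f z = (\<alpha> (?e \<odot>\<^sub>Z z), \<beta> (?d \<odot>\<^sub>Z z))" if "z \<in> carrier Z" for z using that by (simp add: f_def)
 have "f \<in> mod_hom \<Lambda> Z ?XY"
  unfolding f_def
 proof (rule mod_hom_restrictI[OF lmZ])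
  fix z assume z: "z \<in> carrier Z"
  show "(\<alpha> (?e \<odot>\<^sub>Z z), \<beta> (?d \<odot>\<^sub>Z z)) \<in> carrier ?XY"
   using mod_homD(1)[OF \<alpha>(1) eX[OF z]] mod_homD(1)[OF \<beta>(1) dY[OF z]] by simp
  {
   fix w assume w: "w \<in> carrier Z"
   show "(\<alpha> (?e \<odot>\<^sub>Z (z \<oplus>\<^sub>Z w)), \<beta> (?d \<odot>\<^sub>Z (z \<oplus>\<^sub>Z w))) =
    (\<alpha> (?e \<odot>\<^sub>Z z), \<beta> (?d \<odot>\<^sub>Z z)) \<oplus>\<^bsub>?XY\<^esub> (\<alpha> (?e \<odot>\<^sub>Z w), \<beta> (?d \<odot>\<^sub>Z w))"
    using \<alpha>add[OF eX[OF z] eX[OF w]] \<beta>add[OF dY[OF z] dY[OF w]] z w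
     Z.smult_r_distr[of ?e z w] Z.smult_r_distr[of ?d z w] by simp
  next
   fix r assume "r \<in> carrier \<Lambda>"
   then obtain a m b where r: "r = (a, m, b)" and c: "a \<in> carrier A" "m \<in> carrier M" "b \<in> carrier B"
    by (cases r) simp
   have "?e \<odot>\<^sub>Z (r \<odot>\<^sub>Z z) = jA a \<odot>\<^sub>Z (?e \<odot>\<^sub>Z z) \<oplus>\<^sub>Z jM m \<odot>\<^sub>Z (?d \<odot>\<^sub>Z z)"
    using Z.smult_assoc1[of ?e r z] Z.smult_assoc1[of "jA a" ?e z] Z.smult_assoc1[of "jM m" ?d z]
     Z.smult_l_distr[of "jA a" "jM m" z] L.smult_one[of m] N.smult_one[of m] c z by (simp add: r)
   then have "\<alpha> (?e \<odot>\<^sub>Z (r \<odot>\<^sub>Z z)) = \<alpha> (jA a \<odot>\<^sub>Z (?e \<odot>\<^sub>Z z)) \<oplus>\<^sub>X \<alpha> (jM m \<odot>\<^sub>Z (?d \<odot>\<^sub>Z z))"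
    using \<alpha>add[OF _ \<epsilon>X[OF c(2)], of "jA a \<odot>\<^sub>Z (?e \<odot>\<^sub>Z z)" "?d \<odot>\<^sub>Z z"] dY[OF z]
     left_module.smult_closed[OF lmX c(1) eX[OF z]] by simp
   also have "\<alpha> (jA a \<odot>\<^sub>Z (?e \<odot>\<^sub>Z z)) = a \<odot>\<^sub>X \<alpha> (?e \<odot>\<^sub>Z z)"
    using mod_homD(3)[OF \<alpha>(1) c(1) eX[OF z]] by simp
   also have "\<alpha> (jM m \<odot>\<^sub>Z (?d \<odot>\<^sub>Z z)) = \<phi> (\<tau> m (\<beta> (?d \<odot>\<^sub>Z z)))"
    using \<phi>(2) c(2) mod_homD(1)[OF \<beta>(1) dY[OF z]] \<delta>(2)[rule_format, OF dY[OF z]] by simp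
   finally have 1: "\<alpha> (?e \<odot>\<^sub>Z (r \<odot>\<^sub>Z z)) = a \<odot>\<^sub>X \<alpha> (?e \<odot>\<^sub>Z z) \<oplus>\<^sub>X \<phi> (\<tau> m (\<beta> (?d \<odot>\<^sub>Z z)))" .
   have "?d \<odot>\<^sub>Z (r \<odot>\<^sub>Z z) = jB b \<odot>\<^sub>Z (?d \<odot>\<^sub>Z z)"
    using Z.smult_assoc1[of ?d r z] Z.smult_assoc1[of "jB b" ?d z] c z by (simp add: r)
   then have "\<beta> (?d \<odot>\<^sub>Z (r \<odot>\<^sub>Z z)) = b \<odot>\<^sub>Y \<beta> (?d \<odot>\<^sub>Z z)"
    using mod_homD(3)[OF \<beta>(1) c(3) dY[OF z]] by simp
   with 1 show "(\<alpha> (?e \<odot>\<^sub>Z (r \<odot>\<^sub>Z z)), \<beta> (?d \<odot>\<^sub>Z (r \<odot>\<^sub>Z z))) =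
     r \<odot>\<^bsub>?XY\<^esub> (\<alpha> (?e \<odot>\<^sub>Z z), \<beta> (?d \<odot>\<^sub>Z z))" by (simp add: r)
  }
 qed
 moreover have "bij_betw f (carrier Z) (carrier ?XY)"
  unfolding bij_betw_def
 proof
  have sum: "z = ?e \<odot>\<^sub>Z z \<oplus>\<^sub>Z ?d \<odot>\<^sub>Z z" if "z \<in> carrier Z" for z
   using Z.smult_l_distr[of ?e ?d z] Z.smult_one[OF that] that by simp
  show "inj_on f (carrier Z)"
  proof (rule inj_onI)
   fix z w assume zw: "z \<in> carrier Z" "w \<in> carrier Z" "f z = f w"
   then have "\<alpha> (?e \<odot>\<^sub>Z z) = \<alpha> (?e \<odot>\<^sub>Z w)" "\<beta> (?d \<odot>\<^sub>Z z) = \<beta> (?d \<odot>\<^sub>Z w)" by (simp_all add: fz)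
   then have "?e \<odot>\<^sub>Z z = ?e \<odot>\<^sub>Z w" "?d \<odot>\<^sub>Z z = ?d \<odot>\<^sub>Z w"
    using inj_onD[OF bij_betw_imp_inj_on[OF \<alpha>(2)] _ eX eX] inj_onD[OF bij_betw_imp_inj_on[OF \<beta>(2)] _ dY dY] zw by simp_all
   then show "z = w" using sum[OF zw(1)] sum[OF zw(2)] by simp
  qed
  show "f ` carrier Z = carrier ?XY"
  proof
   show "f ` carrier Z \<subseteq> carrier ?XY"
    using mod_homD(1)[OF \<alpha>(1) eX] mod_homD(1)[OF \<beta>(1) dY] by (auto simp: fz)
   show "carrier ?XY \<subseteq> f ` carrier Z"
   proof
    fix v assume "v \<in> carrier ?XY"
    then obtain x y where v: "v = (x, y)" "x \<in> carrier X" "y \<in> carrier Y" by (cases v) simp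
    let ?z = "\<alpha>' x \<oplus>\<^sub>Z \<delta> y"
    have x: "\<alpha>' x \<in> carrier Z" "?e \<odot>\<^sub>Z \<alpha>' x = \<alpha>' x" using mod_homD(1)[OF \<alpha>'(1) v(2)] by simp_all
    note y = \<delta>c[OF v(3)]
    have zero: "\<zero>\<^sub>\<Lambda> \<odot>\<^sub>Z u = \<zero>\<^sub>Z" if "u \<in> carrier Z" for u by (rule Z.zero_smult[OF that])
    have "?e \<odot>\<^sub>Z \<delta> y = \<zero>\<^sub>Z" using Z.smult_assoc1[of ?e ?d "\<delta> y"] y zero[OF y(1)] by simp
    moreover have "?d \<odot>\<^sub>Z \<alpha>' x = \<zero>\<^sub>Z" using Z.smult_assoc1[of ?d ?e "\<alpha>' x"] x zero[OF x(1)] by simp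
    ultimately have "f ?z = v"
     using x y v \<alpha>'(3) \<delta>(3) Z.smult_r_distr[of ?e "\<alpha>' x" "\<delta> y"] Z.smult_r_distr[of ?d "\<alpha>' x" "\<delta> y"] by (simp add: fz)
    then show "v \<in> f ` carrier Z" using x(1) y(1) by (intro image_eqI[of _ _ ?z]) simp_all
   qed
  qed
 qed
 ultimately have "mod_iso \<Lambda> Z ?XY" unfolding mod_iso_def by blast
 then show ?thesis using triple by (rule that[rotated])
qed

end

section \<open>The three equivalences\<close>

lemma fg_module_if_proj_dim:
 assumes "left_module R W" "proj_dim R W < \<infinity>"
 shows "fg_module R W"
proof -
 obtain n where "\<exists>P d e. projective_resolution R W P d e \<and> (\<forall>i>n. carrier (P i) = {\<zero>\<^bsub>P i\<^esub>})"
  using assms(2) unfolding proj_dim_def by (rule enat_less_Inf)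
 then obtain P d e where res: "projective_resolution R W P d e" by (elim exE conjE)
 have "fg_module R (W\<lparr>carrier := e ` carrier (P 0)\<rparr>)"
  by (rule image_fg_module[OF projective_resolutionD(5)[OF res] projective_resolutionD(2)[OF res] assms(1)])
 then show ?thesis by (simp add: projective_resolutionD(6)[OF res])
qed

text \<open>\<open>torsionless\<close> asks for an embedding into a small projective module, so
  \<open>P\<close> is replaced by a small copy and its lifting property transported.\<close>

lemma torsionless_if_projective:
 fixes R :: "'r ring"
 assumes P: "projective_module R P"
 shows "torsionless R P"
proof -
 have fg: "fg_module R P" using P by (simp add: projective_module_def)
 have lmP: "left_module R P" by (rule left_module_if_fg[OF fg])
 obtain P' :: "'r small_module" where fg': "fg_module R P'" and "mod_iso R P P'" using fg_module_small[OF fg] by blast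
 then obtain \<iota> where \<iota>: "\<iota> \<in> mod_hom R P P'" "bij_betw \<iota> (carrier P) (carrier P')" by (auto simp: mod_iso_def)
 have lmP': "left_module R P'" by (rule left_module_if_fg[OF fg'])
 obtain \<iota>' where \<iota>': "\<iota>' \<in> mod_hom R P' P" "\<forall>x\<in>carrier P. \<iota>' (\<iota> x) = x" "\<forall>x\<in>carrier P'. \<iota> (\<iota>' x) = x"
  by (rule mod_hom_inverse[OF \<iota> lmP lmP'])
 have "projective_module R P'"
  unfolding projective_module_def
 proof (intro conjI fg' allI impI, elim conjE)
  fix X Y :: "'r small_module" and g f
  assume X: "fg_module R X" and Y: "fg_module R Y" and g: "g \<in> mod_hom R X Y"
   and surj: "g ` carrier X = carrier Y" and f: "f \<in> mod_hom R P' Y"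
  have f': "(\<lambda>p\<in>carrier P. f (\<iota> p)) \<in> mod_hom R P Y" by (rule mod_hom_compose[OF \<iota>(1) f lmP])
  have "(\<lambda>p\<in>carrier P. f (\<iota> p)) ` carrier P \<subseteq> g ` carrier X"
   using mod_homD(1)[OF f'] unfolding surj by (rule image_subsetI)
  then obtain h where h: "h \<in> mod_hom R P X" "\<forall>p\<in>carrier P. g (h p) = (\<lambda>p\<in>carrier P. f (\<iota> p)) p"
   by (rule projective_lift[OF P X left_module_if_fg[OF Y] g f'])
  have "(\<lambda>p\<in>carrier P'. h (\<iota>' p)) \<in> mod_hom R P' X" by (rule mod_hom_compose[OF \<iota>'(1) h(1) lmP'])
  moreover have "g ((\<lambda>p\<in>carrier P'. h (\<iota>' p)) p) = f p" if "p \<in> carrier P'" for p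
   using h(2) \<iota>'(3) mod_homD(1)[OF \<iota>'(1) that] that by simp
  ultimately show "\<exists>h\<in>mod_hom R P' X. \<forall>p\<in>carrier P'. g (h p) = f p" by (intro bexI) simp_all
 qed
 then show ?thesis unfolding torsionless_def using \<iota> bij_betw_imp_inj_on[OF \<iota>(2)] by blast
qed

context triangular
begin

text \<open>For every triple isomorphic to \<open>Z\<close>, injectivity of the structure map is
  equivalent to the same matrix condition. Hence the existential quantifier in
  \<open>monic_wrt\<close> does not depend on the triple, and \<open>ex_triple\<close> shows that
  there is one.\<close>

lemma monic_wrt_iff_monic_mat:
 fixes Z :: "('a \<times> 'm \<times> 'b, 'z) module"
 assumes Z: "fg_module \<Lambda> Z" and M: "fg_module A L" and res: "mat_resolution \<Lambda> Z n g F"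
 shows "monic_wrt A B M Z \<longleftrightarrow> monic_mat A M (n 0) (n (Suc 0)) (comp_A F 0) (comp_M F 0) (comp_B F 0)"
proof -
 have lmZ: "left_module \<Lambda> Z" by (rule left_module_if_fg[OF Z])
 have iff: "inj_on \<phi> (carrier (tensor B M Y)) \<longleftrightarrow>
   monic_mat A M (n 0) (n (Suc 0)) (comp_A F 0) (comp_M F 0) (comp_B F 0)"
  if t: "module_triple A B M X Y \<phi>" and i: "mod_iso \<Lambda> Z (triple_module B M X Y \<phi>)"
  for X :: "'a small_module" and Y :: "'b small_module" and \<phi>
 proof -
  have X: "left_module A X" and Y: "left_module B Y" and \<phi>: "\<phi> \<in> mod_hom A (tensor B M Y) X"
   using t by (simp_all add: module_triple_def left_module_if_fg)
  obtain f where "f \<in> mod_hom \<Lambda> Z (triple_module B M X Y \<phi>)"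
   "bij_betw f (carrier Z) (carrier (triple_module B M X Y \<phi>))"
   using i unfolding mod_iso_def by blast
  then interpret resolved_triple A B M Y X \<phi> Z n g F f
   by (intro resolved_triple.intro triple.intro tensor_product.intro triangular_axioms X Y triple_axioms.intro \<phi>
     matrix_resolution.intro lmZ matrix_resolution_axioms.intro res resolved_triple_axioms.intro)
  show ?thesis by (rule inj_iff_monic_mat)
 qed
 show ?thesis
 proof
  assume "monic_wrt A B M Z"
  then show "monic_mat A M (n 0) (n (Suc 0)) (comp_A F 0) (comp_M F 0) (comp_B F 0)"
   unfolding monic_wrt_def using iff by (elim exE conjE) (rule iffD1)
 next
  assume m: "monic_mat A M (n 0) (n (Suc 0)) (comp_A F 0) (comp_M F 0) (comp_B F 0)"
  obtain X :: "'a small_module" and Y :: "'b small_module" and \<phi>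
   where t: "module_triple A B M X Y \<phi>" "mod_iso \<Lambda> Z (triple_module B M X Y \<phi>)"
   by (rule ex_triple[OF Z M])
  then show "monic_wrt A B M Z"
   unfolding monic_wrt_def using iffD2[OF iff[OF t] m] by (intro exI conjI)
 qed
qed

lemma all_monic_iff:
 assumes ring: "left_noetherian \<Lambda>" and M: "fg_module A L"
 shows "(\<forall>Z :: ('a \<times> 'm \<times> 'b) small_module. semi_Gorenstein_projective \<Lambda> Z \<longrightarrow> monic_wrt A B M Z) \<longleftrightarrow>
  (\<forall>n F. acyclic_seq \<Lambda> n F \<longrightarrow> monic_mat A M (n 0) (n (Suc 0)) (comp_A F 0) (comp_M F 0) (comp_B F 0))"
proof (intro iffI allI impI)
 fix n F assume all: "\<forall>Z :: ('a \<times> 'm \<times> 'b) small_module. semi_Gorenstein_projective \<Lambda> Z \<longrightarrow> monic_wrt A B M Z"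
  and F: "acyclic_seq \<Lambda> n F"
 have seq: "mat_seq \<Lambda> n F" and cols: "cols_exact (regular \<Lambda>) n F"
  and rows: "rows_exact (regular (opposite \<Lambda>)) n F" using F by (simp_all add: acyclic_seq_def)
 have r\<Lambda>: "ring \<Lambda>" by (rule left_noetherian_ring[OF ring])
 let ?Z = "coker_rows \<Lambda> (n (Suc 0)) (n 0) (F 0)"
 note res = mat_resolution_coker[OF r\<Lambda> seq rows]
 have lm: "left_module \<Lambda> ?Z" by (rule coker_rows_left_module[OF r\<Lambda>]) (use mat_seqD(1)[OF seq, of _ 0] in simp)
 interpret Z: matrix_resolution \<Lambda> ?Z n "%i. coset \<Lambda> (n 0) {v \<in> carrier (free_module \<Lambda> (n 0)). row_span \<Lambda> (n (Suc 0)) (n 0) (F 0) v} (unit_vec \<Lambda> i)" F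
  by (intro matrix_resolution.intro lm matrix_resolution_axioms.intro res)
 have s: "semi_Gorenstein_projective \<Lambda> ?Z" using Z.semi_Gorenstein_projective_iff cols by simp
 then have fg: "fg_module \<Lambda> ?Z" by (simp add: semi_Gorenstein_projective_def left_perp_def)
 have "monic_wrt A B M ?Z" by (rule all[rule_format, OF s])
 then show "monic_mat A M (n 0) (n (Suc 0)) (comp_A F 0) (comp_M F 0) (comp_B F 0)"
  by (rule iffD1[OF monic_wrt_iff_monic_mat[OF fg M res]])
next
 fix Z :: "('a \<times> 'm \<times> 'b) small_module"
 assume all: "\<forall>n F. acyclic_seq \<Lambda> n F \<longrightarrow> monic_mat A M (n 0) (n (Suc 0)) (comp_A F 0) (comp_M F 0) (comp_B F 0)"
  and s: "semi_Gorenstein_projective \<Lambda> Z"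
 have fg: "fg_module \<Lambda> Z" using s by (simp add: semi_Gorenstein_projective_def left_perp_def)
 obtain n g F where res: "mat_resolution \<Lambda> Z n g F" by (rule ex_mat_resolution[OF ring fg])
 interpret Z: matrix_resolution \<Lambda> Z n g F
  by (intro matrix_resolution.intro left_module_if_fg[OF fg] matrix_resolution_axioms.intro res)
 have "acyclic_seq \<Lambda> n F"
  using Z.semi_Gorenstein_projective_iff s Z.seq Z.rows by (simp add: acyclic_seq_def)
 then show "monic_wrt A B M Z" using all monic_wrt_iff_monic_mat[OF fg M res] by simp
qed

text \<open>The conditions on \<open>M\<^sub>B\<close> have been condensed to
  \<open>tor_vanishing\<close>, so the first two parts of the theorem are instances of this
  equivalence.\<close>

theorem weakly_Gorenstein_triangular_iff:
 assumes noeth: "left_noetherian A" "left_noetherian (opposite A)" "left_noetherian B"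
   "left_noetherian (opposite B)" "left_noetherian \<Lambda>" "left_noetherian (opposite \<Lambda>)"
  and pd: "proj_dim A L < \<infinity>" and tv: "tor_vanishing B N"
 shows "weakly_Gorenstein \<Lambda> \<longleftrightarrow>
  (\<forall>Z :: ('a \<times> 'm \<times> 'b) small_module. semi_Gorenstein_projective \<Lambda> Z \<longrightarrow> monic_wrt A B M Z) \<and>
  weakly_Gorenstein A \<and> weakly_Gorenstein B"
 unfolding weakly_Gorenstein_iff_mat[OF noeth(1,2)] weakly_Gorenstein_iff_mat[OF noeth(3,4)]
  weakly_Gorenstein_iff_mat[OF noeth(5,6)]
  all_monic_iff[OF noeth(5) fg_module_if_proj_dim[OF L.left_module_axioms pd]]
proof (intro iffI conjI allI impI)
 fix n F assume wg: "weakly_Gorenstein_mat \<Lambda>" and "acyclic_seq \<Lambda> n F"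
 then interpret triangular_seq A B M n F by unfold_locales
 show "monic_mat A M (n 0) (n (Suc 0)) (FA 0) (FM 0) (FB 0)"
  by (rule monic_if_weakly_Gorenstein[OF pd tv noeth(6) wg])
next
 assume wg: "weakly_Gorenstein_mat \<Lambda>"
 show "weakly_Gorenstein_mat A" by (rule weakly_Gorenstein_mat_A[OF pd tv noeth(6) wg])
 show "weakly_Gorenstein_mat B" by (rule weakly_Gorenstein_mat_B[OF pd tv wg])
next
 assume "(\<forall>n F. acyclic_seq \<Lambda> n F \<longrightarrow> monic_mat A M (n 0) (n (Suc 0)) (comp_A F 0) (comp_M F 0) (comp_B F 0)) \<and>
  weakly_Gorenstein_mat A \<and> weakly_Gorenstein_mat B"
 then show "weakly_Gorenstein_mat \<Lambda>"
  by (intro weakly_Gorenstein_mat_if_monic[OF pd tv noeth(4)]) simp_all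
qed

text \<open>\<open>monic_if_torsionless\<close> derives monicity from weak Gorensteinness of
  \<open>B\<close>, which removes the condition on monic modules from the equivalence.\<close>

theorem weakly_Gorenstein_triangular_iff_torsionless:
 assumes noeth: "left_noetherian A" "left_noetherian (opposite A)" "left_noetherian B"
   "left_noetherian (opposite B)" "left_noetherian \<Lambda>" "left_noetherian (opposite \<Lambda>)"
  and pd: "proj_dim A L < \<infinity>" and tv: "tor_vanishing B N" and tl: "torsionless A L"
 shows "weakly_Gorenstein \<Lambda> \<longleftrightarrow> weakly_Gorenstein A \<and> weakly_Gorenstein B"
 unfolding weakly_Gorenstein_iff_mat[OF noeth(1,2)] weakly_Gorenstein_iff_mat[OF noeth(3,4)]
  weakly_Gorenstein_iff_mat[OF noeth(5,6)]
proof (intro iffI conjI)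
 assume wg: "weakly_Gorenstein_mat \<Lambda>"
 show "weakly_Gorenstein_mat A" by (rule weakly_Gorenstein_mat_A[OF pd tv noeth(6) wg])
 show "weakly_Gorenstein_mat B" by (rule weakly_Gorenstein_mat_B[OF pd tv wg])
next
 assume wg: "weakly_Gorenstein_mat A \<and> weakly_Gorenstein_mat B"
 show "weakly_Gorenstein_mat \<Lambda>"
 proof (rule weakly_Gorenstein_mat_if_monic[OF pd tv noeth(4) conjunct1[OF wg] conjunct2[OF wg]])
  fix n F assume "acyclic_seq \<Lambda> n F"
  then interpret triangular_seq A B M n F by unfold_locales
  show "monic_mat A M (n 0) (n (Suc 0)) (FA 0) (FM 0) (FB 0)"
   by (rule monic_if_torsionless[OF pd tv noeth(4) conjunct2[OF wg] tl])
 qed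
qed

end

theorem theorem1p2:
  fixes A :: "'a ring" and B :: "'b ring" and M :: "('a, 'b, 'm) bimodule"
    and K :: "'k ring" and \<eta> :: "'k \<Rightarrow> 'b" and J :: "('k, 'j) module"
  defines "\<Lambda> \<equiv> triangular_ring A B M"
  assumes "artin_algebra A"
    and "artin_algebra B"
    and "is_bimodule A B M"
    and "proj_dim A (left_part M) < \<infinity>"
    and "artin_algebra \<Lambda>"
  shows
    "(artin_algebra_over K \<eta> B \<and> dualizing_module K J \<and>
      proj_dim (opposite B) (right_part M) < \<infinity> \<and>
      standard_dual K \<eta> J (right_part M)
        \<in> right_perp B (left_perp B (regular B) :: 'b small_module set) \<longrightarrow>
      (weakly_Gorenstein \<Lambda> \<longleftrightarrow>
        (\<forall>N :: ('a \<times> 'm \<times> 'b) small_module.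
           semi_Gorenstein_projective \<Lambda> N \<longrightarrow> monic_wrt A B M N) \<and>
        weakly_Gorenstein A \<and> weakly_Gorenstein B)) \<and>
     (proj_dim (opposite B) (right_part M) < \<infinity> \<and> Gorenstein B \<longrightarrow>
      (weakly_Gorenstein \<Lambda> \<longleftrightarrow>
        (\<forall>N :: ('a \<times> 'm \<times> 'b) small_module.
           semi_Gorenstein_projective \<Lambda> N \<longrightarrow> monic_wrt A B M N) \<and>
        weakly_Gorenstein A)) \<and>
     (torsionless A (left_part M) \<and> projective_module (opposite B) (right_part M) \<longrightarrow>
      (weakly_Gorenstein \<Lambda> \<longleftrightarrow> weakly_Gorenstein A \<and> weakly_Gorenstein B)) \<and>
     (projective_module A (left_part M) \<and> projective_module (opposite B) (right_part M) \<longrightarrow>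
      (weakly_Gorenstein \<Lambda> \<longleftrightarrow> weakly_Gorenstein A \<and> weakly_Gorenstein B))"
proof -
 note nA = artin_algebra_left_noetherian[OF assms(2)]
 note nB = artin_algebra_left_noetherian[OF assms(3)]
 note n\<Lambda> = artin_algebra_left_noetherian[OF assms(6)[unfolded \<Lambda>_def]]
 note pd = assms(5)
 have R: "left_module (opposite B) (right_part M)" using assms(4) by (simp add: is_bimodule_def)
 interpret triangular A B M
  by (intro triangular.intro left_noetherian_ring[OF nA(1)] left_noetherian_ring[OF nB(1)] assms(4))
 note core = weakly_Gorenstein_triangular_iff[OF nA nB n\<Lambda> pd]
 note core' = weakly_Gorenstein_triangular_iff_torsionless[OF nA nB n\<Lambda> pd]
 show ?thesis
  unfolding \<Lambda>_def
 proof (intro conjI impI, goal_cases)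
  case 1
  then have "fg_module (opposite B) (right_part M)" by (intro fg_module_if_proj_dim[OF R]) simp
  then have "tor_vanishing B (right_part M)" using 1 by (intro tor_vanishing_dual[of K \<eta> B J]) simp_all
  then show ?case by (rule core)
 next
  case 2
  \<comment> \<open>A Gorenstein algebra is weakly Gorenstein. This allows the dimension shift for
    rows over \<open>M\<^sub>B\<close> and also absorbs the condition on \<open>B\<close> in the
    equivalence.\<close>
  then have wg: "weakly_Gorenstein_mat B" by (intro Gorenstein_imp_weakly_Gorenstein_mat nB) simp
  then have "tor_vanishing B (right_part M)" using 2 by (intro tor_vanishing_proj_dim[OF nB(2) wg R]) simp
  moreover have "weakly_Gorenstein B" using wg weakly_Gorenstein_iff_mat[OF nB] by simp
  ultimately show ?case using core by simp
 next
  case 3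
  then show ?case by (intro core' tor_vanishing_projective) simp_all
 next
  case 4
  then show ?case by (intro core' tor_vanishing_projective torsionless_if_projective) simp_all
 qed
qed

end
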